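(* Let $(S,g,\xi_i,\eta_i,\Phi_i)$ be a regular or quasi-regular $3$-Sasakian manifold of dimension $7$ and let $Z$ be the quotient of $S$ by the foliation generated by $\xi_3$. Let $(C(S),\bar g,J_i)$ be the hyperkähler cone of $S$, with Kähler forms $\omega_i:=\bar g(J_i\cdot,\cdot)$. Put $2\Omega_{(4)}:=(\omega_1+i\omega_2)^2$ and $\eta:=r^2(\eta_1+i\eta_2)$ on $C(S)$. Then, for the $S^1$-action generated by $\xi_3$ on $(C(S),J_3)$, the holomorphic volume form $2\Omega_{(4)}$ has charge $4i$, and $\eta$ is a twist form of charge $2i$. Moreover the forms $$\omega:=\omega_3-\frac{i}{|\eta|^2}\,\eta\wedge\bar\eta,\qquad \Omega:=-i\,\bar\eta\wedge\big(\bar\eta\cdot(\iota_{\xi_3}\Omega_{(4)})\big),$$ restricted to $S=\{r=1\}$, are basic with respect to $\xi_3$ and induce an LT structure on $Z$, whose non-vanishing torsion classes are $$W_1=\frac{8}{3},\qquad W_2=\frac{W_1}{2}\Big(\omega+\frac{3i}{2}\,\eta\wedge\bar\eta\Big).$$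
   Context: **3-Sasakian structures.** A Riemannian manifold $(S,g)$ is $3$-Sasakian if its cone $(C(S)=S\times\mathbb{R}_{>0},\ \bar g=dr^2+r^2g)$ is hyperkähler, with integrable complex structures $J_1,J_2,J_3$, each Kähler with respect to $\bar g$, satisfying $J_iJ_j=-\delta_{ij}+\epsilon_{ijk}J_k$. $S$ is identified with $\{r=1\}\subset C(S)$. The Reeb vector fields are $\xi_i=J_i(r\partial_r)$ (tangent to $S$), the dual contact forms are $\eta_i=\frac1{r^2}\bar g(\xi_i,\cdot)$, and on $S$ one sets $\Phi_i=\nabla\xi_i$ with $\nabla$ the Levi-Civita connection of $g$. One has $[\xi_i,\xi_j]=-2\epsilon_{ijk}\xi_k$ and $\omega_i=\bar g(J_i\cdot,\cdot)=\frac12 d(r^2\eta_i)$. The Reeb foliation generated by $\xi_u=u_1\xi_1+u_2\xi_2+u_3\xi_3$, $u\in S^2$ (in particular by $\xi_3$) is quasi-regular if $\xi_u$ integrates (up to rescaling of the period) to an effective $S^1$-action that is almost free (finite stabilizers), and regular if this action is free; $S$ is called (quasi-)regular accordingly. Then $Z=S/\langle\xi_3\rangle$ is an orbifold (a manifold in the regular case), and tensors on $Z$ are understood in the orbifold sense. A form $\beta$ on $S$ is basic with respect to $\xi_3$ if $\iota_{\xi_3}\beta=0$ and $\mathcal{L}_{\xi_3}\beta=0$; basic forms descend to $Z$ and are denoted by the same symbol. **Charge and twist forms.** For the $S^1$-action generated by $\xi_3$ on $C(S)$, a complex form $\beta$ has charge $k\in\mathbb{C}$ if $\mathcal{L}_{\xi_3}\beta=k\beta$.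 A twist form is a $1$-form on $C(S)$ which is nowhere vanishing, of type $(1,0)$ with respect to $J_3$, horizontal (i.e. it vanishes on $\xi_3$), and has a charge. **Contraction convention.** The norm and contraction are normalized so that $|\eta|^2=\bar\eta\cdot\eta=r^2$ (half of the value obtained from the complex-bilinear extension of $\bar g$). Explicitly, $\bar\eta\cdot\beta=\iota_V\beta$ with $V=\frac12(\xi_1-i\xi_2)$, which satisfies $\eta(V)=r^2$ and $\bar\eta(V)=0$. **$SU(3)$-structures.** An $SU(3)$-structure on a $6$-dimensional manifold or orbifold is an almost hermitian structure $(g,J,\omega)$ (that is, $\omega$ is a real $2$-form with $\omega(J\cdot,J\cdot)=\omega$ and $g=\omega(\cdot,J\cdot)$ a Riemannian metric) together with a nowhere vanishing $(3,0)$-form $\Omega$ such that $\omega\wedge\Omega=0$ and $\Omega\wedge\overline\Omega=-8i\,\frac{\omega^3}{3!}$. ($J$ and $g$ are determined by $\omega,\Omega$.) Its torsion classes are defined by $$d\omega=\tfrac32\,\mathrm{Im}(\overline{W_1}\,\Omega)+W_4\wedge\omega+W_3,\qquad d\Omega=W_1\,\omega^2+W_2\wedge\omega+\overline{W_5}\wedge\Omega,$$ where $W_1$ is a complex function, $W_2$ a primitive (complex) $(1,1)$-form, $W_3$ a real primitive $(2,1)+(1,2)$-form, $W_4$ a real $1$-form and $W_5$ a $(1,0)$-form; a $k$-form $\beta$ is primitive if $\beta\wedge\omega^{4-k}=0$. The structure is LT if $W_3=W_4=W_5=0$ and $W_1,W_2$ are both non-zero. *)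

theory Defs
  imports "HOL-Analysis.Analysis" "HOL-Combinatorics.Permutations"
begin

section \<open>Smooth maps and charts\<close>

text \<open>Used for open \<open>U\<close> only.\<close>

fun Ck_on :: "nat \<Rightarrow> 'a::euclidean_space set \<Rightarrow> ('a \<Rightarrow> 'b::real_normed_vector) \<Rightarrow> bool" where
  "Ck_on 0 U f \<longleftrightarrow> continuous_on U f"
| "Ck_on (Suc n) U f \<longleftrightarrow> (\<forall>x\<in>U. f differentiable (at x)) \<and>
     (\<forall>v. Ck_on n U (\<lambda>x. frechet_derivative f (at x) v))"

definition smooth_on :: "'a::euclidean_space set \<Rightarrow> ('a \<Rightarrow> 'b::real_normed_vector) \<Rightarrow> bool" where
  "smooth_on U f \<longleftrightarrow> (\<forall>n. Ck_on n U f)"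

text \<open>A chart is a parametrization \<open>(V, q)\<close>: an open set \<open>V\<close> of the model space together with a
  map \<open>q\<close> from \<open>V\<close> to the space. For manifolds \<open>q\<close> is a homeomorphism onto its open image, and
  its inverse is the usual coordinate map. For orbifolds \<open>q\<close> is the quotient of \<open>V\<close> by a finite
  group. This lets manifolds and orbifolds share the notion of tensor field below.\<close>

type_synonym ('e, 'm) chart = "'e set \<times> ('e \<Rightarrow> 'm)"

definition chart_range :: "('e, 'm) chart \<Rightarrow> 'm set" where
  "chart_range c = snd c ` fst c"

definition coord :: "('e, 'm) chart \<Rightarrow> 'm \<Rightarrow> 'e" where
  "coord c = inv_into (fst c) (snd c)"

definition smooth_manifold :: "'m topology \<Rightarrow> ('e::euclidean_space, 'm) chart set \<Rightarrow> bool" where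
  "smooth_manifold X A \<longleftrightarrow>
     Hausdorff_space X \<and> second_countable X \<and>
     (\<Union>c\<in>A. chart_range c) = topspace X \<and>
     (\<forall>c\<in>A. open (fst c) \<and> openin X (chart_range c) \<and>
        homeomorphic_map (top_of_set (fst c)) (subtopology X (chart_range c)) (snd c)) \<and>
     (\<forall>c\<in>A. \<forall>c'\<in>A.
        smooth_on {x \<in> fst c. snd c x \<in> chart_range c'} (\<lambda>x. coord c' (snd c x)))"

text \<open>Smoothness on the open set \<open>U\<close> of a map to a manifold; openness of the preimages of chart
  ranges is continuity.\<close>

definition smooth_map_to ::
  "'m topology \<Rightarrow> ('e::euclidean_space, 'm) chart set \<Rightarrow> 'a::euclidean_space set \<Rightarrow> ('a \<Rightarrow> 'm) \<Rightarrow> bool"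
where
  "smooth_map_to X A U f \<longleftrightarrow> f ` U \<subseteq> topspace X \<and>
     (\<forall>c\<in>A. open {x \<in> U. f x \<in> chart_range c} \<and>
        smooth_on {x \<in> U. f x \<in> chart_range c} (\<lambda>x. coord c (f x)))"

text \<open>A local change of charts \<open>h\<close>. Between manifold charts, \<open>h\<close> is a restriction of the usual
  transition map. Between orbifold charts, \<open>h\<close> is determined only up to the local groups; in
  particular, the elements of the local group of a chart are changes from this chart to itself.\<close>

definition chart_change ::
  "('e::euclidean_space, 'm) chart \<Rightarrow> ('e, 'm) chart \<Rightarrow> 'e set \<Rightarrow> ('e \<Rightarrow> 'e) \<Rightarrow> bool" where
  "chart_change c c' W h \<longleftrightarrow>
     open W \<and> W \<subseteq> fst c \<and> smooth_on W h \<and>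
     (\<forall>x\<in>W. h x \<in> fst c' \<and> snd c' (h x) = snd c x \<and> bij (frechet_derivative h (at x)))"

section \<open>Tensor fields\<close>

text \<open>Tensor fields are families of tensor fields on the chart domains, compatible with all changes
  of charts. The values off the chart domains are irrelevant. A \<open>k\<close>-covector is a function of
  \<open>v :: nat \<Rightarrow> 'e\<close> depending only on \<open>v 0, \<dots>, v (k - 1)\<close>. All forms are complex valued.\<close>

type_synonym 'e covector = "(nat \<Rightarrow> 'e) \<Rightarrow> complex"
type_synonym ('e, 'm) scalar = "('e, 'm) chart \<Rightarrow> 'e \<Rightarrow> complex"
type_synonym ('e, 'm) form = "('e, 'm) chart \<Rightarrow> 'e \<Rightarrow> 'e covector"
type_synonym ('e, 'm) vfield = "('e, 'm) chart \<Rightarrow> 'e \<Rightarrow> 'e"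
type_synonym ('e, 'm) endo = "('e, 'm) chart \<Rightarrow> 'e \<Rightarrow> 'e \<Rightarrow> 'e"
type_synonym ('e, 'm) metric = "('e, 'm) chart \<Rightarrow> 'e \<Rightarrow> 'e \<Rightarrow> 'e \<Rightarrow> real"

definition alternating :: "nat \<Rightarrow> 'e::real_vector covector \<Rightarrow> bool" where
  "alternating k b \<longleftrightarrow>
     (\<forall>v w. (\<forall>i<k. v i = w i) \<longrightarrow> b v = b w) \<and>
     (\<forall>v. \<forall>i<k. linear (\<lambda>u. b (v(i := u)))) \<and>
     (\<forall>v. \<forall>i<k. \<forall>j<k. i \<noteq> j \<and> v i = v j \<longrightarrow> b v = 0)"

definition scalar_field :: "('e::euclidean_space, 'm) chart set \<Rightarrow> ('e, 'm) scalar \<Rightarrow> bool" where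
  "scalar_field A f \<longleftrightarrow> (\<forall>c\<in>A. smooth_on (fst c) (f c)) \<and>
     (\<forall>c\<in>A. \<forall>c'\<in>A. \<forall>W h. chart_change c c' W h \<longrightarrow> (\<forall>x\<in>W. f c x = f c' (h x)))"

definition form_field :: "('e::euclidean_space, 'm) chart set \<Rightarrow> nat \<Rightarrow> ('e, 'm) form \<Rightarrow> bool" where
  "form_field A k \<beta> \<longleftrightarrow>
     (\<forall>c\<in>A. (\<forall>x\<in>fst c. alternating k (\<beta> c x)) \<and> (\<forall>v. smooth_on (fst c) (\<lambda>x. \<beta> c x v))) \<and>
     (\<forall>c\<in>A. \<forall>c'\<in>A. \<forall>W h. chart_change c c' W h \<longrightarrow>
        (\<forall>x\<in>W. \<forall>v. \<beta> c x v = \<beta> c' (h x) (\<lambda>i. frechet_derivative h (at x) (v i))))"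

definition endo_field :: "('e::euclidean_space, 'm) chart set \<Rightarrow> ('e, 'm) endo \<Rightarrow> bool" where
  "endo_field A J \<longleftrightarrow>
     (\<forall>c\<in>A. (\<forall>x\<in>fst c. linear (J c x)) \<and> (\<forall>v. smooth_on (fst c) (\<lambda>x. J c x v))) \<and>
     (\<forall>c\<in>A. \<forall>c'\<in>A. \<forall>W h. chart_change c c' W h \<longrightarrow>
        (\<forall>x\<in>W. \<forall>v. frechet_derivative h (at x) (J c x v)
                   = J c' (h x) (frechet_derivative h (at x) v)))"

definition riemannian_metric :: "('e::euclidean_space, 'm) chart set \<Rightarrow> ('e, 'm) metric \<Rightarrow> bool" where
  "riemannian_metric A g \<longleftrightarrow>
     (\<forall>c\<in>A. (\<forall>x\<in>fst c. bilinear (g c x) \<and> (\<forall>v w. g c x v w = g c x w v) \<and>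
                         (\<forall>v. v \<noteq> 0 \<longrightarrow> g c x v v > 0)) \<and>
             (\<forall>v w. smooth_on (fst c) (\<lambda>x. g c x v w))) \<and>
     (\<forall>c\<in>A. \<forall>c'\<in>A. \<forall>W h. chart_change c c' W h \<longrightarrow>
        (\<forall>x\<in>W. \<forall>v w. g c x v w
                   = g c' (h x) (frechet_derivative h (at x) v) (frechet_derivative h (at x) w)))"

definition nowhere_vanishing :: "('e, 'm) chart set \<Rightarrow> ('e, 'm) form \<Rightarrow> bool" where
  "nowhere_vanishing A \<beta> \<longleftrightarrow> (\<forall>c\<in>A. \<forall>x\<in>fst c. \<exists>v. \<beta> c x v \<noteq> 0)"

definition real_form :: "('e, 'm) chart set \<Rightarrow> ('e, 'm) form \<Rightarrow> bool" where
  "real_form A \<beta> \<longleftrightarrow> (\<forall>c\<in>A. \<forall>x\<in>fst c. \<forall>v. \<beta> c x v \<in> \<real>)"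

section \<open>Exterior calculus\<close>

definition vec2 :: "'e \<Rightarrow> 'e \<Rightarrow> nat \<Rightarrow> 'e" where
  "vec2 v w i = (if i = 0 then v else w)"

text \<open>Normalized so that \<open>(a \<and> b) (v, w) = a v * b w - a w * b v\<close> for \<open>1\<close>-forms.\<close>

definition wedge :: "nat \<Rightarrow> nat \<Rightarrow> 'e covector \<Rightarrow> 'e covector \<Rightarrow> 'e covector" where
  "wedge k l a b v =
     (\<Sum>\<sigma> | \<sigma> permutes {..<k + l}.
        of_int (sign \<sigma>) * a (\<lambda>i. v (\<sigma> i)) * b (\<lambda>i. v (\<sigma> (k + i)))) / (fact k * fact l)"

fun wedge_power :: "'e covector \<Rightarrow> nat \<Rightarrow> 'e covector" where
  "wedge_power w 0 = (\<lambda>_. 1)"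
| "wedge_power w (Suc n) = wedge 2 (2 * n) w (wedge_power w n)"

definition contract :: "'e \<Rightarrow> 'e covector \<Rightarrow> 'e covector" where
  "contract u b v = b (case_nat u v)"

definition conj_form :: "('e, 'm) form \<Rightarrow> ('e, 'm) form" where
  "conj_form \<beta> c x v = cnj (\<beta> c x v)"

definition ext_d :: "nat \<Rightarrow> ('e::euclidean_space, 'm) form \<Rightarrow> ('e, 'm) form" where
  "ext_d k \<beta> c x v =
     (\<Sum>i\<le>k. (-1) ^ i *
        frechet_derivative (\<lambda>y. \<beta> c y (\<lambda>j. if j < i then v j else v (Suc j))) (at x) (v i))"

definition lie_form :: "nat \<Rightarrow> ('e::euclidean_space, 'm) vfield \<Rightarrow> ('e, 'm) form \<Rightarrow> ('e, 'm) form" where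
  "lie_form k Y \<beta> c x v =
     frechet_derivative (\<lambda>y. \<beta> c y v) (at x) (Y c x) +
     (\<Sum>i<k. \<beta> c x (v(i := frechet_derivative (Y c) (at x) (v i))))"

definition lie_bracket :: "('e::euclidean_space \<Rightarrow> 'e) \<Rightarrow> ('e \<Rightarrow> 'e) \<Rightarrow> 'e \<Rightarrow> 'e" where
  "lie_bracket Y Z x = frechet_derivative Z (at x) (Y x) - frechet_derivative Y (at x) (Z x)"

definition basic_form ::
  "('e::euclidean_space, 'm) chart set \<Rightarrow> ('e, 'm) vfield \<Rightarrow> nat \<Rightarrow> ('e, 'm) form \<Rightarrow> bool" where
  "basic_form A Y k \<beta> \<longleftrightarrow> form_field A k \<beta> \<and>
     (\<forall>c\<in>A. \<forall>x\<in>fst c. \<forall>v. contract (Y c x) (\<beta> c x) v = 0 \<and> lie_form k Y \<beta> c x v = 0)"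

definition has_charge ::
  "('e::euclidean_space, 'm) chart set \<Rightarrow> ('e, 'm) vfield \<Rightarrow> nat \<Rightarrow> complex \<Rightarrow> ('e, 'm) form \<Rightarrow> bool"
where
  "has_charge A Y k \<kappa> \<beta> \<longleftrightarrow>
     (\<forall>c\<in>A. \<forall>x\<in>fst c. \<forall>v. lie_form k Y \<beta> c x v = \<kappa> * \<beta> c x v)"

section \<open>Complex geometry\<close>

text \<open>The complex-multilinear extension of a \<open>k\<close>-covector \<open>b\<close> is evaluated on the vectors
  \<open>v\<^sub>i - \<i> J v\<^sub>i\<close> of type \<open>(1,0)\<close>, for \<open>s i\<close> true, and \<open>v\<^sub>i + \<i> J v\<^sub>i\<close> of type \<open>(0,1)\<close>, for \<open>s i\<close>
  false. All components of \<open>b\<close> of type \<open>(p, k - p)\<close> with \<open>p \<notin> P\<close> must vanish.\<close>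

definition covector_type :: "nat \<Rightarrow> nat set \<Rightarrow> ('e \<Rightarrow> 'e) \<Rightarrow> 'e covector \<Rightarrow> bool" where
  "covector_type k P J b \<longleftrightarrow>
     (\<forall>v s. card {i. i < k \<and> s i} \<notin> P \<longrightarrow>
        (\<Sum>B\<in>Pow {..<k}. (\<Prod>i\<in>B. if s i then - \<i> else \<i>) *
           b (\<lambda>i. if i \<in> B then J (v i) else v i)) = 0)"

definition has_type ::
  "('e, 'm) chart set \<Rightarrow> ('e, 'm) endo \<Rightarrow> nat \<Rightarrow> nat set \<Rightarrow> ('e, 'm) form \<Rightarrow> bool" where
  "has_type A J k P \<beta> \<longleftrightarrow> (\<forall>c\<in>A. \<forall>x\<in>fst c. covector_type k P (J c x) (\<beta> c x))"

definition almost_complex :: "('e::euclidean_space, 'm) chart set \<Rightarrow> ('e, 'm) endo \<Rightarrow> bool" where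
  "almost_complex A J \<longleftrightarrow> endo_field A J \<and> (\<forall>c\<in>A. \<forall>x\<in>fst c. \<forall>v. J c x (J c x v) = - v)"

text \<open>Integrability is the vanishing of the Nijenhuis tensor.\<close>

definition integrable_acs :: "('e::euclidean_space, 'm) chart set \<Rightarrow> ('e, 'm) endo \<Rightarrow> bool" where
  "integrable_acs A J \<longleftrightarrow>
     (\<forall>c\<in>A. \<forall>Y Z. smooth_on (fst c) Y \<and> smooth_on (fst c) Z \<longrightarrow>
        (\<forall>x\<in>fst c.
           lie_bracket (\<lambda>y. J c y (Y y)) (\<lambda>y. J c y (Z y)) x
           - J c x (lie_bracket (\<lambda>y. J c y (Y y)) Z x)
           - J c x (lie_bracket Y (\<lambda>y. J c y (Z y)) x)
           - lie_bracket Y Z x = 0))"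

definition kahler_form :: "('e, 'm) metric \<Rightarrow> ('e, 'm) endo \<Rightarrow> ('e, 'm) form" where
  "kahler_form g J c x v = complex_of_real (g c x (J c x (v 0)) (v 1))"

definition kahler :: "('e::euclidean_space, 'm) chart set \<Rightarrow> ('e, 'm) metric \<Rightarrow> ('e, 'm) endo \<Rightarrow> bool" where
  "kahler A g J \<longleftrightarrow>
     riemannian_metric A g \<and> almost_complex A J \<and> integrable_acs A J \<and>
     (\<forall>c\<in>A. \<forall>x\<in>fst c. \<forall>v w. g c x (J c x v) (J c x w) = g c x v w) \<and>
     (\<forall>c\<in>A. \<forall>x\<in>fst c. \<forall>v. ext_d 2 (kahler_form g J) c x v = 0)"

text \<open>The Levi-Civita symbol for indices in \<open>{1, 2, 3}\<close>.\<close>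

definition eps :: "nat \<Rightarrow> nat \<Rightarrow> nat \<Rightarrow> real" where
  "eps i j k = (real j - real i) * (real k - real j) * (real k - real i) / 2"

definition hyperkahler ::
  "('e::euclidean_space, 'm) chart set \<Rightarrow> ('e, 'm) metric \<Rightarrow> (nat \<Rightarrow> ('e, 'm) endo) \<Rightarrow> bool" where
  "hyperkahler A g J \<longleftrightarrow>
     (\<forall>i\<in>{1..3}. kahler A g (J i)) \<and>
     (\<forall>i\<in>{1..3}. \<forall>j\<in>{1..3}. \<forall>c\<in>A. \<forall>x\<in>fst c. \<forall>v.
        J i c x (J j c x v) = - (if i = j then 1 else 0) *\<^sub>R v + (\<Sum>k=1..3. eps i j k *\<^sub>R J k c x v))"

text \<open>A form of type \<open>(n,0)\<close> is holomorphic iff it is closed, since its exterior derivative is the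
  Dolbeault derivative when \<open>n\<close> is the complex dimension.\<close>

definition holomorphic_volume_form ::
  "('e::euclidean_space, 'm) chart set \<Rightarrow> ('e, 'm) endo \<Rightarrow> ('e, 'm) form \<Rightarrow> bool" where
  "holomorphic_volume_form A J \<beta> \<longleftrightarrow>
     (let n = DIM('e) div 2 in
        form_field A n \<beta> \<and> has_type A J n {n} \<beta> \<and> nowhere_vanishing A \<beta> \<and>
        (\<forall>c\<in>A. \<forall>x\<in>fst c. \<forall>v. ext_d n \<beta> c x v = 0))"

definition twist_form ::
  "('e::euclidean_space, 'm) chart set \<Rightarrow> ('e, 'm) endo \<Rightarrow> ('e, 'm) vfield \<Rightarrow> ('e, 'm) form \<Rightarrow> bool"
where
  "twist_form A J Y \<beta> \<longleftrightarrow>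
     form_field A 1 \<beta> \<and> nowhere_vanishing A \<beta> \<and> has_type A J 1 {1} \<beta> \<and>
     (\<forall>c\<in>A. \<forall>x\<in>fst c. \<forall>v. contract (Y c x) (\<beta> c x) v = 0) \<and>
     (\<exists>\<kappa>. has_charge A Y 1 \<kappa> \<beta>)"

section \<open>Cones and 3-Sasakian manifolds\<close>

definition cone_chart :: "('e, 'm) chart \<Rightarrow> ('e \<times> real, 'm \<times> real) chart" where
  "cone_chart c = (fst c \<times> {0<..}, \<lambda>(x, r). (snd c x, r))"

definition cone_atlas :: "('e, 'm) chart set \<Rightarrow> ('e \<times> real, 'm \<times> real) chart set" where
  "cone_atlas A = cone_chart ` A"

definition cone_base :: "('e \<times> real, 'm \<times> real) chart \<Rightarrow> ('e, 'm) chart" where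
  "cone_base C = (fst ` fst C, \<lambda>x. fst (snd C (x, 1)))"

lemma cone_base_cone_chart [simp]: "cone_base (cone_chart c) = c"
proof -
  have "fst ` (fst c \<times> {0::real<..}) = fst c"
    by (auto simp: fst_image_times)
  then show ?thesis
    by (simp add: cone_base_def cone_chart_def)
qed

text \<open>The metric \<open>dr\<^sup>2 + r\<^sup>2 g\<close>; a point of a chart of the cone is a pair \<open>(x, r)\<close>.\<close>

definition cone_metric :: "('e, 'm) metric \<Rightarrow> ('e \<times> real, 'm \<times> real) metric" where
  "cone_metric g C y v w = snd v * snd w + (snd y)\<^sup>2 * g (cone_base C) (fst y) (fst v) (fst w)"

text \<open>The Reeb fields \<open>\<xi>\<^sub>i = J\<^sub>i (r \<partial>\<^sub>r)\<close> on the cone.\<close>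

definition reeb ::
  "(nat \<Rightarrow> ('e::real_vector \<times> real, 'm \<times> real) endo) \<Rightarrow> nat \<Rightarrow> ('e \<times> real, 'm \<times> real) vfield" where
  "reeb J i C y = J i C y (0, snd y)"

definition contact_form ::
  "('e::real_vector, 'm) metric \<Rightarrow> (nat \<Rightarrow> ('e \<times> real, 'm \<times> real) endo) \<Rightarrow> nat
     \<Rightarrow> ('e \<times> real, 'm \<times> real) form" where
  "contact_form g J i C y v = complex_of_real (cone_metric g C y (reeb J i C y) (v 0) / (snd y)\<^sup>2)"

text \<open>Pullback to \<open>{r = 1}\<close>, and the restriction to \<open>{r = 1}\<close> of a vector field tangent to it.\<close>

definition restrict_form :: "('e \<times> real, 'm \<times> real) form \<Rightarrow> ('e, 'm) form" where
  "restrict_form \<beta> c x v = \<beta> (cone_chart c) (x, 1) (\<lambda>i. (v i, 0))"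

definition restrict_field :: "('e \<times> real, 'm \<times> real) vfield \<Rightarrow> ('e, 'm) vfield" where
  "restrict_field Y c x = fst (Y (cone_chart c) (x, 1))"

definition three_sasakian ::
  "'m topology \<Rightarrow> ('e::euclidean_space, 'm) chart set \<Rightarrow> ('e, 'm) metric
     \<Rightarrow> (nat \<Rightarrow> ('e \<times> real, 'm \<times> real) endo) \<Rightarrow> bool" where
  "three_sasakian X A g J \<longleftrightarrow>
     smooth_manifold X A \<and> riemannian_metric A g \<and> hyperkahler (cone_atlas A) (cone_metric g) J"

section \<open>The twist form and the twisted forms on the cone\<close>

definition Upsilon ::
  "('e::real_vector, 'm) metric \<Rightarrow> (nat \<Rightarrow> ('e \<times> real, 'm \<times> real) endo)
     \<Rightarrow> ('e \<times> real, 'm \<times> real) form" where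
  "Upsilon g J C y v =
     kahler_form (cone_metric g) (J 1) C y v + \<i> * kahler_form (cone_metric g) (J 2) C y v"

definition Omega4 ::
  "('e::real_vector, 'm) metric \<Rightarrow> (nat \<Rightarrow> ('e \<times> real, 'm \<times> real) endo)
     \<Rightarrow> ('e \<times> real, 'm \<times> real) form" where
  "Omega4 g J C y v = wedge 2 2 (Upsilon g J C y) (Upsilon g J C y) v / 2"

definition eta ::
  "('e::real_vector, 'm) metric \<Rightarrow> (nat \<Rightarrow> ('e \<times> real, 'm \<times> real) endo)
     \<Rightarrow> ('e \<times> real, 'm \<times> real) form" where
  "eta g J C y v =
     complex_of_real ((snd y)\<^sup>2) * (contact_form g J 1 C y v + \<i> * contact_form g J 2 C y v)"

text \<open>Contraction with \<open>\<eta>\<close>-bar, that is, with the complex vector field \<open>(\<xi>\<^sub>1 - \<i> \<xi>\<^sub>2) / 2\<close>.\<close>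

definition etabar_contract ::
  "(nat \<Rightarrow> ('e::real_vector \<times> real, 'm \<times> real) endo) \<Rightarrow> ('e \<times> real, 'm \<times> real) form
     \<Rightarrow> ('e \<times> real, 'm \<times> real) form" where
  "etabar_contract J \<beta> C y v =
     (contract (reeb J 1 C y) (\<beta> C y) v - \<i> * contract (reeb J 2 C y) (\<beta> C y) v) / 2"

definition eta_etabar ::
  "('e::real_vector, 'm) metric \<Rightarrow> (nat \<Rightarrow> ('e \<times> real, 'm \<times> real) endo)
     \<Rightarrow> ('e \<times> real, 'm \<times> real) form" where
  "eta_etabar g J C y = wedge 1 1 (eta g J C y) (conj_form (eta g J) C y)"

text \<open>The divisor is \<open>|\<eta>|\<^sup>2\<close>, the contraction of \<open>\<eta>\<close> with its conjugate.\<close>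

definition omega_twist ::
  "('e::real_vector, 'm) metric \<Rightarrow> (nat \<Rightarrow> ('e \<times> real, 'm \<times> real) endo)
     \<Rightarrow> ('e \<times> real, 'm \<times> real) form" where
  "omega_twist g J C y v =
     kahler_form (cone_metric g) (J 3) C y v
     - \<i> / etabar_contract J (eta g J) C y (\<lambda>_. 0) * eta_etabar g J C y v"

definition Omega_twist ::
  "('e::real_vector, 'm) metric \<Rightarrow> (nat \<Rightarrow> ('e \<times> real, 'm \<times> real) endo)
     \<Rightarrow> ('e \<times> real, 'm \<times> real) form" where
  "Omega_twist g J C y v =
     - \<i> * wedge 1 2 (conj_form (eta g J) C y)
        (etabar_contract J (\<lambda>C y. contract (reeb J 3 C y) (Omega4 g J C y)) C y) v"

section \<open>Quasi-regularity and the leaf space\<close>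

text \<open>The circle is the unit circle of the complex plane.\<close>

definition circle_action ::
  "'m topology \<Rightarrow> ('e::euclidean_space, 'm) chart set \<Rightarrow> (complex \<Rightarrow> 'm \<Rightarrow> 'm) \<Rightarrow> bool" where
  "circle_action X A \<rho> \<longleftrightarrow>
     (\<forall>z\<in>sphere 0 1. \<forall>p\<in>topspace X. \<rho> z p \<in> topspace X) \<and>
     (\<forall>p\<in>topspace X. \<rho> 1 p = p) \<and>
     (\<forall>z\<in>sphere 0 1. \<forall>w\<in>sphere 0 1. \<forall>p\<in>topspace X. \<rho> (z * w) p = \<rho> z (\<rho> w p)) \<and>
     (\<forall>c\<in>A. smooth_map_to X A (UNIV \<times> fst c) (\<lambda>(t::real, x). \<rho> (cis t) (snd c x)))"

text \<open>\<open>Y\<close> integrates to \<open>\<rho>\<close> up to rescaling of the period.\<close>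

definition integrates_to ::
  "('e::euclidean_space, 'm) chart set \<Rightarrow> ('e, 'm) vfield \<Rightarrow> (complex \<Rightarrow> 'm \<Rightarrow> 'm) \<Rightarrow> bool" where
  "integrates_to A Y \<rho> \<longleftrightarrow>
     (\<exists>l>0. \<forall>c\<in>A. \<forall>x\<in>fst c.
        ((\<lambda>t. coord c (\<rho> (cis (l * t)) (snd c x))) has_vector_derivative Y c x) (at 0))"

definition quasi_regular ::
  "'m topology \<Rightarrow> ('e::euclidean_space, 'm) chart set \<Rightarrow> ('e, 'm) vfield
     \<Rightarrow> (complex \<Rightarrow> 'm \<Rightarrow> 'm) \<Rightarrow> bool" where
  "quasi_regular X A Y \<rho> \<longleftrightarrow>
     circle_action X A \<rho> \<and> integrates_to A Y \<rho> \<and>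
     (\<forall>z\<in>sphere 0 1. (\<forall>p\<in>topspace X. \<rho> z p = p) \<longrightarrow> z = 1) \<and>
     (\<forall>p\<in>topspace X. finite {z\<in>sphere 0 1. \<rho> z p = p})"

definition regular ::
  "'m topology \<Rightarrow> ('e::euclidean_space, 'm) chart set \<Rightarrow> ('e, 'm) vfield
     \<Rightarrow> (complex \<Rightarrow> 'm \<Rightarrow> 'm) \<Rightarrow> bool" where
  "regular X A Y \<rho> \<longleftrightarrow>
     circle_action X A \<rho> \<and> integrates_to A Y \<rho> \<and>
     (\<forall>z\<in>sphere 0 1. (\<forall>p\<in>topspace X. \<rho> z p = p) \<longrightarrow> z = 1) \<and>
     (\<forall>p\<in>topspace X. \<forall>z\<in>sphere 0 1. \<rho> z p = p \<longrightarrow> z = 1)"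

text \<open>Points of the leaf space are the orbits, as subsets of the manifold.\<close>

definition orbit :: "(complex \<Rightarrow> 'm \<Rightarrow> 'm) \<Rightarrow> 'm \<Rightarrow> 'm set" where
  "orbit \<rho> p = (\<lambda>z. \<rho> z p) ` sphere 0 1"

text \<open>This is the quotient topology.\<close>

definition leaf_space :: "'m topology \<Rightarrow> (complex \<Rightarrow> 'm \<Rightarrow> 'm) \<Rightarrow> 'm set topology" where
  "leaf_space X \<rho> = topology (\<lambda>W. W \<subseteq> orbit \<rho> ` topspace X \<and> openin X (\<Union>W))"

text \<open>A uniformizing chart: \<open>q\<close> identifies the quotient of \<open>V\<close> by the finite group \<open>\<Gamma>\<close> of
  diffeomorphisms with an open subset.\<close>

definition orbifold_chart :: "'z topology \<Rightarrow> ('d::euclidean_space, 'z) chart \<Rightarrow> bool" where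
  "orbifold_chart T d \<longleftrightarrow>
     (let V = fst d; q = snd d in
        open V \<and> connected V \<and>
        continuous_map (top_of_set V) T q \<and> open_map (top_of_set V) T q \<and>
        (\<exists>\<Gamma>. finite \<Gamma> \<and> \<Gamma> \<noteq> {} \<and>
           (\<forall>\<gamma>\<in>\<Gamma>. smooth_on V \<gamma> \<and> \<gamma> ` V \<subseteq> V \<and> (\<exists>\<gamma>'\<in>\<Gamma>. \<forall>x\<in>V. \<gamma>' (\<gamma> x) = x)) \<and>
           (\<forall>\<gamma>\<in>\<Gamma>. \<forall>\<delta>\<in>\<Gamma>. \<exists>\<epsilon>\<in>\<Gamma>. \<forall>x\<in>V. \<epsilon> x = \<gamma> (\<delta> x)) \<and>
           (\<forall>x\<in>V. \<forall>y\<in>V. q x = q y \<longleftrightarrow> (\<exists>\<gamma>\<in>\<Gamma>. y = \<gamma> x))))"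

text \<open>A slice \<open>\<sigma>\<close> of the orbits lifting \<open>q\<close>: an immersion transverse to \<open>Y\<close>.\<close>

definition slice_lift ::
  "'m topology \<Rightarrow> ('e::euclidean_space, 'm) chart set \<Rightarrow> ('e, 'm) vfield \<Rightarrow> (complex \<Rightarrow> 'm \<Rightarrow> 'm)
     \<Rightarrow> ('d::euclidean_space, 'm set) chart \<Rightarrow> ('d \<Rightarrow> 'm) \<Rightarrow> bool" where
  "slice_lift X A Y \<rho> d \<sigma> \<longleftrightarrow>
     smooth_map_to X A (fst d) \<sigma> \<and>
     (\<forall>x\<in>fst d. orbit \<rho> (\<sigma> x) = snd d x) \<and>
     (\<forall>x\<in>fst d. \<forall>c\<in>A. \<sigma> x \<in> chart_range c \<longrightarrow>
        (\<forall>u a. frechet_derivative (\<lambda>y. coord c (\<sigma> y)) (at x) u = a *\<^sub>R Y c (coord c (\<sigma> x))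
               \<longrightarrow> u = 0))"

text \<open>The orbifold atlas of the leaf space of a 7-manifold. Forms on the leaf space in the orbifold
  sense are the form fields on this atlas.\<close>

definition leaf_atlas ::
  "'m topology \<Rightarrow> (real^7, 'm) chart set \<Rightarrow> (real^7, 'm) vfield \<Rightarrow> (complex \<Rightarrow> 'm \<Rightarrow> 'm)
     \<Rightarrow> (real^6, 'm set) chart set" where
  "leaf_atlas X A Y \<rho> =
     {d. orbifold_chart (leaf_space X \<rho>) d \<and> (\<exists>\<sigma>. slice_lift X A Y \<rho> d \<sigma>)}"

text \<open>The form \<open>\<beta>'\<close> on the leaf space is induced by \<open>\<beta>\<close>: in each orbifold chart it is the
  pullback of \<open>\<beta>\<close> by any slice.\<close>

definition induces ::
  "'m topology \<Rightarrow> (real^7, 'm) chart set \<Rightarrow> (real^7, 'm) vfield \<Rightarrow> (complex \<Rightarrow> 'm \<Rightarrow> 'm) \<Rightarrow> nat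
     \<Rightarrow> (real^7, 'm) form \<Rightarrow> (real^6, 'm set) form \<Rightarrow> bool" where
  "induces X A Y \<rho> k \<beta> \<beta>' \<longleftrightarrow>
     form_field (leaf_atlas X A Y \<rho>) k \<beta>' \<and>
     (\<forall>d\<in>leaf_atlas X A Y \<rho>. \<forall>\<sigma>. slice_lift X A Y \<rho> d \<sigma> \<longrightarrow>
        (\<forall>x\<in>fst d. \<forall>c\<in>A. \<sigma> x \<in> chart_range c \<longrightarrow>
           (\<forall>v. \<beta>' d x v = \<beta> c (coord c (\<sigma> x))
                  (\<lambda>i. frechet_derivative (\<lambda>y. coord c (\<sigma> y)) (at x) (v i)))))"

section \<open>\<open>SU(3)\<close>-structures on 6-dimensional manifolds and orbifolds\<close>

definition su3_structure ::
  "(real^6, 'z) chart set \<Rightarrow> (real^6, 'z) endo \<Rightarrow> (real^6, 'z) form \<Rightarrow> (real^6, 'z) form \<Rightarrow> bool" where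
  "su3_structure A J \<omega> \<Omega> \<longleftrightarrow>
     almost_complex A J \<and> form_field A 2 \<omega> \<and> real_form A \<omega> \<and>
     (\<forall>c\<in>A. \<forall>x\<in>fst c. \<forall>v. \<omega> c x (\<lambda>i. J c x (v i)) = \<omega> c x v) \<and>
     riemannian_metric A (\<lambda>c x v w. Re (\<omega> c x (vec2 v (J c x w)))) \<and>
     form_field A 3 \<Omega> \<and> nowhere_vanishing A \<Omega> \<and> has_type A J 3 {3} \<Omega> \<and>
     (\<forall>c\<in>A. \<forall>x\<in>fst c. \<forall>v.
        wedge 2 3 (\<omega> c x) (\<Omega> c x) v = 0 \<and>
        wedge 3 3 (\<Omega> c x) (conj_form \<Omega> c x) v = - 8 * \<i> * wedge_power (\<omega> c x) 3 v / fact 3)"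

definition primitive_form :: "('e, 'z) chart set \<Rightarrow> ('e, 'z) form \<Rightarrow> nat \<Rightarrow> ('e, 'z) form \<Rightarrow> bool" where
  "primitive_form A \<omega> k \<beta> \<longleftrightarrow>
     (\<forall>c\<in>A. \<forall>x\<in>fst c. \<forall>v. wedge k (2 * (4 - k)) (\<beta> c x) (wedge_power (\<omega> c x) (4 - k)) v = 0)"

definition torsion_classes ::
  "(real^6, 'z) chart set \<Rightarrow> (real^6, 'z) endo \<Rightarrow> (real^6, 'z) form \<Rightarrow> (real^6, 'z) form
     \<Rightarrow> (real^6, 'z) scalar \<Rightarrow> (real^6, 'z) form \<Rightarrow> (real^6, 'z) form \<Rightarrow> (real^6, 'z) form
     \<Rightarrow> (real^6, 'z) form \<Rightarrow> bool" where
  "torsion_classes A J \<omega> \<Omega> W1 W2 W3 W4 W5 \<longleftrightarrow>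
     scalar_field A W1 \<and>
     form_field A 2 W2 \<and> has_type A J 2 {1} W2 \<and> primitive_form A \<omega> 2 W2 \<and>
     form_field A 3 W3 \<and> real_form A W3 \<and> has_type A J 3 {1, 2} W3 \<and> primitive_form A \<omega> 3 W3 \<and>
     form_field A 1 W4 \<and> real_form A W4 \<and>
     form_field A 1 W5 \<and> has_type A J 1 {1} W5 \<and>
     (\<forall>c\<in>A. \<forall>x\<in>fst c. \<forall>v.
        ext_d 2 \<omega> c x v =
          complex_of_real (3 / 2 * Im (cnj (W1 c x) * \<Omega> c x v))
          + wedge 1 2 (W4 c x) (\<omega> c x) v + W3 c x v \<and>
        ext_d 3 \<Omega> c x v =
          W1 c x * wedge_power (\<omega> c x) 2 v
          + wedge 2 2 (W2 c x) (\<omega> c x) v + wedge 1 3 (conj_form W5 c x) (\<Omega> c x) v)"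

text \<open>An LT structure with non-vanishing torsion classes \<open>W1\<close> and \<open>W2\<close>.\<close>

definition lt_structure ::
  "(real^6, 'z) chart set \<Rightarrow> (real^6, 'z) form \<Rightarrow> (real^6, 'z) form
     \<Rightarrow> (real^6, 'z) scalar \<Rightarrow> (real^6, 'z) form \<Rightarrow> bool" where
  "lt_structure A \<omega> \<Omega> W1 W2 \<longleftrightarrow>
     (\<exists>J. su3_structure A J \<omega> \<Omega> \<and>
          torsion_classes A J \<omega> \<Omega> W1 W2 (\<lambda>_ _ _. 0) (\<lambda>_ _ _. 0) (\<lambda>_ _ _. 0)) \<and>
     (\<forall>c\<in>A. \<forall>x\<in>fst c. W1 c x \<noteq> 0) \<and> nowhere_vanishing A W2"

end

theory Submission
  imports Defs
begin

text \<open>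
  Let \<open>E = r \<partial>\<^sub>r\<close>. Integrability of \<open>J\<^sub>i\<close> and \<open>d \<omega>\<^sub>i = 0\<close> give \<open>d (r\<^sup>2 \<eta>\<^sub>i) = 2 \<omega>\<^sub>i\<close>, and the flow of
  \<open>\<xi>\<^sub>3\<close> rotates \<open>\<omega>\<^sub>1 + \<i> \<omega>\<^sub>2\<close> and \<open>\<eta>\<close> with charge \<open>2 \<i>\<close>. On \<open>{r = 1}\<close> a quaternionic orthonormal frame
  yields complex \<open>1\<close>-forms \<open>\<alpha>, \<beta>\<close> with
  \<open>\<omega>\<^sub>1 + \<i> \<omega>\<^sub>2 = \<alpha> \<and> \<beta> - \<i> \<eta> \<and> \<eta>\<^sub>3\<close> and
  \<open>\<omega>\<^sub>3 = \<i>/2 (\<alpha> \<and> \<alpha>' + \<beta> \<and> \<beta>' + \<eta> \<and> \<eta>')\<close>, primes denoting conjugates. Hence \<open>\<omega>\<close> and \<open>\<Omega>\<close> are the standard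
  \<open>SU(3)\<close> forms of the coframe \<open>\<alpha>, \<beta>, \<eta>'\<close>: twisting replaces \<open>\<eta>\<close> by its conjugate.

  Only the equations \<open>d \<eta> = 2 (\<omega>\<^sub>1 + \<i> \<omega>\<^sub>2)\<close> and \<open>d \<eta>\<^sub>3 = 2 \<omega>\<^sub>3\<close> are needed to compute
  \<open>d \<omega> = 4 Im \<Omega>\<close> and \<open>d \<Omega> = d \<eta>' \<and> P - \<eta>' \<and> d P\<close>, where
  \<open>P = \<omega>\<^sub>1 + \<i> \<omega>\<^sub>2 + \<i> \<eta> \<and> \<eta>\<^sub>3\<close>; comparing coefficients in the coframe gives the torsion classes.
  Forms on the orbifold are pullbacks along slices. They do not depend on the slice because basic
  forms are invariant under the flow, and the almost complex structure is recovered from \<open>\<Omega>\<close>.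
\<close>

section \<open>Calculus of smooth maps and forms\<close>

text \<open>The constants come from comparing coefficients. As d omega = 4 Im Omega, 3/2 W1 = 4. In
  the coframe, d Omega has coefficients -2, -1, -1 on the three products of pairs and omega^2 has
  -1/2 on each; the mean -4/3 is 8/3 times -1/2, and the traceless rest is W2 times omega, with W2
  proportional to 1, 1, -2, whose vanishing sum is primitivity. Two obstacles shape the proof. The
  forms alpha, beta are chosen separately at each point, without any regularity, so nothing that is
  differentiated or shown to be smooth may be expressed through them: omega_1 + i omega_2 and
  omega_3 become half the exterior derivatives of eta and eta_3, and the almost complex structure of
  Z is smooth because it solves a linear system whose matrix is the transverse metric, g minus the
  square of eta_3. And two slices over one orbifold chart may differ by a group element that jumps
  from point to point, so their pullbacks are compared by an argument with sequences.\<close>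

lemma frechet_derivative_eq:
  "(f has_derivative f') (at x) \<Longrightarrow> frechet_derivative f (at x) = f'"
  by (metis frechet_derivative_at)

lemma differentiable_has_derivative:
  "f differentiable (at x) \<Longrightarrow> (f has_derivative frechet_derivative f (at x)) (at x)"
  using frechet_derivative_works by blast

lemma has_derivative_cong_open:
  assumes "open U" "x \<in> U" "\<And>y. y \<in> U \<Longrightarrow> f y = g y"
  shows "(f has_derivative f') (at x) \<longleftrightarrow> (g has_derivative f') (at x)"
  using assms has_derivative_transform_within_open[of f f' x UNIV U g]
    has_derivative_transform_within_open[of g f' x UNIV U f] by auto

lemma frechet_derivative_cong_open:
  assumes "open U" "x \<in> U" "\<And>y. y \<in> U \<Longrightarrow> f y = g y"
  shows "frechet_derivative f (at x) = frechet_derivative g (at x)"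
  unfolding frechet_derivative_def using has_derivative_cong_open[OF assms] by simp

lemma differentiable_cong_open:
  assumes "open U" "x \<in> U" "\<And>y. y \<in> U \<Longrightarrow> f y = g y"
  shows "f differentiable (at x) \<longleftrightarrow> g differentiable (at x)"
  unfolding differentiable_def using has_derivative_cong_open[OF assms] by simp

lemma Ck_on_cong:
  assumes "open U" "\<And>x. x \<in> U \<Longrightarrow> f x = g x"
  shows "Ck_on n U f \<longleftrightarrow> Ck_on n U g"
  using assms(2)
proof (induction n arbitrary: f g)
  case 0
  then show ?case by (auto intro: continuous_on_eq)
next
  case (Suc n)
  have "Ck_on n U (\<lambda>x. frechet_derivative f (at x) v) \<longleftrightarrow> Ck_on n U (\<lambda>x. frechet_derivative g (at x) v)" for v
    by (rule Suc.IH) (simp add: frechet_derivative_cong_open[OF assms(1) _ Suc.prems])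
  moreover have "f differentiable (at x) \<longleftrightarrow> g differentiable (at x)" if "x \<in> U" for x
    by (rule differentiable_cong_open[OF assms(1) that Suc.prems])
  ultimately show ?case unfolding Ck_on.simps(2) by (simp cong: ball_cong)
qed

lemma smooth_on_cong:
  assumes "open U" "\<And>x. x \<in> U \<Longrightarrow> f x = g x"
  shows "smooth_on U f \<longleftrightarrow> smooth_on U g"
  proof -
  have "Ck_on n U f \<longleftrightarrow> Ck_on n U g" for n
    by (rule Ck_on_cong) (fact assms)+
  then show ?thesis unfolding smooth_on_def by blast
qed

lemma Ck_on_SucD: "Ck_on (Suc n) U f \<Longrightarrow> Ck_on n U f"
proof (induction n arbitrary: f)
  case 0
  have "continuous (at x) f" if "x \<in> U" for x
  proof -
    have "f differentiable (at x)" using 0 that unfolding Ck_on.simps(2) by blast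
    then show ?thesis by (rule differentiable_imp_continuous_within)
  qed
  then show ?case using continuous_at_imp_continuous_on[of U f] by simp
next
  case (Suc n)
  note S = Suc.prems[unfolded Ck_on.simps(2)[of "Suc n"]]
  show ?case unfolding Ck_on.simps(2)[of n]
  proof (intro conjI allI)
    show "\<forall>x\<in>U. f differentiable (at x)" by (rule S[THEN conjunct1])
    show "Ck_on n U (\<lambda>x. frechet_derivative f (at x) v)" for v
      by (rule Suc.IH, rule spec[OF S[THEN conjunct2]])
  qed
qed

lemma Ck_on_has_derivative:
  "Ck_on (Suc n) U f \<Longrightarrow> x \<in> U \<Longrightarrow> (f has_derivative frechet_derivative f (at x)) (at x)"
  by (rule differentiable_has_derivative) simp

lemma Ck_on_subset: "Ck_on n U f \<Longrightarrow> V \<subseteq> U \<Longrightarrow> Ck_on n V f"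
proof (induction n arbitrary: f)
  case 0
  then show ?case by (simp add: continuous_on_subset)
next
  case (Suc n)
  then show ?case by (simp add: subset_iff)
qed

lemma smooth_on_subset: "smooth_on U f \<Longrightarrow> V \<subseteq> U \<Longrightarrow> smooth_on V f"
  unfolding smooth_on_def by (intro allI Ck_on_subset[of _ U f V]) auto

lemma smooth_on_differentiable: "smooth_on U f \<Longrightarrow> x \<in> U \<Longrightarrow> f differentiable (at x)"
  unfolding smooth_on_def by (drule spec[of _ "Suc 0"]) (unfold Ck_on.simps(2), blast)

lemma smooth_on_has_derivative:
  "smooth_on U f \<Longrightarrow> x \<in> U \<Longrightarrow> (f has_derivative frechet_derivative f (at x)) (at x)"
  using smooth_on_differentiable differentiable_has_derivative by blast

lemma smooth_on_continuous: "smooth_on U f \<Longrightarrow> continuous_on U f"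
  unfolding smooth_on_def by (drule spec[of _ 0]) auto

lemma smooth_on_derivative: "smooth_on U f \<Longrightarrow> smooth_on U (\<lambda>x. frechet_derivative f (at x) v)"
  unfolding smooth_on_def
proof
  fix n assume "\<forall>n. Ck_on n U f"
  then have "Ck_on (Suc n) U f" by blast
  then show "Ck_on n U (\<lambda>x. frechet_derivative f (at x) v)" by simp
qed

lemma frechet_derivative_linear:
  "smooth_on U f \<Longrightarrow> x \<in> U \<Longrightarrow> linear (frechet_derivative f (at x))"
  using smooth_on_has_derivative has_derivative_linear by blast

lemma Ck_on_local:
  assumes "\<And>x. x \<in> U \<Longrightarrow> \<exists>V. open V \<and> x \<in> V \<and> Ck_on n V f"
  shows "Ck_on n U f"
  using assms
proof (induction n arbitrary: f)
  case 0
  show ?case unfolding Ck_on.simps continuous_on_eq_continuous_within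
  proof
    fix x assume "x \<in> U"
    then obtain V where V: "open V" "x \<in> V" "continuous_on V f" using 0 by auto
    then show "continuous (at x within U) f"
      using continuous_at_imp_continuous_at_within continuous_on_eq_continuous_at by blast
  qed
next
  case (Suc n)
  show ?case unfolding Ck_on.simps
  proof (intro conjI ballI allI)
    fix x assume "x \<in> U"
    then show "f differentiable (at x)" using Suc.prems[of x] by auto
  next
    fix v show "Ck_on n U (\<lambda>x. frechet_derivative f (at x) v)"
    proof (rule Suc.IH)
      fix x assume "x \<in> U"
      then show "\<exists>V. open V \<and> x \<in> V \<and> Ck_on n V (\<lambda>x. frechet_derivative f (at x) v)"
        using Suc.prems[of x] by auto
    qed
  qed
qed

lemma smooth_on_local:
  assumes "\<And>x. x \<in> U \<Longrightarrow> \<exists>V. open V \<and> x \<in> V \<and> smooth_on V f"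
  shows "smooth_on U f"
  using assms Ck_on_local[of U _ f] unfolding smooth_on_def by meson

section \<open>Closure properties of smooth maps\<close>

lemma Ck_on_const: "Ck_on n U (\<lambda>x. c)"
  by (induction n arbitrary: c) (auto simp: frechet_derivative_eq[OF has_derivative_const])

lemma smooth_on_const [simp]: "smooth_on U (\<lambda>x. c)"
  by (simp add: smooth_on_def Ck_on_const)

lemma Ck_on_add:
  assumes "open U"
  shows "Ck_on n U f \<Longrightarrow> Ck_on n U g \<Longrightarrow> Ck_on n U (\<lambda>x. f x + g x)"
proof (induction n arbitrary: f g)
  case 0
  then show ?case by (auto intro: continuous_on_add)
next
  case (Suc n)
  have "frechet_derivative (\<lambda>x. f x + g x) (at x) v =
      frechet_derivative f (at x) v + frechet_derivative g (at x) v" if "x \<in> U" for x v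
  proof -
    note Suc.prems[THEN Ck_on_has_derivative, OF that]
    from has_derivative_add[OF this] show ?thesis by (simp add: frechet_derivative_eq)
  qed
  then have "Ck_on n U (\<lambda>x. frechet_derivative (\<lambda>x. f x + g x) (at x) v)" for v
    using Suc by (subst Ck_on_cong[OF assms]) auto
  then show ?case using Suc.prems by (auto intro: differentiable_add)
qed

lemma Ck_on_sum:
  assumes "open U" "\<And>i. i \<in> I \<Longrightarrow> Ck_on n U (f i)"
  shows "Ck_on n U (\<lambda>x. \<Sum>i\<in>I. f i x)"
  using assms(2)
proof (induction I rule: infinite_finite_induct)
  case (insert i I)
  have "Ck_on n U (\<lambda>x. f i x + (\<Sum>i\<in>I. f i x))"
    by (rule Ck_on_add[OF assms(1)]) (simp_all add: insert)
  then show ?case by (simp add: insert)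
qed (simp_all add: Ck_on_const)

lemma Ck_on_bounded_linear:
  assumes "open U" "bounded_linear L"
  shows "Ck_on n U f \<Longrightarrow> Ck_on n U (\<lambda>x. L (f x))"
proof (induction n arbitrary: f)
  case 0
  then show ?case by (simp add: bounded_linear.continuous_on[OF assms(2)])
next
  case (Suc n)
  have d: "((\<lambda>x. L (f x)) has_derivative (\<lambda>v. L (frechet_derivative f (at x) v))) (at x)" if "x \<in> U" for x
    by (rule bounded_linear.has_derivative[OF assms(2) Ck_on_has_derivative[OF Suc.prems that]])
  then have "Ck_on n U (\<lambda>x. frechet_derivative (\<lambda>x. L (f x)) (at x) v)" for v
    using Suc by (subst Ck_on_cong[OF assms(1)]) (auto simp: frechet_derivative_eq[OF d])
  then show ?case using d by (auto simp: differentiable_def)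
qed

lemma Ck_on_bilinear:
  assumes "open U" "bounded_bilinear p"
  shows "Ck_on n U f \<Longrightarrow> Ck_on n U g \<Longrightarrow> Ck_on n U (\<lambda>x. p (f x) (g x))"
proof (induction n arbitrary: f g)
  case 0
  then show ?case by (auto intro: bounded_bilinear.continuous_on[OF assms(2)])
next
  case (Suc n)
  have d: "((\<lambda>x. p (f x) (g x)) has_derivative
      (\<lambda>v. p (f x) (frechet_derivative g (at x) v) + p (frechet_derivative f (at x) v) (g x))) (at x)"
    if "x \<in> U" for x
    by (rule bounded_bilinear.FDERIV[OF assms(2) Suc.prems[THEN Ck_on_has_derivative, OF that]])
  have "Ck_on n U (\<lambda>x. p (f x) (frechet_derivative g (at x) v) + p (frechet_derivative f (at x) v) (g x))" for v
    using Suc.prems Ck_on_SucD[OF Suc.prems(1)] Ck_on_SucD[OF Suc.prems(2)]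
    by (intro Ck_on_add[OF assms(1)] Suc.IH) auto
  then have "Ck_on n U (\<lambda>x. frechet_derivative (\<lambda>x. p (f x) (g x)) (at x) v)" for v
    by (subst Ck_on_cong[OF assms(1)]) (auto simp: frechet_derivative_eq[OF d])
  then show ?case using d by (auto simp: differentiable_def)
qed

lemma smooth_on_add: "open U \<Longrightarrow> smooth_on U f \<Longrightarrow> smooth_on U g \<Longrightarrow> smooth_on U (\<lambda>x. f x + g x)"
  by (simp add: smooth_on_def Ck_on_add)

lemma smooth_on_bounded_linear:
  "open U \<Longrightarrow> bounded_linear L \<Longrightarrow> smooth_on U f \<Longrightarrow> smooth_on U (\<lambda>x. L (f x))"
  by (simp add: smooth_on_def Ck_on_bounded_linear)

lemma smooth_on_linear:
  fixes L :: "'b::euclidean_space \<Rightarrow> 'c::real_normed_vector"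
  shows "open U \<Longrightarrow> linear L \<Longrightarrow> smooth_on U f \<Longrightarrow> smooth_on U (\<lambda>x. L (f x))"
  by (simp add: smooth_on_bounded_linear linear_conv_bounded_linear)

lemma smooth_on_bilinear:
  "open U \<Longrightarrow> bounded_bilinear p \<Longrightarrow> smooth_on U f \<Longrightarrow> smooth_on U g \<Longrightarrow> smooth_on U (\<lambda>x. p (f x) (g x))"
  by (simp add: smooth_on_def Ck_on_bilinear)

lemma smooth_on_scaleR:
  "open U \<Longrightarrow> smooth_on U f \<Longrightarrow> smooth_on U g \<Longrightarrow> smooth_on U (\<lambda>x. f x *\<^sub>R g x)"
  by (rule smooth_on_bilinear[OF _ bounded_bilinear_scaleR])

lemma smooth_on_mult:
  fixes f g :: "_ \<Rightarrow> 'b::real_normed_algebra"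
  shows "open U \<Longrightarrow> smooth_on U f \<Longrightarrow> smooth_on U g \<Longrightarrow> smooth_on U (\<lambda>x. f x * g x)"
  by (rule smooth_on_bilinear[OF _ bounded_bilinear_mult])

lemma smooth_on_minus: "open U \<Longrightarrow> smooth_on U f \<Longrightarrow> smooth_on U (\<lambda>x. - f x)"
  by (rule smooth_on_bounded_linear[OF _ bounded_linear_minus[OF bounded_linear_ident]])

lemma smooth_on_diff: "open U \<Longrightarrow> smooth_on U f \<Longrightarrow> smooth_on U g \<Longrightarrow> smooth_on U (\<lambda>x. f x - g x)"
  using smooth_on_add[of U f "\<lambda>x. - g x"] by (simp add: smooth_on_minus)

lemma smooth_on_sum:
  assumes "open U" "\<And>i. i \<in> I \<Longrightarrow> smooth_on U (f i)"
  shows "smooth_on U (\<lambda>x. \<Sum>i\<in>I. f i x)"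
  using assms by (induction I rule: infinite_finite_induct) (auto intro: smooth_on_add)

lemma smooth_on_prod:
  fixes f :: "'i \<Rightarrow> 'a::euclidean_space \<Rightarrow> 'b::real_normed_field"
  assumes "open U" "\<And>i. i \<in> I \<Longrightarrow> smooth_on U (f i)"
  shows "smooth_on U (\<lambda>x. \<Prod>i\<in>I. f i x)"
  using assms by (induction I rule: infinite_finite_induct) (auto intro: smooth_on_mult)

lemma smooth_on_ident: "smooth_on U (\<lambda>x. x)"
  unfolding smooth_on_def
proof
  fix n show "Ck_on n U (\<lambda>x. x)"
    by (cases n) (auto simp: frechet_derivative_eq[OF has_derivative_ident] intro: Ck_on_const)
qed

lemma smooth_on_linear_map:
  fixes L :: "'b::euclidean_space \<Rightarrow> 'c::real_normed_vector"
  shows "open U \<Longrightarrow> linear L \<Longrightarrow> smooth_on U L"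
  using smooth_on_linear[of U L "\<lambda>x. x"] smooth_on_ident by auto

lemma smooth_on_fst_arg: "open U \<Longrightarrow> smooth_on U fst" and smooth_on_snd_arg: "open U \<Longrightarrow> smooth_on U snd"
  by (auto intro!: smooth_on_linear_map linear_fst linear_snd)

lemma smooth_on_Pair:
  fixes f :: "'a::euclidean_space \<Rightarrow> 'b::euclidean_space" and g :: "'a \<Rightarrow> 'c::euclidean_space"
  assumes "open U" "smooth_on U f" "smooth_on U g"
  shows "smooth_on U (\<lambda>x. (f x, g x))"
proof -
  have "smooth_on U (\<lambda>x. (\<lambda>a. (a, 0)) (f x) + (\<lambda>b. (0, b)) (g x))"
    by (intro smooth_on_add[OF assms(1)] smooth_on_linear[OF assms(1) _ assms(2)]
        smooth_on_linear[OF assms(1) _ assms(3)]) (auto intro!: linearI)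
  then show ?thesis by simp
qed

text \<open>Smoothness is tested on derivatives along fixed vectors only; expanding the direction in
  a basis reduces derivatives along moving vectors to these.\<close>

lemma frechet_derivative_basis:
  fixes f :: "'a::euclidean_space \<Rightarrow> 'b::real_normed_vector"
  assumes "f differentiable (at x)"
  shows "frechet_derivative f (at x) u = (\<Sum>b\<in>Basis. (u \<bullet> b) *\<^sub>R frechet_derivative f (at x) b)"
proof -
  have "linear (frechet_derivative f (at x))"
    using assms by (simp add: linear_frechet_derivative)
  then have "frechet_derivative f (at x) (\<Sum>b\<in>Basis. (u \<bullet> b) *\<^sub>R b)
     = (\<Sum>b\<in>Basis. (u \<bullet> b) *\<^sub>R frechet_derivative f (at x) b)"
    by (simp add: linear_sum linear_cmul)
  then show ?thesis by (simp add: euclidean_representation)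
qed

text \<open>By the chain rule the derivative along a fixed \<open>v\<close> is a sum over basis
  vectors \<open>b\<close> of the functions \<open>frechet_derivative g (at (f x)) b\<close>, to
  which the induction hypothesis applies because \<open>g\<close> is arbitrary, with components of a
  derivative of \<open>f\<close> as coefficients.\<close>

lemma Ck_on_compose:
  fixes f :: "'a::euclidean_space \<Rightarrow> 'b::euclidean_space" and g :: "'b \<Rightarrow> 'c::real_normed_vector"
  assumes "open U" "open V" "f ` U \<subseteq> V"
  shows "Ck_on n U f \<Longrightarrow> Ck_on n V g \<Longrightarrow> Ck_on n U (\<lambda>x. g (f x))"
proof (induction n arbitrary: g)
  case 0
  then show ?case using continuous_on_compose2[OF _ _ assms(3), of g] by simp
next
  case (Suc n)
  have d: "((\<lambda>x. g (f x)) has_derivative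
      (\<lambda>v. \<Sum>b\<in>Basis. (frechet_derivative f (at x) v \<bullet> b) *\<^sub>R frechet_derivative g (at (f x)) b)) (at x)"
    if "x \<in> U" for x
  proof -
    have fx: "f x \<in> V" using assms(3) that by blast
    have dg: "g differentiable (at (f x))" using Suc.prems(2) fx by simp
    show ?thesis
      by (rule has_derivative_eq_rhs[OF has_derivative_compose[OF
            Ck_on_has_derivative[OF Suc.prems(1) that] Ck_on_has_derivative[OF Suc.prems(2) fx]]])
        (rule ext, rule frechet_derivative_basis[OF dg])
  qed
  have c: "Ck_on n U (\<lambda>x. (frechet_derivative f (at x) v \<bullet> b) *\<^sub>R frechet_derivative g (at (f x)) b)" for v b
  proof (rule Ck_on_bilinear[OF assms(1) bounded_bilinear_scaleR])
    show "Ck_on n U (\<lambda>x. frechet_derivative f (at x) v \<bullet> b)"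
      by (rule Ck_on_bounded_linear[OF assms(1) bounded_linear_inner_left]) (use Suc.prems(1) in simp)
    show "Ck_on n U (\<lambda>x. frechet_derivative g (at (f x)) b)"
      by (rule Suc.IH[OF Ck_on_SucD[OF Suc.prems(1)]]) (use Suc.prems(2) in simp)
  qed
  have "Ck_on n U (\<lambda>x. frechet_derivative (\<lambda>x. g (f x)) (at x) v)" for v
    by (rule Ck_on_cong[OF assms(1), THEN iffD2, OF _ Ck_on_sum[OF assms(1) c[of v]]])
      (simp add: frechet_derivative_eq[OF d])
  then show ?case using d by (auto simp: differentiable_def)
qed

lemma smooth_on_compose:
  fixes f :: "'a::euclidean_space \<Rightarrow> 'b::euclidean_space" and g :: "'b \<Rightarrow> 'c::real_normed_vector"
  assumes "open U" "open V" "f ` U \<subseteq> V" "smooth_on U f" "smooth_on V g"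
  shows "smooth_on U (\<lambda>x. g (f x))"
  unfolding smooth_on_def
  by (intro allI Ck_on_compose[OF assms(1-3), where g = g]) (use assms(4,5) in \<open>simp_all add: smooth_on_def\<close>)

text \<open>The derivative of the reciprocal is a product of the reciprocal, taken twice, and a
  derivative of \<open>f\<close>, so each order of differentiability follows from the previous
  one.\<close>

lemma smooth_on_inverse:
  fixes f :: "'a::euclidean_space \<Rightarrow> real"
  assumes "open U" "smooth_on U f" "\<And>x. x \<in> U \<Longrightarrow> f x \<noteq> 0"
  shows "smooth_on U (\<lambda>x. inverse (f x))"
proof -
  have d: "((\<lambda>x. inverse (f x)) has_derivative
      (\<lambda>v. - (inverse (f x) * frechet_derivative f (at x) v * inverse (f x)))) (at x)" if "x \<in> U" for x
    by (rule Deriv.has_derivative_inverse[OF assms(3)[OF that] smooth_on_has_derivative[OF assms(2) that]])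
  have "Ck_on n U (\<lambda>x. inverse (f x))" for n
  proof (induction n)
    case 0
    then show ?case using assms smooth_on_continuous by (auto intro: continuous_on_inverse)
  next
    case (Suc n)
    have "Ck_on n U (\<lambda>x. - (inverse (f x) * frechet_derivative f (at x) v * inverse (f x)))" for v
      using Suc smooth_on_derivative[OF assms(2)] unfolding smooth_on_def
      by (intro Ck_on_bounded_linear[OF assms(1) bounded_linear_minus[OF bounded_linear_ident]]
          Ck_on_bilinear[OF assms(1) bounded_bilinear_mult]) auto
    then have "Ck_on n U (\<lambda>x. frechet_derivative (\<lambda>x. inverse (f x)) (at x) v)" for v
      by (subst Ck_on_cong[OF assms(1)]) (auto simp: frechet_derivative_eq[OF d])
    then show ?case using d by (auto simp: differentiable_def)
  qed
  then show ?thesis unfolding smooth_on_def by blast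
qed

lemma smooth_on_componentwise:
  fixes f :: "'a::euclidean_space \<Rightarrow> 'b::euclidean_space"
  assumes "open U" "\<And>b. b \<in> Basis \<Longrightarrow> smooth_on U (\<lambda>x. f x \<bullet> b)"
  shows "smooth_on U f"
proof -
  have "smooth_on U (\<lambda>x. \<Sum>b\<in>Basis. (f x \<bullet> b) *\<^sub>R b)"
    using assms by (intro smooth_on_sum smooth_on_scaleR) auto
  then show ?thesis by (simp add: euclidean_representation)
qed

section \<open>Symmetry of second derivatives\<close>

lemma mixed_difference_quotient:
  fixes f :: "'a::euclidean_space \<Rightarrow> real"
  assumes "open U" "x \<in> U" "smooth_on U f"
  shows "\<exists>e>0. \<forall>s. 0 < s \<and> s < e \<longrightarrow> (\<exists>a b. 0 < a \<and> a < s \<and> 0 < b \<and> b < s \<and>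
     f (x + s *\<^sub>R u + s *\<^sub>R v) - f (x + s *\<^sub>R u) - f (x + s *\<^sub>R v) + f x =
     s * (s * frechet_derivative (\<lambda>y. frechet_derivative f (at y) u) (at (x + a *\<^sub>R u + b *\<^sub>R v)) v))"
proof -
  obtain r where r: "r > 0" "ball x r \<subseteq> U" using assms(1,2) openE by blast
  \<comment> \<open>With this bound every point \<open>x + a u + b v\<close> with \<open>a\<close>
    and \<open>b\<close> below \<open>e\<close> stays in the ball of radius
    \<open>r\<close>.\<close>
  define e where "e = r / (norm u + norm v + 1)"
  have n: "norm u + norm v + 1 > 0" by (smt (verit) norm_ge_zero)
  have e: "e > 0" using r n by (simp add: e_def)
  have inU: "x + a *\<^sub>R u + b *\<^sub>R v \<in> U" if "0 \<le> a" "a < e" "0 \<le> b" "b < e" for a b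
  proof -
    have "norm (a *\<^sub>R u + b *\<^sub>R v) \<le> a * norm u + b * norm v"
      using that by (intro norm_triangle_le) simp
    also have "\<dots> \<le> e * norm u + e * norm v"
      using that by (intro add_mono mult_right_mono) auto
    also have "\<dots> < e * (norm u + norm v + 1)" using e by (simp add: algebra_simps)
    also have "\<dots> = r" using n by (simp add: e_def)
    finally have "x + (a *\<^sub>R u + b *\<^sub>R v) \<in> ball x r"
      by (metis add_diff_cancel_left' dist_commute dist_norm mem_ball)
    then show ?thesis using r(2) by (metis add.assoc subsetD)
  qed
  have deriv: "((\<lambda>t. g (p + t *\<^sub>R w)) has_real_derivative frechet_derivative g (at (p + t *\<^sub>R w)) w) (at t)"
    if "smooth_on U g" "p + t *\<^sub>R w \<in> U" for g :: "'a \<Rightarrow> real" and p w t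
  proof -
    have "((\<lambda>t. p + t *\<^sub>R w) has_derivative (\<lambda>h. h *\<^sub>R w)) (at t)"
      by (auto intro!: derivative_eq_intros)
    from has_derivative_compose[OF this smooth_on_has_derivative[OF that]]
    have "((\<lambda>t. g (p + t *\<^sub>R w)) has_derivative (\<lambda>h. frechet_derivative g (at (p + t *\<^sub>R w)) (h *\<^sub>R w))) (at t)" .
    moreover have "frechet_derivative g (at (p + t *\<^sub>R w)) (h *\<^sub>R w) =
        frechet_derivative g (at (p + t *\<^sub>R w)) w * h" for h
      using linear_cmul[OF frechet_derivative_linear[OF that]] by simp
    ultimately show ?thesis by (simp add: has_field_derivative_def)
  qed
  let ?D = "\<lambda>y. frechet_derivative f (at y) u"
  have "\<exists>a b. 0 < a \<and> a < s \<and> 0 < b \<and> b < s \<and>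
     f (x + s *\<^sub>R u + s *\<^sub>R v) - f (x + s *\<^sub>R u) - f (x + s *\<^sub>R v) + f x =
     s * (s * frechet_derivative ?D (at (x + a *\<^sub>R u + b *\<^sub>R v)) v)" if s: "0 < s" "s < e" for s
  proof -
    \<comment> \<open>\<open>h\<close> is the increment along \<open>s v\<close>. The mean value
      theorem in the direction \<open>u\<close>, and then for the derivative of \<open>f\<close>
      along \<open>u\<close> in the direction \<open>v\<close>, produces the mixed derivative at an
      intermediate point.\<close>
    define h where "h t = f ((x + s *\<^sub>R v) + t *\<^sub>R u) - f (x + t *\<^sub>R u)" for t
    have "\<exists>a. 0 < a \<and> a < s \<and> h s - h 0 =
        (s - 0) * (?D ((x + s *\<^sub>R v) + a *\<^sub>R u) - ?D (x + a *\<^sub>R u))"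
    proof (rule MVT2)
      fix t assume t: "0 \<le> t" "t \<le> s"
      show "(h has_real_derivative ?D ((x + s *\<^sub>R v) + t *\<^sub>R u) - ?D (x + t *\<^sub>R u)) (at t)"
        unfolding h_def
        using inU[of t s] inU[of t 0] t s
        by (intro DERIV_diff deriv[OF assms(3)]) (simp_all add: add_ac)
    qed (use s in auto)
    then obtain a where a: "0 < a" "a < s" and ha: "h s - h 0 =
        s * (?D ((x + s *\<^sub>R v) + a *\<^sub>R u) - ?D (x + a *\<^sub>R u))" by auto
    have "\<exists>b. 0 < b \<and> b < s \<and> ?D ((x + a *\<^sub>R u) + s *\<^sub>R v) - ?D ((x + a *\<^sub>R u) + 0 *\<^sub>R v) =
        (s - 0) * frechet_derivative ?D (at ((x + a *\<^sub>R u) + b *\<^sub>R v)) v"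
    proof (rule MVT2)
      fix t assume t: "0 \<le> t" "t \<le> s"
      show "((\<lambda>t. ?D ((x + a *\<^sub>R u) + t *\<^sub>R v)) has_real_derivative
           frechet_derivative ?D (at ((x + a *\<^sub>R u) + t *\<^sub>R v)) v) (at t)"
        using inU[of a t] t s a
        by (intro deriv[OF smooth_on_derivative[OF assms(3)]]) simp
    qed (use s in auto)
    then obtain b where b: "0 < b" "b < s"
      and hb: "?D ((x + a *\<^sub>R u) + s *\<^sub>R v) - ?D (x + a *\<^sub>R u) =
        s * frechet_derivative ?D (at ((x + a *\<^sub>R u) + b *\<^sub>R v)) v" by auto
    have "h s - h 0 = s * (s * frechet_derivative ?D (at (x + a *\<^sub>R u + b *\<^sub>R v)) v)"
      using ha hb by (simp add: add_ac)
    moreover have "h s - h 0 = f (x + s *\<^sub>R u + s *\<^sub>R v) - f (x + s *\<^sub>R u) - f (x + s *\<^sub>R v) + f x"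
      by (simp add: h_def add_ac)
    ultimately show ?thesis using a b by auto
  qed
  then show ?thesis using e by blast
qed

text \<open>The second difference is symmetric in \<open>u\<close> and \<open>v\<close>, so the two
  mixed derivatives agree at suitable pairs of points near \<open>x\<close>. These points tend to
  \<open>x\<close>, and the mixed derivatives of a smooth function are continuous.\<close>

lemma second_derivative_symmetric_real:
  fixes f :: "'a::euclidean_space \<Rightarrow> real"
  assumes "open U" "x \<in> U" "smooth_on U f"
  shows "frechet_derivative (\<lambda>y. frechet_derivative f (at y) u) (at x) v =
         frechet_derivative (\<lambda>y. frechet_derivative f (at y) v) (at x) u"
proof -
  define D where "D u v y = frechet_derivative (\<lambda>y. frechet_derivative f (at y) u) (at y) v" for u v y
  obtain e1 where e1: "e1 > 0" "\<And>s. 0 < s \<Longrightarrow> s < e1 \<Longrightarrow> \<exists>a b. 0 < a \<and> a < s \<and> 0 < b \<and> b < s \<and>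
     f (x + s *\<^sub>R u + s *\<^sub>R v) - f (x + s *\<^sub>R u) - f (x + s *\<^sub>R v) + f x =
     s * (s * D u v (x + a *\<^sub>R u + b *\<^sub>R v))"
    using mixed_difference_quotient[OF assms, of u v] unfolding D_def by auto
  obtain e2 where e2: "e2 > 0" "\<And>s. 0 < s \<Longrightarrow> s < e2 \<Longrightarrow> \<exists>a b. 0 < a \<and> a < s \<and> 0 < b \<and> b < s \<and>
     f (x + s *\<^sub>R v + s *\<^sub>R u) - f (x + s *\<^sub>R v) - f (x + s *\<^sub>R u) + f x =
     s * (s * D v u (x + a *\<^sub>R v + b *\<^sub>R u))"
    using mixed_difference_quotient[OF assms, of v u] unfolding D_def by auto
  \<comment> \<open>The denominator is at least 2, so that \<open>s n\<close> is strictly below both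
    bounds already for \<open>n = 0\<close>.\<close>
  define s where "s n = min e1 e2 / (real n + 2)" for n
  have s: "0 < s n" "s n < e1" "s n < e2" for n
  proof -
    have "min e1 e2 / (real n + 2) < min e1 e2 / 1"
      using e1(1) e2(1) by (intro divide_strict_left_mono) auto
    then show "0 < s n" "s n < e1" "s n < e2" using e1(1) e2(1) by (auto simp: s_def)
  qed
  have "\<exists>p q. norm (p - x) \<le> s n * (norm u + norm v) \<and> norm (q - x) \<le> s n * (norm u + norm v) \<and>
      D u v p = D v u q" for n
  proof -
    obtain a b where ab: "0 < a" "a < s n" "0 < b" "b < s n"
      and 1: "f (x + s n *\<^sub>R u + s n *\<^sub>R v) - f (x + s n *\<^sub>R u) - f (x + s n *\<^sub>R v) + f x =
       s n * (s n * D u v (x + a *\<^sub>R u + b *\<^sub>R v))" using e1(2)[OF s(1,2)] by blast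
    obtain c d where cd: "0 < c" "c < s n" "0 < d" "d < s n"
      and 2: "f (x + s n *\<^sub>R v + s n *\<^sub>R u) - f (x + s n *\<^sub>R v) - f (x + s n *\<^sub>R u) + f x =
       s n * (s n * D v u (x + c *\<^sub>R v + d *\<^sub>R u))" using e2(2)[OF s(1,3)] by blast
    have bound: "norm (a *\<^sub>R u + b *\<^sub>R v) \<le> s n * (norm u + norm v)"
      if "0 < a" "a < s n" "0 < b" "b < s n" for a b and u v :: 'a
    proof -
      have "norm (a *\<^sub>R u + b *\<^sub>R v) \<le> a * norm u + b * norm v"
        using that by (intro norm_triangle_le) simp
      also have "\<dots> \<le> s n * norm u + s n * norm v"
        using that by (intro add_mono mult_right_mono) auto
      finally show ?thesis by (simp add: algebra_simps)
    qed
    have c: "x + s n *\<^sub>R u + s n *\<^sub>R v = x + s n *\<^sub>R v + s n *\<^sub>R u"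
      by (simp add: add_ac)
    have "s n * (s n * D u v (x + a *\<^sub>R u + b *\<^sub>R v)) = s n * (s n * D v u (x + c *\<^sub>R v + d *\<^sub>R u))"
      unfolding 1[symmetric] 2[symmetric] c by simp
    then have "D u v (x + a *\<^sub>R u + b *\<^sub>R v) = D v u (x + c *\<^sub>R v + d *\<^sub>R u)"
      using s(1)[of n] by simp
    moreover have "norm (x + a *\<^sub>R u + b *\<^sub>R v - x) \<le> s n * (norm u + norm v)"
      using bound[OF ab] by (simp add: add.assoc)
    moreover have "norm (x + c *\<^sub>R v + d *\<^sub>R u - x) \<le> s n * (norm u + norm v)"
      using bound[OF cd, of v u] by (simp add: add_ac)
    ultimately show ?thesis by blast
  qed
  then obtain p q where pq: "\<And>n. norm (p n - x) \<le> s n * (norm u + norm v)"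
    "\<And>n. norm (q n - x) \<le> s n * (norm u + norm v)" "\<And>n. D u v (p n) = D v u (q n)" by metis
  have "(\<lambda>n. inverse (real (n + 2))) \<longlonglongrightarrow> 0"
    by (rule LIMSEQ_ignore_initial_segment[OF lim_inverse_n])
  then have "(\<lambda>n. min e1 e2 * (norm u + norm v) * inverse (real (n + 2))) \<longlonglongrightarrow> min e1 e2 * (norm u + norm v) * 0"
    by (intro tendsto_mult tendsto_const)
  then have lim: "(\<lambda>n. s n * (norm u + norm v)) \<longlonglongrightarrow> 0"
    by (simp add: s_def divide_inverse mult_ac add_ac)
  have conv: "r \<longlonglongrightarrow> x" if "\<And>n. norm (r n - x) \<le> s n * (norm u + norm v)" for r
    by (rule LIM_zero_cancel, rule tendsto_norm_zero_cancel, rule tendsto_sandwich[OF _ _ tendsto_const lim])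
      (use that in \<open>auto intro: always_eventually\<close>)
  have cont: "isCont (D u v) x" for u v
  proof -
    have "smooth_on U (D u v)" unfolding D_def by (rule smooth_on_derivative[OF smooth_on_derivative[OF assms(3)]])
    from smooth_on_continuous[OF this] show ?thesis
      using continuous_on_eq_continuous_at[OF assms(1), of "D u v"] assms(2) by simp
  qed
  have "(\<lambda>n. D u v (p n)) \<longlonglongrightarrow> D u v x" using cont conv[OF pq(1)] by (rule isCont_tendsto_compose)
  moreover have "(\<lambda>n. D v u (q n)) \<longlonglongrightarrow> D v u x" using cont conv[OF pq(2)] by (rule isCont_tendsto_compose)
  ultimately have "D u v x = D v u x" using pq(3) LIMSEQ_unique by simp
  then show ?thesis by (simp add: D_def)
qed

lemma frechet_derivative_bounded_linear:
  "bounded_linear L \<Longrightarrow> f differentiable (at x) \<Longrightarrow>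
    frechet_derivative (\<lambda>y. L (f y)) (at x) v = L (frechet_derivative f (at x) v)"
  by (simp add: frechet_derivative_eq[OF bounded_linear.has_derivative[OF _ differentiable_has_derivative]])

lemma second_derivative_symmetric:
  fixes f :: "'a::euclidean_space \<Rightarrow> 'b::euclidean_space"
  assumes "open U" "x \<in> U" "smooth_on U f"
  shows "frechet_derivative (\<lambda>y. frechet_derivative f (at y) u) (at x) v =
         frechet_derivative (\<lambda>y. frechet_derivative f (at y) v) (at x) u"
proof (rule euclidean_eqI)
  fix b :: 'b assume "b \<in> Basis"
  have bl: "bounded_linear (\<lambda>y. y \<bullet> b)" by (rule bounded_linear_inner_left)
  have sm: "smooth_on U (\<lambda>y. f y \<bullet> b)"
    by (rule smooth_on_bounded_linear[OF assms(1) bl assms(3)])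
  have *: "frechet_derivative (\<lambda>y. frechet_derivative f (at y) u) (at x) v \<bullet> b =
     frechet_derivative (\<lambda>y. frechet_derivative (\<lambda>y. f y \<bullet> b) (at y) u) (at x) v" for u v
  proof -
    have "frechet_derivative (\<lambda>y. frechet_derivative f (at y) u) (at x) v \<bullet> b =
       frechet_derivative (\<lambda>y. frechet_derivative f (at y) u \<bullet> b) (at x) v"
      by (rule frechet_derivative_bounded_linear[OF bl smooth_on_differentiable[OF smooth_on_derivative[OF assms(3)] assms(2)], symmetric])
    also have "frechet_derivative (\<lambda>y. frechet_derivative f (at y) u \<bullet> b) (at x) =
       frechet_derivative (\<lambda>y. frechet_derivative (\<lambda>y. f y \<bullet> b) (at y) u) (at x)"
      by (rule frechet_derivative_cong_open[OF assms(1,2)])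
        (simp add: frechet_derivative_bounded_linear[OF bl smooth_on_differentiable[OF assms(3)]])
    finally show ?thesis .
  qed
  show "frechet_derivative (\<lambda>y. frechet_derivative f (at y) u) (at x) v \<bullet> b =
         frechet_derivative (\<lambda>y. frechet_derivative f (at y) v) (at x) u \<bullet> b"
    unfolding * by (rule second_derivative_symmetric_real[OF assms(1,2) sm])
qed

section \<open>Smooth families of linear and alternating forms\<close>

lemma linear_family_expand:
  fixes b :: "'e::euclidean_space \<Rightarrow> 'c::real_vector"
  assumes "linear b"
  shows "b v = (\<Sum>i\<in>Basis. (v \<bullet> i) *\<^sub>R b i)"
proof -
  have "b v = b (\<Sum>i\<in>Basis. (v \<bullet> i) *\<^sub>R i)" by (simp add: euclidean_representation)
  also have "\<dots> = (\<Sum>i\<in>Basis. (v \<bullet> i) *\<^sub>R b i)" using assms by (simp add: linear_sum linear_cmul)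
  finally show ?thesis .
qed

text \<open>A product rule. Differentiability of \<open>b y v\<close> is given for fixed
  \<open>v\<close> only; expanding \<open>F y\<close> in a basis turns the expression into a finite
  sum of products.\<close>

lemma linear_family_has_derivative:
  fixes b :: "'x::euclidean_space \<Rightarrow> 'e::euclidean_space \<Rightarrow> 'c::real_normed_vector"
  assumes "open U" "x \<in> U" "\<And>y. y \<in> U \<Longrightarrow> linear (b y)" "\<And>v. (\<lambda>y. b y v) differentiable (at x)"
    and F: "(F has_derivative F') (at x)"
  shows "((\<lambda>y. b y (F y)) has_derivative
     (\<lambda>h. frechet_derivative (\<lambda>y. b y (F x)) (at x) h + b x (F' h))) (at x)"
proof -
  note b = differentiable_has_derivative[OF assms(4)]
  have e: "frechet_derivative (\<lambda>y. b y v) (at x) h =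
     (\<Sum>i\<in>Basis. (v \<bullet> i) *\<^sub>R frechet_derivative (\<lambda>y. b y i) (at x) h)" for v h
  proof -
    have "((\<lambda>y. \<Sum>i\<in>Basis. (v \<bullet> i) *\<^sub>R b y i) has_derivative
       (\<lambda>h. \<Sum>i\<in>Basis. (v \<bullet> i) *\<^sub>R frechet_derivative (\<lambda>y. b y i) (at x) h)) (at x)"
      by (intro has_derivative_sum has_derivative_scaleR_right b)
    then have "((\<lambda>y. b y v) has_derivative
       (\<lambda>h. \<Sum>i\<in>Basis. (v \<bullet> i) *\<^sub>R frechet_derivative (\<lambda>y. b y i) (at x) h)) (at x)"
      using has_derivative_cong_open[OF assms(1,2), of "\<lambda>y. b y v" "\<lambda>y. \<Sum>i\<in>Basis. (v \<bullet> i) *\<^sub>R b y i"]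
        linear_family_expand[OF assms(3)] by simp
    then show ?thesis by (simp add: frechet_derivative_eq)
  qed
  have "((\<lambda>y. \<Sum>i\<in>Basis. (F y \<bullet> i) *\<^sub>R b y i) has_derivative
     (\<lambda>h. \<Sum>i\<in>Basis. (F x \<bullet> i) *\<^sub>R frechet_derivative (\<lambda>y. b y i) (at x) h + (F' h \<bullet> i) *\<^sub>R b x i)) (at x)"
    by (intro has_derivative_sum has_derivative_scaleR has_derivative_inner_left F b)
  moreover have "(\<Sum>i\<in>Basis. (F x \<bullet> i) *\<^sub>R frechet_derivative (\<lambda>y. b y i) (at x) h + (F' h \<bullet> i) *\<^sub>R b x i)
     = frechet_derivative (\<lambda>y. b y (F x)) (at x) h + b x (F' h)" for h
    by (simp only: e[of "F x" h] linear_family_expand[OF assms(3)[OF assms(2)], of "F' h"] sum.distrib)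
  ultimately have "((\<lambda>y. \<Sum>i\<in>Basis. (F y \<bullet> i) *\<^sub>R b y i) has_derivative
     (\<lambda>h. frechet_derivative (\<lambda>y. b y (F x)) (at x) h + b x (F' h))) (at x)" by simp
  then show ?thesis
    by (rule has_derivative_cong_open[OF assms(1,2), THEN iffD1, rotated])
      (rule linear_family_expand[OF assms(3), symmetric])
qed

lemma linear_family_smooth:
  fixes b :: "'x::euclidean_space \<Rightarrow> 'e::euclidean_space \<Rightarrow> 'c::real_normed_vector"
  assumes "open U" "\<And>y. y \<in> U \<Longrightarrow> linear (b y)" "\<And>v. smooth_on U (\<lambda>y. b y v)" "smooth_on U F"
  shows "smooth_on U (\<lambda>y. b y (F y))"
proof -
  have "smooth_on U (\<lambda>y. \<Sum>i\<in>Basis. (F y \<bullet> i) *\<^sub>R b y i)"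
    by (intro smooth_on_sum[OF assms(1)] smooth_on_scaleR[OF assms(1) _ assms(3)]
        smooth_on_bounded_linear[OF assms(1) bounded_linear_inner_left assms(4)])
  then show ?thesis
    by (rule smooth_on_cong[OF assms(1), THEN iffD2, rotated])
      (rule linear_family_expand[OF assms(2)])
qed

lemma alternating_depends: "alternating k b \<Longrightarrow> (\<And>i. i < k \<Longrightarrow> v i = w i) \<Longrightarrow> b v = b w"
  unfolding alternating_def by blast

lemma alternating_linear: "alternating k b \<Longrightarrow> i < k \<Longrightarrow> linear (\<lambda>u. b (v(i := u)))"
  unfolding alternating_def by blast

lemma alternating_zero: "alternating k b \<Longrightarrow> i < k \<Longrightarrow> j < k \<Longrightarrow> i \<noteq> j \<Longrightarrow> v i = v j \<Longrightarrow> b v = 0"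
  unfolding alternating_def by blast

text \<open>Induction on the number \<open>m\<close> of slots that already carry a moving vector.
  The slots from \<open>m\<close> on hold the fixed vectors \<open>w\<close>, so each step sets one
  more slot in motion and uses linearity in that slot.\<close>

lemma alternating_family_aux:
  fixes \<beta> :: "'x::euclidean_space \<Rightarrow> 'e::euclidean_space covector"
  assumes U: "open U" and alt: "\<And>y. y \<in> U \<Longrightarrow> alternating k (\<beta> y)"
    and sm: "\<And>v. smooth_on U (\<lambda>y. \<beta> y v)" and F: "\<And>i. i < k \<Longrightarrow> smooth_on U (F i)"
  shows "m \<le> k \<Longrightarrow> smooth_on U (\<lambda>y. \<beta> y (\<lambda>i. if i < m then F i y else w i)) \<and>
    (\<forall>x\<in>U. \<forall>h. frechet_derivative (\<lambda>y. \<beta> y (\<lambda>i. if i < m then F i y else w i)) (at x) h =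
       frechet_derivative (\<lambda>y. \<beta> y (\<lambda>i. if i < m then F i x else w i)) (at x) h +
       (\<Sum>i<m. \<beta> x ((\<lambda>i. if i < m then F i x else w i)(i := frechet_derivative (F i) (at x) h))))"
proof (induction m arbitrary: w)
  case 0
  then show ?case by (simp add: sm)
next
  case (Suc m)
  then have m: "m < k" "m \<le> k" by auto
  define b where "b y u = \<beta> y (\<lambda>i. if i < m then F i y else (w(m := u)) i)" for y u
  have lin: "linear (b y)" if "y \<in> U" for y
  proof -
    have "b y = (\<lambda>u. \<beta> y ((\<lambda>i. if i < m then F i y else w i)(m := u)))"
      unfolding b_def by (rule ext, rule arg_cong[of _ _ "\<beta> y"]) auto
    then show ?thesis using alternating_linear[OF alt[OF that] m(1)] by simp
  qed
  have smb: "smooth_on U (\<lambda>y. b y u)" for u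
    unfolding b_def using Suc.IH[OF m(2), of "w(m := u)"] by blast
  have eq: "(\<lambda>y. \<beta> y (\<lambda>i. if i < Suc m then F i y else w i)) = (\<lambda>y. b y (F m y))"
    unfolding b_def by (rule ext, rule arg_cong[of _ _ "\<beta> _"]) auto
  have "smooth_on U (\<lambda>y. b y (F m y))"
    by (rule linear_family_smooth[OF U lin smb F[OF m(1)]])
  moreover have "frechet_derivative (\<lambda>y. b y (F m y)) (at x) h =
       frechet_derivative (\<lambda>y. \<beta> y (\<lambda>i. if i < Suc m then F i x else w i)) (at x) h +
       (\<Sum>i<Suc m. \<beta> x ((\<lambda>i. if i < Suc m then F i x else w i)(i := frechet_derivative (F i) (at x) h)))"
    if x: "x \<in> U" for x h
  proof -
    have f: "(\<lambda>i. if i < m then F i x else (w(m := F m x)) i) = (\<lambda>i. if i < Suc m then F i x else w i)"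
      by (rule ext) (auto simp: less_Suc_eq)
    have "frechet_derivative (\<lambda>y. b y (F m y)) (at x) h =
      frechet_derivative (\<lambda>y. b y (F m x)) (at x) h + b x (frechet_derivative (F m) (at x) h)"
      by (rule fun_cong[OF frechet_derivative_eq[OF linear_family_has_derivative[OF U x lin
         smooth_on_differentiable[OF smb x] smooth_on_has_derivative[OF F[OF m(1)] x]]]])
    also have "frechet_derivative (\<lambda>y. b y (F m x)) (at x) h =
        frechet_derivative (\<lambda>y. \<beta> y (\<lambda>i. if i < Suc m then F i x else w i)) (at x) h +
       (\<Sum>i<m. \<beta> x ((\<lambda>i. if i < Suc m then F i x else w i)(i := frechet_derivative (F i) (at x) h)))"
      unfolding b_def
      by (rule Suc.IH[OF m(2), of "w(m := F m x)", THEN conjunct2, THEN bspec, OF x, THEN spec, of h, unfolded f])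
    also have "b x (frechet_derivative (F m) (at x) h) =
       \<beta> x ((\<lambda>i. if i < Suc m then F i x else w i)(m := frechet_derivative (F m) (at x) h))"
      unfolding b_def by (rule arg_cong[of _ _ "\<beta> x"]) auto
    finally show ?thesis by (simp add: add.assoc fun_upd_def)
  qed
  ultimately show ?case unfolding eq by blast
qed

lemma alternating_family:
  fixes \<beta> :: "'x::euclidean_space \<Rightarrow> 'e::euclidean_space covector"
  assumes U: "open U" and alt: "\<And>y. y \<in> U \<Longrightarrow> alternating k (\<beta> y)"
    and sm: "\<And>v. smooth_on U (\<lambda>y. \<beta> y v)" and F: "\<And>i. i < k \<Longrightarrow> smooth_on U (F i)"
  shows "smooth_on U (\<lambda>y. \<beta> y (\<lambda>i. F i y))"
    and "x \<in> U \<Longrightarrow> frechet_derivative (\<lambda>y. \<beta> y (\<lambda>i. F i y)) (at x) h =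
       frechet_derivative (\<lambda>y. \<beta> y (\<lambda>i. F i x)) (at x) h +
       (\<Sum>i<k. \<beta> x ((\<lambda>i. F i x)(i := frechet_derivative (F i) (at x) h)))"
proof -
  \<comment> \<open>The slots from \<open>k\<close> on do not influence the value; they are set to 0
    to match \<open>alternating_family_aux\<close> with \<open>w = 0\<close>.\<close>
  define G where "G y i = (if i < k then F i y else 0)" for y i
  have e: "\<beta> y (G z) = \<beta> y (\<lambda>i. F i z)" if "y \<in> U" for y z
    by (rule alternating_depends[OF alt[OF that]]) (simp add: G_def)
  note A = alternating_family_aux[where F = F and w = "\<lambda>_. 0" and m = k, OF U alt sm F order_refl,
      folded G_def]
  show "smooth_on U (\<lambda>y. \<beta> y (\<lambda>i. F i y))"
    using A by (subst smooth_on_cong[OF U e[symmetric]]) auto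
  assume x: "x \<in> U"
  have "\<beta> x ((G x)(i := a)) = \<beta> x ((\<lambda>i. F i x)(i := a))" for i a
    by (rule alternating_depends[OF alt[OF x]]) (simp add: G_def)
  then show "frechet_derivative (\<lambda>y. \<beta> y (\<lambda>i. F i y)) (at x) h =
       frechet_derivative (\<lambda>y. \<beta> y (\<lambda>i. F i x)) (at x) h +
       (\<Sum>i<k. \<beta> x ((\<lambda>i. F i x)(i := frechet_derivative (F i) (at x) h)))"
    using A[THEN conjunct2, rule_format, of x h] x
    by (simp add: frechet_derivative_cong_open[OF U x e])
qed

section \<open>The wedge product and its Leibniz rules\<close>

lemma wedge_scale_left: "wedge k l (\<lambda>v. c * a v) b v = c * wedge k l a b v"
  and wedge_scale_right: "wedge k l a (\<lambda>v. c * b v) v = c * wedge k l a b v"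
  by (simp_all add: wedge_def sum_distrib_left mult_ac)

lemma wedge_add_left: "wedge k l (\<lambda>v. a v + a' v) b v = wedge k l a b v + wedge k l a' b v"
  and wedge_add_right: "wedge k l a (\<lambda>v. b v + b' v) v = wedge k l a b v + wedge k l a b' v"
  by (simp_all add: wedge_def ring_distribs sum.distrib add_divide_distrib)

lemma wedge_zero_left: "wedge k l (\<lambda>v. 0) b v = 0"
  and wedge_zero_right: "wedge k l a (\<lambda>v. 0) v = 0"
  by (simp_all add: wedge_def)

lemma wedge_pullback:
  "wedge k l (\<lambda>v. a (\<lambda>i. L (v i))) (\<lambda>v. b (\<lambda>i. L (v i))) v = wedge k l a b (\<lambda>i. L (v i))"
  by (simp add: wedge_def)

lemma smooth_on_wedge:
  assumes "open U" "\<And>v. smooth_on U (\<lambda>y. a y v)" "\<And>v. smooth_on U (\<lambda>y. b y v)"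
  shows "smooth_on U (\<lambda>y. wedge k l (a y) (b y) v)"
proof -
  have "smooth_on U (\<lambda>y. \<Sum>\<sigma> | \<sigma> permutes {..<k + l}. of_int (sign \<sigma>) / (fact k * fact l) *
        (a y (\<lambda>i. v (\<sigma> i)) * b y (\<lambda>i. v (\<sigma> (k + i)))))"
    by (intro smooth_on_sum[OF assms(1)] smooth_on_mult[OF assms(1)] smooth_on_const assms(2,3))
  then show ?thesis by (simp add: wedge_def sum_divide_distrib mult_ac)
qed

lemma wedge_permutes_fixes: "\<sigma> permutes {..<n} \<Longrightarrow> i < n \<Longrightarrow> \<sigma> i < (n::nat)"
  using permutes_in_image by fastforce

lemma fun_upd_permutes:
  assumes "\<sigma> permutes S"
  shows "(\<lambda>m. (v(\<sigma> j := u)) (\<sigma> m)) = (\<lambda>m. v (\<sigma> m))(j := u)"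
  using permutes_inj[OF assms] by (auto simp: inj_eq)

lemma linear_mult_right: "linear f \<Longrightarrow> linear (\<lambda>u. c * f u)"
  and linear_mult_left: "linear f \<Longrightarrow> linear (\<lambda>u. f u * c)"
  for f :: "'a::real_vector \<Rightarrow> complex"
  by (simp_all add: linear_iff algebra_simps)

lemma bij_betw_permutations_compose_left:
  assumes "q permutes S"
  shows "bij_betw (\<lambda>p. q \<circ> p) {p. p permutes S} {p. p permutes S}"
  by (rule bij_betwI[of _ _ _ "\<lambda>p. inv q \<circ> p"])
    (auto simp: permutes_inv_o[OF assms] o_assoc intro: permutes_compose permutes_inv assms)

lemma alternating_wedge:
  assumes a: "alternating k a" and b: "alternating l b"
  shows "alternating (k + l) (wedge k l a b)"
  unfolding alternating_def
proof (intro conjI allI impI)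
  fix v w :: "nat \<Rightarrow> 'a" assume vw: "\<forall>i<k + l. v i = w i"
  have "a (\<lambda>i. v (\<sigma> i)) = a (\<lambda>i. w (\<sigma> i))" "b (\<lambda>i. v (\<sigma> (k + i))) = b (\<lambda>i. w (\<sigma> (k + i)))"
    if "\<sigma> permutes {..<k + l}" for \<sigma>
    using vw wedge_permutes_fixes[OF that]
    by (auto intro!: alternating_depends[OF a] alternating_depends[OF b])
  then show "wedge k l a b v = wedge k l a b w" by (simp add: wedge_def)
next
  fix v i assume i: "i < k + l"
  have lin: "linear (\<lambda>u. a (\<lambda>m. (v(i := u)) (\<sigma> m)) * b (\<lambda>m. (v(i := u)) (\<sigma> (k + m))))"
    if \<sigma>: "\<sigma> permutes {..<k + l}" for \<sigma>
  proof -
    \<comment> \<open>The argument \<open>v i\<close> occupies slot \<open>j\<close> of the permuted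
      list, which belongs to \<open>a\<close> or to \<open>b\<close> according to
      \<open>j < k\<close>.\<close>
    obtain j where j: "i = \<sigma> j" using permutes_surj[OF \<sigma>] by (meson surjD)
    have jk: "j < k + l" using i j \<sigma> by (metis lessThan_iff permutes_in_image)
    have ea: "(\<lambda>m. (v(i := u)) (\<sigma> m)) = (\<lambda>m. v (\<sigma> m))(j := u)" for u
      unfolding j by (rule fun_upd_permutes[OF \<sigma>])
    have eb: "(v(i := u)) (\<sigma> (k + m)) = ((\<lambda>m. v (\<sigma> m))(j := u)) (k + m)" for u m
      using ea by metis
    show ?thesis
    proof (cases "j < k")
      case True
      have "(\<lambda>m. (v(i := u)) (\<sigma> (k + m))) = (\<lambda>m. v (\<sigma> (k + m)))" for u
        unfolding eb using True by auto
      then show ?thesis unfolding ea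
        by (simp only:) (rule linear_mult_left, rule alternating_linear[OF a True])
    next
      case False
      define j' where "j' = j - k"
      have j': "j' < l" "j = k + j'" using False jk by (auto simp: j'_def)
      have "(\<lambda>m. (v(i := u)) (\<sigma> (k + m))) = (\<lambda>m. v (\<sigma> (k + m)))(j' := u)" for u
        unfolding eb using j' by auto
      moreover have "a ((\<lambda>m. v (\<sigma> m))(j := u)) = a (\<lambda>m. v (\<sigma> m))" for u
        using False by (intro alternating_depends[OF a]) auto
      ultimately show ?thesis unfolding ea
        by (simp only:) (rule linear_mult_right, rule alternating_linear[OF b j'(1)])
    qed
  qed
  note lin' = linear_mult_right[OF lin]
  have "wedge k l a b (v(i := u)) = (\<Sum>\<sigma> | \<sigma> permutes {..<k + l}. of_int (sign \<sigma>) / (fact k * fact l) *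
      (a (\<lambda>m. (v(i := u)) (\<sigma> m)) * b (\<lambda>m. (v(i := u)) (\<sigma> (k + m)))))" for u
    by (simp add: wedge_def sum_divide_distrib mult_ac)
  then show "linear (\<lambda>u. wedge k l a b (v(i := u)))"
    by (simp only:) (rule linear_compose_sum, use lin' in blast)
next
  fix v :: "nat \<Rightarrow> 'a" and i j assume i: "i < k + l" and j: "j < k + l" and ij: "i \<noteq> j \<and> v i = v j"
  \<comment> \<open>Composition with this transposition leaves the arguments unchanged and reverses
    the sign, so the sum equals its own negative.\<close>
  let ?t = "Transposition.transpose i j"
  have t: "?t permutes {..<k + l}" using i j by (simp add: permutes_swap_id)
  define f where "f \<sigma> = of_int (sign \<sigma>) * a (\<lambda>m. v (\<sigma> m)) * b (\<lambda>m. v (\<sigma> (k + m)))" for \<sigma>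
  have "f (?t \<circ> \<sigma>) = - f \<sigma>" if "\<sigma> permutes {..<k + l}" for \<sigma>
  proof -
    have "permutation \<sigma>" using that permutes_imp_permutation by blast
    then have "sign (?t \<circ> \<sigma>) = - sign \<sigma>"
      using ij by (simp add: sign_compose permutation_swap_id sign_swap_id)
    moreover have "v (?t m) = v m" for m using ij by (simp add: Transposition.transpose_def)
    ultimately show ?thesis by (simp add: f_def)
  qed
  then have "sum f {\<sigma>. \<sigma> permutes {..<k + l}} = - sum f {\<sigma>. \<sigma> permutes {..<k + l}}"
    using sum.reindex_bij_betw[OF bij_betw_permutations_compose_left[OF t], of f]
    by (simp add: sum_negf)
  then have "sum f {\<sigma>. \<sigma> permutes {..<k + l}} = 0" by simp
  then show "wedge k l a b v = 0" by (simp add: wedge_def f_def)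
qed

text \<open>Leibniz rule for inserting \<open>L\<close> into one slot at a time. With
  \<open>L\<close> the derivative of a vector field, these sums are the part of the Lie derivative
  that does not differentiate the coefficients of the form.\<close>

lemma wedge_derivation:
  assumes a: "alternating k a" and b: "alternating l b"
  shows "(\<Sum>i<k + l. wedge k l a b (v(i := L (v i)))) =
    wedge k l (\<lambda>w. \<Sum>i<k. a (w(i := L (w i)))) b v + wedge k l a (\<lambda>w. \<Sum>i<l. b (w(i := L (w i)))) v"
proof -
  define s where "s v \<sigma> = a (\<lambda>m. v (\<sigma> m)) * b (\<lambda>m. v (\<sigma> (k + m)))" for v :: "nat \<Rightarrow> 'a" and \<sigma>
  have "(\<Sum>i<k + l. s (v(i := L (v i))) \<sigma>) =
      (\<Sum>i<k. a ((\<lambda>m. v (\<sigma> m))(i := L (v (\<sigma> i))))) * b (\<lambda>m. v (\<sigma> (k + m))) +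
      a (\<lambda>m. v (\<sigma> m)) * (\<Sum>i<l. b ((\<lambda>m. v (\<sigma> (k + m)))(i := L (v (\<sigma> (k + i))))))"
    if \<sigma>: "\<sigma> permutes {..<k + l}" for \<sigma>
  proof -
    let ?w = "\<lambda>m. v (\<sigma> m)"
    \<comment> \<open>Reindexing by \<open>\<sigma>\<close> puts the modified argument into slot
      \<open>i\<close> of the permuted list; the sum then splits into the slots of \<open>a\<close>
      and those of \<open>b\<close>.\<close>
    have "(\<Sum>i<k + l. s (v(i := L (v i))) \<sigma>) = (\<Sum>i<k + l. s (v(\<sigma> i := L (v (\<sigma> i)))) \<sigma>)"
      using sum.permute[OF \<sigma>, of "\<lambda>i. s (v(i := L (v i))) \<sigma>"] by (simp add: o_def)
    also have "\<dots> = (\<Sum>i<k + l. a (?w(i := L (?w i))) * b (\<lambda>m. (?w(i := L (?w i))) (k + m)))"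
      unfolding s_def by (simp only: fun_cong[OF fun_upd_permutes[OF \<sigma>, of v]])
    also have "\<dots> = (\<Sum>i<k. a (?w(i := L (?w i))) * b (\<lambda>m. (?w(i := L (?w i))) (k + m))) +
        (\<Sum>i<l. a (?w(k + i := L (?w (k + i)))) * b (\<lambda>m. (?w(k + i := L (?w (k + i)))) (k + m)))"
      by (induction l) (simp_all add: add.assoc)
    also have "(\<Sum>i<k. a (?w(i := L (?w i))) * b (\<lambda>m. (?w(i := L (?w i))) (k + m))) =
        (\<Sum>i<k. a (?w(i := L (?w i))) * b (\<lambda>m. ?w (k + m)))"
      by (intro sum.cong refl arg_cong2[where f = "(*)"] arg_cong[where f = b]) auto
    also have "(\<Sum>i<l. a (?w(k + i := L (?w (k + i)))) * b (\<lambda>m. (?w(k + i := L (?w (k + i)))) (k + m))) =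
        (\<Sum>i<l. a ?w * b ((\<lambda>m. ?w (k + m))(i := L (?w (k + i)))))"
      by (intro sum.cong refl arg_cong2[where f = "(*)"] arg_cong[where f = b] alternating_depends[OF a]) auto
    finally show ?thesis by (simp add: sum_distrib_left sum_distrib_right fun_upd_def)
  qed
  note s = this
  have "(\<Sum>i<k + l. wedge k l a b (v(i := L (v i)))) =
    (\<Sum>i<k + l. \<Sum>\<sigma> | \<sigma> permutes {..<k + l}. of_int (sign \<sigma>) / (fact k * fact l) * s (v(i := L (v i))) \<sigma>)"
    unfolding wedge_def s_def by (simp add: sum_divide_distrib mult_ac)
  also have "\<dots> = (\<Sum>\<sigma> | \<sigma> permutes {..<k + l}. of_int (sign \<sigma>) / (fact k * fact l) * (\<Sum>i<k + l. s (v(i := L (v i))) \<sigma>))"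
    by (subst sum.swap) (simp add: sum_distrib_left)
  also have "\<dots> = wedge k l (\<lambda>w. \<Sum>i<k. a (w(i := L (w i)))) b v + wedge k l a (\<lambda>w. \<Sum>i<l. b (w(i := L (w i)))) v"
    unfolding wedge_def sum_divide_distrib sum.distrib[symmetric]
    by (intro sum.cong refl) (simp add: s ring_distribs add_divide_distrib mult_ac)
  finally show ?thesis .
qed

lemma frechet_derivative_wedge:
  assumes "\<And>v. (\<lambda>y. a y v) differentiable (at x)" "\<And>v. (\<lambda>y. b y v) differentiable (at x)"
  shows "frechet_derivative (\<lambda>y. wedge k l (a y) (b y) v) (at x) h =
    wedge k l (\<lambda>v. frechet_derivative (\<lambda>y. a y v) (at x) h) (b x) v +
    wedge k l (a x) (\<lambda>v. frechet_derivative (\<lambda>y. b y v) (at x) h) v"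
proof -
  let ?P = "{\<sigma>. \<sigma> permutes {..<k + l}}"
  have "((\<lambda>y. \<Sum>\<sigma>\<in>?P. (of_int (sign \<sigma>) / (fact k * fact l)) *
        (a y (\<lambda>i. v (\<sigma> i)) * b y (\<lambda>i. v (\<sigma> (k + i))))) has_derivative
     (\<lambda>h. \<Sum>\<sigma>\<in>?P. (of_int (sign \<sigma>) / (fact k * fact l)) *
        (a x (\<lambda>i. v (\<sigma> i)) * frechet_derivative (\<lambda>y. b y (\<lambda>i. v (\<sigma> (k + i)))) (at x) h +
         frechet_derivative (\<lambda>y. a y (\<lambda>i. v (\<sigma> i))) (at x) h * b x (\<lambda>i. v (\<sigma> (k + i)))))) (at x)"
    by (intro has_derivative_sum has_derivative_mult_right has_derivative_mult
        differentiable_has_derivative[OF assms(1)] differentiable_has_derivative[OF assms(2)])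
  moreover have "(\<lambda>y. wedge k l (a y) (b y) v) = (\<lambda>y. \<Sum>\<sigma>\<in>?P. (of_int (sign \<sigma>) / (fact k * fact l)) *
        (a y (\<lambda>i. v (\<sigma> i)) * b y (\<lambda>i. v (\<sigma> (k + i)))))"
    by (simp add: wedge_def sum_divide_distrib mult_ac)
  ultimately show ?thesis
    by (simp only: frechet_derivative_eq wedge_def)
      (simp add: sum_divide_distrib sum.distrib ring_distribs add_divide_distrib mult_ac add.commute)
qed

lemma lie_form_wedge:
  assumes "open U" "x \<in> U" "\<And>v. smooth_on U (\<lambda>y. a c y v)" "\<And>v. smooth_on U (\<lambda>y. b c y v)"
    "alternating k (a c x)" "alternating l (b c x)"
  shows "lie_form (k + l) Y (\<lambda>c y. wedge k l (a c y) (b c y)) c x v =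
    wedge k l (lie_form k Y a c x) (b c x) v + wedge k l (a c x) (lie_form l Y b c x) v"
  unfolding lie_form_def wedge_derivation[OF assms(5,6)]
    frechet_derivative_wedge[OF smooth_on_differentiable[OF assms(3,2)] smooth_on_differentiable[OF assms(4,2)]]
    wedge_add_left wedge_add_right
  by simp

text \<open>This is the determinant with entries \<open>(as ! i) (v j)\<close>, that is, the wedge
  product of the one-forms in \<open>as\<close>. Coframe computations are done with such monomials
  because products become concatenations of lists and signs become transpositions of
  entries.\<close>

definition wprod :: "('e \<Rightarrow> complex) list \<Rightarrow> 'e covector" where
  "wprod as v = (\<Sum>\<sigma> | \<sigma> permutes {..<length as}.
     of_int (sign \<sigma>) * (\<Prod>i<length as. (as ! i) (v (\<sigma> i))))"

lemma prod_lessThan_add: "(\<Prod>m<k + l. f m) = (\<Prod>i<k. f i) * (\<Prod>i<l. f (k + i :: nat))"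
  for f :: "nat \<Rightarrow> 'a::comm_monoid_mult"
  by (induction l) (simp_all add: mult.assoc)

text \<open>Rotating the two blocks past each other conjugates this permutation to
  \<open>\<tau>\<close>, and conjugation preserves the sign.\<close>

lemma shifted_permutation:
  fixes k l :: nat
  assumes "\<tau> permutes {..<l}"
  shows "(\<lambda>m. if m < k then m else if m < k + l then k + \<tau> (m - k) else m) permutes {..<k + l}"
    and "sign (\<lambda>m. if m < k then m else if m < k + l then k + \<tau> (m - k) else m) = sign \<tau>"
proof -
  let ?p = "\<lambda>m. if m < k then m else if m < k + l then k + \<tau> (m - k) else m"
  define \<rho> where "\<rho> m = (if m < l then m + k else if m < k + l then m - l else m)" for m
  define \<rho>' where "\<rho>' m = (if m < k then m + l else if m < k + l then m - k else m)" for m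
  have 1: "\<rho> (\<rho>' m) = m" "\<rho>' (\<rho> m) = m" for m by (auto simp: \<rho>_def \<rho>'_def)
  have \<rho>: "\<rho> permutes {..<k + l}"
    by (rule bij_imp_permutes) (auto intro!: bij_betwI[of _ _ _ \<rho>'] simp: 1, auto simp: \<rho>_def \<rho>'_def)
  have inv: "inv \<rho> = \<rho>'" by (rule inv_equality) (simp_all add: 1)
  have \<tau>: "\<tau> permutes {..<k + l}" by (rule permutes_subset[OF assms]) auto
  have \<tau>l: "\<tau> m < l \<longleftrightarrow> m < l" for m using permutes_in_image[OF assms] by simp
  have \<tau>f: "\<not> m < l \<Longrightarrow> \<tau> m = m" for m using permutes_not_in[OF assms] by simp
  have e: "?p = \<rho> \<circ> \<tau> \<circ> inv \<rho>"
  proof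
    fix m
    consider "m < k" | "k \<le> m" "m < k + l" | "k + l \<le> m" by linarith
    then show "?p m = (\<rho> \<circ> \<tau> \<circ> inv \<rho>) m"
    proof cases
      case 1
      have "\<tau> (m + l) = m + l" by (rule \<tau>f) simp
      then show ?thesis using 1 unfolding inv by (simp add: \<rho>_def \<rho>'_def)
    next
      case 2
      then have "\<tau> (m - k) < l" using \<tau>l by simp
      then show ?thesis using 2 unfolding inv by (simp add: \<rho>_def \<rho>'_def)
    next
      case 3
      then have "\<tau> m = m" by (intro \<tau>f) simp
      then show ?thesis using 3 unfolding inv by (simp add: \<rho>_def \<rho>'_def)
    qed
  qed
  show "?p permutes {..<k + l}"
    unfolding e by (intro permutes_compose permutes_inv \<rho> \<tau>)
  have "permutation \<rho>" "permutation \<tau>" "permutation (inv \<rho>)"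
    using \<rho> \<tau> permutes_inv[OF \<rho>] permutes_imp_permutation by blast+
  then show "sign ?p = sign \<tau>"
    unfolding e by (simp add: sign_compose sign_inverse permutation_compose)
qed

text \<open>Both factors are determinants, so each term is indexed by \<open>\<sigma>\<close> and a
  pair of permutations of the two blocks. The pair combines to one permutation \<open>B\<close>,
  which is absorbed into \<open>\<sigma>\<close>. Every pair then contributes the same determinant,
  and the number of pairs is \<open>fact k * fact l\<close>, the normalization of
  \<open>wedge\<close>.\<close>

lemma wedge_wprod:
  assumes "k = length as" "l = length bs"
  shows "wedge k l (wprod as) (wprod bs) = wprod (as @ bs)"
proof
  fix v :: "nat \<Rightarrow> 'a"
  let ?P = "\<lambda>n. {\<sigma>. \<sigma> permutes {..<n::nat}}"
  define c where "c m = (as @ bs) ! m" for m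
  define T where "T \<sigma> = (\<Prod>m<k + l. c m (v (\<sigma> m)))" for \<sigma>
  have W: "wprod (as @ bs) v = (\<Sum>\<sigma>\<in>?P (k + l). of_int (sign \<sigma>) * T \<sigma>)"
    using assms by (simp add: wprod_def T_def c_def)
  have ca: "i < k \<Longrightarrow> c i = as ! i" and cb: "i < l \<Longrightarrow> c (k + i) = bs ! i" for i
    using assms by (simp_all add: c_def nth_append)
  define B where "B \<tau> \<tau>' m = (if m < k then \<tau> m else if m < k + l then k + \<tau>' (m - k) else m)" for \<tau> \<tau>' :: "nat \<Rightarrow> nat" and m
  have B: "B \<tau> \<tau>' permutes {..<k + l} \<and> sign (B \<tau> \<tau>') = sign \<tau> * sign \<tau>'"
    if "\<tau> permutes {..<k}" "\<tau>' permutes {..<l}" for \<tau> \<tau>'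
  proof -
    let ?p = "\<lambda>m. if m < k then m else if m < k + l then k + \<tau>' (m - k) else m"
    have \<tau>: "\<tau> permutes {..<k + l}" by (rule permutes_subset[OF that(1)]) auto
    have f: "\<not> m < k \<Longrightarrow> \<tau> m = m" for m using permutes_not_in[OF that(1)] by simp
    have e: "B \<tau> \<tau>' = \<tau> \<circ> ?p" by (auto simp: B_def f fun_eq_iff)
    have "permutation \<tau>" "permutation ?p"
      using \<tau> shifted_permutation(1)[OF that(2), of k] permutes_imp_permutation by blast+
    then show ?thesis unfolding e
      using shifted_permutation[OF that(2), of k] \<tau> by (auto intro: permutes_compose simp: sign_compose)
  qed
  have expand: "wprod as (\<lambda>i. v (\<sigma> i)) * wprod bs (\<lambda>i. v (\<sigma> (k + i))) =
      (\<Sum>\<tau>\<in>?P k. \<Sum>\<tau>'\<in>?P l. of_int (sign (B \<tau> \<tau>')) * T (\<sigma> \<circ> B \<tau> \<tau>'))" for \<sigma>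
  proof -
    have "of_int (sign \<tau>) * (\<Prod>i<k. (as ! i) (v (\<sigma> (\<tau> i)))) * (of_int (sign \<tau>') * (\<Prod>i<l. (bs ! i) (v (\<sigma> (k + \<tau>' i)))))
       = of_int (sign (B \<tau> \<tau>')) * T (\<sigma> \<circ> B \<tau> \<tau>')"
      if t: "\<tau> permutes {..<k}" "\<tau>' permutes {..<l}" for \<tau> \<tau>'
      using B[OF t] by (simp add: T_def prod_lessThan_add B_def ca cb mult_ac)
    then show ?thesis
      unfolding wprod_def assms(1)[symmetric] assms(2)[symmetric] sum_product by simp
  qed
  have inner: "(\<Sum>\<sigma>\<in>?P (k + l). of_int (sign \<sigma>) * (of_int (sign \<pi>) * T (\<sigma> \<circ> \<pi>))) = wprod (as @ bs) v"
    if "\<pi> permutes {..<k + l}" for \<pi>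
  proof -
    have "permutation \<pi>" using that permutes_imp_permutation by blast
    moreover have "permutation \<sigma>" if "\<sigma> \<in> ?P (k + l)" for \<sigma> using that permutes_imp_permutation by blast
    ultimately have "(\<Sum>\<sigma>\<in>?P (k + l). of_int (sign \<sigma>) * (of_int (sign \<pi>) * T (\<sigma> \<circ> \<pi>))) =
       (\<Sum>\<sigma>\<in>?P (k + l). of_int (sign (\<sigma> \<circ> \<pi>)) * T (\<sigma> \<circ> \<pi>))"
      by (intro sum.cong refl) (simp add: sign_compose)
    also have "\<dots> = wprod (as @ bs) v"
      unfolding W by (rule sum_permutations_compose_right[OF that, symmetric])
    finally show ?thesis .
  qed
  have "(\<Sum>\<sigma>\<in>?P (k + l). of_int (sign \<sigma>) * wprod as (\<lambda>i. v (\<sigma> i)) * wprod bs (\<lambda>i. v (\<sigma> (k + i)))) =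
     (\<Sum>\<sigma>\<in>?P (k + l). \<Sum>\<tau>\<in>?P k. \<Sum>\<tau>'\<in>?P l. of_int (sign \<sigma>) * (of_int (sign (B \<tau> \<tau>')) * T (\<sigma> \<circ> B \<tau> \<tau>')))"
    by (simp add: mult.assoc expand sum_distrib_left)
  also have "\<dots> = (\<Sum>\<tau>\<in>?P k. \<Sum>\<sigma>\<in>?P (k + l). \<Sum>\<tau>'\<in>?P l. of_int (sign \<sigma>) * (of_int (sign (B \<tau> \<tau>')) * T (\<sigma> \<circ> B \<tau> \<tau>')))"
    by (rule sum.swap)
  also have "\<dots> = (\<Sum>\<tau>\<in>?P k. \<Sum>\<tau>'\<in>?P l. \<Sum>\<sigma>\<in>?P (k + l). of_int (sign \<sigma>) * (of_int (sign (B \<tau> \<tau>')) * T (\<sigma> \<circ> B \<tau> \<tau>')))"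
    by (rule sum.cong[OF refl], rule sum.swap)
  also have "\<dots> = (\<Sum>\<tau>\<in>?P k. \<Sum>\<tau>'\<in>?P l. wprod (as @ bs) v)"
    by (intro sum.cong refl inner) (use B in auto)
  also have "\<dots> = (fact k * fact l) * wprod (as @ bs) v"
    by (simp add: card_permutations)
  finally show "wedge k l (wprod as) (wprod bs) v = wprod (as @ bs) v"
    by (simp add: wedge_def)
qed

lemma wprod_transpose:
  assumes "i < length as" "j < length as" "i \<noteq> j"
  shows "wprod (as[i := as ! j, j := as ! i]) v = - wprod as v"
proof -
  let ?t = "Transposition.transpose i j" and ?n = "length as" and ?bs = "as[i := as ! j, j := as ! i]"
  have t: "?t permutes {..<?n}" using assms by (simp add: permutes_swap_id)
  have b: "m < ?n \<Longrightarrow> ?bs ! (?t m) = as ! m" for m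
    using assms by (auto simp: Transposition.transpose_def nth_list_update)
  have "(\<Prod>m<?n. (?bs ! m) (v (\<sigma> m))) = (\<Prod>m<?n. (as ! m) (v ((\<sigma> \<circ> ?t) m)))" for \<sigma>
  proof -
    have "(\<Prod>m<?n. (?bs ! m) (v (\<sigma> m))) = (\<Prod>m<?n. (?bs ! (?t m)) (v (\<sigma> (?t m))))"
      using prod.permute[OF t, of "\<lambda>m. (?bs ! m) (v (\<sigma> m))"] by (simp add: o_def)
    then show ?thesis using b by simp
  qed
  then have "wprod ?bs v = (\<Sum>\<sigma> | \<sigma> permutes {..<?n}. of_int (sign \<sigma>) * (\<Prod>m<?n. (as ! m) (v ((\<sigma> \<circ> ?t) m))))"
    by (simp add: wprod_def)
  also have "\<dots> = (\<Sum>\<sigma> | \<sigma> permutes {..<?n}. - (of_int (sign (\<sigma> \<circ> ?t)) * (\<Prod>m<?n. (as ! m) (v ((\<sigma> \<circ> ?t) m)))))"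
  proof (intro sum.cong refl)
    fix \<sigma> assume "\<sigma> \<in> {\<sigma>. \<sigma> permutes {..<?n}}"
    then have "permutation \<sigma>" using permutes_imp_permutation by blast
    then have "sign (\<sigma> \<circ> ?t) = - sign \<sigma>"
      using assms(3) by (simp add: sign_compose permutation_swap_id sign_swap_id)
    then show "of_int (sign \<sigma>) * (\<Prod>m<?n. (as ! m) (v ((\<sigma> \<circ> ?t) m))) =
        - (of_int (sign (\<sigma> \<circ> ?t)) * (\<Prod>m<?n. (as ! m) (v ((\<sigma> \<circ> ?t) m))))" by simp
  qed
  also have "\<dots> = - (\<Sum>\<sigma> | \<sigma> permutes {..<?n}. of_int (sign (\<sigma> \<circ> ?t)) * (\<Prod>m<?n. (as ! m) (v ((\<sigma> \<circ> ?t) m))))"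
    by (simp only: sum_negf)
  also have "\<dots> = - wprod as v"
    unfolding wprod_def by (subst sum_permutations_compose_right[OF t]) (rule refl)
  finally show ?thesis .
qed

lemma wprod_not_distinct:
  assumes "\<not> distinct as"
  shows "wprod as v = 0"
proof -
  obtain i j where ij: "i < length as" "j < length as" "i \<noteq> j" "as ! i = as ! j"
    using assms by (auto simp: distinct_conv_nth)
  then have "as[i := as ! j, j := as ! i] = as" by (metis list_update_id)
  then have "wprod as v = - wprod as v" using wprod_transpose[OF ij(1-3)] by metis
  then show ?thesis by simp
qed

text \<open>Every permutation of \<open>{..<Suc n}\<close> is, uniquely, a permutation of
  \<open>{..<n}\<close> followed by an exchange of \<open>n\<close> with some \<open>b\<close>.
  Iterating this evaluates alternating sums over a concrete number of arguments.\<close>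

lemma sum_signed_permutations_Suc:
  "(\<Sum>\<sigma> | \<sigma> permutes {..<Suc n}. of_int (sign \<sigma>) * F \<sigma>) =
   (\<Sum>b<Suc n. (if b = n then 1 else -1) * (\<Sum>\<sigma> | \<sigma> permutes {..<n}. of_int (sign \<sigma>) * F (Transposition.transpose n b \<circ> \<sigma>)))"
  for F :: "(nat \<Rightarrow> nat) \<Rightarrow> complex"
proof -
  have "{..<Suc n} = insert n {..<n}" by auto
  then have "(\<Sum>\<sigma> | \<sigma> permutes {..<Suc n}. of_int (sign \<sigma>) * F \<sigma>) =
     (\<Sum>b<Suc n. \<Sum>\<sigma> | \<sigma> permutes {..<n}. of_int (sign (Transposition.transpose n b \<circ> \<sigma>)) * F (Transposition.transpose n b \<circ> \<sigma>))"
    by (simp only:) (rule sum_over_permutations_insert, auto)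
  also have "\<dots> = (\<Sum>b<Suc n. (if b = n then 1 else -1) * (\<Sum>\<sigma> | \<sigma> permutes {..<n}. of_int (sign \<sigma>) * F (Transposition.transpose n b \<circ> \<sigma>)))"
  proof (rule sum.cong[OF refl])
    fix b
    have "sign (Transposition.transpose n b \<circ> \<sigma>) = (if b = n then 1 else -1) * sign \<sigma>" if "\<sigma> permutes {..<n}" for \<sigma>
    proof -
      have "permutation \<sigma>" using that permutes_imp_permutation by blast
      then show ?thesis by (simp add: sign_compose permutation_swap_id sign_swap_id)
    qed
    then show "(\<Sum>\<sigma> | \<sigma> permutes {..<n}. of_int (sign (Transposition.transpose n b \<circ> \<sigma>)) * F (Transposition.transpose n b \<circ> \<sigma>)) =
      (if b = n then 1 else -1) * (\<Sum>\<sigma> | \<sigma> permutes {..<n}. of_int (sign \<sigma>) * F (Transposition.transpose n b \<circ> \<sigma>))"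
      by (auto simp: sum_distrib_left intro!: sum.cong)
  qed
  finally show ?thesis .
qed

lemma sum_signed_permutations_0: "(\<Sum>\<sigma> | \<sigma> permutes {..<0::nat}. of_int (sign \<sigma>) * F \<sigma>) = F id"
  by simp

lemmas signed_permutations_eval =
  sum_signed_permutations_Suc sum_signed_permutations_0 sum.lessThan_Suc numeral_nat Transposition.transpose_def

lemma wprod_1: "wprod [f] v = f (v 0)"
  unfolding wprod_def by (simp add: signed_permutations_eval del: One_nat_def)

lemma wprod_2: "wprod [f, g] v = f (v 0) * g (v 1) - f (v 1) * g (v 0)"
  unfolding wprod_def by (simp add: signed_permutations_eval)

lemma wprod_0: "wprod [] v = 1"
  by (simp add: wprod_def)

lemma wedge_1_1: "wedge 1 1 (\<lambda>v. f (v 0)) (\<lambda>v. g (v 0)) v = f (v 0) * g (v 1) - f (v 1) * g (v 0)"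
proof -
  have "wedge 1 1 (wprod [f]) (wprod [g]) v = wprod [f, g] v"
    by (subst wedge_wprod) simp_all
  then show ?thesis by (simp add: wprod_1[abs_def] wprod_2)
qed

text \<open>By skewness of \<open>B\<close> the six permutations give three shuffles, each twice,
  which cancels the factor \<open>1 / 2\<close>. The formulas in \<open>wedge_2_2\<close> and
  \<open>wedge_1_3\<close> arise in the same way, from six shuffles of multiplicity 4 and from four
  of multiplicity 6.\<close>

lemma wedge_1_2:
  assumes "\<And>u w. B u w = - B w u"
  shows "wedge 1 2 (\<lambda>v. f (v 0)) (\<lambda>v. B (v 0) (v 1)) v =
     f (v 0) * B (v 1) (v 2) - f (v 1) * B (v 0) (v 2) + f (v 2) * B (v 0) (v 1)"
proof -
  have e: "(1::nat) + 2 = Suc (Suc (Suc 0))" by simp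
  have "wedge 1 2 (\<lambda>v. f (v 0)) (\<lambda>v. B (v 0) (v 1)) v =
    (\<Sum>\<sigma> | \<sigma> permutes {..<Suc (Suc (Suc 0))}. of_int (sign \<sigma>) *
      (f (v (\<sigma> 0)) * B (v (\<sigma> 1)) (v (\<sigma> 2)))) / 2"
    unfolding wedge_def e by (simp add: mult.assoc numeral_2_eq_2)
  also have "\<dots> = f (v 0) * B (v 1) (v 2) - f (v 1) * B (v 0) (v 2) + f (v 2) * B (v 0) (v 1)"
    by (simp add: signed_permutations_eval assms[of "v (Suc 0)" "v 0"] assms[of "v (Suc (Suc 0))" "v 0"]
        assms[of "v (Suc (Suc 0))" "v (Suc 0)"])
  finally show ?thesis .
qed

lemma wedge_2_2:
  assumes "\<And>u w. A u w = - A w u" "\<And>u w. B u w = - B w u"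
  shows "wedge 2 2 (\<lambda>v. A (v 0) (v 1)) (\<lambda>v. B (v 0) (v 1)) v =
     A (v 0) (v 1) * B (v 2) (v 3) - A (v 0) (v 2) * B (v 1) (v 3) + A (v 0) (v 3) * B (v 1) (v 2)
     + A (v 1) (v 2) * B (v 0) (v 3) - A (v 1) (v 3) * B (v 0) (v 2) + A (v 2) (v 3) * B (v 0) (v 1)"
proof -
  have e: "(2::nat) + 2 = Suc (Suc (Suc (Suc 0)))" by simp
  have "wedge 2 2 (\<lambda>v. A (v 0) (v 1)) (\<lambda>v. B (v 0) (v 1)) v =
    (\<Sum>\<sigma> | \<sigma> permutes {..<Suc (Suc (Suc (Suc 0)))}. of_int (sign \<sigma>) *
      (A (v (\<sigma> 0)) (v (\<sigma> 1)) * B (v (\<sigma> 2)) (v (\<sigma> 3)))) / 4"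
    unfolding wedge_def e by (simp add: mult.assoc numeral_2_eq_2 numeral_3_eq_3)
  also have "\<dots> = A (v 0) (v 1) * B (v 2) (v 3) - A (v 0) (v 2) * B (v 1) (v 3) + A (v 0) (v 3) * B (v 1) (v 2)
     + A (v 1) (v 2) * B (v 0) (v 3) - A (v 1) (v 3) * B (v 0) (v 2) + A (v 2) (v 3) * B (v 0) (v 1)"
    using assms(1)[of "v (Suc 0)" "v 0"] assms(1)[of "v (Suc (Suc 0))" "v 0"]
        assms(1)[of "v (Suc (Suc 0))" "v (Suc 0)"] assms(1)[of "v (Suc (Suc (Suc 0)))" "v 0"]
        assms(1)[of "v (Suc (Suc (Suc 0)))" "v (Suc 0)"] assms(1)[of "v (Suc (Suc (Suc 0)))" "v (Suc (Suc 0))"]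
      assms(2)[of "v (Suc 0)" "v 0"] assms(2)[of "v (Suc (Suc 0))" "v 0"]
        assms(2)[of "v (Suc (Suc 0))" "v (Suc 0)"] assms(2)[of "v (Suc (Suc (Suc 0)))" "v 0"]
        assms(2)[of "v (Suc (Suc (Suc 0)))" "v (Suc 0)"] assms(2)[of "v (Suc (Suc (Suc 0)))" "v (Suc (Suc 0))"]
    by (simp add: signed_permutations_eval field_simps)
  finally show ?thesis .
qed

lemma wedge_1_3:
  assumes "\<And>u w z. Q u w z = - Q w u z" "\<And>u w z. Q u w z = - Q u z w"
  shows "wedge 1 3 (\<lambda>v. f (v 0)) (\<lambda>v. Q (v 0) (v 1) (v 2)) v =
     f (v 0) * Q (v 1) (v 2) (v 3) - f (v 1) * Q (v 0) (v 2) (v 3)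
     + f (v 2) * Q (v 0) (v 1) (v 3) - f (v 3) * Q (v 0) (v 1) (v 2)"
proof -
  have e: "(1::nat) + 3 = Suc (Suc (Suc (Suc 0)))" by simp
  have r: "Q y x z = - Q x y z" "Q x z y = - Q x y z" "Q y z x = Q x y z" "Q z x y = Q x y z" "Q z y x = - Q x y z"
    for x y z
    using assms by (metis minus_minus)+
  have "wedge 1 3 (\<lambda>v. f (v 0)) (\<lambda>v. Q (v 0) (v 1) (v 2)) v =
    (\<Sum>\<sigma> | \<sigma> permutes {..<Suc (Suc (Suc (Suc 0)))}. of_int (sign \<sigma>) *
      (f (v (\<sigma> 0)) * Q (v (\<sigma> 1)) (v (\<sigma> 2)) (v (\<sigma> 3)))) / 6"
    unfolding wedge_def e by (simp add: mult.assoc numeral_2_eq_2 numeral_3_eq_3)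
  also have "\<dots> = f (v 0) * Q (v 1) (v 2) (v 3) - f (v 1) * Q (v 0) (v 2) (v 3)
     + f (v 2) * Q (v 0) (v 1) (v 3) - f (v 3) * Q (v 0) (v 1) (v 2)"
    using r[of "v 1" "v 0" "v 2"] r[of "v 1" "v 0" "v 3"] r[of "v 2" "v 0" "v 3"] r[of "v 2" "v 1" "v 3"]
    by (simp add: signed_permutations_eval r(1-5)[of "v 0" "v (Suc 0)" "v (Suc (Suc 0))"]
      r(1-5)[of "v 0" "v (Suc 0)" "v (Suc (Suc (Suc 0)))"] r(1-5)[of "v 0" "v (Suc (Suc 0))" "v (Suc (Suc (Suc 0)))"]
      r(1-5)[of "v (Suc 0)" "v (Suc (Suc 0))" "v (Suc (Suc (Suc 0)))"])
  finally show ?thesis .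
qed

section \<open>Operations on alternating forms, form fields and vector fields\<close>

lemma alternating_add: "alternating k a \<Longrightarrow> alternating k b \<Longrightarrow> alternating k (\<lambda>v. a v + b v)"
proof -
  assume a: "alternating k a" and b: "alternating k b"
  show "alternating k (\<lambda>v. a v + b v)"
    unfolding alternating_def
  proof (intro conjI allI impI)
    fix v w :: "nat \<Rightarrow> 'a" assume "\<forall>i<k. v i = w i"
    then show "a v + b v = a w + b w" using alternating_depends[OF a, of v w] alternating_depends[OF b, of v w] by simp
  next
    fix v i assume "i < k"
    then show "linear (\<lambda>u. a (v(i := u)) + b (v(i := u)))"
      by (intro linear_compose_add alternating_linear[OF a] alternating_linear[OF b])
  next
    fix v :: "nat \<Rightarrow> 'a" and i j assume "i < k" "j < k" "i \<noteq> j \<and> v i = v j"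
    then show "a v + b v = 0" using alternating_zero[OF a, of i j v] alternating_zero[OF b, of i j v] by simp
  qed
qed

lemma alternating_real_linear:
  assumes a: "alternating k a" and L: "linear L"
  shows "alternating k (\<lambda>v. L (a v))"
  unfolding alternating_def
proof (intro conjI allI impI)
  fix v w :: "nat \<Rightarrow> 'a" assume "\<forall>i<k. v i = w i"
  then show "L (a v) = L (a w)" using alternating_depends[OF a, of v w] by simp
next
  fix v i assume "i < k"
  then show "linear (\<lambda>u. L (a (v(i := u))))"
    using linear_compose[OF alternating_linear[OF a] L] by (simp add: o_def)
next
  fix v :: "nat \<Rightarrow> 'a" and i j assume "i < k" "j < k" "i \<noteq> j \<and> v i = v j"
  then show "L (a v) = 0" using alternating_zero[OF a, of i j v] L by (simp add: linear_0)
qed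

lemma alternating_pullback:
  assumes a: "alternating k a" and L: "linear L"
  shows "alternating k (\<lambda>v. a (\<lambda>i. L (v i)))"
  unfolding alternating_def
proof (intro conjI allI impI)
  fix v w :: "nat \<Rightarrow> 'b" assume "\<forall>i<k. v i = w i"
  then show "a (\<lambda>i. L (v i)) = a (\<lambda>i. L (w i))" by (intro alternating_depends[OF a]) simp
next
  fix v :: "nat \<Rightarrow> 'b" and i assume i: "i < k"
  have "(\<lambda>m. L ((v(i := u)) m)) = (\<lambda>m. L (v m))(i := L u)" for u by auto
  then show "linear (\<lambda>u. a (\<lambda>m. L ((v(i := u)) m)))"
    using linear_compose[OF L alternating_linear[OF a i, of "\<lambda>m. L (v m)"]] by (simp only: o_def)
next
  fix v :: "nat \<Rightarrow> 'b" and i j assume "i < k" "j < k" "i \<noteq> j \<and> v i = v j"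
  then show "a (\<lambda>i. L (v i)) = 0" using alternating_zero[OF a, of i j "\<lambda>i. L (v i)"] by simp
qed

lemma alternating_contract:
  assumes a: "alternating (Suc k) a"
  shows "alternating k (contract u a)"
  unfolding alternating_def contract_def
proof (intro conjI allI impI)
  fix v w :: "nat \<Rightarrow> 'a" assume "\<forall>i<k. v i = w i"
  then show "a (case_nat u v) = a (case_nat u w)"
    by (intro alternating_depends[OF a]) (simp split: nat.splits)
next
  fix v :: "nat \<Rightarrow> 'a" and i assume i: "i < k"
  have e: "case_nat u (v(i := w)) = (case_nat u v)(Suc i := w)" for w
    by (auto split: nat.splits)
  have "Suc i < Suc k" using i by simp
  from alternating_linear[OF a this] show "linear (\<lambda>w. a (case_nat u (v(i := w))))" by (simp only: e)
next
  fix v :: "nat \<Rightarrow> 'a" and i j assume "i < k" "j < k" "i \<noteq> j \<and> v i = v j"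
  then show "a (case_nat u v) = 0" using alternating_zero[OF a, of "Suc i" "Suc j" "case_nat u v"] by simp
qed

lemma alternating_2I:
  assumes "bilinear B" "\<And>u. B u u = 0"
  shows "alternating 2 (\<lambda>v. B (v 0) (v 1))"
  unfolding alternating_def
proof (intro conjI allI impI)
  fix v :: "nat \<Rightarrow> 'a" and i :: nat assume "i < 2"
  then consider "i = 0" | "i = 1" by linarith
  then show "linear (\<lambda>u. B ((v(i := u)) 0) ((v(i := u)) 1))"
    using assms(1) unfolding bilinear_def by cases auto
next
  fix v :: "nat \<Rightarrow> 'a" and i j :: nat assume "i < 2" "j < 2" "i \<noteq> j \<and> v i = v j"
  moreover from this have "{i, j} = {0, 1}" by auto
  ultimately show "B (v 0) (v 1) = 0" using assms(2) by (metis doubleton_eq_iff)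
qed auto

text \<open>Polarization: the value is 0 when both slots carry \<open>x + y\<close>.\<close>

lemma alternating_swap:
  assumes a: "alternating k a" and ij: "i < k" "j < k" "i \<noteq> j"
  shows "a (v(i := x, j := y)) = - a (v(i := y, j := x))"
proof -
  let ?f = "\<lambda>x y. a (v(i := x, j := y))"
  have l1: "linear (\<lambda>x. ?f x y)" for y
    using alternating_linear[OF a ij(1), of "v(j := y)"] ij(3) by (simp add: fun_upd_twist)
  have l2: "linear (\<lambda>y. ?f x y)" for x
    using alternating_linear[OF a ij(2)] by blast
  have z: "?f x x = 0" for x
    by (rule alternating_zero[OF a ij]) (use ij in auto)
  have "0 = ?f (x + y) (x + y)" by (simp only: z)
  also have "\<dots> = ?f x x + ?f x y + (?f y x + ?f y y)"
    by (simp only: linear_add[OF l1] linear_add[OF l2] add_ac)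
  finally show ?thesis by (simp only: z) (simp add: eq_neg_iff_add_eq_0)
qed

lemma form_field_alternating: "form_field A k \<beta> \<Longrightarrow> c \<in> A \<Longrightarrow> x \<in> fst c \<Longrightarrow> alternating k (\<beta> c x)"
  and form_field_smooth: "form_field A k \<beta> \<Longrightarrow> c \<in> A \<Longrightarrow> smooth_on (fst c) (\<lambda>x. \<beta> c x v)"
  and form_field_change: "form_field A k \<beta> \<Longrightarrow> c \<in> A \<Longrightarrow> c' \<in> A \<Longrightarrow> chart_change c c' W h \<Longrightarrow> x \<in> W \<Longrightarrow>
     \<beta> c x v = \<beta> c' (h x) (\<lambda>i. frechet_derivative h (at x) (v i))"
  by (simp_all add: form_field_def)

lemma form_fieldI:
  assumes "\<And>c x. c \<in> A \<Longrightarrow> x \<in> fst c \<Longrightarrow> alternating k (\<beta> c x)"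
    and "\<And>c v. c \<in> A \<Longrightarrow> smooth_on (fst c) (\<lambda>x. \<beta> c x v)"
    and "\<And>c c' W h x v. c \<in> A \<Longrightarrow> c' \<in> A \<Longrightarrow> chart_change c c' W h \<Longrightarrow> x \<in> W \<Longrightarrow>
       \<beta> c x v = \<beta> c' (h x) (\<lambda>i. frechet_derivative h (at x) (v i))"
  shows "form_field A k \<beta>"
  unfolding form_field_def using assms by blast

definition open_charts :: "('e::euclidean_space, 'm) chart set \<Rightarrow> bool" where
  "open_charts A \<longleftrightarrow> (\<forall>c\<in>A. open (fst c))"

lemma form_field_cong:
  assumes "open_charts A" and e: "\<And>c x v. c \<in> A \<Longrightarrow> x \<in> fst c \<Longrightarrow> \<beta> c x v = \<beta>' c x v" and "form_field A k \<beta>"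
  shows "form_field A k \<beta>'"
proof (rule form_fieldI)
  fix c v assume c: "c \<in> A"
  have "smooth_on (fst c) (\<lambda>x. \<beta> c x v)" by (rule form_field_smooth[OF assms(3) c])
  then show "smooth_on (fst c) (\<lambda>x. \<beta>' c x v)"
    using smooth_on_cong[of "fst c" "\<lambda>x. \<beta> c x v" "\<lambda>x. \<beta>' c x v"] e[OF c] assms(1) c
    by (simp add: open_charts_def)
next
  fix c x assume "c \<in> A" "x \<in> fst c"
  then have "\<beta> c x = \<beta>' c x" using e by blast
  then show "alternating k (\<beta>' c x)"
    using form_field_alternating[OF assms(3) \<open>c \<in> A\<close> \<open>x \<in> fst c\<close>] by simp
next
  fix c c' W h x v assume A: "c \<in> A" "c' \<in> A" "chart_change c c' W h" "x \<in> W"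
  then have "x \<in> fst c" "h x \<in> fst c'" by (auto simp: chart_change_def)
  then show "\<beta>' c x v = \<beta>' c' (h x) (\<lambda>i. frechet_derivative h (at x) (v i))"
    using form_field_change[OF assms(3) A, of v] by (simp add: e[OF A(1)] e[OF A(2)])
qed

lemma form_field_add:
  assumes "open_charts A" "form_field A k \<alpha>" "form_field A k \<beta>"
  shows "form_field A k (\<lambda>c x v. \<alpha> c x v + \<beta> c x v)"
proof (rule form_fieldI)
  fix c x assume "c \<in> A" "x \<in> fst c"
  then show "alternating k (\<lambda>v. \<alpha> c x v + \<beta> c x v)"
    using assms(2,3) by (simp add: alternating_add form_field_alternating)
next
  fix c v assume "c \<in> A"
  then show "smooth_on (fst c) (\<lambda>x. \<alpha> c x v + \<beta> c x v)"
    using assms by (simp add: smooth_on_add form_field_smooth open_charts_def)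
next
  fix c c' W h x v assume A: "c \<in> A" "c' \<in> A" "chart_change c c' W h" "x \<in> W"
  show "\<alpha> c x v + \<beta> c x v = \<alpha> c' (h x) (\<lambda>i. frechet_derivative h (at x) (v i)) +
      \<beta> c' (h x) (\<lambda>i. frechet_derivative h (at x) (v i))"
    by (rule arg_cong2[where f = "(+)", OF form_field_change[OF assms(2) A] form_field_change[OF assms(3) A]])
qed

lemma form_field_linear:
  assumes "open_charts A" "form_field A k \<beta>" "linear (L :: complex \<Rightarrow> complex)"
  shows "form_field A k (\<lambda>c x v. L (\<beta> c x v))"
proof (rule form_fieldI)
  fix c x assume "c \<in> A" "x \<in> fst c"
  then show "alternating k (\<lambda>v. L (\<beta> c x v))"
    by (rule alternating_real_linear[OF form_field_alternating[OF assms(2)] assms(3)])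
next
  fix c v assume "c \<in> A"
  then show "smooth_on (fst c) (\<lambda>x. L (\<beta> c x v))"
    using assms(1) by (intro smooth_on_linear[OF _ assms(3) form_field_smooth[OF assms(2)]])
      (simp_all add: open_charts_def)
next
  fix c c' W h x v assume A: "c \<in> A" "c' \<in> A" "chart_change c c' W h" "x \<in> W"
  show "L (\<beta> c x v) = L (\<beta> c' (h x) (\<lambda>i. frechet_derivative h (at x) (v i)))"
    by (rule arg_cong[where f = L, OF form_field_change[OF assms(2) A]])
qed

lemma form_field_scale:
  "open_charts A \<Longrightarrow> form_field A k \<beta> \<Longrightarrow> form_field A k (\<lambda>c x v. (z::complex) * \<beta> c x v)"
  by (rule form_field_linear) (auto simp: linear_iff algebra_simps)

lemma linear_cnj: "linear cnj"
  by (auto simp: linear_iff)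

lemma form_field_conj: "open_charts A \<Longrightarrow> form_field A k \<beta> \<Longrightarrow> form_field A k (conj_form \<beta>)"
  unfolding conj_form_def[abs_def] by (rule form_field_linear[OF _ _ linear_cnj])

lemma form_field_wedge:
  assumes "open_charts A" "form_field A k \<alpha>" "form_field A l \<beta>"
  shows "form_field A (k + l) (\<lambda>c x. wedge k l (\<alpha> c x) (\<beta> c x))"
proof (rule form_fieldI)
  fix c v assume c: "c \<in> A"
  show "smooth_on (fst c) (\<lambda>x. wedge k l (\<alpha> c x) (\<beta> c x) v)"
    using assms(1) c by (intro smooth_on_wedge form_field_smooth[OF assms(2) c] form_field_smooth[OF assms(3) c])
      (simp add: open_charts_def)
next
  fix c x assume "c \<in> A" "x \<in> fst c"
  then show "alternating (k + l) (wedge k l (\<alpha> c x) (\<beta> c x))"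
    by (intro alternating_wedge form_field_alternating[OF assms(2)] form_field_alternating[OF assms(3)])
next
  fix c c' W h x v assume A: "c \<in> A" "c' \<in> A" "chart_change c c' W h" "x \<in> W"
  have "\<alpha> c x = (\<lambda>v. \<alpha> c' (h x) (\<lambda>i. frechet_derivative h (at x) (v i)))"
    "\<beta> c x = (\<lambda>v. \<beta> c' (h x) (\<lambda>i. frechet_derivative h (at x) (v i)))"
    by (rule ext, rule form_field_change[OF assms(2) A], rule ext, rule form_field_change[OF assms(3) A])
  then show "wedge k l (\<alpha> c x) (\<beta> c x) v =
      wedge k l (\<alpha> c' (h x)) (\<beta> c' (h x)) (\<lambda>i. frechet_derivative h (at x) (v i))"
    by (simp only: wedge_pullback)
qed

definition vector_field :: "('e::euclidean_space, 'm) chart set \<Rightarrow> ('e, 'm) vfield \<Rightarrow> bool" where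
  "vector_field A Y \<longleftrightarrow> (\<forall>c\<in>A. smooth_on (fst c) (Y c)) \<and>
     (\<forall>c\<in>A. \<forall>c'\<in>A. \<forall>W h. chart_change c c' W h \<longrightarrow>
        (\<forall>x\<in>W. frechet_derivative h (at x) (Y c x) = Y c' (h x)))"

lemma vector_field_change: "vector_field A Y \<Longrightarrow> c \<in> A \<Longrightarrow> c' \<in> A \<Longrightarrow> chart_change c c' W h \<Longrightarrow> x \<in> W \<Longrightarrow>
     frechet_derivative h (at x) (Y c x) = Y c' (h x)"
  by (simp add: vector_field_def)

lemma endo_field_change: "endo_field A J \<Longrightarrow> c \<in> A \<Longrightarrow> c' \<in> A \<Longrightarrow> chart_change c c' W h \<Longrightarrow> x \<in> W \<Longrightarrow>
     frechet_derivative h (at x) (J c x v) = J c' (h x) (frechet_derivative h (at x) v)"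
  by (simp add: endo_field_def)

lemma vector_field_smooth: "vector_field A Y \<Longrightarrow> c \<in> A \<Longrightarrow> smooth_on (fst c) (Y c)"
  unfolding vector_field_def by blast

lemma endo_field_linear: "endo_field A J \<Longrightarrow> c \<in> A \<Longrightarrow> x \<in> fst c \<Longrightarrow> linear (J c x)"
  unfolding endo_field_def by blast

lemma endo_field_smooth: "endo_field A J \<Longrightarrow> c \<in> A \<Longrightarrow> smooth_on (fst c) (\<lambda>x. J c x v)"
  unfolding endo_field_def by blast

lemma form_field_contract:
  assumes "open_charts A" "vector_field A Y" "form_field A (Suc k) \<beta>"
  shows "form_field A k (\<lambda>c x. contract (Y c x) (\<beta> c x))"
proof (rule form_fieldI)
  fix c v assume c: "c \<in> A"
  have Y: "smooth_on (fst c) (Y c)" by (rule vector_field_smooth[OF assms(2) c])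
  have "smooth_on (fst c) (\<lambda>x. \<beta> c x (\<lambda>i. case_nat (Y c x) v i))"
  proof (rule alternating_family(1)[where \<beta> = "\<beta> c" and k = "Suc k" and F = "\<lambda>i x. case_nat (Y c x) v i"])
    show "open (fst c)" using assms(1) c by (simp add: open_charts_def)
    show "smooth_on (fst c) (\<lambda>x. case_nat (Y c x) v i)" for i
    proof (cases i)
      case 0
      then show ?thesis using Y by simp
    next
      case (Suc j)
      then show ?thesis by simp
    qed
    show "alternating (Suc k) (\<beta> c x)" if "x \<in> fst c" for x
      by (rule form_field_alternating[OF assms(3) c that])
    show "smooth_on (fst c) (\<lambda>x. \<beta> c x v)" for v
      by (rule form_field_smooth[OF assms(3) c])
  qed
  then show "smooth_on (fst c) (\<lambda>x. contract (Y c x) (\<beta> c x) v)" by (simp add: contract_def)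
next
  fix c x assume "c \<in> A" "x \<in> fst c"
  then show "alternating k (contract (Y c x) (\<beta> c x))"
    by (intro alternating_contract form_field_alternating[OF assms(3)])
next
  fix c c' W h x v assume A: "c \<in> A" "c' \<in> A" "chart_change c c' W h" "x \<in> W"
  have Y: "frechet_derivative h (at x) (Y c x) = Y c' (h x)"
    by (rule vector_field_change[OF assms(2) A])
  have e: "(\<lambda>i. frechet_derivative h (at x) (case_nat (Y c x) v i)) =
      case_nat (Y c' (h x)) (\<lambda>i. frechet_derivative h (at x) (v i))"
  proof
    fix i show "frechet_derivative h (at x) (case_nat (Y c x) v i) =
      case_nat (Y c' (h x)) (\<lambda>i. frechet_derivative h (at x) (v i)) i"
      using Y by (cases i) simp_all
  qed
  have "\<beta> c x (case_nat (Y c x) v) =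
      \<beta> c' (h x) (\<lambda>i. frechet_derivative h (at x) (case_nat (Y c x) v i))"
    by (rule form_field_change[OF assms(3) A])
  then show "contract (Y c x) (\<beta> c x) v =
      contract (Y c' (h x)) (\<beta> c' (h x)) (\<lambda>i. frechet_derivative h (at x) (v i))"
    unfolding contract_def e .
qed

text \<open>For a slot \<open>j\<close> of type \<open>(0,1)\<close>, adding \<open>j\<close> to a
  subset multiplies its term by \<open>\<i>\<close> from the coefficient and by \<open>\<i>\<close>
  from the hypothesis. Hence the subsets with and without \<open>j\<close> cancel.\<close>

lemma covector_type_top:
  assumes J: "\<And>v j. j < k \<Longrightarrow> b (v(j := J (v j))) = \<i> * b v"
  shows "covector_type k {k} J b"
  unfolding covector_type_def
proof (intro allI impI)
  fix v s assume "card {i. i < k \<and> s i} \<notin> {k}"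
  then have "{i. i < k \<and> s i} \<noteq> {..<k}" by (metis card_lessThan insertI1)
  then obtain j where j: "j < k" "\<not> s j" by blast
  define t where "t B = (\<Prod>i\<in>B. if s i then - \<i> else \<i>) * b (\<lambda>i. if i \<in> B then J (v i) else v i)" for B
  have "Pow {..<k} = Pow (insert j ({..<k} - {j}))" using j by (simp add: insert_absorb)
  also have "\<dots> = Pow ({..<k} - {j}) \<union> insert j ` Pow ({..<k} - {j})" by (rule Pow_insert)
  finally have P: "Pow {..<k} = Pow ({..<k} - {j}) \<union> insert j ` Pow ({..<k} - {j})" .
  have inj: "inj_on (insert j) (Pow ({..<k} - {j}))" by (rule inj_onI) (auto simp: insert_ident)
  have "t (insert j B) = - t B" if "B \<in> Pow ({..<k} - {j})" for B
  proof -
    have B: "finite B" "j \<notin> B" using that finite_subset[of B "{..<k} - {j}"] by auto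
    have "(\<lambda>i. if i \<in> insert j B then J (v i) else v i) =
        (\<lambda>i. if i \<in> B then J (v i) else v i)(j := J ((\<lambda>i. if i \<in> B then J (v i) else v i) j))"
      using B by (intro ext) auto
    then have "b (\<lambda>i. if i \<in> insert j B then J (v i) else v i) = \<i> * b (\<lambda>i. if i \<in> B then J (v i) else v i)"
      using J[OF j(1), of "\<lambda>i. if i \<in> B then J (v i) else v i"] by simp
    then show ?thesis using B j by (simp add: t_def mult_ac)
  qed
  then have "sum t (insert j ` Pow ({..<k} - {j})) = - sum t (Pow ({..<k} - {j}))"
    by (simp add: sum.reindex[OF inj] sum_negf)
  then have "sum t (Pow {..<k}) = 0"
    unfolding P by (subst sum.union_disjoint) auto
  then show "(\<Sum>B\<in>Pow {..<k}. (\<Prod>i\<in>B. if s i then - \<i> else \<i>) * b (\<lambda>i. if i \<in> B then J (v i) else v i)) = 0"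
    by (simp add: t_def)
qed

text \<open>Invariance and \<open>JJ\<close> give \<open>b (x, J y) = - b (J x, y)\<close>. With
  both arguments of the same type, the terms for the empty and the full subset cancel by invariance,
  and the two middle terms by this sign.\<close>

lemma covector_type_1_1:
  assumes alt: "alternating 2 b" and J: "\<And>v. b (\<lambda>i. J (v i)) = b v" and JJ: "\<And>v. J (J v) = - v"
  shows "covector_type 2 {1} J b"
  unfolding covector_type_def
proof (intro allI impI)
  fix v :: "nat \<Rightarrow> 'a" and s :: "nat \<Rightarrow> bool" assume c: "card {i. i < 2 \<and> s i} \<notin> {1}"
  \<comment> \<open>A count different from 1 means that both arguments have the same type.\<close>
  have s: "s 0 = s 1"
  proof (rule ccontr)
    assume "s 0 \<noteq> s 1"
    then have "{i. i < 2 \<and> s i} = (if s 0 then {0} else {1})" by (auto simp: less_2_cases_iff)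
    then show False using c by (auto split: if_splits)
  qed
  have dep: "b w = b (vec2 (w 0) (w 1))" for w
    by (rule alternating_depends[OF alt]) (auto simp: vec2_def less_2_cases_iff)
  have neg: "b (vec2 (- x) y) = - b (vec2 x y)" for x y
  proof -
    have "linear (\<lambda>u. b ((vec2 x y)(0 := u)))" by (rule alternating_linear[OF alt]) simp
    moreover have "(vec2 x y)(0 := u) = vec2 u y" for u by (auto simp: vec2_def)
    ultimately have "linear (\<lambda>u. b (vec2 u y))" by simp
    then show ?thesis by (rule linear_neg)
  qed
  have J2: "b (vec2 (J x) (J y)) = b (vec2 x y)" for x y
  proof -
    have "(\<lambda>i. J (vec2 x y i)) = vec2 (J x) (J y)" by (auto simp: vec2_def)
    then show ?thesis using J[of "vec2 x y"] by simp
  qed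
  have J3: "b (vec2 x (J y)) = - b (vec2 (J x) y)" for x y
    using arg_cong[OF J2[of "J x" y], of uminus] by (simp add: JJ neg)
  have P: "Pow {..<2::nat} = {{}, {0}, {1}, {0, 1}}"
    by (auto simp: lessThan_nat_numeral lessThan_Suc Pow_insert)
  define t where "t B = (\<Prod>i\<in>B. if s i then - \<i> else \<i>) * b (\<lambda>i. if i \<in> B then J (v i) else v i)" for B
  have t0: "t {} = b (vec2 (v 0) (v 1))"
    unfolding t_def by (subst dep) simp
  have t1: "t {0} = (if s 1 then - \<i> else \<i>) * b (vec2 (J (v 0)) (v 1))"
    unfolding t_def by (subst dep) (simp add: s)
  have t2: "t {1} = - (if s 1 then - \<i> else \<i>) * b (vec2 (J (v 0)) (v 1))"
    unfolding t_def by (subst dep) (simp add: J3)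
  have t3: "t {0, 1} = - b (vec2 (v 0) (v 1))"
    unfolding t_def by (subst dep) (simp add: s J2)
  have "sum t (Pow {..<2}) = t {} + t {0} + t {1} + t {0, 1}"
    unfolding P by (simp add: doubleton_eq_iff)
  then have "sum t (Pow {..<2}) = 0" unfolding t0 t1 t2 t3 by simp
  then show "(\<Sum>B\<in>Pow {..<2}. (\<Prod>i\<in>B. if s i then - \<i> else \<i>) * b (\<lambda>i. if i \<in> B then J (v i) else v i)) = 0"
    by (simp add: t_def)
qed

abbreviation dder :: "('a::real_normed_vector \<Rightarrow> 'b::real_normed_vector) \<Rightarrow> 'a \<Rightarrow> 'a \<Rightarrow> 'b" where
  "dder f x v \<equiv> frechet_derivative f (at x) v"

lemma dder_linear_family:
  fixes b :: "'x::euclidean_space \<Rightarrow> 'e::euclidean_space \<Rightarrow> 'c::real_normed_vector"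
  assumes "open U" "x \<in> U" "\<And>y. y \<in> U \<Longrightarrow> linear (b y)" "\<And>v. smooth_on U (\<lambda>y. b y v)" "smooth_on U F"
  shows "dder (\<lambda>y. b y (F y)) x h = dder (\<lambda>y. b y (F x)) x h + b x (dder F x h)"
  by (rule fun_cong[OF frechet_derivative_eq[OF linear_family_has_derivative[OF assms(1-3)
     smooth_on_differentiable[OF assms(4,2)] smooth_on_has_derivative[OF assms(5,2)]]]])

section \<open>The hyperkaehler cone\<close>

text \<open>One chart of the cone. Below, \<open>E\<close> is the Euler field \<open>r \<partial>\<^sub>r\<close>, \<open>xi i\<close> the Reeb field \<open>\<xi>\<^sub>i\<close>, \<open>om i\<close> the
  Kaehler form \<open>\<omega>\<^sub>i\<close> and \<open>th i\<close> the form \<open>r\<^sup>2 \<eta>\<^sub>i\<close>.\<close>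

locale hk_chart =
  fixes U :: "('e::euclidean_space \<times> real) set"
    and g0 :: "'e \<Rightarrow> 'e \<Rightarrow> 'e \<Rightarrow> real"
    and G :: "'e \<times> real \<Rightarrow> 'e \<times> real \<Rightarrow> 'e \<times> real \<Rightarrow> real"
    and J :: "nat \<Rightarrow> 'e \<times> real \<Rightarrow> 'e \<times> real \<Rightarrow> 'e \<times> real"
  assumes open_U: "open U" and snd_pos: "y \<in> U \<Longrightarrow> 0 < snd y"
    and g0_bilinear: "y \<in> U \<Longrightarrow> bilinear (g0 (fst y))"
    and g0_smooth: "smooth_on U (\<lambda>y. g0 (fst y) a b)"
    and G_eq: "G y v w = snd v * snd w + (snd y)\<^sup>2 * g0 (fst y) (fst v) (fst w)"
    and G_bilinear: "y \<in> U \<Longrightarrow> bilinear (G y)"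
    and G_sym: "y \<in> U \<Longrightarrow> G y v w = G y w v"
    and G_pos: "y \<in> U \<Longrightarrow> v \<noteq> 0 \<Longrightarrow> G y v v > 0"
    and J_linear: "i \<in> {1..3} \<Longrightarrow> y \<in> U \<Longrightarrow> linear (J i y)"
    and J_smooth: "i \<in> {1..3} \<Longrightarrow> smooth_on U (\<lambda>y. J i y v)"
    and J_square: "i \<in> {1..3} \<Longrightarrow> y \<in> U \<Longrightarrow> J i y (J i y v) = - v"
    and J_mult: "y \<in> U \<Longrightarrow> J 1 y (J 2 y v) = J 3 y v" "y \<in> U \<Longrightarrow> J 2 y (J 3 y v) = J 1 y v"
      "y \<in> U \<Longrightarrow> J 3 y (J 1 y v) = J 2 y v" "y \<in> U \<Longrightarrow> J 2 y (J 1 y v) = - J 3 y v"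
      "y \<in> U \<Longrightarrow> J 3 y (J 2 y v) = - J 1 y v" "y \<in> U \<Longrightarrow> J 1 y (J 3 y v) = - J 2 y v"
    and J_orth: "i \<in> {1..3} \<Longrightarrow> y \<in> U \<Longrightarrow> G y (J i y v) (J i y w) = G y v w"
    and om_closed: "i \<in> {1..3} \<Longrightarrow> y \<in> U \<Longrightarrow> dder (\<lambda>y. G y (J i y v) w) y u - dder (\<lambda>y. G y (J i y u) w) y v
        + dder (\<lambda>y. G y (J i y u) v) y w = 0"
    and nijenhuis: "i \<in> {1..3} \<Longrightarrow> y \<in> U \<Longrightarrow> dder (\<lambda>y. J i y w) y (J i y v) - dder (\<lambda>y. J i y v) y (J i y w)
        + J i y (dder (\<lambda>y. J i y v) y w) - J i y (dder (\<lambda>y. J i y w) y v) = 0"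
begin

definition E :: "'e \<times> real \<Rightarrow> 'e \<times> real" where "E y = (0, snd y)"
definition xi :: "nat \<Rightarrow> 'e \<times> real \<Rightarrow> 'e \<times> real" where "xi i y = J i y (E y)"
definition om :: "nat \<Rightarrow> 'e \<times> real \<Rightarrow> 'e \<times> real \<Rightarrow> 'e \<times> real \<Rightarrow> real" where "om i y v w = G y (J i y v) w"
definition th :: "nat \<Rightarrow> 'e \<times> real \<Rightarrow> 'e \<times> real \<Rightarrow> real" where "th i y w = G y (xi i y) w"

lemma G_linear_left: "y \<in> U \<Longrightarrow> linear (\<lambda>v. G y v w)" and G_linear_right: "y \<in> U \<Longrightarrow> linear (G y v)"
  using G_bilinear[of y] unfolding bilinear_def by blast+

lemma G_add_left: "y \<in> U \<Longrightarrow> G y (u + v) w = G y u w + G y v w"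
  and G_diff_left: "y \<in> U \<Longrightarrow> G y (u - v) w = G y u w - G y v w"
  and G_minus_left: "y \<in> U \<Longrightarrow> G y (- v) w = - G y v w"
  and G_scale_left: "y \<in> U \<Longrightarrow> G y (a *\<^sub>R v) w = a * G y v w"
  and G_add_right: "y \<in> U \<Longrightarrow> G y w (u + v) = G y w u + G y w v"
  and G_diff_right: "y \<in> U \<Longrightarrow> G y w (u - v) = G y w u - G y w v"
  and G_minus_right: "y \<in> U \<Longrightarrow> G y w (- v) = - G y w v"
  and G_scale_right: "y \<in> U \<Longrightarrow> G y w (a *\<^sub>R v) = a * G y w v"
  and G_zero_right: "y \<in> U \<Longrightarrow> G y w 0 = 0"
  using linear_add[OF G_linear_left] linear_diff[OF G_linear_left] linear_neg[OF G_linear_left]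
    linear_cmul[OF G_linear_left] linear_0[OF G_linear_left]
    linear_add[OF G_linear_right] linear_diff[OF G_linear_right] linear_neg[OF G_linear_right]
    linear_cmul[OF G_linear_right] linear_0[OF G_linear_right]
  by simp_all

lemma index_123: "1 \<in> {1..3::nat}" "2 \<in> {1..3::nat}" "3 \<in> {1..3::nat}"
  by simp_all

lemmas J_lin = linear_add[OF J_linear] linear_diff[OF J_linear] linear_neg[OF J_linear]
  linear_cmul[OF J_linear] linear_0[OF J_linear]

lemma J_skew: "i \<in> {1..3} \<Longrightarrow> y \<in> U \<Longrightarrow> G y (J i y v) w = - G y v (J i y w)"
  using J_orth[of i y v "J i y w"] J_square[of i y w] G_minus_right[of y "J i y v" w] by simp

lemma G_smooth: "smooth_on U (\<lambda>y. G y v w)"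
proof -
  have "smooth_on U (\<lambda>y. snd v * snd w + (snd y * snd y) * g0 (fst y) (fst v) (fst w))"
    by (intro smooth_on_add[OF open_U] smooth_on_mult[OF open_U] smooth_on_const smooth_on_snd_arg[OF open_U] g0_smooth)
  then show ?thesis by (simp add: G_eq power2_eq_square)
qed

lemma E_smooth: "smooth_on U E"
  unfolding E_def[abs_def] by (rule smooth_on_linear_map[OF open_U]) (simp add: linear_iff)

lemma dder_E: "dder E y h = (0, snd h)"
proof -
  have "linear E" by (simp add: linear_iff E_def)
  then have "(E has_derivative E) (at y)" by (simp add: linear_imp_has_derivative)
  then show ?thesis by (simp add: frechet_derivative_eq E_def)
qed

lemma xi_smooth: "i \<in> {1..3} \<Longrightarrow> smooth_on U (xi i)"
  unfolding xi_def[abs_def] by (rule linear_family_smooth[OF open_U J_linear J_smooth E_smooth])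

lemma G_family_smooth: "smooth_on U F \<Longrightarrow> smooth_on U (\<lambda>y. G y (F y) w)"
  by (rule linear_family_smooth[OF open_U G_linear_left G_smooth])

lemma om_smooth: "i \<in> {1..3} \<Longrightarrow> smooth_on U (\<lambda>y. om i y v w)"
  unfolding om_def by (rule G_family_smooth[OF J_smooth])

lemma th_smooth: "i \<in> {1..3} \<Longrightarrow> smooth_on U (\<lambda>y. th i y w)"
  unfolding th_def by (rule G_family_smooth[OF xi_smooth])

text \<open>\<open>E\<close> is metrically dual to \<open>r dr\<close>. This is how the last
  component \<open>snd\<close> enters the formulas that follow.\<close>

lemma G_E: "y \<in> U \<Longrightarrow> G y (E y) w = snd y * snd w" "y \<in> U \<Longrightarrow> G y (0, s) w = s * snd w"
  using g0_bilinear[of y] by (simp_all add: G_eq E_def bilinear_lzero)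

text \<open>In other words \<open>th i\<close> is \<open>- r dr\<close> composed with
  \<open>J i\<close>, so that its derivatives involve only \<open>J i\<close> and the coordinate
  \<open>r\<close>.\<close>

lemma th_eq: "i \<in> {1..3} \<Longrightarrow> y \<in> U \<Longrightarrow> th i y w = - (snd y * snd (J i y w))"
  by (simp add: th_def xi_def J_skew G_E)

lemma om_bilinear: "i \<in> {1..3} \<Longrightarrow> y \<in> U \<Longrightarrow> bilinear (om i y)"
  using linear_compose[OF J_linear G_linear_left] G_linear_right
  by (simp add: bilinear_def om_def[abs_def] o_def)

lemma om_skew: "i \<in> {1..3} \<Longrightarrow> y \<in> U \<Longrightarrow> om i y v w = - om i y w v"
  using J_skew[of i y v w] G_sym[of y v "J i y w"] by (simp add: om_def)

lemma om_self: "i \<in> {1..3} \<Longrightarrow> y \<in> U \<Longrightarrow> om i y v v = 0"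
  using om_skew[of i y v v] by simp

lemma th_linear: "y \<in> U \<Longrightarrow> linear (th i y)"
  using G_linear_right by (simp add: th_def[abs_def])

lemma om_E: "om i y (E y) w = th i y w"
  by (simp add: om_def th_def xi_def)

text \<open>Differentiating \<open>J i\<close> squared, which is constant, shows that derivatives of
  \<open>J i\<close> anticommute with \<open>J i\<close>.\<close>

lemma dder_J_square:
  assumes "i \<in> {1..3}" "y \<in> U"
  shows "dder (\<lambda>y. J i y (J i y w)) y v = 0"
    "dder (\<lambda>z. J i z (J i y w)) y v + J i y (dder (\<lambda>y. J i y w) y v) = 0"
proof -
  have "frechet_derivative (\<lambda>y. J i y (J i y w)) (at y) = frechet_derivative (\<lambda>y. - w) (at y)"
    by (rule frechet_derivative_cong_open[OF open_U assms(2)]) (rule J_square[OF assms(1)])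
  then show 1: "dder (\<lambda>y. J i y (J i y w)) y v = 0"
    by (simp add: frechet_derivative_eq[OF has_derivative_const])
  show "dder (\<lambda>z. J i z (J i y w)) y v + J i y (dder (\<lambda>y. J i y w) y v) = 0"
    using dder_linear_family[OF open_U assms(2) J_linear[OF assms(1)] J_smooth[OF assms(1)] J_smooth[OF assms(1)], of w v]
    by (simp only: 1)
qed

lemma dder_th:
  assumes i: "i \<in> {1..3}" and y: "y \<in> U"
  shows "dder (\<lambda>y. th i y w) y v = - (snd v * snd (J i y w)) - snd y * snd (dder (\<lambda>y. J i y w) y v)"
proof -
  have "((\<lambda>y. - (snd y * snd (J i y w))) has_derivative
     (\<lambda>v. - (snd y * snd (dder (\<lambda>y. J i y w) y v) + snd v * snd (J i y w)))) (at y)"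
    by (intro has_derivative_minus has_derivative_mult has_derivative_snd has_derivative_ident
        smooth_on_has_derivative[OF J_smooth[OF i] y])
  then have "((\<lambda>y. th i y w) has_derivative
     (\<lambda>v. - (snd y * snd (dder (\<lambda>y. J i y w) y v) + snd v * snd (J i y w)))) (at y)"
    by (rule has_derivative_cong_open[OF open_U y, THEN iffD1, rotated]) (simp add: th_eq[OF i])
  then show ?thesis by (simp add: frechet_derivative_eq)
qed

text \<open>The base metric is independent of \<open>r\<close>, so only the factor
  \<open>r\<^sup>2\<close> is differentiated. Together with the derivative of \<open>E\<close> this
  says that the Lie derivative of \<open>G\<close> along \<open>E\<close> is
  \<open>2 G\<close>.\<close>

lemma dder_G_E:
  assumes y: "y \<in> U"
  shows "dder (\<lambda>y. G y v w) y (E y) = 2 * G y v w - 2 * (snd v * snd w)"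
proof -
  define f where "f y = g0 (fst y) (fst v) (fst w)" for y :: "'e \<times> real"
  have f: "(f has_derivative frechet_derivative f (at y)) (at y)"
    unfolding f_def[abs_def] by (rule smooth_on_has_derivative[OF g0_smooth y])
  have "dder f y (E y) = 0"
  proof -
    have "((\<lambda>t. f (y + t *\<^sub>R E y)) has_derivative (\<lambda>t. dder f y (t *\<^sub>R E y))) (at 0)"
    proof (rule has_derivative_compose[of "\<lambda>t. y + t *\<^sub>R E y" "\<lambda>t. t *\<^sub>R E y" 0 UNIV f])
      show "((\<lambda>t. y + t *\<^sub>R E y) has_derivative (\<lambda>t. t *\<^sub>R E y)) (at 0)"
        by (auto intro!: derivative_eq_intros)
    qed (use f in simp)
    moreover have "(\<lambda>t. f (y + t *\<^sub>R E y)) = (\<lambda>t. f y)" by (simp add: f_def E_def)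
    ultimately have "(\<lambda>t::real. dder f y (t *\<^sub>R E y)) = (\<lambda>t. 0)"
      using has_derivative_unique[OF _ has_derivative_const] by metis
    from fun_cong[OF this, of 1] show ?thesis by simp
  qed
  moreover have "((\<lambda>y. snd v * snd w + (snd y)\<^sup>2 * f y) has_derivative
      (\<lambda>h. 0 + ((snd y)\<^sup>2 * dder f y h + of_nat 2 * snd h * snd y ^ (2 - 1) * f y))) (at y)"
    by (intro has_derivative_add has_derivative_const has_derivative_mult has_derivative_power
        has_derivative_snd has_derivative_ident f)
  then have "dder (\<lambda>y. G y v w) y (E y) = (snd y)\<^sup>2 * dder f y (E y) + 2 * snd (E y) * snd y * f y"
    unfolding G_eq f_def[symmetric] by (simp add: frechet_derivative_eq)
  ultimately show ?thesis
    by (simp add: E_def G_eq f_def power2_eq_square)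
qed

text \<open>The left-hand side is of type \<open>(1,1)\<close> by integrability. It is also the Lie derivative of
  \<open>om i\<close> along \<open>E\<close>, which differs from \<open>2 om i\<close> by the form \<open>G A\<close> of the Lie derivative \<open>A\<close> of
  \<open>J i\<close>; as \<open>A\<close> anticommutes with \<open>J i\<close>, that form has no \<open>(1,1)\<close> part.\<close>

lemma d_th:
  assumes i: "i \<in> {1..3}" and y: "y \<in> U"
  shows "dder (\<lambda>y. th i y w) y v - dder (\<lambda>y. th i y v) y w = 2 * om i y v w"
proof -
  define K where "K = J i y"
  define dJ where "dJ v w = dder (\<lambda>y. J i y w) y v" for v w
  define B where "B v w = dder (\<lambda>y. th i y w) y v - dder (\<lambda>y. th i y v) y w" for v w
  \<comment> \<open>The Lie derivative of \<open>J i\<close> along \<open>E\<close>, applied to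
    \<open>v\<close>; here \<open>(0, snd v)\<close> is the derivative of \<open>E\<close> in the
    direction \<open>v\<close>.\<close>
  define A where "A v = dJ (E y) v - (0, snd (K v)) + K (0, snd v)" for v
  have K: "K (K v) = - v" "K (a + b) = K a + K b" "K (a - b) = K a - K b" "K (- a) = - K a" for a b v
    unfolding K_def using J_square[OF i y] J_lin[OF i y] by simp_all
  have skew: "G y (K v) w = - G y v (K w)" for v w unfolding K_def by (rule J_skew[OF i y])
  have KdJ: "dJ v (K w) = - K (dJ v w)" for v w
    using dder_J_square(2)[OF i y, of w v] unfolding dJ_def K_def by (simp add: eq_neg_iff_add_eq_0)
  have N: "dJ (K v) w - dJ (K w) v + K (dJ w v) - K (dJ v w) = 0" for v w
    using nijenhuis[OF i y, of w v] unfolding dJ_def K_def .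
  have Bv: "B v w = - (snd v * snd (K w)) + snd w * snd (K v) - snd y * snd (dJ v w - dJ w v)" for v w
    unfolding B_def dder_th[OF i y] K_def[symmetric] dJ_def[symmetric] by (simp add: algebra_simps)
  have BJ: "B (K v) (K w) = B v w" for v w
  proof -
    \<comment> \<open>This yields invariance under \<open>K\<close> of the skew part of
      \<open>dJ\<close>; the other terms of \<open>Bv\<close> are invariant because \<open>K\<close>
      squares to -1.\<close>
    have "K (dJ (K v) w - dJ (K w) v + K (dJ w v) - K (dJ v w)) = 0"
      unfolding N using K(3)[of 0 0] by simp
    then have "K (dJ (K v) w) - K (dJ (K w) v) = dJ w v - dJ v w"
      by (simp add: K algebra_simps)
    then have "dJ (K v) (K w) - dJ (K w) (K v) = dJ v w - dJ w v"
      by (simp add: KdJ algebra_simps)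
    then show ?thesis unfolding Bv[of "K v" "K w"] Bv[of v w] by (simp add: K)
  qed
  have BA: "B v w = 2 * om i y v w + G y (A v) w" for v w
  proof -
    have 1: "dder (\<lambda>z. om i z v w) y (E y) = dder (\<lambda>z. G z (K v) w) y (E y) + G y (dJ (E y) v) w"
      unfolding om_def K_def dJ_def
      by (rule dder_linear_family[where b = "\<lambda>z u. G z u w", OF open_U y G_linear_left G_smooth J_smooth[OF i]])
    have 2: "dder (\<lambda>z. om i z (E y) w) y v = dder (\<lambda>z. th i z w) y v - om i y (0, snd v) w" for v w
    proof -
      have lin: "linear (\<lambda>u. om i z u w)" if "z \<in> U" for z
        using om_bilinear[OF i that] unfolding bilinear_def by blast
      show ?thesis
        using dder_linear_family[OF open_U y lin om_smooth[OF i] E_smooth, of v]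
        by (simp add: om_E dder_E)
    qed
    \<comment> \<open>Closedness of \<open>om i\<close> turns its Lie derivative along
      \<open>E\<close> into the exterior derivative of its contraction with \<open>E\<close>, which
      is \<open>th i\<close>.\<close>
    have "dder (\<lambda>z. om i z v w) y (E y) - dder (\<lambda>z. om i z (E y) w) y v + dder (\<lambda>z. om i z (E y) v) y w = 0"
      unfolding om_def by (rule om_closed[OF i y])
    then have "B v w = dder (\<lambda>z. om i z v w) y (E y) + om i y (0, snd v) w - om i y (0, snd w) v"
      unfolding 2 B_def by simp
    also have "om i y (0, s) u = - (s * snd (K u))" for s u
      unfolding om_def K_def[symmetric] skew by (simp add: G_E(2)[OF y])
    finally show ?thesis
      unfolding 1 dder_G_E[OF y]
      by (simp add: A_def om_def K_def[symmetric] G_add_left[OF y] G_diff_left[OF y] skew G_E(2)[OF y])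
  qed
  have AK: "A (K v) = - K (A v)" for v
    by (simp add: A_def K KdJ)
  \<comment> \<open>\<open>BA\<close> is now compared at \<open>(K v, K w)\<close> and at
    \<open>(v, w)\<close>: the left-hand sides agree, so the term with \<open>A\<close> equals its
    own negative.\<close>
  have "G y (A (K v)) (K w) = - G y (A v) w" for v w
    unfolding AK using skew[of "A v" "K w"] by (simp add: G_minus_left[OF y] G_minus_right[OF y] K)
  moreover have "om i y (K v) (K w) = om i y v w" for v w
    unfolding om_def K_def using J_orth[OF i y] by simp
  ultimately have "2 * om i y v w - G y (A v) w = B v w"
    using BJ[of v w] BA[of "K v" "K w"] by simp
  then have "B v w = 2 * om i y v w" using BA[of v w] by simp
  then show ?thesis by (simp add: B_def)
qed

text \<open>Cartan's formula for a closed form. The left-hand side is the Lie derivative of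
  \<open>om i\<close> along \<open>Y\<close> in coordinates.\<close>

lemma cartan_om:
  assumes i: "i \<in> {1..3}" and y: "y \<in> U" and Y: "smooth_on U Y"
  shows "dder (\<lambda>y. om i y v w) y (Y y) + om i y (dder Y y v) w + om i y v (dder Y y w) =
    dder (\<lambda>z. om i z (Y z) w) y v - dder (\<lambda>z. om i z (Y z) v) y w"
proof -
  have lin: "linear (\<lambda>u. om i z u w)" if "z \<in> U" for z w
    using om_bilinear[OF i that] unfolding bilinear_def by blast
  have 2: "dder (\<lambda>z. om i z (Y z) w) y v = dder (\<lambda>z. om i z (Y y) w) y v + om i y (dder Y y v) w" for v w
    by (rule dder_linear_family[OF open_U y lin om_smooth[OF i] Y])
  have "dder (\<lambda>z. om i z v w) y (Y y) - dder (\<lambda>z. om i z (Y y) w) y v + dder (\<lambda>z. om i z (Y y) v) y w = 0"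
    unfolding om_def by (rule om_closed[OF i y])
  then show ?thesis unfolding 2 using om_skew[OF i y, of v "dder Y y w"] by simp
qed

text \<open>Cartan's formula again, with the exterior derivative of \<open>th i\<close> taken from
  \<open>d_th\<close>.\<close>

lemma lie_th_general:
  assumes i: "i \<in> {1..3}" and y: "y \<in> U" and Y: "smooth_on U Y"
  shows "dder (\<lambda>y. th i y w) y (Y y) + th i y (dder Y y w) =
    dder (\<lambda>z. th i z (Y z)) y w + 2 * om i y (Y y) w"
proof -
  have "dder (\<lambda>z. th i z (Y z)) y w = dder (\<lambda>z. th i z (Y y)) y w + th i y (dder Y y w)"
    by (rule dder_linear_family[OF open_U y th_linear th_smooth[OF i] Y])
  then show ?thesis using d_th[OF i y, of w "Y y"] by simp
qed

lemma om_xi3: "y \<in> U \<Longrightarrow> om 1 y (xi 3 y) w = - th 2 y w" "y \<in> U \<Longrightarrow> om 2 y (xi 3 y) w = th 1 y w"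
  "y \<in> U \<Longrightarrow> om 3 y (xi 3 y) w = - (snd y * snd w)"
  by (simp_all add: om_def th_def xi_def J_mult G_minus_left J_square G_E del: One_nat_def)

text \<open>\<open>om i\<close> vanishes on the pair \<open>(E, E)\<close>, so \<open>xi i\<close>
  is orthogonal to \<open>E\<close> and therefore tangent to the level sets of
  \<open>r\<close>.\<close>

lemma snd_xi: "i \<in> {1..3} \<Longrightarrow> y \<in> U \<Longrightarrow> snd (xi i y) = 0"
proof -
  assume i: "i \<in> {1..3}" and y: "y \<in> U"
  have "G y (E y) (xi i y) = 0"
    using om_self[OF i y, of "E y"] G_sym[OF y, of "E y" "J i y (E y)"] by (simp add: om_def xi_def)
  then show ?thesis using G_E(1)[OF y, of "xi i y"] snd_pos[OF y] by simp
qed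

lemma th_xi3: "y \<in> U \<Longrightarrow> th 1 y (xi 3 y) = 0" "y \<in> U \<Longrightarrow> th 2 y (xi 3 y) = 0"
  "y \<in> U \<Longrightarrow> th 3 y (xi 3 y) = (snd y)\<^sup>2"
proof -
  assume y: "y \<in> U"
  note z = index_123[THEN snd_xi, OF y]
  show "th 1 y (xi 3 y) = 0"
    using z(2) unfolding th_eq[OF index_123(1) y] xi_def J_mult(6)[OF y] by simp
  show "th 2 y (xi 3 y) = 0"
    using z(1) unfolding th_eq[OF index_123(2) y] xi_def J_mult(2)[OF y] by simp
  show "th 3 y (xi 3 y) = (snd y)\<^sup>2"
    unfolding th_eq[OF index_123(3) y] xi_def J_square[OF index_123(3) y]
    by (simp add: E_def power2_eq_square)
qed

lemma dder_cong: "y \<in> U \<Longrightarrow> (\<And>z. z \<in> U \<Longrightarrow> f z = g z) \<Longrightarrow> dder f y v = dder g y v"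
  using frechet_derivative_cong_open[OF open_U] by metis

lemma dder_uminus: "f differentiable (at y) \<Longrightarrow> dder (\<lambda>z. - f z) y v = - dder f y v"
  by (rule frechet_derivative_bounded_linear[OF bounded_linear_minus[OF bounded_linear_ident]])

text \<open>By Cartan's formula these are the exterior derivatives of the contractions in
  \<open>om_xi3\<close>, namely of \<open>- th 2\<close>, of \<open>th 1\<close> and of the closed
  form \<open>- r dr\<close>.\<close>

lemma lie_om:
  assumes y: "y \<in> U"
  defines "L i v w \<equiv> dder (\<lambda>y. om i y v w) y (xi 3 y) + om i y (dder (xi 3) y v) w + om i y v (dder (xi 3) y w)"
  shows "L 1 v w = - 2 * om 2 y v w" "L 2 v w = 2 * om 1 y v w" "L 3 v w = 0"
proof -
  have s: "smooth_on U (xi 3)" by (rule xi_smooth) simp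
  note C = index_123[THEN cartan_om, OF y s]
  have "L 1 v w = dder (\<lambda>z. - th 2 z w) y v - dder (\<lambda>z. - th 2 z v) y w"
    unfolding L_def C(1)
    by (intro arg_cong2[where f = "(-)"] dder_cong[OF y] om_xi3)
  also have "\<dots> = - (dder (\<lambda>z. th 2 z w) y v - dder (\<lambda>z. th 2 z v) y w)"
    by (simp add: dder_uminus smooth_on_differentiable[OF th_smooth[OF index_123(2)] y])
  also have "\<dots> = - 2 * om 2 y v w" using d_th[OF index_123(2) y, of w v] by simp
  finally show "L 1 v w = - 2 * om 2 y v w" .
  have "L 2 v w = dder (\<lambda>z. th 1 z w) y v - dder (\<lambda>z. th 1 z v) y w"
    unfolding L_def C(2)
    by (intro arg_cong2[where f = "(-)"] dder_cong[OF y] om_xi3)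
  also have "\<dots> = 2 * om 1 y v w" using d_th[OF index_123(1) y, of w v] by simp
  finally show "L 2 v w = 2 * om 1 y v w" .
  have d: "dder (\<lambda>z. - (snd z * snd w)) y v = - (snd v * snd w)" for v w :: "'e \<times> real"
  proof -
    have "((\<lambda>z::'e \<times> real. - (snd z * snd w)) has_derivative (\<lambda>v. - (snd v * snd w))) (at y)"
      by (auto intro!: derivative_eq_intros)
    then show ?thesis by (simp add: frechet_derivative_eq)
  qed
  have "L 3 v w = dder (\<lambda>z. - (snd z * snd w)) y v - dder (\<lambda>z. - (snd z * snd v)) y w"
    unfolding L_def C(3)
    by (intro arg_cong2[where f = "(-)"] dder_cong[OF y] om_xi3)
  also have "\<dots> = 0" unfolding d by simp
  finally show "L 3 v w = 0" .
qed

text \<open>The functions \<open>th i (xi 3)\<close> are 0, 0 and \<open>r\<^sup>2\<close>. In the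
  last case the differential \<open>2 r dr\<close> cancels against twice the contraction of
  \<open>om 3\<close> with \<open>xi 3\<close>, which is \<open>- 2 r dr\<close>.\<close>

lemma lie_th:
  assumes y: "y \<in> U"
  defines "L i w \<equiv> dder (\<lambda>y. th i y w) y (xi 3 y) + th i y (dder (xi 3) y w)"
  shows "L 1 w = - 2 * th 2 y w" "L 2 w = 2 * th 1 y w" "L 3 w = 0"
proof -
  have s: "smooth_on U (xi 3)" by (rule xi_smooth) simp
  note C = index_123[THEN lie_th_general, OF y s]
  have z: "dder (\<lambda>z::'e \<times> real. 0::real) y w = 0" by (simp add: frechet_derivative_eq[OF has_derivative_const])
  have "dder (\<lambda>z. th 1 z (xi 3 z)) y w = 0"
    using dder_cong[OF y th_xi3(1), where v = w] z by simp
  then show "L 1 w = - 2 * th 2 y w" unfolding L_def C(1) om_xi3[OF y] by simp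
  have "dder (\<lambda>z. th 2 z (xi 3 z)) y w = 0"
    using dder_cong[OF y th_xi3(2), where v = w] z by simp
  then show "L 2 w = 2 * th 1 y w" unfolding L_def C(2) om_xi3[OF y] by simp
  have "((\<lambda>z::'e \<times> real. (snd z)\<^sup>2) has_derivative (\<lambda>v. 2 * (snd v * snd y))) (at y)"
    by (auto intro!: derivative_eq_intros)
  then have "dder (\<lambda>z. th 3 z (xi 3 z)) y w = 2 * (snd w * snd y)"
    using dder_cong[OF y th_xi3(3), where v = w] by (simp add: frechet_derivative_eq)
  then show "L 3 w = 0" unfolding L_def C(3) om_xi3[OF y] by simp
qed


section \<open>Quaternionic orthonormal frames and the complex coframe\<close>

definition orthonormal :: "'e \<times> real \<Rightarrow> (nat \<Rightarrow> 'e \<times> real) \<Rightarrow> nat \<Rightarrow> bool" where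
  "orthonormal y f n \<longleftrightarrow> (\<forall>i<n. \<forall>j<n. G y (f i) (f j) = (if i = j then 1 else 0))"

lemma G_sum_right: "y \<in> U \<Longrightarrow> G y v (\<Sum>i\<in>I. a i *\<^sub>R f i) = (\<Sum>i\<in>I. a i * G y v (f i))"
  using linear_sum[OF G_linear_right, of y v "\<lambda>i. a i *\<^sub>R f i" I] by (simp add: G_scale_right)

lemma orthonormal_sum:
  assumes "y \<in> U" "orthonormal y f n" "j < n"
  shows "G y (f j) (\<Sum>i<n. a i *\<^sub>R f i) = a j"
proof -
  have "G y (f j) (\<Sum>i<n. a i *\<^sub>R f i) = (\<Sum>i<n. if j = i then a i else 0)"
    unfolding G_sum_right[OF assms(1)]
    by (intro sum.cong refl) (use assms(2,3) in \<open>simp add: orthonormal_def\<close>)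
  also have "\<dots> = a j" using assms(3) by simp
  finally show ?thesis .
qed

lemma orthonormal_complement:
  assumes y: "y \<in> U" and f: "orthonormal y f n" and n: "n < DIM('e \<times> real)"
  shows "\<exists>e. G y e e = 1 \<and> (\<forall>i<n. G y (f i) e = 0)"
proof -
  have "dim (f ` {..<n}) \<le> n"
    using dim_le_card'[of "f ` {..<n}"] card_image_le[of "{..<n}" f] by simp
  then have "span (f ` {..<n}) \<noteq> UNIV"
    using n dim_UNIV[where 'a = "'e \<times> real"] dim_span[of "f ` {..<n}"] by (metis leD)
  then obtain v where v: "v \<notin> span (f ` {..<n})" by blast
  define e where "e = v - (\<Sum>i<n. G y (f i) v *\<^sub>R f i)"
  have "(\<Sum>i<n. G y (f i) v *\<^sub>R f i) \<in> span (f ` {..<n})"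
    by (intro span_sum span_scale span_base) simp
  then have "e \<noteq> 0" using v by (auto simp: e_def)
  then have p: "G y e e > 0" by (rule G_pos[OF y])
  have "G y (f i) e = 0" if "i < n" for i
    unfolding e_def G_diff_right[OF y] orthonormal_sum[OF y f that] by simp
  then have "G y (f i) ((1 / sqrt (G y e e)) *\<^sub>R e) = 0" if "i < n" for i
    using that by (simp add: G_scale_right y)
  moreover have "G y ((1 / sqrt (G y e e)) *\<^sub>R e) ((1 / sqrt (G y e e)) *\<^sub>R e) = 1"
    using p by (simp add: G_scale_right[OF y] G_scale_left[OF y] divide_simps)
  ultimately show ?thesis by blast
qed

lemma orthonormal_expansion:
  assumes y: "y \<in> U" and f: "orthonormal y f n" and n: "n = DIM('e \<times> real)"
  shows "v = (\<Sum>i<n. G y (f i) v *\<^sub>R f i)"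
proof -
  have inj: "inj_on f {..<n}"
  proof (rule inj_onI)
    fix i j assume "i \<in> {..<n}" "j \<in> {..<n}" "f i = f j"
    then show "i = j" using f unfolding orthonormal_def by (metis lessThan_iff zero_neq_one)
  qed
  have "independent (f ` {..<n})"
  proof (rule independent_if_scalars_zero)
    fix u x assume u: "(\<Sum>x\<in>f ` {..<n}. u x *\<^sub>R x) = 0" and x: "x \<in> f ` {..<n}"
    obtain j where j: "j < n" "x = f j" using x by auto
    have "(\<Sum>i<n. u (f i) *\<^sub>R f i) = 0" using u by (simp add: sum.reindex[OF inj])
    then show "u x = 0"
      using orthonormal_sum[OF y f j(1), of "\<lambda>i. u (f i)"] by (simp add: j G_zero_right y)
  qed simp
  moreover have "card (f ` {..<n}) = n" using card_image[OF inj] by simp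
  ultimately have "UNIV \<subseteq> span (f ` {..<n})"
    using n by (intro card_ge_dim_independent) (auto simp: dim_UNIV)
  then have "v \<in> span (f ` {..<n})" by blast
  then obtain u where "v = (\<Sum>x\<in>f ` {..<n}. u x *\<^sub>R x)"
    using span_finite[of "f ` {..<n}"] by auto
  then have v: "v = (\<Sum>i<n. u (f i) *\<^sub>R f i)" by (simp add: sum.reindex[OF inj])
  have "G y (f i) v = u (f i)" if "i < n" for i
    using orthonormal_sum[OF y f that, of "\<lambda>i. u (f i)"] v by simp
  then show ?thesis using v by simp
qed

lemma G_JE: "i \<in> {1..3} \<Longrightarrow> y \<in> U \<Longrightarrow> G y (J i y v) v = 0"
  using om_self by (simp add: om_def)

lemma G_J_cross:
  assumes "y \<in> U"
  shows "G y (J 1 y v) (J 2 y w) = G y (J 3 y v) w" "G y (J 2 y v) (J 3 y w) = G y (J 1 y v) w"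
    "G y (J 3 y v) (J 1 y w) = G y (J 2 y v) w" "G y (J 2 y v) (J 1 y w) = - G y (J 3 y v) w"
    "G y (J 3 y v) (J 2 y w) = - G y (J 1 y v) w" "G y (J 1 y v) (J 3 y w) = - G y (J 2 y v) w"
proof -
  have s: "G y a (J i y w) = - G y (J i y a) w" if "i \<in> {1..3}" for i a w
    using J_skew[OF that assms, of a w] by simp
  show "G y (J 1 y v) (J 2 y w) = G y (J 3 y v) w" "G y (J 2 y v) (J 3 y w) = G y (J 1 y v) w"
    "G y (J 3 y v) (J 1 y w) = G y (J 2 y v) w" "G y (J 2 y v) (J 1 y w) = - G y (J 3 y v) w"
    "G y (J 3 y v) (J 2 y w) = - G y (J 1 y v) w" "G y (J 1 y v) (J 3 y w) = - G y (J 2 y v) w"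
    by (simp_all only: s index_123 J_mult[OF assms] G_minus_left[OF assms] minus_minus)
qed

definition quat :: "'e \<times> real \<Rightarrow> 'e \<times> real \<Rightarrow> nat \<Rightarrow> 'e \<times> real" where
  "quat y v i = (if i = 0 then v else J i y v)"

text \<open>The quaternion relations and skewness reduce every entry to \<open>G y v w\<close> or to
  some \<open>G y (J i y v) w\<close>. Hence two quaternionic lines are orthogonal as soon as
  \<open>w\<close> is orthogonal to the whole line of \<open>v\<close>.\<close>

lemma quat_Gram:
  assumes y: "y \<in> U" and i: "i < 4" and j: "j < 4"
  shows "G y v w = 0 \<and> G y (J 1 y v) w = 0 \<and> G y (J 2 y v) w = 0 \<and> G y (J 3 y v) w = 0 \<Longrightarrow>
      G y (quat y v i) (quat y w j) = 0"
    and "G y v v = 1 \<Longrightarrow> G y (quat y v i) (quat y v j) = (if i = j then 1 else 0)"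
proof -
  have s: "G y a (J i y w) = - G y (J i y a) w" if "i \<in> {1..3}" for i a w
    using J_skew[OF that y, of a w] by simp
  have cases: "k = 0 \<or> k = 1 \<or> k = 2 \<or> k = 3" if "k < 4" for k :: nat using that by linarith
  note facts = J_orth[OF index_123(1) y] J_orth[OF index_123(2) y] J_orth[OF index_123(3) y] G_J_cross[OF y]
    s[OF index_123(1)] s[OF index_123(2)] s[OF index_123(3)] J_mult[OF y] J_square[OF index_123(1) y]
    J_square[OF index_123(2) y] J_square[OF index_123(3) y] G_minus_left[OF y]
  have z: "G y (J 1 y v) v = 0" "G y (J 2 y v) v = 0" "G y (J 3 y v) v = 0"
    using G_JE index_123 y by blast+
  show "G y v w = 0 \<and> G y (J 1 y v) w = 0 \<and> G y (J 2 y v) w = 0 \<and> G y (J 3 y v) w = 0 \<Longrightarrow>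
      G y (quat y v i) (quat y w j) = 0"
    using cases[OF i] cases[OF j] by (elim disjE) (simp_all add: quat_def facts del: One_nat_def)
  show "G y v v = 1 \<Longrightarrow> G y (quat y v i) (quat y v j) = (if i = j then 1 else 0)"
    using cases[OF i] cases[OF j] by (elim disjE) (simp_all add: quat_def facts z del: One_nat_def)
qed

lemma G_EE: "y \<in> U \<Longrightarrow> G y (E y) (E y) = (snd y)\<^sup>2"
  by (simp add: G_E power2_eq_square) (simp add: E_def)

text \<open>The cone has real dimension 8 and the quaternionic line of \<open>E\<close> has
  dimension 4, so there is room for a unit vector orthogonal to it.\<close>

lemma horizontal_vector:
  assumes y: "y \<in> U" and d: "DIM('e) = 7"
  shows "\<exists>e. G y e e = 1 \<and> G y (E y) e = 0 \<and> th 1 y e = 0 \<and> th 2 y e = 0 \<and> th 3 y e = 0"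
proof -
  define u where "u = (1 / snd y) *\<^sub>R E y"
  have u: "G y u u = 1"
    using snd_pos[OF y] G_EE[OF y] by (simp add: u_def G_scale_left[OF y] G_scale_right[OF y] power2_eq_square)
  have "orthonormal y (quat y u) 4"
    using quat_Gram(2)[OF y _ _ u] by (simp add: orthonormal_def)
  from orthonormal_complement[OF y this] d
  obtain e where e: "G y e e = 1" "\<And>i. i < 4 \<Longrightarrow> G y (quat y u i) e = 0" by auto
  have J: "J i y u = (1 / snd y) *\<^sub>R xi i y" if "i \<in> {1..3}" for i
    unfolding u_def xi_def by (rule J_lin(4)[OF that y])
  have "G y (xi i y) e = 0" if "i \<in> {1..3}" for i
    using e(2)[of i] snd_pos[OF y] that unfolding quat_def J[OF that] by (simp add: G_scale_left[OF y])
  moreover have "G y (E y) e = 0"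
    using e(2)[of 0] snd_pos[OF y] by (simp add: quat_def u_def G_scale_left[OF y])
  ultimately show ?thesis using e(1) index_123 unfolding th_def by blast
qed

text \<open>At \<open>r = 1\<close> the Euler vector has length 1, and the quaternionic lines of
  \<open>E\<close> and of \<open>e\<close> together give an orthonormal frame of the
  eight-dimensional tangent space.\<close>

lemma coframe:
  assumes y: "y \<in> U" and d: "DIM('e) = 7" and r: "snd y = 1"
    and e: "G y e e = 1" "G y (E y) e = 0" "th 1 y e = 0" "th 2 y e = 0" "th 3 y e = 0"
  shows "v = G y (E y) v *\<^sub>R E y + th 1 y v *\<^sub>R xi 1 y + th 2 y v *\<^sub>R xi 2 y + th 3 y v *\<^sub>R xi 3 y
     + G y e v *\<^sub>R e + G y (J 1 y e) v *\<^sub>R J 1 y e + G y (J 2 y e) v *\<^sub>R J 2 y e + G y (J 3 y e) v *\<^sub>R J 3 y e"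
proof -
  define f where "f i = (if i < 4 then quat y (E y) i else quat y e (i - 4))" for i
  have u: "G y (E y) (E y) = 1" using G_EE[OF y] r by simp
  have o: "G y (E y) e = 0 \<and> G y (J 1 y (E y)) e = 0 \<and> G y (J 2 y (E y)) e = 0 \<and> G y (J 3 y (E y)) e = 0"
    using e by (simp add: th_def xi_def)
  have "orthonormal y f 8"
    unfolding orthonormal_def
  proof (intro allI impI)
    fix i j :: nat assume ij: "i < 8" "j < 8"
    show "G y (f i) (f j) = (if i = j then 1 else 0)"
    proof (cases "i < 4"; cases "j < 4")
      assume "i < 4" "j < 4"
      then show ?thesis using quat_Gram(2)[OF y _ _ u] by (simp add: f_def)
    next
      assume "i < 4" "\<not> j < 4"
      then show ?thesis using quat_Gram(1)[OF y _ _ o, of i "j - 4"] ij by (simp add: f_def)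
    next
      assume "\<not> i < 4" "j < 4"
      then show ?thesis using quat_Gram(1)[OF y _ _ o, of j "i - 4"] ij G_sym[OF y]
        by (simp add: f_def)
    next
      assume "\<not> i < 4" "\<not> j < 4"
      then show ?thesis using quat_Gram(2)[OF y _ _ e(1), of "i - 4" "j - 4"] ij by (auto simp: f_def)
    qed
  qed
  then have "v = (\<Sum>i<8. G y (f i) v *\<^sub>R f i)"
    by (rule orthonormal_expansion[OF y]) (simp add: d)
  also have "(\<Sum>i<8. G y (f i) v *\<^sub>R f i) = G y (f 0) v *\<^sub>R f 0 + G y (f 1) v *\<^sub>R f 1 + G y (f 2) v *\<^sub>R f 2
      + G y (f 3) v *\<^sub>R f 3 + G y (f 4) v *\<^sub>R f 4 + G y (f 5) v *\<^sub>R f 5 + G y (f 6) v *\<^sub>R f 6 + G y (f 7) v *\<^sub>R f 7"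
    by (simp add: eval_nat_numeral)
  finally show ?thesis by (simp add: f_def quat_def th_def xi_def)
qed

lemma coframe_G:
  assumes y: "y \<in> U" and d: "DIM('e) = 7" and r: "snd y = 1"
    and e: "G y e e = 1" "G y (E y) e = 0" "th 1 y e = 0" "th 2 y e = 0" "th 3 y e = 0"
  shows "G y v w = G y (E y) v * G y (E y) w + th 1 y v * th 1 y w + th 2 y v * th 2 y w + th 3 y v * th 3 y w
     + G y e v * G y e w + G y (J 1 y e) v * G y (J 1 y e) w + G y (J 2 y e) v * G y (J 2 y e) w
     + G y (J 3 y e) v * G y (J 3 y e) w"
  using arg_cong[OF coframe[OF assms, of v], of "\<lambda>v. G y v w"]
  unfolding G_add_left[OF y] G_scale_left[OF y] th_def by simp

text \<open>\<open>om i v w\<close> is the product of \<open>J i v\<close> with \<open>w\<close>,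
  and the components of \<open>J i v\<close> in the frame are those of \<open>v\<close>, permuted
  and with signs. Tangency to the level set of \<open>r\<close> removes the components along
  \<open>E\<close>.\<close>

lemma coframe_om:
  assumes y: "y \<in> U" and d: "DIM('e) = 7" and r: "snd y = 1"
    and e: "G y e e = 1" "G y (E y) e = 0" "th 1 y e = 0" "th 2 y e = 0" "th 3 y e = 0"
    and v: "snd v = 0" and w: "snd w = 0"
  defines "c i \<equiv> G y (quat y e i)" and "t i \<equiv> th i y"
  shows "om 1 y v w = (t 2 v * t 3 w - t 2 w * t 3 v) + (c 0 v * c 1 w - c 0 w * c 1 v) + (c 2 v * c 3 w - c 2 w * c 3 v)"
    and "om 2 y v w = (t 3 v * t 1 w - t 3 w * t 1 v) + (c 0 v * c 2 w - c 0 w * c 2 v) + (c 3 v * c 1 w - c 3 w * c 1 v)"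
    and "om 3 y v w = (t 1 v * t 2 w - t 1 w * t 2 v) + (c 0 v * c 3 w - c 0 w * c 3 v) + (c 1 v * c 2 w - c 1 w * c 2 v)"
proof -
  have s: "G y a (J i y w) = - G y (J i y a) w" if "i \<in> {1..3}" for i a w
    using J_skew[OF that y, of a w] by simp
  note cf = coframe_G[OF y d r e]
  have z: "G y (E y) v = 0" "G y (E y) w = 0" using G_E(1)[OF y] v w by simp_all
  note J = J_mult[OF y] J_square[OF index_123(1) y] J_square[OF index_123(2) y] J_square[OF index_123(3) y]
    s[OF index_123(1)] s[OF index_123(2)] s[OF index_123(3)]
  have q: "c 0 = G y e" "c 1 = G y (J 1 y e)" "c 2 = G y (J 2 y e)" "c 3 = G y (J 3 y e)"
    unfolding c_def by (simp_all add: quat_def)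
  show "om 1 y v w = (t 2 v * t 3 w - t 2 w * t 3 v) + (c 0 v * c 1 w - c 0 w * c 1 v) + (c 2 v * c 3 w - c 2 w * c 3 v)"
    unfolding om_def q t_def cf[of "J 1 y v" w] th_def xi_def J
    by (simp add: z G_minus_left[OF y] algebra_simps del: One_nat_def)
  show "om 2 y v w = (t 3 v * t 1 w - t 3 w * t 1 v) + (c 0 v * c 2 w - c 0 w * c 2 v) + (c 3 v * c 1 w - c 3 w * c 1 v)"
    unfolding om_def q t_def cf[of "J 2 y v" w] th_def xi_def J
    by (simp add: z G_minus_left[OF y] algebra_simps del: One_nat_def)
  show "om 3 y v w = (t 1 v * t 2 w - t 1 w * t 2 v) + (c 0 v * c 3 w - c 0 w * c 3 v) + (c 1 v * c 2 w - c 1 w * c 2 v)"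
    unfolding om_def q t_def cf[of "J 3 y v" w] th_def xi_def J
    by (simp add: z G_minus_left[OF y] algebra_simps del: One_nat_def)
qed

text \<open>The last two claims prepare the quotient by \<open>\<xi>\<^sub>3\<close>: the transverse
  metric is the hermitian metric of the coframe, and the three complex forms vanish together only
  along \<open>\<xi>\<^sub>3\<close>. As \<open>e\<close> is chosen for this point alone, nothing is
  claimed about the dependence of \<open>al\<close> and \<open>be\<close> on
  \<open>y\<close>.\<close>

lemma complex_coframe:
  assumes y: "y \<in> U" and d: "DIM('e) = 7" and r: "snd y = 1"
  defines "et v \<equiv> complex_of_real (th 1 y v) + \<i> * complex_of_real (th 2 y v)"
  shows "\<exists>al be. linear al \<and> linear be \<and>
    (\<forall>v w. snd v = 0 \<longrightarrow> snd w = 0 \<longrightarrow>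
       complex_of_real (om 1 y v w) + \<i> * complex_of_real (om 2 y v w) =
         al v * be w - al w * be v - \<i> * (et v * complex_of_real (th 3 y w) - et w * complex_of_real (th 3 y v)) \<and>
       complex_of_real (om 3 y v w) = \<i> / 2 * (al v * cnj (al w) - al w * cnj (al v)
         + (be v * cnj (be w) - be w * cnj (be v)) + (et v * cnj (et w) - et w * cnj (et v))) \<and>
       complex_of_real (G y v w - th 3 y v * th 3 y w) = complex_of_real (Re (al v * cnj (al w) + be v * cnj (be w) + et v * cnj (et w)))) \<and>
    (\<forall>v. snd v = 0 \<longrightarrow> al v = 0 \<longrightarrow> be v = 0 \<longrightarrow> et v = 0 \<longrightarrow> v = th 3 y v *\<^sub>R xi 3 y)"
proof -
  obtain e where e: "G y e e = 1" "G y (E y) e = 0" "th 1 y e = 0" "th 2 y e = 0" "th 3 y e = 0"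
    using horizontal_vector[OF y d] by blast
  define c where "c i = G y (quat y e i)" for i
  \<comment> \<open>Pairing \<open>c 0\<close> with \<open>c 3\<close> and \<open>c 1\<close> with
    \<open>c 2\<close> makes both forms of type \<open>(1,0)\<close> for \<open>J 3\<close>.\<close>
  define al where "al v = complex_of_real (c 0 v) + \<i> * complex_of_real (c 3 v)" for v
  define be where "be v = complex_of_real (c 1 v) + \<i> * complex_of_real (c 2 v)" for v
  have lin: "linear (\<lambda>v. complex_of_real (c i v) + \<i> * complex_of_real (c j v))" for i j
    using G_add_right[OF y] G_scale_right[OF y]
    by (auto simp: linear_iff c_def algebra_simps scaleR_conv_of_real)
  have q: "c 0 = G y e" "c 1 = G y (J 1 y e)" "c 2 = G y (J 2 y e)" "c 3 = G y (J 3 y e)"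
    unfolding c_def by (simp_all add: quat_def)
  show ?thesis
  proof (rule exI[of _ al], rule exI[of _ be], intro conjI allI impI)
    show "linear al" unfolding al_def[abs_def] by (rule lin)
    show "linear be" unfolding be_def[abs_def] by (rule lin)
  next
    fix v w :: "'e \<times> real" assume v: "snd v = 0" and w: "snd w = 0"
    note om = coframe_om[OF y d r e v w, folded c_def]
    show "complex_of_real (om 1 y v w) + \<i> * complex_of_real (om 2 y v w) =
         al v * be w - al w * be v - \<i> * (et v * complex_of_real (th 3 y w) - et w * complex_of_real (th 3 y v))"
      unfolding om al_def be_def et_def by (simp add: complex_eq_iff algebra_simps)
    show "complex_of_real (om 3 y v w) = \<i> / 2 * (al v * cnj (al w) - al w * cnj (al v)
         + (be v * cnj (be w) - be w * cnj (be v)) + (et v * cnj (et w) - et w * cnj (et v)))"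
      unfolding om al_def be_def et_def by (simp add: complex_eq_iff algebra_simps)
    have z: "G y (E y) v = 0" "G y (E y) w = 0" using G_E(1)[OF y] v w by simp_all
    show "complex_of_real (G y v w - th 3 y v * th 3 y w) = complex_of_real (Re (al v * cnj (al w) + be v * cnj (be w) + et v * cnj (et w)))"
      unfolding coframe_G[OF y d r e, of v w] al_def be_def et_def q z
      by (simp add: complex_eq_iff)
  next
    fix v :: "'e \<times> real" assume v: "snd v = 0" and z: "al v = 0" "be v = 0" "et v = 0"
    have "c 0 v = 0" "c 3 v = 0" "c 1 v = 0" "c 2 v = 0" "th 1 y v = 0" "th 2 y v = 0"
      using z unfolding al_def be_def et_def by (simp_all add: complex_eq_iff)
    moreover have "G y (E y) v = 0" using G_E(1)[OF y] v by simp
    ultimately show "v = th 3 y v *\<^sub>R xi 3 y"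
      using coframe[OF y d r e, of v] unfolding q by simp
  qed
qed

end

section \<open>Derivative rules and the exterior derivative of the square of a closed
  two-form\<close>

lemma smooth_on_of_real: "open U \<Longrightarrow> smooth_on U f \<Longrightarrow> smooth_on U (\<lambda>x. complex_of_real (f x))"
  by (rule smooth_on_bounded_linear[OF _ bounded_linear_of_real])

lemma dder_of_real: "f differentiable (at x) \<Longrightarrow> dder (\<lambda>y. complex_of_real (f y)) x v = complex_of_real (dder f x v)"
  by (rule frechet_derivative_bounded_linear[OF bounded_linear_of_real])

lemma dder_add: "f differentiable (at x) \<Longrightarrow> g differentiable (at x) \<Longrightarrow>
    dder (\<lambda>y. f y + g y) x v = dder f x v + dder g x v"
  by (simp add: frechet_derivative_eq[OF has_derivative_add[OF differentiable_has_derivative differentiable_has_derivative]])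

lemma dder_diff: "f differentiable (at x) \<Longrightarrow> g differentiable (at x) \<Longrightarrow>
    dder (\<lambda>y. f y - g y) x v = dder f x v - dder g x v"
  by (simp add: frechet_derivative_eq[OF has_derivative_diff[OF differentiable_has_derivative differentiable_has_derivative]])

lemma dder_mult:
  fixes f g :: "'a::real_normed_vector \<Rightarrow> complex"
  shows "f differentiable (at x) \<Longrightarrow> g differentiable (at x) \<Longrightarrow>
    dder (\<lambda>y. f y * g y) x v = f x * dder g x v + dder f x v * g x"
  by (simp add: frechet_derivative_eq[OF has_derivative_mult[OF differentiable_has_derivative differentiable_has_derivative]])

lemma dder_cmult: "f differentiable (at x) \<Longrightarrow> dder (\<lambda>y. c * f y) x v = (c::complex) * dder f x v"
  by (rule frechet_derivative_bounded_linear[OF bounded_linear_mult_right])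

lemma dder_cnj: "f differentiable (at x) \<Longrightarrow> dder (\<lambda>y. cnj (f y)) x v = cnj (dder f x v)"
  by (rule frechet_derivative_bounded_linear[OF bounded_linear_cnj])

lemma ext_d_2:
  "ext_d 2 \<beta> c x v = dder (\<lambda>y. \<beta> c y (\<lambda>j. v (Suc j))) x (v 0)
     - dder (\<lambda>y. \<beta> c y (\<lambda>j. if j < 1 then v j else v (Suc j))) x (v 1)
     + dder (\<lambda>y. \<beta> c y (\<lambda>j. if j < 2 then v j else v (Suc j))) x (v 2)"
  by (simp add: ext_d_def eval_nat_numeral)

text \<open>The identity \<open>d (P \<and> P) = 2 P \<and> dP\<close> in coordinates, with
  \<open>p i j\<close> for \<open>P (v i, v j)\<close> and \<open>D k i j\<close> for its derivative
  along \<open>v k\<close>. Each \<open>p i j\<close> multiplies the exterior derivative of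
  \<open>P\<close> on the other three arguments.\<close>

lemma square_closed_identity:
  fixes p :: "nat \<Rightarrow> nat \<Rightarrow> complex" and D :: "nat \<Rightarrow> nat \<Rightarrow> nat \<Rightarrow> complex"
  assumes closed: "\<And>i j k. D i j k - D j i k + D k i j = 0"
  shows "2 * ((p 1 2 * D 0 3 4 + D 0 1 2 * p 3 4) - (p 1 3 * D 0 2 4 + D 0 1 3 * p 2 4) + (p 1 4 * D 0 2 3 + D 0 1 4 * p 2 3))
     - 2 * ((p 0 2 * D 1 3 4 + D 1 0 2 * p 3 4) - (p 0 3 * D 1 2 4 + D 1 0 3 * p 2 4) + (p 0 4 * D 1 2 3 + D 1 0 4 * p 2 3))
     + 2 * ((p 0 1 * D 2 3 4 + D 2 0 1 * p 3 4) - (p 0 3 * D 2 1 4 + D 2 0 3 * p 1 4) + (p 0 4 * D 2 1 3 + D 2 0 4 * p 1 3))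
     - 2 * ((p 0 1 * D 3 2 4 + D 3 0 1 * p 2 4) - (p 0 2 * D 3 1 4 + D 3 0 2 * p 1 4) + (p 0 4 * D 3 1 2 + D 3 0 4 * p 1 2))
     + 2 * ((p 0 1 * D 4 2 3 + D 4 0 1 * p 2 3) - (p 0 2 * D 4 1 3 + D 4 0 2 * p 1 3) + (p 0 3 * D 4 1 2 + D 4 0 3 * p 1 2)) = 0" (is "?L = 0")
proof -
  have "?L = 2 * (0
     + p 3 4 * (D 0 1 2 - D 1 0 2 + D 2 0 1) - p 2 4 * (D 0 1 3 - D 1 0 3 + D 3 0 1)
     + p 2 3 * (D 0 1 4 - D 1 0 4 + D 4 0 1)
     + p 1 4 * (D 0 2 3 - D 2 0 3 + D 3 0 2) - p 1 3 * (D 0 2 4 - D 2 0 4 + D 4 0 2) + p 1 2 * (D 0 3 4 - D 3 0 4 + D 4 0 3)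
     - p 0 4 * (D 1 2 3 - D 2 1 3 + D 3 1 2) + p 0 3 * (D 1 2 4 - D 2 1 4 + D 4 1 2) - p 0 2 * (D 1 3 4 - D 3 1 4 + D 4 1 3) + p 0 1 * (D 2 3 4 - D 3 2 4 + D 4 2 3))"
    by algebra
  then show ?thesis by (simp only: closed) simp
qed

text \<open>For skew \<open>P\<close> the form in question is \<open>P \<and> P\<close>, by
  \<open>wedge_2_2\<close>.\<close>

lemma ext_d_square_closed_2_form:
  fixes P :: "'a::euclidean_space \<Rightarrow> 'a \<Rightarrow> 'a \<Rightarrow> complex"
  assumes diff: "\<And>v w. (\<lambda>y. P y v w) differentiable (at x)"
    and closed: "\<And>u v w. dder (\<lambda>y. P y v w) x u - dder (\<lambda>y. P y u w) x v + dder (\<lambda>y. P y u v) x w = 0"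
  shows "ext_d 4 (\<lambda>c y v. 2 * (P y (v 0) (v 1) * P y (v 2) (v 3) - P y (v 0) (v 2) * P y (v 1) (v 3)
     + P y (v 0) (v 3) * P y (v 1) (v 2))) c x v = 0"
proof -
  have d: "dder (\<lambda>y. 2 * (P y a b * P y c d) - 2 * (P y a' b' * P y c' d') + 2 * (P y a'' b'' * P y c'' d'')) x h =
     2 * ((P x a b * dder (\<lambda>y. P y c d) x h + dder (\<lambda>y. P y a b) x h * P x c d)
       - (P x a' b' * dder (\<lambda>y. P y c' d') x h + dder (\<lambda>y. P y a' b') x h * P x c' d')
       + (P x a'' b'' * dder (\<lambda>y. P y c'' d'') x h + dder (\<lambda>y. P y a'' b'') x h * P x c'' d''))"
    for a b c d a' b' c' d' a'' b'' c'' d'' h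
  proof -
    have m: "(\<lambda>y. P y a b * P y c d) differentiable (at x)" for a b c d
      by (intro differentiable_mult diff)
    have m2: "(\<lambda>y. 2 * (P y a b * P y c d)) differentiable (at x)" for a b c d
      by (intro differentiable_mult differentiable_const diff)
    have e: "dder (\<lambda>y. 2 * (P y a b * P y c d)) x h =
        2 * (P x a b * dder (\<lambda>y. P y c d) x h + dder (\<lambda>y. P y a b) x h * P x c d)" for a b c d
      unfolding dder_cmult[OF m] dder_mult[OF diff diff] ..
    show ?thesis
      unfolding dder_add[OF differentiable_diff[OF m2 m2] m2] dder_diff[OF m2 m2] e
      by (simp only: distrib_left right_diff_distrib)
  qed
  define p where "p i j = P x (v i) (v j)" for i j
  define D where "D k i j = dder (\<lambda>y. P y (v i) (v j)) x (v k)" for k i j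
  have n: "(2::nat) = Suc 1" "(3::nat) = Suc 2" "(4::nat) = Suc 3" by simp_all
  have "ext_d 4 (\<lambda>c y v. 2 * (P y (v 0) (v 1) * P y (v 2) (v 3) - P y (v 0) (v 2) * P y (v 1) (v 3)
     + P y (v 0) (v 3) * P y (v 1) (v 2))) c x v =
    2 * ((p 1 2 * D 0 3 4 + D 0 1 2 * p 3 4) - (p 1 3 * D 0 2 4 + D 0 1 3 * p 2 4) + (p 1 4 * D 0 2 3 + D 0 1 4 * p 2 3))
     - 2 * ((p 0 2 * D 1 3 4 + D 1 0 2 * p 3 4) - (p 0 3 * D 1 2 4 + D 1 0 3 * p 2 4) + (p 0 4 * D 1 2 3 + D 1 0 4 * p 2 3))
     + 2 * ((p 0 1 * D 2 3 4 + D 2 0 1 * p 3 4) - (p 0 3 * D 2 1 4 + D 2 0 3 * p 1 4) + (p 0 4 * D 2 1 3 + D 2 0 4 * p 1 3))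
     - 2 * ((p 0 1 * D 3 2 4 + D 3 0 1 * p 2 4) - (p 0 2 * D 3 1 4 + D 3 0 2 * p 1 4) + (p 0 4 * D 3 1 2 + D 3 0 4 * p 1 2))
     + 2 * ((p 0 1 * D 4 2 3 + D 4 0 1 * p 2 3) - (p 0 2 * D 4 1 3 + D 4 0 2 * p 1 3) + (p 0 3 * D 4 1 2 + D 4 0 3 * p 1 2))"
    unfolding ext_d_def p_def D_def n(3) sum.atMost_Suc n(2) n(1) One_nat_def
    by (simp add: d)
  also have "\<dots> = 0"
    by (rule square_closed_identity) (simp add: D_def closed)
  finally show ?thesis .
qed

section \<open>The atlas of the cone and its charts\<close>

locale sasakian3 =
  fixes X :: "'s topology" and A :: "(real^7, 's) chart set" and g :: "(real^7, 's) metric"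
    and J :: "nat \<Rightarrow> ((real^7) \<times> real, 's \<times> real) endo"
  assumes sasakian: "three_sasakian X A g J"
begin

lemma manifold: "smooth_manifold X A" and metric: "riemannian_metric A g"
  and hyper: "hyperkahler (cone_atlas A) (cone_metric g) J"
  using sasakian by (simp_all add: three_sasakian_def)

lemma open_charts: "open_charts A"
  using manifold by (simp add: open_charts_def smooth_manifold_def)

lemma fst_cone_chart: "fst (cone_chart c) = fst c \<times> {0<..}"
  by (simp add: cone_chart_def)

lemma open_charts_cone: "open_charts (cone_atlas A)"
  using open_charts by (auto simp: open_charts_def cone_atlas_def fst_cone_chart intro: open_Times)

lemma kahler_J: "i \<in> {1..3} \<Longrightarrow> kahler (cone_atlas A) (cone_metric g) (J i)"
  using hyper by (simp add: hyperkahler_def)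

lemma cone_riemannian: "riemannian_metric (cone_atlas A) (cone_metric g)"
  using kahler_J[of 1] by (simp add: kahler_def)

lemma endo_J: "i \<in> {1..3} \<Longrightarrow> endo_field (cone_atlas A) (J i)"
  using kahler_J unfolding kahler_def almost_complex_def by blast

abbreviation "cG c \<equiv> cone_metric g (cone_chart c)"
abbreviation "cJ c \<equiv> \<lambda>i. J i (cone_chart c)"

lemma metric_bilinear: "c \<in> A \<Longrightarrow> x \<in> fst c \<Longrightarrow> bilinear (g c x)"
  and metric_smooth: "c \<in> A \<Longrightarrow> smooth_on (fst c) (\<lambda>x. g c x v w)"
  using metric unfolding riemannian_metric_def by blast+

lemma smooth_on_fst_compose:
  assumes "open V" "smooth_on V f"
  shows "smooth_on (V \<times> {0::real<..}) (\<lambda>y. f (fst y))"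
  by (rule smooth_on_compose[OF _ assms(1) _ _ assms(2)])
    (auto intro!: open_Times assms(1) smooth_on_fst_arg[OF open_Times[OF assms(1) open_greaterThan]])

lemma mult_table:
  assumes "c \<in> A" "y \<in> fst (cone_chart c)"
  shows "cJ c 1 y (cJ c 2 y v) = cJ c 3 y v" "cJ c 2 y (cJ c 3 y v) = cJ c 1 y v"
      "cJ c 3 y (cJ c 1 y v) = cJ c 2 y v" "cJ c 2 y (cJ c 1 y v) = - cJ c 3 y v"
      "cJ c 3 y (cJ c 2 y v) = - cJ c 1 y v" "cJ c 1 y (cJ c 3 y v) = - cJ c 2 y v"
proof -
  have C: "cone_chart c \<in> cone_atlas A" using assms(1) by (simp add: cone_atlas_def)
  have m: "cJ c i y (cJ c j y v) = - (if i = j then 1 else 0) *\<^sub>R v + (\<Sum>k=1..3. eps i j k *\<^sub>R cJ c k y v)"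
    if "i \<in> {1..3}" "j \<in> {1..3}" for i j
    using hyper C assms(2) that unfolding hyperkahler_def by blast
  have s: "(\<Sum>k=1..3. f k) = f 1 + f 2 + f 3" for f :: "nat \<Rightarrow> (real^7) \<times> real"
    by (simp add: numeral_3_eq_3 numeral_2_eq_2)
  show "cJ c 1 y (cJ c 2 y v) = cJ c 3 y v" "cJ c 2 y (cJ c 3 y v) = cJ c 1 y v"
      "cJ c 3 y (cJ c 1 y v) = cJ c 2 y v" "cJ c 2 y (cJ c 1 y v) = - cJ c 3 y v"
      "cJ c 3 y (cJ c 2 y v) = - cJ c 1 y v" "cJ c 1 y (cJ c 3 y v) = - cJ c 2 y v"
    using m[of 1 2] m[of 2 3] m[of 3 1] m[of 2 1] m[of 3 2] m[of 1 3] unfolding s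
    by (simp_all add: eps_def)
qed

lemma chart:
  assumes c: "c \<in> A"
  shows "hk_chart (fst (cone_chart c)) (g c) (cG c) (cJ c)"
proof (rule hk_chart.intro)
  let ?C = "cone_chart c" and ?U = "fst (cone_chart c)"
  have C: "?C \<in> cone_atlas A" using c by (simp add: cone_atlas_def)
  show "open ?U" using open_charts_cone C by (simp add: open_charts_def)
  show "0 < snd y" if "y \<in> ?U" for y using that by (auto simp: fst_cone_chart)
  show "bilinear (g c (fst y))" if "y \<in> ?U" for y
    using that by (intro metric_bilinear c) (auto simp: fst_cone_chart)
  show "smooth_on ?U (\<lambda>y. g c (fst y) a b)" for a b
    unfolding fst_cone_chart using open_charts c
    by (intro smooth_on_fst_compose[of "fst c" "\<lambda>x. g c x a b"] metric_smooth) (simp_all add: open_charts_def)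
  show "cG c y v w = snd v * snd w + (snd y)\<^sup>2 * g c (fst y) (fst v) (fst w)" for y v w
    by (simp add: cone_metric_def)
  show "bilinear (cG c y)" if "y \<in> ?U" for y
    using cone_riemannian C that unfolding riemannian_metric_def by blast
  show "cG c y v w = cG c y w v" if "y \<in> ?U" for y v w
    using cone_riemannian C that unfolding riemannian_metric_def by blast
  show "0 < cG c y v v" if "y \<in> ?U" "v \<noteq> 0" for y v
    using cone_riemannian C that unfolding riemannian_metric_def by blast
next
  fix i assume i: "i \<in> {1..3::nat}"
  let ?C = "cone_chart c" and ?U = "fst (cone_chart c)"
  have C: "?C \<in> cone_atlas A" using c by (simp add: cone_atlas_def)
  show "linear (cJ c i y)" if "y \<in> ?U" for y by (rule endo_field_linear[OF endo_J[OF i] C that])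
  show sm: "smooth_on ?U (\<lambda>y. cJ c i y v)" for v by (rule endo_field_smooth[OF endo_J[OF i] C])
  show "cJ c i y (cJ c i y v) = - v" if "y \<in> ?U" for y v
    using kahler_J[OF i] C that unfolding kahler_def almost_complex_def by blast
  show "cG c y (cJ c i y v) (cJ c i y w) = cG c y v w" if "y \<in> ?U" for y v w
    using kahler_J[OF i] C that unfolding kahler_def by blast
  have diff: "(\<lambda>y. cG c y (cJ c i y v) w) differentiable (at y)" if "y \<in> ?U" for y v w
  proof (rule smooth_on_differentiable[OF linear_family_smooth[OF _ _ _ sm] that])
    show "open ?U" using open_charts_cone C by (simp add: open_charts_def)
    show "linear (\<lambda>u. cG c y u w)" if "y \<in> ?U" for y
    proof -
      have "bilinear (cG c y)" using cone_riemannian C that unfolding riemannian_metric_def by blast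
      then show ?thesis unfolding bilinear_def by blast
    qed
    show "smooth_on ?U (\<lambda>y. cG c y u w)" for u
      using cone_riemannian C unfolding riemannian_metric_def by blast
  qed
  show "dder (\<lambda>y. cG c y (cJ c i y v) w) y u - dder (\<lambda>y. cG c y (cJ c i y u) w) y v
        + dder (\<lambda>y. cG c y (cJ c i y u) v) y w = 0" if y: "y \<in> ?U" for y u v w
  proof -
    let ?v = "\<lambda>j. if j = 0 then u else if j = Suc 0 then v else w"
    have "ext_d 2 (kahler_form (cone_metric g) (J i)) ?C y ?v = 0"
      using kahler_J[OF i] C y unfolding kahler_def by blast
    then have "complex_of_real (dder (\<lambda>y. cG c y (cJ c i y v) w) y u - dder (\<lambda>y. cG c y (cJ c i y u) w) y v
        + dder (\<lambda>y. cG c y (cJ c i y u) v) y w) = 0"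
      unfolding ext_d_2 kahler_form_def by (simp add: dder_of_real diff[OF y])
    then show ?thesis by (simp only: of_real_eq_0_iff)
  qed
  show "dder (\<lambda>y. cJ c i y w) y (cJ c i y v) - dder (\<lambda>y. cJ c i y v) y (cJ c i y w)
        + cJ c i y (dder (\<lambda>y. cJ c i y v) y w) - cJ c i y (dder (\<lambda>y. cJ c i y w) y v) = 0" if y: "y \<in> ?U" for y v w
  proof -
    have "integrable_acs (cone_atlas A) (J i)" using kahler_J[OF i] by (simp add: kahler_def)
    \<comment> \<open>The Nijenhuis tensor is evaluated on the constant fields \<open>v\<close> and
      \<open>w\<close>, so that the brackets reduce to derivatives of \<open>J i\<close>.\<close>
    then have "lie_bracket (\<lambda>y. cJ c i y v) (\<lambda>y. cJ c i y w) y - cJ c i y (lie_bracket (\<lambda>y. cJ c i y v) (\<lambda>_. w) y)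
       - cJ c i y (lie_bracket (\<lambda>_. v) (\<lambda>y. cJ c i y w) y) - lie_bracket (\<lambda>_. v) (\<lambda>_. w) y = 0"
      using C y smooth_on_const unfolding integrable_acs_def by blast
    moreover have "linear (cJ c i y)" by (rule endo_field_linear[OF endo_J[OF i] C y])
    ultimately show ?thesis
      by (simp add: lie_bracket_def frechet_derivative_eq[OF has_derivative_const] linear_neg)
  qed
qed (use mult_table[OF c] in blast)+

abbreviation "cE \<equiv> hk_chart.E :: (real^7) \<times> real \<Rightarrow> (real^7) \<times> real"
abbreviation "cxi c \<equiv> hk_chart.xi (cJ c)"
abbreviation "com c \<equiv> hk_chart.om (cG c) (cJ c)"
abbreviation "cth c \<equiv> hk_chart.th (cG c) (cJ c)"

lemma E_eq: "c \<in> A \<Longrightarrow> cE y = (0, snd y)"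
  by (rule hk_chart.E_def[OF chart])

lemma reeb_eq: "c \<in> A \<Longrightarrow> reeb J i (cone_chart c) = cxi c i"
  by (simp add: fun_eq_iff reeb_def hk_chart.xi_def[OF chart] E_eq)

lemma cone_atlasE:
  assumes "C \<in> cone_atlas A"
  obtains c where "c \<in> A" "C = cone_chart c"
  using assms by (auto simp: cone_atlas_def)

abbreviation "kf i \<equiv> kahler_form (cone_metric g) (J i)"

lemma kf_eq: "c \<in> A \<Longrightarrow> kf i (cone_chart c) y v = complex_of_real (com c i y (v 0) (v 1))"
  by (simp add: kahler_form_def hk_chart.om_def[OF chart])

lemma form_field_kf: "i \<in> {1..3} \<Longrightarrow> form_field (cone_atlas A) 2 (kf i)"
proof (rule form_fieldI)
  assume i: "i \<in> {1..3}"
  fix C y assume C: "C \<in> cone_atlas A" and y: "y \<in> fst C"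
  obtain c where c: "c \<in> A" "C = cone_chart c" using C by (rule cone_atlasE)
  have y': "y \<in> fst (cone_chart c)" using y c by simp
  have "bilinear (com c i y)" by (rule hk_chart.om_bilinear[OF chart[OF c(1)] i y'])
  then have "bilinear (\<lambda>v w. complex_of_real (com c i y v w))"
    unfolding bilinear_def linear_iff by (simp add: scaleR_conv_of_real)
  then show "alternating 2 (kf i C y)"
    using alternating_2I[of "\<lambda>v w. complex_of_real (com c i y v w)"] hk_chart.om_self[OF chart[OF c(1)] i y']
    unfolding c(2) kf_eq[OF c(1), abs_def] by simp
next
  assume i: "i \<in> {1..3}"
  fix C v assume C: "C \<in> cone_atlas A"
  obtain c where c: "c \<in> A" "C = cone_chart c" using C by (rule cone_atlasE)
  have "open (fst (cone_chart c))" using open_charts_cone C c by (simp add: open_charts_def)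
  then show "smooth_on (fst C) (\<lambda>y. kf i C y v)"
    unfolding c(2) kf_eq[OF c(1)] by (intro smooth_on_of_real hk_chart.om_smooth[OF chart[OF c(1)] i])
next
  assume i: "i \<in> {1..3}"
  fix C C' W h y and v :: "nat \<Rightarrow> (real^7) \<times> real"
  assume H: "C \<in> cone_atlas A" "C' \<in> cone_atlas A" "chart_change C C' W h" "y \<in> W"
  have "cone_metric g C y (J i C y (v 0)) (v 1) =
      cone_metric g C' (h y) (dder h y (J i C y (v 0))) (dder h y (v 1))"
    using cone_riemannian H unfolding riemannian_metric_def by blast
  then show "kf i C y v = kf i C' (h y) (\<lambda>i. dder h y (v i))"
    by (simp add: kahler_form_def endo_field_change[OF endo_J[OF i] H])
qed

lemma chart_inj: "c \<in> A \<Longrightarrow> inj_on (snd c) (fst c)"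
  and chart_open: "c \<in> A \<Longrightarrow> open (fst c)"
proof -
  assume c: "c \<in> A"
  have h: "homeomorphic_map (top_of_set (fst c)) (subtopology X (chart_range c)) (snd c)"
    using manifold c by (simp add: smooth_manifold_def)
  show "inj_on (snd c) (fst c)" using homeomorphic_imp_injective_map[OF h] by simp
  show "open (fst c)" using manifold c by (simp add: smooth_manifold_def)
qed

lemma coord_inverse: "c \<in> A \<Longrightarrow> x \<in> fst c \<Longrightarrow> coord c (snd c x) = x"
  unfolding coord_def by (rule inv_into_f_f[OF chart_inj])

text \<open>A change of cone charts preserves \<open>r\<close>, and injectivity of the base charts
  fixes its other component. So it maps the radial line through \<open>y\<close> to a radial line,
  and differentiating along this line gives the transformation rule.\<close>

lemma vector_field_E: "vector_field (cone_atlas A) (\<lambda>C. cE)"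
  unfolding vector_field_def
proof (intro conjI ballI allI impI)
  fix C assume C: "C \<in> cone_atlas A"
  obtain c where c: "c \<in> A" "C = cone_chart c" using C by (rule cone_atlasE)
  show "smooth_on (fst C) cE" using hk_chart.E_smooth[OF chart[OF c(1)]] c by simp
next
  fix C C' W h y assume H: "C \<in> cone_atlas A" "C' \<in> cone_atlas A" "chart_change C C' W h" "y \<in> W"
  obtain c where c: "c \<in> A" "C = cone_chart c" using H(1) by (rule cone_atlasE)
  obtain c' where c': "c' \<in> A" "C' = cone_chart c'" using H(2) by (rule cone_atlasE)
  have W: "open W" "W \<subseteq> fst C" "smooth_on W h" "\<And>z. z \<in> W \<Longrightarrow> h z \<in> fst C' \<and> snd C' (h z) = snd C z"
    using H(3) by (auto simp: chart_change_def)
  have h: "h z = (coord c' (snd c (fst z)), snd z)" if "z \<in> W" for z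
  proof -
    have "h z \<in> fst c' \<times> {0<..}" "snd c' (fst (h z)) = snd c (fst z)" "snd (h z) = snd z"
      using W(4)[OF that] by (auto simp: c c' cone_chart_def split: prod.splits)
    then show ?thesis using coord_inverse[OF c'(1), of "fst (h z)"] by (auto simp: prod_eq_iff)
  qed
  have E: "cE z = (0, snd z)" for z by (rule E_eq[OF c(1)])
  have "((\<lambda>t. y + t *\<^sub>R cE y) has_derivative (\<lambda>t. t *\<^sub>R cE y)) (at 0)"
    by (auto intro!: derivative_eq_intros)
  then have d1: "((\<lambda>t. h (y + t *\<^sub>R cE y)) has_derivative (\<lambda>t. dder h y (t *\<^sub>R cE y))) (at 0)"
    by (rule has_derivative_compose) (use smooth_on_has_derivative[OF W(3) H(4)] in simp)
  have "((\<lambda>t. y + t *\<^sub>R cE y) \<longlongrightarrow> y + 0 *\<^sub>R cE y) (at 0)"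
    by (intro tendsto_intros)
  then have "\<forall>\<^sub>F t in at 0. y + t *\<^sub>R cE y \<in> W"
    using W(1) H(4) by (auto dest: topological_tendstoD)
  then have ev: "\<forall>\<^sub>F t in at 0. (coord c' (snd c (fst y)), snd y + t * snd y) = h (y + t *\<^sub>R cE y)"
    by eventually_elim (simp add: h E)
  have d0: "((\<lambda>t. (coord c' (snd c (fst y)), snd y + t * snd y)) has_derivative (\<lambda>t. (0, t * snd y))) (at 0)"
    by (rule has_derivative_Pair) (auto intro!: derivative_eq_intros)
  have d2: "((\<lambda>t. h (y + t *\<^sub>R cE y)) has_derivative (\<lambda>t. (0, t * snd y))) (at 0)"
    by (rule has_derivative_transform_eventually[OF d0 ev _ UNIV_I]) (simp add: h[OF H(4)])
  have "(\<lambda>t. dder h y (t *\<^sub>R cE y)) = (\<lambda>t. (0, t * snd y))"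
    by (rule has_derivative_unique[OF d1 d2])
  from fun_cong[OF this, of 1] show "dder h y (cE y) = cE (h y)"
    by (simp add: E h[OF H(4)])
qed

end

section \<open>Lie derivatives along the third Reeb field\<close>

lemma lie_form_add:
  assumes "\<And>v. (\<lambda>y. \<alpha> c y v) differentiable (at x)" "\<And>v. (\<lambda>y. \<beta> c y v) differentiable (at x)"
  shows "lie_form k Y (\<lambda>c y v. \<alpha> c y v + \<beta> c y v) c x v = lie_form k Y \<alpha> c x v + lie_form k Y \<beta> c x v"
  by (simp add: lie_form_def dder_add assms sum.distrib)

lemma lie_form_scale:
  assumes "\<And>v. (\<lambda>y. \<beta> c y v) differentiable (at x)"
  shows "lie_form k Y (\<lambda>c y v. z * \<beta> c y v) c x v = z * lie_form k Y \<beta> c x v"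
  by (simp add: lie_form_def dder_cmult assms sum_distrib_left distrib_left)

lemma lie_form_conj:
  assumes "\<And>v. (\<lambda>y. \<beta> c y v) differentiable (at x)"
  shows "lie_form k Y (conj_form \<beta>) c x v = cnj (lie_form k Y \<beta> c x v)"
  by (simp add: lie_form_def conj_form_def dder_cnj assms)

lemma lie_form_cong:
  assumes "open U" "x \<in> U" "\<And>y v. y \<in> U \<Longrightarrow> \<alpha> c y v = \<beta> c y v"
  shows "lie_form k Y \<alpha> c x v = lie_form k Y \<beta> c x v"
proof -
  have "dder (\<lambda>y. \<alpha> c y v) x h = dder (\<lambda>y. \<beta> c y v) x h" for h
    using frechet_derivative_cong_open[OF assms(1,2), of "\<lambda>y. \<alpha> c y v" "\<lambda>y. \<beta> c y v"] assms(3) by simp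
  then show ?thesis by (simp add: lie_form_def assms(2,3))
qed

context sasakian3
begin

text \<open>As a contraction with the Euler field this is a form field by
  \<open>form_field_contract\<close>; it equals \<open>r\<^sup>2 \<eta>\<^sub>i\<close>.\<close>

definition thf :: "nat \<Rightarrow> ((real^7) \<times> real, 's \<times> real) form" where
  "thf i C y = contract (cE y) (kf i C y)"

text \<open>For \<open>r = 1\<close> this is the horizontal part of
  \<open>\<omega>\<^sub>1 + \<i> \<omega>\<^sub>2\<close>: contraction with
  \<open>\<xi>\<^sub>3\<close> gives \<open>\<i> \<eta>\<close> from the first term and
  \<open>- \<i> r\<^sup>2 \<eta>\<close> from the second.\<close>

definition Psi :: "((real^7) \<times> real, 's \<times> real) form" where
  "Psi C y v = Upsilon g J C y v + \<i> * wedge 1 1 (eta g J C y) (thf 3 C y) v"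

text \<open>\<open>cone_omega\<close> and \<open>cone_Omega\<close> agree with the twisted forms for \<open>r = 1\<close>, but no contraction and no
  division occur in them, so that their Lie derivatives follow from the Leibniz rule.\<close>

definition cone_omega :: "((real^7) \<times> real, 's \<times> real) form" where
  "cone_omega C y v = kf 3 C y v + (- \<i>) * eta_etabar g J C y v"

definition cone_Omega :: "((real^7) \<times> real, 's \<times> real) form" where
  "cone_Omega C y = wedge 1 2 (conj_form (eta g J) C y) (Psi C y)"

abbreviation "AC \<equiv> cone_atlas A"

lemma form_field_thf: "i \<in> {1..3} \<Longrightarrow> form_field AC 1 (thf i)"
  unfolding thf_def[abs_def] using form_field_contract[OF open_charts_cone vector_field_E, of 1 "kf i"] form_field_kf[of i]
  by (simp add: numeral_2_eq_2)

lemma thf_eq: "c \<in> A \<Longrightarrow> thf i (cone_chart c) y v = complex_of_real (cth c i y (v 0))"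
  by (simp add: thf_def contract_def kf_eq hk_chart.om_E[OF chart])

lemma Upsilon_eq: "c \<in> A \<Longrightarrow> Upsilon g J (cone_chart c) y v =
    complex_of_real (com c 1 y (v 0) (v 1)) + \<i> * complex_of_real (com c 2 y (v 0) (v 1))"
  unfolding Upsilon_def by (simp add: kf_eq del: One_nat_def)

lemma form_field_Upsilon: "form_field AC 2 (Upsilon g J)"
  unfolding Upsilon_def[abs_def]
  by (intro form_field_add form_field_scale open_charts_cone form_field_kf) simp_all

lemma eta_eq_thf:
  assumes "C \<in> AC" "y \<in> fst C"
  shows "eta g J C y v = thf 1 C y v + \<i> * thf 2 C y v"
proof -
  obtain c where c: "c \<in> A" "C = cone_chart c" using assms(1) by (rule cone_atlasE)
  have "snd y \<noteq> 0" using assms(2) c by (auto simp: fst_cone_chart)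
  then show ?thesis
    unfolding c(2) thf_eq[OF c(1)]
    by (simp add: eta_def contact_form_def hk_chart.th_def[OF chart[OF c(1)]] reeb_eq[OF c(1)] distrib_left
        del: One_nat_def)
qed

lemma eta_eq: "c \<in> A \<Longrightarrow> y \<in> fst (cone_chart c) \<Longrightarrow> eta g J (cone_chart c) y v =
    complex_of_real (cth c 1 y (v 0)) + \<i> * complex_of_real (cth c 2 y (v 0))"
  using eta_eq_thf[of "cone_chart c" y v] by (simp add: cone_atlas_def thf_eq del: One_nat_def)

lemma form_field_eta: "form_field AC 1 (eta g J)"
proof (rule form_field_cong[OF open_charts_cone])
  show "form_field AC 1 (\<lambda>C y v. thf 1 C y v + \<i> * thf 2 C y v)"
    by (intro form_field_add form_field_scale open_charts_cone form_field_thf) simp_all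
qed (simp add: eta_eq_thf)

lemma form_field_eta_etabar: "form_field AC 2 (eta_etabar g J)"
  using form_field_wedge[OF open_charts_cone form_field_eta form_field_conj[OF open_charts_cone form_field_eta]]
  by (simp add: eta_etabar_def[abs_def] numeral_2_eq_2)

lemma form_field_Psi: "form_field AC 2 Psi"
  unfolding Psi_def[abs_def]
  using form_field_wedge[OF open_charts_cone form_field_eta form_field_thf[of 3]]
  by (intro form_field_add form_field_scale open_charts_cone form_field_Upsilon) (simp add: numeral_2_eq_2)

lemma form_field_cone_omega: "form_field AC 2 cone_omega"
  unfolding cone_omega_def[abs_def]
  by (intro form_field_add form_field_scale open_charts_cone form_field_kf form_field_eta_etabar) simp

lemma form_field_cone_Omega: "form_field AC 3 cone_Omega"
  unfolding cone_Omega_def[abs_def]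
  using form_field_wedge[OF open_charts_cone form_field_conj[OF open_charts_cone form_field_eta] form_field_Psi]
  by (simp add: numeral_3_eq_3)

lemma form_field_Omega4: "form_field AC 4 (\<lambda>C y v. 2 * Omega4 g J C y v)"
  using form_field_wedge[OF open_charts_cone form_field_Upsilon form_field_Upsilon]
  by (simp add: Omega4_def)

lemma cone_chart_in: "c \<in> A \<Longrightarrow> cone_chart c \<in> AC"
  by (simp add: cone_atlas_def)

lemma open_cone_chart: "c \<in> A \<Longrightarrow> open (fst (cone_chart c))"
  using open_charts_cone cone_chart_in by (simp add: open_charts_def)

lemma form_differentiable: "form_field AC k \<beta> \<Longrightarrow> c \<in> A \<Longrightarrow> y \<in> fst (cone_chart c) \<Longrightarrow>
    (\<lambda>y. \<beta> (cone_chart c) y v) differentiable (at y)"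
  by (rule smooth_on_differentiable[OF form_field_smooth[OF _ cone_chart_in]])

lemma lie_add:
  assumes "form_field AC k \<alpha>" "form_field AC k \<beta>" "c \<in> A" "y \<in> fst (cone_chart c)"
  shows "lie_form k (reeb J 3) (\<lambda>C y v. \<alpha> C y v + \<beta> C y v) (cone_chart c) y v =
    lie_form k (reeb J 3) \<alpha> (cone_chart c) y v + lie_form k (reeb J 3) \<beta> (cone_chart c) y v"
  by (rule lie_form_add) (rule form_differentiable; fact)+

lemma lie_scale:
  assumes "form_field AC k \<beta>" "c \<in> A" "y \<in> fst (cone_chart c)"
  shows "lie_form k (reeb J 3) (\<lambda>C y v. z * \<beta> C y v) (cone_chart c) y v =
    z * lie_form k (reeb J 3) \<beta> (cone_chart c) y v"
  by (rule lie_form_scale) (rule form_differentiable; fact)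

lemma lie_conj:
  assumes "form_field AC k \<beta>" "c \<in> A" "y \<in> fst (cone_chart c)"
  shows "lie_form k (reeb J 3) (conj_form \<beta>) (cone_chart c) y v =
    cnj (lie_form k (reeb J 3) \<beta> (cone_chart c) y v)"
  by (rule lie_form_conj) (rule form_differentiable; fact)

lemma lie_kf:
  assumes c: "c \<in> A" and y: "y \<in> fst (cone_chart c)"
  shows "lie_form 2 (reeb J 3) (kf 1) (cone_chart c) y v = - 2 * kf 2 (cone_chart c) y v"
    "lie_form 2 (reeb J 3) (kf 2) (cone_chart c) y v = 2 * kf 1 (cone_chart c) y v"
    "lie_form 2 (reeb J 3) (kf 3) (cone_chart c) y v = 0"
proof -
  have "lie_form 2 (reeb J 3) (kf i) (cone_chart c) y v = complex_of_real
     (dder (\<lambda>y. com c i y (v 0) (v 1)) y (cxi c 3 y) + com c i y (dder (cxi c 3) y (v 0)) (v 1)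
      + com c i y (v 0) (dder (cxi c 3) y (v 1)))" if i: "i \<in> {1..3}" for i
    using smooth_on_differentiable[OF hk_chart.om_smooth[OF chart[OF c] i] y]
    by (simp add: lie_form_def kf_eq[OF c] reeb_eq[OF c] dder_of_real numeral_2_eq_2)
  note L = this[OF hk_chart.index_123(1)[OF chart[OF c]]] this[OF hk_chart.index_123(2)[OF chart[OF c]]]
    this[OF hk_chart.index_123(3)[OF chart[OF c]]]
  show "lie_form 2 (reeb J 3) (kf 1) (cone_chart c) y v = - 2 * kf 2 (cone_chart c) y v"
    "lie_form 2 (reeb J 3) (kf 2) (cone_chart c) y v = 2 * kf 1 (cone_chart c) y v"
    "lie_form 2 (reeb J 3) (kf 3) (cone_chart c) y v = 0"
    unfolding L hk_chart.lie_om[OF chart[OF c] y] by (simp_all add: kf_eq[OF c] del: One_nat_def)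
qed

lemma lie_thf:
  assumes c: "c \<in> A" and y: "y \<in> fst (cone_chart c)"
  shows "lie_form 1 (reeb J 3) (thf 1) (cone_chart c) y v = - 2 * thf 2 (cone_chart c) y v"
    "lie_form 1 (reeb J 3) (thf 2) (cone_chart c) y v = 2 * thf 1 (cone_chart c) y v"
    "lie_form 1 (reeb J 3) (thf 3) (cone_chart c) y v = 0"
proof -
  have "lie_form 1 (reeb J 3) (thf i) (cone_chart c) y v = complex_of_real
     (dder (\<lambda>y. cth c i y (v 0)) y (cxi c 3 y) + cth c i y (dder (cxi c 3) y (v 0)))" if i: "i \<in> {1..3}" for i
    using smooth_on_differentiable[OF hk_chart.th_smooth[OF chart[OF c] i] y]
    by (simp add: lie_form_def thf_eq[OF c] reeb_eq[OF c] dder_of_real)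
  note L = this[OF hk_chart.index_123(1)[OF chart[OF c]]] this[OF hk_chart.index_123(2)[OF chart[OF c]]]
    this[OF hk_chart.index_123(3)[OF chart[OF c]]]
  show "lie_form 1 (reeb J 3) (thf 1) (cone_chart c) y v = - 2 * thf 2 (cone_chart c) y v"
    "lie_form 1 (reeb J 3) (thf 2) (cone_chart c) y v = 2 * thf 1 (cone_chart c) y v"
    "lie_form 1 (reeb J 3) (thf 3) (cone_chart c) y v = 0"
    unfolding L hk_chart.lie_th[OF chart[OF c] y] by (simp_all add: thf_eq[OF c] del: One_nat_def)
qed

lemma lie_Upsilon:
  assumes c: "c \<in> A" and y: "y \<in> fst (cone_chart c)"
  shows "lie_form 2 (reeb J 3) (Upsilon g J) (cone_chart c) y v = 2 * \<i> * Upsilon g J (cone_chart c) y v"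
proof -
  have f: "form_field AC 2 (kf 1)" "form_field AC 2 (kf 2)" by (rule form_field_kf, simp)+
  have "lie_form 2 (reeb J 3) (Upsilon g J) (cone_chart c) y v =
      lie_form 2 (reeb J 3) (kf 1) (cone_chart c) y v + \<i> * lie_form 2 (reeb J 3) (kf 2) (cone_chart c) y v"
    unfolding Upsilon_def[abs_def]
    by (simp only: lie_add[OF f(1) form_field_scale[OF open_charts_cone f(2)] c y] lie_scale[OF f(2) c y])
  then show ?thesis unfolding lie_kf[OF assms] by (simp add: Upsilon_def algebra_simps)
qed

lemma lie_eta:
  assumes c: "c \<in> A" and y: "y \<in> fst (cone_chart c)"
  shows "lie_form 1 (reeb J 3) (eta g J) (cone_chart c) y v = 2 * \<i> * eta g J (cone_chart c) y v"
proof -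
  have f: "form_field AC 1 (thf 1)" "form_field AC 1 (thf 2)" by (rule form_field_thf, simp)+
  have "lie_form 1 (reeb J 3) (eta g J) (cone_chart c) y v =
     lie_form 1 (reeb J 3) (\<lambda>C y v. thf 1 C y v + \<i> * thf 2 C y v) (cone_chart c) y v"
    by (rule lie_form_cong[OF open_cone_chart[OF c] y]) (rule eta_eq_thf[OF cone_chart_in[OF c]])
  also have "\<dots> = lie_form 1 (reeb J 3) (thf 1) (cone_chart c) y v + \<i> * lie_form 1 (reeb J 3) (thf 2) (cone_chart c) y v"
    by (simp only: lie_add[OF f(1) form_field_scale[OF open_charts_cone f(2)] c y] lie_scale[OF f(2) c y])
  finally show ?thesis
    unfolding lie_thf[OF assms] eta_eq_thf[OF cone_chart_in[OF c] y] by (simp add: algebra_simps)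
qed

text \<open>Conjugation reverses the charge. Therefore the products of this form with
  \<open>eta g J\<close> and with \<open>Psi\<close>, both of charge \<open>2 * \<i>\<close>, are
  invariant.\<close>

lemma lie_etabar:
  assumes c: "c \<in> A" and y: "y \<in> fst (cone_chart c)"
  shows "lie_form 1 (reeb J 3) (conj_form (eta g J)) (cone_chart c) y v = - 2 * \<i> * conj_form (eta g J) (cone_chart c) y v"
  unfolding lie_conj[OF form_field_eta c y] lie_eta[OF c y]
  by (simp add: conj_form_def)

lemma lie_wedge:
  assumes c: "c \<in> A" and y: "y \<in> fst (cone_chart c)" and a: "form_field AC k \<alpha>" and b: "form_field AC l \<beta>"
  shows "lie_form (k + l) (reeb J 3) (\<lambda>C y. wedge k l (\<alpha> C y) (\<beta> C y)) (cone_chart c) y v =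
    wedge k l (lie_form k (reeb J 3) \<alpha> (cone_chart c) y) (\<beta> (cone_chart c) y) v
    + wedge k l (\<alpha> (cone_chart c) y) (lie_form l (reeb J 3) \<beta> (cone_chart c) y) v"
  by (rule lie_form_wedge[OF open_cone_chart[OF c] y])
    (rule form_field_smooth[OF a cone_chart_in[OF c]] form_field_smooth[OF b cone_chart_in[OF c]]
      form_field_alternating[OF a cone_chart_in[OF c] y] form_field_alternating[OF b cone_chart_in[OF c] y])+

lemma lie_eta_etabar:
  assumes c: "c \<in> A" and y: "y \<in> fst (cone_chart c)"
  shows "lie_form 2 (reeb J 3) (eta_etabar g J) (cone_chart c) y v = 0"
proof -
  have "lie_form (1 + 1) (reeb J 3) (\<lambda>C y. wedge 1 1 (eta g J C y) (conj_form (eta g J) C y)) (cone_chart c) y v = 0"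
    unfolding lie_wedge[OF c y form_field_eta form_field_conj[OF open_charts_cone form_field_eta]]
      lie_eta[OF c y, abs_def] lie_etabar[OF c y, abs_def] wedge_scale_left wedge_scale_right
    by simp
  then show ?thesis by (simp add: eta_etabar_def[abs_def] numeral_2_eq_2)
qed

lemma lie_cone_omega:
  assumes c: "c \<in> A" and y: "y \<in> fst (cone_chart c)"
  shows "lie_form 2 (reeb J 3) cone_omega (cone_chart c) y v = 0"
proof -
  have "form_field AC 2 (kf 3)" by (rule form_field_kf) simp
  then have "lie_form 2 (reeb J 3) cone_omega (cone_chart c) y v = lie_form 2 (reeb J 3) (kf 3) (cone_chart c) y v
      + (- \<i>) * lie_form 2 (reeb J 3) (eta_etabar g J) (cone_chart c) y v"
    unfolding cone_omega_def[abs_def]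
    by (simp only: lie_add[OF _ form_field_scale[OF open_charts_cone form_field_eta_etabar] c y]
        lie_scale[OF form_field_eta_etabar c y])
  then show ?thesis by (simp only: lie_kf(3)[OF c y] lie_eta_etabar[OF c y]) simp
qed

lemma lie_Psi:
  assumes c: "c \<in> A" and y: "y \<in> fst (cone_chart c)"
  shows "lie_form 2 (reeb J 3) Psi (cone_chart c) y v = 2 * \<i> * Psi (cone_chart c) y v"
proof -
  have i: "3 \<in> {1..3::nat}" by simp
  have f: "form_field AC 2 (\<lambda>C y. wedge 1 1 (eta g J C y) (thf 3 C y))"
    using form_field_wedge[OF open_charts_cone form_field_eta form_field_thf[OF i]] by (simp add: numeral_2_eq_2)
  have "lie_form (1 + 1) (reeb J 3) (\<lambda>C y. wedge 1 1 (eta g J C y) (thf 3 C y)) (cone_chart c) y v =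
      2 * \<i> * wedge 1 1 (eta g J (cone_chart c) y) (thf 3 (cone_chart c) y) v"
    unfolding lie_wedge[OF c y form_field_eta form_field_thf[OF i]]
      lie_eta[OF c y, abs_def] lie_thf(3)[OF c y, abs_def] wedge_scale_left wedge_zero_right
    by simp
  then have w: "lie_form 2 (reeb J 3) (\<lambda>C y. wedge 1 1 (eta g J C y) (thf 3 C y)) (cone_chart c) y v =
      2 * \<i> * wedge 1 1 (eta g J (cone_chart c) y) (thf 3 (cone_chart c) y) v" by (simp add: numeral_2_eq_2)
  show ?thesis
    unfolding Psi_def[abs_def] lie_add[OF form_field_Upsilon form_field_scale[OF open_charts_cone f] c y]
      lie_scale[OF f c y] lie_Upsilon[OF c y] w
    by (simp add: algebra_simps)
qed

lemma lie_cone_Omega: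
  assumes c: "c \<in> A" and y: "y \<in> fst (cone_chart c)"
  shows "lie_form 3 (reeb J 3) cone_Omega (cone_chart c) y v = 0"
proof -
  have "lie_form (1 + 2) (reeb J 3) (\<lambda>C y. wedge 1 2 (conj_form (eta g J) C y) (Psi C y)) (cone_chart c) y v = 0"
    unfolding lie_wedge[OF c y form_field_conj[OF open_charts_cone form_field_eta] form_field_Psi]
      lie_etabar[OF c y, abs_def] lie_Psi[OF c y, abs_def] wedge_scale_left wedge_scale_right
    by simp
  then show ?thesis by (simp add: cone_Omega_def[abs_def] numeral_3_eq_3)
qed

lemma charge_Omega4: "has_charge AC (reeb J 3) 4 (4 * \<i>) (\<lambda>C y v. 2 * Omega4 g J C y v)"
  unfolding has_charge_def
proof (intro ballI allI)
  fix C y v assume C: "C \<in> AC" and y: "y \<in> fst C"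
  obtain c where c: "c \<in> A" "C = cone_chart c" using C by (rule cone_atlasE)
  have y': "y \<in> fst (cone_chart c)" using y c by simp
  have "lie_form (2 + 2) (reeb J 3) (\<lambda>C y. wedge 2 2 (Upsilon g J C y) (Upsilon g J C y)) (cone_chart c) y v
     = 4 * \<i> * wedge 2 2 (Upsilon g J (cone_chart c) y) (Upsilon g J (cone_chart c) y) v"
    unfolding lie_wedge[OF c(1) y' form_field_Upsilon form_field_Upsilon]
      lie_Upsilon[OF c(1) y', abs_def] wedge_scale_left wedge_scale_right
    by simp
  then show "lie_form 4 (reeb J 3) (\<lambda>C y v. 2 * Omega4 g J C y v) C y v = 4 * \<i> * (2 * Omega4 g J C y v)"
    by (simp add: Omega4_def c)
qed

lemma charge_eta: "has_charge AC (reeb J 3) 1 (2 * \<i>) (eta g J)"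
  unfolding has_charge_def
proof (intro ballI allI)
  fix C y v assume C: "C \<in> AC" and y: "y \<in> fst C"
  obtain c where c: "c \<in> A" "C = cone_chart c" using C by (rule cone_atlasE)
  then show "lie_form 1 (reeb J 3) (eta g J) C y v = 2 * \<i> * eta g J C y v"
    using lie_eta[OF c(1)] y by simp
qed

end

section \<open>The holomorphic volume form and the twist form on the cone\<close>

lemma ext_d_cong:
  assumes "open U" "x \<in> U" "\<And>y v. y \<in> U \<Longrightarrow> \<alpha> c y v = \<beta> c y v"
  shows "ext_d k \<alpha> c x v = ext_d k \<beta> c x v"
proof -
  have "dder (\<lambda>y. \<alpha> c y v) x h = dder (\<lambda>y. \<beta> c y v) x h" for v h
    using frechet_derivative_cong_open[OF assms(1,2), of "\<lambda>y. \<alpha> c y v" "\<lambda>y. \<beta> c y v"] assms(3) by simp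
  then show ?thesis by (simp add: ext_d_def)
qed

lemma (in hk_chart) th_xi:
  assumes y: "y \<in> U"
  shows "th 1 y (xi 1 y) = (snd y)\<^sup>2" "th 2 y (xi 2 y) = (snd y)\<^sup>2" "th 1 y (xi 2 y) = 0" "th 2 y (xi 1 y) = 0"
proof -
  note z = index_123[THEN snd_xi, OF y]
  show "th 1 y (xi 2 y) = 0"
    using z(3) unfolding th_eq[OF index_123(1) y] xi_def J_mult(1)[OF y] by simp
  show "th 2 y (xi 1 y) = 0"
    using z(3) unfolding th_eq[OF index_123(2) y] xi_def J_mult(4)[OF y] by simp
  show "th 1 y (xi 1 y) = (snd y)\<^sup>2"
    unfolding th_eq[OF index_123(1) y] xi_def J_square[OF index_123(1) y]
    by (simp add: E_def power2_eq_square)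
  show "th 2 y (xi 2 y) = (snd y)\<^sup>2"
    unfolding th_eq[OF index_123(2) y] xi_def J_square[OF index_123(2) y]
    by (simp add: E_def power2_eq_square)
qed

lemma (in hk_chart) th_J3:
  assumes y: "y \<in> U"
  shows "th 1 y (J 3 y v) = - th 2 y v" "th 2 y (J 3 y v) = th 1 y v"
  unfolding th_def xi_def using G_J_cross[OF y, of "E y" v] by simp_all

lemma (in hk_chart) om_J3:
  assumes y: "y \<in> U"
  shows "om 1 y (J 3 y v) w = - om 2 y v w" "om 2 y (J 3 y v) w = om 1 y v w"
  unfolding om_def J_mult[OF y] by (simp_all add: G_minus_left[OF y])

lemma (in hk_chart) om_xi12:
  assumes y: "y \<in> U"
  shows "om 1 y (xi 1 y) w = - (snd y * snd w)" "om 2 y (xi 1 y) w = - th 3 y w"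
    "om 1 y (xi 2 y) w = th 3 y w" "om 2 y (xi 2 y) w = - (snd y * snd w)"
  unfolding om_def th_def xi_def J_mult[OF y] J_square[OF index_123(1) y] J_square[OF index_123(2) y]
  by (simp_all add: G_minus_left[OF y] G_E(1)[OF y])

definition (in hk_chart) ups :: "'e \<times> real \<Rightarrow> 'e \<times> real \<Rightarrow> 'e \<times> real \<Rightarrow> complex" where
  "ups y v w = complex_of_real (om 1 y v w) + \<i> * complex_of_real (om 2 y v w)"

lemma (in hk_chart) ups_skew: "y \<in> U \<Longrightarrow> ups y v w = - ups y w v"
  unfolding ups_def using om_skew[OF index_123(1), of y v w] om_skew[OF index_123(2), of y v w] by simp

text \<open>This is the reason for the type \<open>(4,0)\<close> of \<open>Omega4\<close>:
  \<open>ups\<close> is complex linear for \<open>J 3\<close> in each slot, hence so is its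
  square.\<close>

lemma (in hk_chart) ups_J3:
  assumes y: "y \<in> U"
  shows "ups y (J 3 y v) w = \<i> * ups y v w" "ups y v (J 3 y w) = \<i> * ups y v w"
proof -
  show 1: "ups y (J 3 y v) w = \<i> * ups y v w" for v w
    by (simp only: ups_def om_J3[OF y]) (simp add: algebra_simps)
  show "ups y v (J 3 y w) = \<i> * ups y v w"
    using ups_skew[OF y, of v "J 3 y w"] ups_skew[OF y, of w v] 1[of w v] by simp
qed

lemma (in hk_chart) ups_smooth: "smooth_on U (\<lambda>y. ups y v w)"
  unfolding ups_def
  by (intro smooth_on_add[OF open_U] smooth_on_mult[OF open_U] smooth_on_const smooth_on_of_real[OF open_U]
      om_smooth index_123)

lemma (in hk_chart) ups_closed:
  assumes y: "y \<in> U"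
  shows "dder (\<lambda>y. ups y v w) y u - dder (\<lambda>y. ups y u w) y v + dder (\<lambda>y. ups y u v) y w = 0"
proof -
  have d: "(\<lambda>y. om i y v w) differentiable (at y)" if "i \<in> {1..3}" for i v w
    by (rule smooth_on_differentiable[OF om_smooth[OF that] y])
  have "dder (\<lambda>y. ups y v w) y u = complex_of_real (dder (\<lambda>y. om 1 y v w) y u) + \<i> * complex_of_real (dder (\<lambda>y. om 2 y v w) y u)" for u v w
  proof -
    have r: "(\<lambda>y. complex_of_real (om i y v w)) differentiable (at y)" if "i \<in> {1..3}" for i
      by (rule smooth_on_differentiable[OF smooth_on_of_real[OF open_U om_smooth[OF that]] y])
    have r2: "(\<lambda>y. \<i> * complex_of_real (om 2 y v w)) differentiable (at y)"
      by (intro differentiable_mult differentiable_const r index_123)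
    show ?thesis
      unfolding ups_def dder_add[OF r[OF index_123(1)] r2] dder_cmult[OF r[OF index_123(2)]]
        dder_of_real[OF d[OF index_123(1)]] dder_of_real[OF d[OF index_123(2)]] ..
  qed
  note e = this
  have "complex_of_real (dder (\<lambda>y. om i y v w) y u - dder (\<lambda>y. om i y u w) y v + dder (\<lambda>y. om i y u v) y w) = 0"
    if "i \<in> {1..3}" for i
    unfolding om_def om_closed[OF that y] by simp
  from this[OF index_123(1)] this[OF index_123(2)] show ?thesis
    unfolding e of_real_add of_real_diff by algebra
qed

context sasakian3
begin

abbreviation "cups c \<equiv> hk_chart.ups (cG c) (cJ c)"

lemma Upsilon_ups: "c \<in> A \<Longrightarrow> Upsilon g J (cone_chart c) y = (\<lambda>v. cups c y (v 0) (v 1))"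
  by (rule ext) (simp only: Upsilon_eq hk_chart.ups_def[OF chart])

lemma Omega4_eq:
  assumes c: "c \<in> A" and y: "y \<in> fst (cone_chart c)"
  shows "2 * Omega4 g J (cone_chart c) y v = 2 * (cups c y (v 0) (v 1) * cups c y (v 2) (v 3)
     - cups c y (v 0) (v 2) * cups c y (v 1) (v 3) + cups c y (v 0) (v 3) * cups c y (v 1) (v 2))"
proof -
  note s = hk_chart.ups_skew[OF chart[OF c] y]
  show ?thesis
    unfolding Omega4_def Upsilon_ups[OF c] wedge_2_2[of "cups c y" "cups c y", OF s s]
    by (simp add: field_simps)
qed

lemma horizontal_vector_cone:
  assumes c: "c \<in> A" and y: "y \<in> fst (cone_chart c)"
  shows "\<exists>e. cG c y e e = 1 \<and> cG c y (cE y) e = 0 \<and> cth c 1 y e = 0 \<and> cth c 2 y e = 0 \<and> cth c 3 y e = 0"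
  using hk_chart.horizontal_vector[OF chart[OF c] y] by simp

lemma Omega4_nonzero:
  assumes c: "c \<in> A" and y: "y \<in> fst (cone_chart c)"
  shows "\<exists>v. 2 * Omega4 g J (cone_chart c) y v \<noteq> 0"
proof -
  interpret hk_chart "fst (cone_chart c)" "g c" "cG c" "cJ c" by (rule chart[OF c])
  obtain e where e: "cG c y e e = 1" "cG c y (cE y) e = 0" "cth c 1 y e = 0" "cth c 2 y e = 0" "cth c 3 y e = 0"
    using horizontal_vector_cone[OF c y] by blast
  \<comment> \<open>\<open>ups\<close> pairs \<open>E\<close> with \<open>xi 1\<close> and
    \<open>e\<close> with \<open>J 1 e\<close>, while it vanishes on the mixed pairs
    \<open>(E, e)\<close> and \<open>(xi 1, e)\<close>. So only one of the three products
    survives.\<close>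
  define v where "v i = (if i = 0 then E y else if i = 1 then xi 1 y else if i = 2 then e else cJ c 1 y e)" for i :: nat
  have v: "v 0 = E y" "v 1 = xi 1 y" "v 2 = e" "v 3 = cJ c 1 y e" by (simp_all add: v_def)
  have p01: "ups y (E y) (xi 1 y) = complex_of_real ((snd y)\<^sup>2)"
    unfolding ups_def om_E th_xi[OF y] by simp
  have p02: "ups y (E y) e = 0" unfolding ups_def om_E using e by simp
  have p12: "ups y (xi 1 y) e = 0"
    unfolding ups_def om_xi12[OF y] using e(2,5) G_E(1)[OF y, of e] by simp
  have p23: "ups y e (cJ c 1 y e) = 1"
    unfolding ups_def om_def J_orth[OF index_123(1) y] e(1) G_J_cross(4)[OF y]
    using G_JE[OF index_123(3) y, of e] by simp
  have "2 * Omega4 g J (cone_chart c) y v = 2 * complex_of_real ((snd y)\<^sup>2)"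
    unfolding Omega4_eq[OF c y] v p01 p02 p12 p23 by simp
  then show ?thesis using snd_pos[OF y] by (intro exI[of _ v]) simp
qed

lemma holomorphic_Omega4: "holomorphic_volume_form AC (J 3) (\<lambda>C y v. 2 * Omega4 g J C y v)"
proof -
  have "has_type AC (J 3) 4 {4} (\<lambda>C y v. 2 * Omega4 g J C y v)"
    unfolding has_type_def
  proof (intro ballI covector_type_top)
    fix C y j and v :: "nat \<Rightarrow> (real^7) \<times> real" assume C: "C \<in> AC" and y: "y \<in> fst C" and j: "j < (4::nat)"
    obtain c where c: "c \<in> A" "C = cone_chart c" using C by (rule cone_atlasE)
    have y': "y \<in> fst (cone_chart c)" using y c by simp
    note J3 = hk_chart.ups_J3[OF chart[OF c(1)] y']
    have "j = 0 \<or> j = 1 \<or> j = 2 \<or> j = 3" using j by linarith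
    then show "2 * Omega4 g J C y (v(j := J 3 C y (v j))) = \<i> * (2 * Omega4 g J C y v)"
      unfolding c(2) Omega4_eq[OF c(1) y']
      by (elim disjE) (simp_all add: J3 algebra_simps)
  qed
  moreover have "nowhere_vanishing AC (\<lambda>C y v. 2 * Omega4 g J C y v)"
    unfolding nowhere_vanishing_def
  proof (intro ballI)
    fix C y assume C: "C \<in> AC" and y: "y \<in> fst C"
    obtain c where c: "c \<in> A" "C = cone_chart c" using C by (rule cone_atlasE)
    then show "\<exists>v. 2 * Omega4 g J C y v \<noteq> 0" using Omega4_nonzero[OF c(1)] y by simp
  qed
  moreover have "ext_d 4 (\<lambda>C y v. 2 * Omega4 g J C y v) C y v = 0" if C: "C \<in> AC" and y: "y \<in> fst C" for C y v
  proof -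
    obtain c where c: "c \<in> A" "C = cone_chart c" using C by (rule cone_atlasE)
    have y': "y \<in> fst (cone_chart c)" using y c by simp
    interpret hk_chart "fst (cone_chart c)" "g c" "cG c" "cJ c" by (rule chart[OF c(1)])
    have "ext_d 4 (\<lambda>C y v. 2 * Omega4 g J C y v) (cone_chart c) y v =
       ext_d 4 (\<lambda>C y v. 2 * (ups y (v 0) (v 1) * ups y (v 2) (v 3)
     - ups y (v 0) (v 2) * ups y (v 1) (v 3) + ups y (v 0) (v 3) * ups y (v 1) (v 2))) (cone_chart c) y v"
      by (rule ext_d_cong[OF open_U y']) (rule Omega4_eq[OF c(1)])
    also have "\<dots> = 0"
      by (rule ext_d_square_closed_2_form[OF smooth_on_differentiable[OF ups_smooth y'] ups_closed[OF y']])
    finally show ?thesis by (simp only: c(2))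
  qed
  ultimately show ?thesis
    using form_field_Omega4 by (simp add: holomorphic_volume_form_def)
qed

lemma twist_form_eta: "twist_form AC (J 3) (reeb J 3) (eta g J)"
proof -
  have "nowhere_vanishing AC (eta g J)"
    unfolding nowhere_vanishing_def
  proof (intro ballI)
    fix C y assume C: "C \<in> AC" and y: "y \<in> fst C"
    obtain c where c: "c \<in> A" "C = cone_chart c" using C by (rule cone_atlasE)
    have y': "y \<in> fst (cone_chart c)" using y c by simp
    interpret hk_chart "fst (cone_chart c)" "g c" "cG c" "cJ c" by (rule chart[OF c(1)])
    have "eta g J C y (\<lambda>_. xi 1 y) = complex_of_real ((snd y)\<^sup>2)"
      unfolding c(2) eta_eq[OF c(1) y'] th_xi[OF y'] by simp
    then show "\<exists>v. eta g J C y v \<noteq> 0" using snd_pos[OF y'] by (intro exI[of _ "\<lambda>_. xi 1 y"]) simp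
  qed
  moreover have "has_type AC (J 3) 1 {1} (eta g J)"
    unfolding has_type_def
  proof (intro ballI covector_type_top)
    fix C y j and v :: "nat \<Rightarrow> (real^7) \<times> real" assume C: "C \<in> AC" and y: "y \<in> fst C" and j: "j < (1::nat)"
    obtain c where c: "c \<in> A" "C = cone_chart c" using C by (rule cone_atlasE)
    have y': "y \<in> fst (cone_chart c)" using y c by simp
    show "eta g J C y (v(j := J 3 C y (v j))) = \<i> * eta g J C y v"
      using j unfolding c(2) eta_eq[OF c(1) y']
      by (simp add: hk_chart.th_J3[OF chart[OF c(1)] y', simplified] algebra_simps)
  qed
  moreover have "contract (reeb J 3 C y) (eta g J C y) v = 0" if C: "C \<in> AC" and y: "y \<in> fst C" for C y v
  proof -
    obtain c where c: "c \<in> A" "C = cone_chart c" using C by (rule cone_atlasE)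
    have y': "y \<in> fst (cone_chart c)" using y c by simp
    show ?thesis
      unfolding c(2) contract_def eta_eq[OF c(1) y'] reeb_eq[OF c(1)] nat.case
        hk_chart.th_xi3[OF chart[OF c(1)] y'] by simp
  qed
  ultimately show ?thesis
    using form_field_eta charge_eta unfolding twist_form_def by blast
qed

section \<open>Restriction of forms and vector fields to the level set \<open>r = 1\<close>\<close>

lemma one_in_cone: "c \<in> A \<Longrightarrow> x \<in> fst c \<Longrightarrow> (x, 1) \<in> fst (cone_chart c)"
  by (simp add: fst_cone_chart)

lemma smooth_on_at_1:
  assumes "c \<in> A" "smooth_on (fst (cone_chart c)) f"
  shows "smooth_on (fst c) (\<lambda>x. f (x, 1))"
    and "x \<in> fst c \<Longrightarrow> dder (\<lambda>x. f (x, 1)) x v = dder f (x, 1) (v, 0)"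
proof -
  show "smooth_on (fst c) (\<lambda>x. f (x, 1))"
    by (rule smooth_on_compose[OF chart_open[OF assms(1)] open_cone_chart[OF assms(1)] _ _ assms(2)])
      (auto simp: fst_cone_chart intro!: smooth_on_Pair chart_open[OF assms(1)] smooth_on_ident)
  assume x: "x \<in> fst c"
  have "((\<lambda>x. (x, 1::real)) has_derivative (\<lambda>v. (v, 0))) (at x)"
    by (auto intro!: derivative_eq_intros)
  from has_derivative_compose[OF this smooth_on_has_derivative[OF assms(2) one_in_cone[OF assms(1) x]]]
  show "dder (\<lambda>x. f (x, 1)) x v = dder f (x, 1) (v, 0)"
    by (simp add: frechet_derivative_eq)
qed

text \<open>A change of base charts extends to the cone as its product with the identity in
  \<open>r\<close>. In this way the compatibility of a form on the cone passes to its
  restriction.\<close>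

lemma chart_change_cone:
  assumes "c \<in> A" "c' \<in> A" "chart_change c c' W h"
  shows "chart_change (cone_chart c) (cone_chart c') (W \<times> {0::real<..}) (\<lambda>y. (h (fst y), snd y))"
    and "x \<in> W \<Longrightarrow> dder (\<lambda>y. (h (fst y), snd y)) (x, 1::real) (v, 0) = (dder h x v, 0)"
proof -
  have W: "open W" "W \<subseteq> fst c" "smooth_on W h"
    "\<And>z. z \<in> W \<Longrightarrow> h z \<in> fst c' \<and> snd c' (h z) = snd c z \<and> bij (frechet_derivative h (at z))"
    using assms(3) by (auto simp: chart_change_def)
  have o: "open (W \<times> {0::real<..})" by (intro open_Times W open_greaterThan)
  have s: "smooth_on (W \<times> {0::real<..}) (\<lambda>y. h (fst y))"
    by (rule smooth_on_fst_compose[OF W(1,3)])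
  have d: "((\<lambda>y. (h (fst y), snd y)) has_derivative (\<lambda>u. (dder h (fst y) (fst u), snd u))) (at y)"
    if "fst y \<in> W" for y :: "(real^7) \<times> real"
    by (rule has_derivative_Pair[OF has_derivative_compose[OF has_derivative_fst[OF has_derivative_ident]
          smooth_on_has_derivative[OF W(3) that]] has_derivative_snd[OF has_derivative_ident]])
  show "x \<in> W \<Longrightarrow> dder (\<lambda>y. (h (fst y), snd y)) (x, 1::real) (v, 0) = (dder h x v, 0)"
    using frechet_derivative_eq[OF d[of "(x, 1)"]] by simp
  have b: "bij (dder (\<lambda>y. (h (fst y), snd y)) y)" if "y \<in> W \<times> {0::real<..}" for y
  proof -
    have y: "fst y \<in> W" using that by auto
    have bb: "bij (dder h (fst y))" using W(4)[OF y] by blast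
    have "bij (\<lambda>u :: (real^7) \<times> real. (dder h (fst y) (fst u), snd u))"
      by (rule o_bij[of "\<lambda>u. (inv (dder h (fst y)) (fst u), snd u)"])
        (simp_all add: fun_eq_iff inv_f_f[OF bij_is_inj[OF bb]] surj_f_inv_f[OF bij_is_surj[OF bb]])
    then show ?thesis using frechet_derivative_eq[OF d[OF y]] by simp
  qed
  show "chart_change (cone_chart c) (cone_chart c') (W \<times> {0::real<..}) (\<lambda>y. (h (fst y), snd y))"
    unfolding chart_change_def
  proof (intro conjI ballI)
    show "smooth_on (W \<times> {0::real<..}) (\<lambda>y. (h (fst y), snd y))"
      by (rule smooth_on_Pair[OF o s smooth_on_snd_arg[OF o]])
    show "W \<times> {0<..} \<subseteq> fst (cone_chart c)" using W(2) by (auto simp: fst_cone_chart)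
  next
    fix y assume y: "y \<in> W \<times> {0::real<..}"
    then have y1: "fst y \<in> W" "0 < snd y" by auto
    show "(h (fst y), snd y) \<in> fst (cone_chart c')" using W(4)[OF y1(1)] y1 by (simp add: fst_cone_chart)
    show "snd (cone_chart c') (h (fst y), snd y) = snd (cone_chart c) y"
      using W(4)[OF y1(1)] by (simp add: cone_chart_def case_prod_unfold)
    show "bij (dder (\<lambda>y. (h (fst y), snd y)) y)" by (rule b[OF y])
  qed (rule o)
qed

lemma form_field_restrict:
  assumes b: "form_field AC k \<beta>"
  shows "form_field A k (restrict_form \<beta>)"
proof (rule form_fieldI)
  fix c x assume c: "c \<in> A" and x: "x \<in> fst c"
  have "linear (\<lambda>u :: real^7. (u, 0::real))" by (simp add: linear_iff)
  from alternating_pullback[OF form_field_alternating[OF b cone_chart_in[OF c] one_in_cone[OF c x]] this]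
  show "alternating k (restrict_form \<beta> c x)" by (simp add: restrict_form_def[abs_def])
next
  fix c v assume c: "c \<in> A"
  show "smooth_on (fst c) (\<lambda>x. restrict_form \<beta> c x v)"
    unfolding restrict_form_def by (rule smooth_on_at_1(1)[OF c form_field_smooth[OF b cone_chart_in[OF c]]])
next
  fix c c' W h x v assume H: "c \<in> A" "c' \<in> A" "chart_change c c' W h" "x \<in> W"
  have x: "(x, 1) \<in> W \<times> {0::real<..}" using H(4) by simp
  show "restrict_form \<beta> c x v = restrict_form \<beta> c' (h x) (\<lambda>i. dder h x (v i))"
    unfolding restrict_form_def
    using form_field_change[OF b cone_chart_in[OF H(1)] cone_chart_in[OF H(2)] chart_change_cone(1)[OF H(1-3)] x, of "\<lambda>i. (v i, 0)"]
    by (simp add: chart_change_cone(2)[OF H])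
qed

text \<open>\<open>\<xi>\<^sub>3\<close> is tangent to every level set of \<open>r\<close>, so
  neither it nor its derivatives have a radial component; this is why the Lie derivative commutes
  with restriction.\<close>

lemma lie_form_restrict:
  assumes b: "form_field AC k \<beta>" and c: "c \<in> A" and x: "x \<in> fst c"
  shows "lie_form k (restrict_field (reeb J 3)) (restrict_form \<beta>) c x v =
    lie_form k (reeb J 3) \<beta> (cone_chart c) (x, 1) (\<lambda>i. (v i, 0))"
proof -
  interpret hk_chart "fst (cone_chart c)" "g c" "cG c" "cJ c" by (rule chart[OF c])
  let ?Y = "xi 3" and ?C = "cone_chart c"
  have Y: "smooth_on (fst ?C) ?Y" by (rule xi_smooth[OF index_123(3)])
  have z: "snd (?Y y) = 0" if "y \<in> fst ?C" for y by (rule snd_xi[OF index_123(3) that])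
  note x1 = one_in_cone[OF c x]
  have f: "dder (\<lambda>x. fst (?Y (x, 1))) x u = fst (dder ?Y (x, 1) (u, 0))" for u
  proof -
    have "dder (\<lambda>x. fst (?Y (x, 1))) x u = dder (\<lambda>y. fst (?Y y)) (x, 1) (u, 0)"
      by (rule smooth_on_at_1(2)[OF c smooth_on_linear[OF open_U linear_fst Y] x])
    also have "\<dots> = fst (dder ?Y (x, 1) (u, 0))"
      by (rule frechet_derivative_bounded_linear[OF bounded_linear_fst smooth_on_differentiable[OF Y x1]])
    finally show ?thesis .
  qed
  have s: "snd (dder ?Y (x, 1) u) = 0" for u
  proof -
    have "snd (dder ?Y (x, 1) u) = dder (\<lambda>y. snd (?Y y)) (x, 1) u"
      by (rule frechet_derivative_bounded_linear[OF bounded_linear_snd smooth_on_differentiable[OF Y x1], symmetric])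
    also have "\<dots> = dder (\<lambda>y. 0) (x, 1) u" by (rule dder_cong[OF x1 z])
    finally show ?thesis by (simp add: frechet_derivative_eq[OF has_derivative_const])
  qed
  have p: "(fst (dder ?Y (x, 1) u), 0) = dder ?Y (x, 1) u" for u using s[of u] by (simp add: prod_eq_iff)
  have p2: "(fst (?Y (x, 1)), 0) = ?Y (x, 1)" using z[OF x1] by (simp add: prod_eq_iff)
  have u: "(\<lambda>j. ((v(i := a)) j, 0::real)) = (\<lambda>j. (v j, 0))(i := (a, 0))" for i a by auto
  have d: "dder (\<lambda>x. \<beta> ?C (x, 1) w) x a = dder (\<lambda>y. \<beta> ?C y w) (x, 1) (a, 0)" for w a
    by (rule smooth_on_at_1(2)[OF c form_field_smooth[OF b cone_chart_in[OF c]] x])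
  have r: "restrict_field (reeb J 3) c = (\<lambda>x. fst (?Y (x, 1)))"
    by (simp add: restrict_field_def[abs_def] reeb_eq[OF c])
  show ?thesis
    unfolding lie_form_def r restrict_form_def d f u p p2 reeb_eq[OF c] by (simp only: p p2)
qed

definition "sOmega = restrict_form cone_Omega"
definition "somega = restrict_form cone_omega"
definition "sth = restrict_form (eta_etabar g J)"

lemma basic_restrict:
  assumes b: "form_field AC k \<beta>"
    and l: "\<And>c y v. c \<in> A \<Longrightarrow> y \<in> fst (cone_chart c) \<Longrightarrow> lie_form k (reeb J 3) \<beta> (cone_chart c) y v = 0"
    and k: "\<And>c x v. c \<in> A \<Longrightarrow> x \<in> fst c \<Longrightarrow>
      \<beta> (cone_chart c) (x, 1) (case_nat (cxi c 3 (x, 1)) (\<lambda>i. (v i, 0))) = 0"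
  shows "basic_form A (restrict_field (reeb J 3)) k (restrict_form \<beta>)"
  unfolding basic_form_def
proof (intro conjI ballI allI)
  show "form_field A k (restrict_form \<beta>)" by (rule form_field_restrict[OF b])
next
  fix c x v assume c: "c \<in> A" and x: "x \<in> fst c"
  interpret hk_chart "fst (cone_chart c)" "g c" "cG c" "cJ c" by (rule chart[OF c])
  have "(fst (xi 3 (x, 1)), 0) = xi 3 (x, 1)"
    using snd_xi[OF index_123(3) one_in_cone[OF c x]] by (simp add: prod_eq_iff)
  then have "(\<lambda>i. (case_nat (restrict_field (reeb J 3) c x) v i, 0::real)) = case_nat (xi 3 (x, 1)) (\<lambda>i. (v i, 0))"
    by (auto simp: restrict_field_def reeb_eq[OF c] fun_eq_iff split: nat.splits)
  then show "contract (restrict_field (reeb J 3) c x) (restrict_form \<beta> c x) v = 0"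
    unfolding contract_def restrict_form_def using k[OF c x, of v] by simp
  show "lie_form k (restrict_field (reeb J 3)) (restrict_form \<beta>) c x v = 0"
    unfolding lie_form_restrict[OF b c x] by (rule l[OF c one_in_cone[OF c x]])
qed


abbreviation "Yf \<equiv> restrict_field (reeb J 3)"

text \<open>The restrictions to \<open>{r = 1}\<close> of \<open>\<eta>\<close>, \<open>\<eta>\<^sub>3\<close>, \<open>\<omega>\<^sub>1 + \<i> \<omega>\<^sub>2\<close> and \<open>\<omega>\<^sub>3\<close>.\<close>

definition et :: "(real^7, 's) chart \<Rightarrow> real^7 \<Rightarrow> real^7 \<Rightarrow> complex" where
  "et c x u = complex_of_real (cth c 1 (x, 1) (u, 0)) + \<i> * complex_of_real (cth c 2 (x, 1) (u, 0))"

definition tt :: "(real^7, 's) chart \<Rightarrow> real^7 \<Rightarrow> real^7 \<Rightarrow> complex" where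
  "tt c x u = complex_of_real (cth c 3 (x, 1) (u, 0))"

definition us :: "(real^7, 's) chart \<Rightarrow> real^7 \<Rightarrow> real^7 \<Rightarrow> real^7 \<Rightarrow> complex" where
  "us c x u w = cups c (x, 1) (u, 0) (w, 0)"

definition o3 :: "(real^7, 's) chart \<Rightarrow> real^7 \<Rightarrow> real^7 \<Rightarrow> real^7 \<Rightarrow> complex" where
  "o3 c x u w = complex_of_real (com c 3 (x, 1) (u, 0) (w, 0))"

lemma Yf_eq: "c \<in> A \<Longrightarrow> x \<in> fst c \<Longrightarrow> (Yf c x, 0) = cxi c 3 (x, 1)"
  using hk_chart.snd_xi[OF chart _ one_in_cone, of c 3 x] by (simp add: prod_eq_iff restrict_field_def reeb_eq)

lemma Yf_smooth: "c \<in> A \<Longrightarrow> smooth_on (fst c) (Yf c)"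
proof -
  assume c: "c \<in> A"
  have "smooth_on (fst c) (\<lambda>x. fst (cxi c 3 (x, 1)))"
    by (rule smooth_on_at_1(1)[OF c smooth_on_linear[OF open_cone_chart[OF c] linear_fst
          hk_chart.xi_smooth[OF chart[OF c] hk_chart.index_123(3)[OF chart[OF c]]]]])
  then show ?thesis by (simp add: restrict_field_def[abs_def] reeb_eq[OF c])
qed

lemma et_linear: "c \<in> A \<Longrightarrow> x \<in> fst c \<Longrightarrow> linear (et c x)"
  and tt_linear: "c \<in> A \<Longrightarrow> x \<in> fst c \<Longrightarrow> linear (tt c x)"
proof -
  assume c: "c \<in> A" and x: "x \<in> fst c"
  have "linear (\<lambda>u. cth c i (x, 1) (u, 0))" for i
    using linear_compose[OF _ hk_chart.th_linear[OF chart[OF c] one_in_cone[OF c x]], of "\<lambda>u. (u, 0)" i]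
    by (simp add: o_def linear_iff)
  then show "linear (et c x)" "linear (tt c x)"
    unfolding et_def[abs_def] tt_def[abs_def] linear_iff
    by (simp_all add: scaleR_conv_of_real algebra_simps)
qed

lemma th_smooth_at_1:
  assumes "c \<in> A" "i \<in> {1..3}"
  shows "smooth_on (fst c) (\<lambda>x. cth c i (x, 1) (u, 0))"
    "x \<in> fst c \<Longrightarrow> dder (\<lambda>x. cth c i (x, 1) (u, 0)) x v - dder (\<lambda>x. cth c i (x, 1) (v, 0)) x u
      = 2 * com c i (x, 1) (v, 0) (u, 0)"
proof -
  note s = hk_chart.th_smooth[OF chart[OF assms(1)] assms(2)]
  show "smooth_on (fst c) (\<lambda>x. cth c i (x, 1) (u, 0))"
    by (rule smooth_on_at_1(1)[OF assms(1) s])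
  assume x: "x \<in> fst c"
  show "dder (\<lambda>x. cth c i (x, 1) (u, 0)) x v - dder (\<lambda>x. cth c i (x, 1) (v, 0)) x u
      = 2 * com c i (x, 1) (v, 0) (u, 0)"
    unfolding smooth_on_at_1(2)[OF assms(1) s x]
    by (rule hk_chart.d_th[OF chart[OF assms(1)] assms(2) one_in_cone[OF assms(1) x]])
qed

lemma et_smooth: "c \<in> A \<Longrightarrow> smooth_on (fst c) (\<lambda>x. et c x u)"
  and tt_smooth: "c \<in> A \<Longrightarrow> smooth_on (fst c) (\<lambda>x. tt c x u)"
proof -
  assume c: "c \<in> A"
  note o = chart_open[OF c]
  show "smooth_on (fst c) (\<lambda>x. et c x u)" unfolding et_def
    by (intro smooth_on_add[OF o] smooth_on_mult[OF o] smooth_on_const smooth_on_of_real[OF o] th_smooth_at_1(1)[OF c]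
        hk_chart.index_123[OF chart[OF c]])
  show "smooth_on (fst c) (\<lambda>x. tt c x u)" unfolding tt_def
    by (intro smooth_on_of_real[OF o] th_smooth_at_1(1)[OF c] hk_chart.index_123[OF chart[OF c]])
qed

lemma d_et:
  assumes c: "c \<in> A" and x: "x \<in> fst c"
  shows "dder (\<lambda>x. et c x u) x v - dder (\<lambda>x. et c x v) x u = 2 * us c x v u"
    and "dder (\<lambda>x. tt c x u) x v - dder (\<lambda>x. tt c x v) x u = 2 * o3 c x v u"
proof -
  note o = chart_open[OF c] and i = hk_chart.index_123[OF chart[OF c]]
  have d: "(\<lambda>x. cth c i (x, 1) (u, 0)) differentiable (at x)" if "i \<in> {1..3}" for i u
    by (rule smooth_on_differentiable[OF th_smooth_at_1(1)[OF c that] x])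
  have r: "(\<lambda>x. complex_of_real (cth c i (x, 1) (u, 0))) differentiable (at x)" if "i \<in> {1..3}" for i u
    by (rule smooth_on_differentiable[OF smooth_on_of_real[OF o th_smooth_at_1(1)[OF c that]] x])
  have r2: "(\<lambda>x. \<i> * complex_of_real (cth c 2 (x, 1) (u, 0))) differentiable (at x)" for u
    by (intro differentiable_mult differentiable_const r i)
  have e: "dder (\<lambda>x. et c x u) x v = complex_of_real (dder (\<lambda>x. cth c 1 (x, 1) (u, 0)) x v)
      + \<i> * complex_of_real (dder (\<lambda>x. cth c 2 (x, 1) (u, 0)) x v)" for u v
    unfolding et_def dder_add[OF r[OF i(1)] r2] dder_cmult[OF r[OF i(2)]] dder_of_real[OF d[OF i(1)]]
      dder_of_real[OF d[OF i(2)]] ..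
  have t: "dder (\<lambda>x. tt c x u) x v = complex_of_real (dder (\<lambda>x. cth c 3 (x, 1) (u, 0)) x v)" for u v
    unfolding tt_def dder_of_real[OF d[OF i(3)]] ..
  note h = arg_cong[OF th_smooth_at_1(2)[OF c _ x, of _ u v], of _ complex_of_real]
  show "dder (\<lambda>x. et c x u) x v - dder (\<lambda>x. et c x v) x u = 2 * us c x v u"
    using h[OF i(1)] h[OF i(2)] unfolding e us_def hk_chart.ups_def[OF chart[OF c]] of_real_diff of_real_mult of_real_numeral
    by algebra
  show "dder (\<lambda>x. tt c x u) x v - dder (\<lambda>x. tt c x v) x u = 2 * o3 c x v u"
    using h[OF i(3)] unfolding t o3_def by simp
qed

text \<open>The contraction \<open>\<i> et\<close> of \<open>us\<close> is what the term
  \<open>\<i> et \<and> tt\<close> in the restriction of \<open>Psi\<close> compensates.\<close>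

lemma at_Yf:
  assumes c: "c \<in> A" and x: "x \<in> fst c"
  shows "et c x (Yf c x) = 0" "tt c x (Yf c x) = 1" "us c x (Yf c x) w = \<i> * et c x w" "o3 c x (Yf c x) w = 0"
    "us c x w (Yf c x) = - \<i> * et c x w"
proof -
  interpret hk_chart "fst (cone_chart c)" "g c" "cG c" "cJ c" by (rule chart[OF c])
  note y = one_in_cone[OF c x]
  show "et c x (Yf c x) = 0" "tt c x (Yf c x) = 1"
    unfolding et_def tt_def Yf_eq[OF c x] th_xi3[OF y] by simp_all
  show 1: "us c x (Yf c x) w = \<i> * et c x w" for w
    unfolding us_def et_def Yf_eq[OF c x] ups_def om_xi3[OF y] by (simp add: algebra_simps)
  show "o3 c x (Yf c x) w = 0"
    unfolding o3_def Yf_eq[OF c x] om_xi3[OF y] by simp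
  show "us c x w (Yf c x) = - \<i> * et c x w"
    using 1[of w] ups_skew[OF y, of "(w, 0)" "(Yf c x, 0)"] by (simp add: us_def)
qed

lemma us_skew: "c \<in> A \<Longrightarrow> x \<in> fst c \<Longrightarrow> us c x v w = - us c x w v"
  unfolding us_def by (rule hk_chart.ups_skew[OF chart one_in_cone])

lemma coframe_restricted:
  assumes c: "c \<in> A" and x: "x \<in> fst c"
  shows "\<exists>al be. linear al \<and> linear be \<and>
    (\<forall>v w. us c x v w = al v * be w - al w * be v - \<i> * (et c x v * tt c x w - et c x w * tt c x v)) \<and>
    (\<forall>v w. o3 c x v w = \<i> / 2 * (al v * cnj (al w) - al w * cnj (al v)
         + (be v * cnj (be w) - be w * cnj (be v)) + (et c x v * cnj (et c x w) - et c x w * cnj (et c x v)))) \<and>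
    (\<forall>v w. complex_of_real (g c x v w) - tt c x v * tt c x w
       = complex_of_real (Re (al v * cnj (al w) + be v * cnj (be w) + et c x v * cnj (et c x w)))) \<and>
    (\<forall>v. al v = 0 \<longrightarrow> be v = 0 \<longrightarrow> et c x v = 0 \<longrightarrow> v = cth c 3 (x, 1) (v, 0) *\<^sub>R Yf c x)"
proof -
  note y = one_in_cone[OF c x]
  have "DIM(real^7) = 7" by simp
  from hk_chart.complex_coframe[OF chart[OF c] y this snd_conv]
  obtain al be where ab: "linear al" "linear be"
    "\<And>v w. snd v = 0 \<Longrightarrow> snd w = 0 \<Longrightarrow> complex_of_real (com c 1 (x, 1) v w) + \<i> * complex_of_real (com c 2 (x, 1) v w) =
         al v * be w - al w * be v - \<i> * ((complex_of_real (cth c 1 (x, 1) v) + \<i> * complex_of_real (cth c 2 (x, 1) v)) * complex_of_real (cth c 3 (x, 1) w)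
           - (complex_of_real (cth c 1 (x, 1) w) + \<i> * complex_of_real (cth c 2 (x, 1) w)) * complex_of_real (cth c 3 (x, 1) v))"
    "\<And>v w. snd v = 0 \<Longrightarrow> snd w = 0 \<Longrightarrow> complex_of_real (com c 3 (x, 1) v w) = \<i> / 2 * (al v * cnj (al w) - al w * cnj (al v)
         + (be v * cnj (be w) - be w * cnj (be v)) +
        ((complex_of_real (cth c 1 (x, 1) v) + \<i> * complex_of_real (cth c 2 (x, 1) v)) * cnj (complex_of_real (cth c 1 (x, 1) w) + \<i> * complex_of_real (cth c 2 (x, 1) w))
        - (complex_of_real (cth c 1 (x, 1) w) + \<i> * complex_of_real (cth c 2 (x, 1) w)) * cnj (complex_of_real (cth c 1 (x, 1) v) + \<i> * complex_of_real (cth c 2 (x, 1) v))))"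
    "\<And>v w. snd v = 0 \<Longrightarrow> snd w = 0 \<Longrightarrow> complex_of_real (cG c (x, 1) v w - cth c 3 (x, 1) v * cth c 3 (x, 1) w)
      = complex_of_real (Re (al v * cnj (al w) + be v * cnj (be w) +
        (complex_of_real (cth c 1 (x, 1) v) + \<i> * complex_of_real (cth c 2 (x, 1) v)) * cnj (complex_of_real (cth c 1 (x, 1) w) + \<i> * complex_of_real (cth c 2 (x, 1) w))))"
    "\<And>v. snd v = 0 \<Longrightarrow> al v = 0 \<Longrightarrow> be v = 0 \<Longrightarrow> complex_of_real (cth c 1 (x, 1) v) + \<i> * complex_of_real (cth c 2 (x, 1) v) = 0
      \<Longrightarrow> v = cth c 3 (x, 1) v *\<^sub>R cxi c 3 (x, 1)"
    by blast
  have L: "linear (\<lambda>u::real^7. (u, 0::real))" by (simp add: linear_iff)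
  show ?thesis
  proof (rule exI[of _ "\<lambda>u. al (u, 0)"], rule exI[of _ "\<lambda>u. be (u, 0)"], intro conjI allI impI)
    show "linear (\<lambda>u. al (u, 0))" using linear_compose[OF L ab(1)] by (simp add: o_def)
    show "linear (\<lambda>u. be (u, 0))" using linear_compose[OF L ab(2)] by (simp add: o_def)
  next
    fix v w
    show "us c x v w = al (v, 0) * be (w, 0) - al (w, 0) * be (v, 0) - \<i> * (et c x v * tt c x w - et c x w * tt c x v)"
      unfolding us_def et_def tt_def hk_chart.ups_def[OF chart[OF c]] by (rule ab(3)) simp_all
    show "o3 c x v w = \<i> / 2 * (al (v, 0) * cnj (al (w, 0)) - al (w, 0) * cnj (al (v, 0))
         + (be (v, 0) * cnj (be (w, 0)) - be (w, 0) * cnj (be (v, 0))) + (et c x v * cnj (et c x w) - et c x w * cnj (et c x v)))"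
      unfolding o3_def et_def by (rule ab(4)) simp_all
    have "g c x v w = cG c (x, 1) (v, 0) (w, 0)" by (simp add: cone_metric_def)
    then show "complex_of_real (g c x v w) - tt c x v * tt c x w
       = complex_of_real (Re (al (v, 0) * cnj (al (w, 0)) + be (v, 0) * cnj (be (w, 0)) + et c x v * cnj (et c x w)))"
      unfolding tt_def et_def using ab(5)[of "(v, 0)" "(w, 0)"] by simp
  next
    fix v assume z: "al (v, 0) = 0" "be (v, 0) = 0" "et c x v = 0"
    have "(v, 0) = cth c 3 (x, 1) (v, 0) *\<^sub>R cxi c 3 (x, 1)"
      by (rule ab(6)[OF _ z(1,2)]) (use z(3) in \<open>simp_all add: et_def\<close>)
    then have "(v, 0) = cth c 3 (x, 1) (v, 0) *\<^sub>R (Yf c x, 0::real)"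
      by (simp only: Yf_eq[OF c x])
    then show "v = cth c 3 (x, 1) (v, 0) *\<^sub>R Yf c x"
      by (metis fst_conv fst_scaleR)
  qed
qed

lemma eta_restricted: "c \<in> A \<Longrightarrow> x \<in> fst c \<Longrightarrow> eta g J (cone_chart c) (x, 1) (\<lambda>i. (v i, 0)) = et c x (v 0)"
  by (simp only: eta_eq one_in_cone et_def)

lemma eta_etabar_restricted:
  assumes c: "c \<in> A" and x: "x \<in> fst c"
  shows "sth c x v = et c x (v 0) * cnj (et c x (v 1)) - et c x (v 1) * cnj (et c x (v 0))"
proof -
  have "sth c x v = wedge 1 1 (\<lambda>v. eta g J (cone_chart c) (x, 1) (\<lambda>i. (v i, 0)))
      (\<lambda>v. conj_form (eta g J) (cone_chart c) (x, 1) (\<lambda>i. (v i, 0))) v"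
    unfolding sth_def restrict_form_def eta_etabar_def by (rule wedge_pullback[symmetric])
  also have "\<dots> = wedge 1 1 (\<lambda>v. et c x (v 0)) (\<lambda>v. cnj (et c x (v 0))) v"
    unfolding conj_form_def eta_restricted[OF c x] ..
  finally show ?thesis unfolding wedge_1_1[of "et c x" "\<lambda>u. cnj (et c x u)"] .
qed

lemma somega_eq:
  assumes c: "c \<in> A" and x: "x \<in> fst c"
  shows "somega c x v = o3 c x (v 0) (v 1) - \<i> * (et c x (v 0) * cnj (et c x (v 1)) - et c x (v 1) * cnj (et c x (v 0)))"
proof -
  have "somega c x v = kf 3 (cone_chart c) (x, 1) (\<lambda>i. (v i, 0)) + (- \<i>) * sth c x v"
    by (simp add: somega_def restrict_form_def cone_omega_def sth_def)
  then show ?thesis unfolding eta_etabar_restricted[OF c x] kf_eq[OF c] o3_def by simp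
qed

lemma Psi_restricted:
  assumes c: "c \<in> A" and x: "x \<in> fst c"
  shows "Psi (cone_chart c) (x, 1) (\<lambda>i. (v i, 0)) = us c x (v 0) (v 1) + \<i> * (et c x (v 0) * tt c x (v 1) - et c x (v 1) * tt c x (v 0))"
proof -
  have "wedge 1 1 (eta g J (cone_chart c) (x, 1)) (thf 3 (cone_chart c) (x, 1)) (\<lambda>i. (v i, 0)) =
     wedge 1 1 (\<lambda>v. eta g J (cone_chart c) (x, 1) (\<lambda>i. (v i, 0))) (\<lambda>v. thf 3 (cone_chart c) (x, 1) (\<lambda>i. (v i, 0))) v"
    by (rule wedge_pullback[symmetric])
  also have "\<dots> = wedge 1 1 (\<lambda>v. et c x (v 0)) (\<lambda>v. tt c x (v 0)) v"
    unfolding eta_restricted[OF c x] thf_eq[OF c] tt_def ..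
  finally show ?thesis unfolding wedge_1_1 Psi_def Upsilon_ups[OF c] us_def by simp
qed

lemma sOmega_eq:
  assumes c: "c \<in> A" and x: "x \<in> fst c"
  shows "sOmega c x v = wedge 1 2 (\<lambda>v. cnj (et c x (v 0)))
    (\<lambda>v. us c x (v 0) (v 1) + \<i> * (et c x (v 0) * tt c x (v 1) - et c x (v 1) * tt c x (v 0))) v"
proof -
  have "sOmega c x v = wedge 1 2 (\<lambda>v. conj_form (eta g J) (cone_chart c) (x, 1) (\<lambda>i. (v i, 0)))
     (\<lambda>v. Psi (cone_chart c) (x, 1) (\<lambda>i. (v i, 0))) v"
    unfolding sOmega_def restrict_form_def cone_Omega_def by (rule wedge_pullback[symmetric])
  then show ?thesis unfolding conj_form_def eta_restricted[OF c x] Psi_restricted[OF c x] .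
qed

lemma basic_sth: "basic_form A Yf 2 sth"
  unfolding sth_def
proof (rule basic_restrict[OF form_field_eta_etabar lie_eta_etabar])
  fix c x and v :: "nat \<Rightarrow> real^7" assume c: "c \<in> A" and x: "x \<in> fst c"
  have "sth c x (case_nat (Yf c x) v) = 0"
    unfolding eta_etabar_restricted[OF c x] by (simp add: at_Yf[OF c x])
  moreover have "(\<lambda>i. (case_nat (Yf c x) v i, 0::real)) = case_nat (cxi c 3 (x, 1)) (\<lambda>i. (v i, 0))"
    by (rule ext) (simp add: Yf_eq[OF c x, symmetric] split: nat.splits)
  ultimately show "eta_etabar g J (cone_chart c) (x, 1) (case_nat (cxi c 3 (x, 1)) (\<lambda>i. (v i, 0))) = 0"
    by (simp add: sth_def restrict_form_def)
qed

lemma basic_somega: "basic_form A Yf 2 somega"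
  unfolding somega_def
proof (rule basic_restrict[OF form_field_cone_omega lie_cone_omega])
  fix c x and v :: "nat \<Rightarrow> real^7" assume c: "c \<in> A" and x: "x \<in> fst c"
  have "somega c x (case_nat (Yf c x) v) = 0"
    unfolding somega_eq[OF c x] by (simp add: at_Yf[OF c x])
  moreover have "(\<lambda>i. (case_nat (Yf c x) v i, 0::real)) = case_nat (cxi c 3 (x, 1)) (\<lambda>i. (v i, 0))"
    by (rule ext) (simp add: Yf_eq[OF c x, symmetric] split: nat.splits)
  ultimately show "cone_omega (cone_chart c) (x, 1) (case_nat (cxi c 3 (x, 1)) (\<lambda>i. (v i, 0))) = 0"
    by (simp add: somega_def restrict_form_def)
qed

lemma basic_sOmega: "basic_form A Yf 3 sOmega"
  unfolding sOmega_def
proof (rule basic_restrict[OF form_field_cone_Omega lie_cone_Omega])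
  fix c x and v :: "nat \<Rightarrow> real^7" assume c: "c \<in> A" and x: "x \<in> fst c"
  have sk: "us c x u w + \<i> * (et c x u * tt c x w - et c x w * tt c x u)
      = - (us c x w u + \<i> * (et c x w * tt c x u - et c x u * tt c x w))" for u w
    using us_skew[OF c x, of u w] by (simp add: algebra_simps)
  have "sOmega c x (case_nat (Yf c x) v) = 0"
    unfolding sOmega_eq[OF c x]
    by (subst wedge_1_2[of "\<lambda>v w. us c x v w + \<i> * (et c x v * tt c x w - et c x w * tt c x v)", OF sk])
      (simp add: at_Yf[OF c x] numeral_2_eq_2)
  moreover have "(\<lambda>i. (case_nat (Yf c x) v i, 0::real)) = case_nat (cxi c 3 (x, 1)) (\<lambda>i. (v i, 0))"
    by (rule ext) (simp add: Yf_eq[OF c x, symmetric] split: nat.splits)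
  ultimately show "cone_Omega (cone_chart c) (x, 1) (case_nat (cxi c 3 (x, 1)) (\<lambda>i. (v i, 0))) = 0"
    by (simp add: sOmega_def restrict_form_def)
qed

lemma omega_twist_restricted:
  assumes c: "c \<in> A" and x: "x \<in> fst c"
  shows "restrict_form (omega_twist g J) c x v = somega c x v"
proof -
  interpret hk_chart "fst (cone_chart c)" "g c" "cG c" "cJ c" by (rule chart[OF c])
  note y = one_in_cone[OF c x]
  \<comment> \<open>At \<open>r = 1\<close> the squared norm of \<open>\<eta>\<close> is 1: the
    values of \<open>eta\<close> on \<open>xi 1\<close> and \<open>xi 2\<close> are 1 and
    \<open>\<i>\<close>.\<close>
  have "etabar_contract J (eta g J) (cone_chart c) (x, 1) (\<lambda>_. 0) = 1"
    unfolding etabar_contract_def contract_def eta_eq[OF c y] reeb_eq[OF c] nat.case th_xi[OF y]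
    by simp
  then show ?thesis
    by (simp add: restrict_form_def omega_twist_def somega_def cone_omega_def)
qed

text \<open>Contracting \<open>Omega4\<close> with \<open>\<xi>\<^sub>3\<close> and then with
  \<open>(\<xi>\<^sub>1 - \<i> \<xi>\<^sub>2) / 2\<close> gives \<open>\<i>\<close> times
  \<open>Psi\<close> at \<open>r = 1\<close>; the prefactor \<open>- \<i>\<close> in
  \<open>Omega_twist\<close> removes this factor.\<close>

lemma Omega_twist_restricted:
  assumes c: "c \<in> A" and x: "x \<in> fst c"
  shows "restrict_form (Omega_twist g J) c x v = sOmega c x v"
proof -
  interpret hk_chart "fst (cone_chart c)" "g c" "cG c" "cJ c" by (rule chart[OF c])
  note y = one_in_cone[OF c x]
  let ?Q = "etabar_contract J (\<lambda>C y. contract (reeb J 3 C y) (Omega4 g J C y)) (cone_chart c) (x, 1)"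
  have O4: "Omega4 g J (cone_chart c) (x, 1) w = cups c (x, 1) (w 0) (w 1) * cups c (x, 1) (w 2) (w 3)
     - cups c (x, 1) (w 0) (w 2) * cups c (x, 1) (w 1) (w 3) + cups c (x, 1) (w 0) (w 3) * cups c (x, 1) (w 1) (w 2)" for w
    by (rule mult_left_cancel[THEN iffD1, OF _ Omega4_eq[OF c y, of w]]) simp
  have Q: "?Q (\<lambda>i. (v i, 0)) = \<i> * (us c x (v 0) (v 1) + \<i> * (et c x (v 0) * tt c x (v 1) - et c x (v 1) * tt c x (v 0)))" for v
  proof -
    have n: "(1::nat) = Suc 0" "(2::nat) = Suc (Suc 0)" "(3::nat) = Suc (Suc (Suc 0))" by simp_all
    have u3: "ups (x, 1) (xi 3 (x, 1)) w = \<i> * (complex_of_real (th 1 (x, 1) w) + \<i> * complex_of_real (th 2 (x, 1) w))" for w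
      unfolding ups_def om_xi3[OF y] by (simp add: algebra_simps)
    have u1: "ups (x, 1) (xi 1 (x, 1)) (w, 0) = - \<i> * tt c x w" for w
      unfolding ups_def om_xi12[OF y] tt_def by simp
    have u2: "ups (x, 1) (xi 2 (x, 1)) (w, 0) = tt c x w" for w
      unfolding ups_def om_xi12[OF y] tt_def by simp
    \<comment> \<open>Hence \<open>ups\<close> takes the value \<open>\<i>\<close> on
      \<open>xi 3\<close> and the complex vector \<open>(xi 1 - \<i> xi 2) / 2\<close>; this becomes
      the coefficient of \<open>us\<close>.\<close>
    have u31: "ups (x, 1) (xi 3 (x, 1)) (xi 1 (x, 1)) = \<i>" "ups (x, 1) (xi 3 (x, 1)) (xi 2 (x, 1)) = -1"
      unfolding u3 th_xi[OF y] by simp_all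
    have u3': "ups (x, 1) (xi 3 (x, 1)) (w, 0) = \<i> * et c x w" for w
      unfolding u3 et_def ..
    have a: "Omega4 g J (cone_chart c) (x, 1) (case_nat a (case_nat b (\<lambda>i. (v i, 0)))) =
       ups (x, 1) a b * us c x (v 0) (v 1) - ups (x, 1) a (v 0, 0) * ups (x, 1) b (v 1, 0) + ups (x, 1) a (v 1, 0) * ups (x, 1) b (v 0, 0)" for a b
      unfolding O4 us_def by (simp add: eval_nat_numeral)
    have "?Q (\<lambda>i. (v i, 0)) = (\<i> * us c x (v 0) (v 1) - \<i> * et c x (v 0) * (- \<i> * tt c x (v 1)) + \<i> * et c x (v 1) * (- \<i> * tt c x (v 0))
       - \<i> * (- us c x (v 0) (v 1) - \<i> * et c x (v 0) * tt c x (v 1) + \<i> * et c x (v 1) * tt c x (v 0))) / 2"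
      unfolding etabar_contract_def contract_def reeb_eq[OF c] a u31 u1 u2 u3' by (simp add: mult.assoc)
    also have "\<dots> = \<i> * (us c x (v 0) (v 1) + \<i> * (et c x (v 0) * tt c x (v 1) - et c x (v 1) * tt c x (v 0)))"
      by (simp add: field_simps)
    finally show ?thesis .
  qed
  have "restrict_form (Omega_twist g J) c x v = - \<i> * wedge 1 2 (\<lambda>v. conj_form (eta g J) (cone_chart c) (x, 1) (\<lambda>i. (v i, 0)))
     (\<lambda>v. ?Q (\<lambda>i. (v i, 0))) v"
    unfolding restrict_form_def Omega_twist_def
    by (rule arg_cong[where f = "\<lambda>z. - \<i> * z"], rule wedge_pullback[symmetric])
  also have "\<dots> = sOmega c x v"
    unfolding Q conj_form_def eta_restricted[OF c x] wedge_scale_right sOmega_eq[OF c x] by (simp add: mult.assoc[symmetric])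
  finally show ?thesis .
qed

lemma basic_form_cong:
  assumes e: "\<And>c x v. c \<in> A \<Longrightarrow> x \<in> fst c \<Longrightarrow> \<alpha> c x v = \<beta> c x v" and b: "basic_form A Y k \<alpha>"
  shows "basic_form A Y k \<beta>"
  unfolding basic_form_def
proof (intro conjI ballI allI)
  show "form_field A k \<beta>"
    by (rule form_field_cong[OF open_charts e]) (use b in \<open>simp_all add: basic_form_def\<close>)
next
  fix c x v assume c: "c \<in> A" and x: "x \<in> fst c"
  have z: "contract (Y c x) (\<alpha> c x) v = 0" "lie_form k Y \<alpha> c x v = 0"
    using b c x unfolding basic_form_def by blast+
  show "contract (Y c x) (\<beta> c x) v = 0"
    using z(1) e[OF c x] by (simp add: contract_def)
  have "lie_form k Y \<alpha> c x v = lie_form k Y \<beta> c x v"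
    by (rule lie_form_cong[OF chart_open[OF c] x]) (rule e[OF c])
  then show "lie_form k Y \<beta> c x v = 0" using z(2) by simp
qed

lemma basic_omega_twist: "basic_form A Yf 2 (restrict_form (omega_twist g J))"
  by (rule basic_form_cong[OF omega_twist_restricted[symmetric] basic_somega])

lemma basic_Omega_twist: "basic_form A Yf 3 (restrict_form (Omega_twist g J))"
  by (rule basic_form_cong[OF Omega_twist_restricted[symmetric] basic_sOmega])

end

section \<open>Basic forms and the leaf space\<close>

text \<open>The sequence need not lie on a line; it is enough that the increments converge after
  division by \<open>e n\<close>. The remainder divided by the distance to \<open>p\<close> extends
  continuously to \<open>p\<close> by 0, which also covers indices with
  \<open>q n = p\<close>.\<close>

lemma sequential_derivative:
  fixes F :: "'a::real_normed_vector \<Rightarrow> 'b::real_normed_vector"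
  assumes F: "(F has_derivative F') (at p)" and q: "q \<longlonglongrightarrow> p"
    and lim: "(\<lambda>n. (q n - p) /\<^sub>R e n) \<longlonglongrightarrow> w"
    and e: "\<And>n. e n > (0::real)"
  shows "(\<lambda>n. (F (q n) - F p) /\<^sub>R e n) \<longlonglongrightarrow> F' w"
proof -
  define R where "R y = ((F y - F p) - F' (y - p)) /\<^sub>R norm (y - p)" for y
  have bl: "bounded_linear F'" and "(R \<longlongrightarrow> 0) (at p)"
    using F unfolding has_derivative_at_within R_def[abs_def] by auto
  then have "isCont R p" by (simp add: isCont_def R_def)
  from isCont_tendsto_compose[OF this q] have R: "(\<lambda>n. R (q n)) \<longlonglongrightarrow> 0" by (simp add: R_def)
  have F0: "F' 0 = 0" using bl by (rule linear_simps(3))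
  have "(F (q n) - F p) /\<^sub>R e n = F' ((q n - p) /\<^sub>R e n) + norm ((q n - p) /\<^sub>R e n) *\<^sub>R R (q n)" for n
  proof -
    have "F (q n) - F p = F' (q n - p) + norm (q n - p) *\<^sub>R R (q n)"
      by (cases "q n = p") (simp_all add: R_def F0)
    then show ?thesis using e[of n]
      by (simp add: linear_simps(5)[OF bl] scaleR_add_right mult.commute)
  qed
  moreover have "(\<lambda>n. F' ((q n - p) /\<^sub>R e n) + norm ((q n - p) /\<^sub>R e n) *\<^sub>R R (q n)) \<longlonglongrightarrow> F' w + norm w *\<^sub>R 0"
    by (intro tendsto_add tendsto_scaleR tendsto_norm lim R bounded_linear.tendsto[OF bl])
  ultimately show ?thesis by simp
qed

text \<open>A proper subspace is a null set, and so is a finite union of them.\<close>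

lemma finite_subspace_cover:
  fixes V :: "'i \<Rightarrow> 'a::euclidean_space set"
  assumes "finite I" "\<And>i. i \<in> I \<Longrightarrow> subspace (V i)" "(\<Union>i\<in>I. V i) = UNIV"
  shows "\<exists>i\<in>I. V i = UNIV"
proof (rule ccontr)
  assume n: "\<not> (\<exists>i\<in>I. V i = UNIV)"
  have "negligible (V i)" if i: "i \<in> I" for i
  proof (rule negligible_lowdim)
    have "span (V i) = V i" by (rule span_eq_iff[THEN iffD2, OF assms(2)[OF i]])
    then have "dim (V i) \<noteq> DIM('a)" using n i dim_eq_full[of "V i"] by metis
    then show "dim (V i) < DIM('a)" using dim_subset_UNIV[of "V i"] by linarith
  qed
  then have "negligible (\<Union> (V ` I))" using assms(1) by (intro negligible_Union) auto
  then have "negligible (UNIV :: 'a set)" using assms(3) by simp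
  then show False by simp
qed

lemma finite_cis_fibre: "finite {t \<in> {0..2 * pi}. cis t = z}"
proof (cases "{t \<in> {0..2 * pi}. cis t = z} = {}")
  case False
  then obtain t0 where t0: "0 \<le> t0" "t0 \<le> 2 * pi" "cis t0 = z" by auto
  have "{t \<in> {0..2 * pi}. cis t = z} \<subseteq> {t0, t0 + 2 * pi, t0 - 2 * pi}"
  proof
    fix t assume "t \<in> {t \<in> {0..2 * pi}. cis t = z}"
    then have t: "0 \<le> t" "t \<le> 2 * pi" "cis t = cis t0" using t0 by auto
    then have "sin t = sin t0 \<and> cos t = cos t0" by (simp add: complex_eq_iff)
    then obtain n :: int where n: "t = t0 + 2 * pi * n" using sin_cos_eq_iff by blast
    have "2 * pi * of_int n = t - t0" using n by simp
    then have "2 * pi * of_int n \<le> 2 * pi * 1" "2 * pi * (-1) \<le> 2 * pi * of_int n"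
      using t(1,2) t0(1,2) by linarith+
    then have "real_of_int n \<le> 1" "-1 \<le> real_of_int n"
      by (simp_all only: mult_le_cancel_left) (use pi_gt_zero in auto)
    then have "n = 1 \<or> n = 0 \<or> n = -1" by linarith
    then show "t \<in> {t0, t0 + 2 * pi, t0 - 2 * pi}" using n by auto
  qed
  then show ?thesis by (rule finite_subset) simp
next
  case True
  then show ?thesis by (simp only: finite.emptyI)
qed

lemma cis_surj: "z \<in> sphere 0 1 \<Longrightarrow> \<exists>t\<in>{0..2 * pi}. z = cis t"
  using complex_unimodular_polar[of z] by (metis atLeastAtMost_iff cis.ctr dist_0_norm less_imp_le mem_sphere)

lemma cis_in_sphere: "cis t \<in> sphere 0 1"
  by simp

text \<open>Finiteness of the stabilizers is what regular and quasi-regular actions have in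
  common.\<close>

locale circle_manifold =
  fixes X :: "'m topology" and A :: "('e::euclidean_space, 'm) chart set" and Y :: "('e, 'm) vfield"
    and \<rho> :: "complex \<Rightarrow> 'm \<Rightarrow> 'm"
  assumes mf: "smooth_manifold X A" and action: "circle_action X A \<rho>" and flow: "integrates_to A Y \<rho>"
    and finite_stabilizers: "p \<in> topspace X \<Longrightarrow> finite {z \<in> sphere 0 1. \<rho> z p = p}"
    and Y_smooth: "c \<in> A \<Longrightarrow> smooth_on (fst c) (Y c)"
    and Y_nonzero: "c \<in> A \<Longrightarrow> x \<in> fst c \<Longrightarrow> Y c x \<noteq> 0"
begin

lemma dom_open: "c \<in> A \<Longrightarrow> open (fst c)"
  using mf by (simp add: smooth_manifold_def)

lemma range_open: "c \<in> A \<Longrightarrow> openin X (chart_range c)"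
  using mf by (simp add: smooth_manifold_def)

lemma in_topspace: "c \<in> A \<Longrightarrow> x \<in> fst c \<Longrightarrow> snd c x \<in> topspace X"
  using openin_subset[OF range_open[of c]] by (auto simp: chart_range_def)

lemma in_range: "x \<in> fst c \<Longrightarrow> snd c x \<in> chart_range c"
  by (auto simp: chart_range_def)

lemma covers: "p \<in> topspace X \<Longrightarrow> \<exists>c\<in>A. p \<in> chart_range c"
  using mf by (auto simp: smooth_manifold_def)

lemma homeo: "c \<in> A \<Longrightarrow> homeomorphic_map (top_of_set (fst c)) (subtopology X (chart_range c)) (snd c)"
  using mf by (simp add: smooth_manifold_def)

lemma coord_of: "c \<in> A \<Longrightarrow> x \<in> fst c \<Longrightarrow> coord c (snd c x) = x"
  unfolding coord_def by (rule inv_into_f_f) (use homeomorphic_imp_injective_map[OF homeo] in auto)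

lemma coord_mem: "p \<in> chart_range c \<Longrightarrow> coord c p \<in> fst c"
  unfolding coord_def chart_range_def by (rule inv_into_into)

lemma of_coord: "p \<in> chart_range c \<Longrightarrow> snd c (coord c p) = p"
  unfolding coord_def chart_range_def by (rule f_inv_into_f)

lemma preimage_open:
  assumes c: "c \<in> A" and O: "openin X B"
  shows "open {x \<in> fst c. snd c x \<in> B}"
proof -
  have "continuous_map (top_of_set (fst c)) (subtopology X (chart_range c)) (snd c)"
    using homeomorphic_imp_continuous_map[OF homeo[OF c]] .
  moreover have "openin (subtopology X (chart_range c)) (B \<inter> chart_range c)"
    using O by (auto simp: openin_subtopology)
  ultimately have "openin (top_of_set (fst c)) {x \<in> topspace (top_of_set (fst c)). snd c x \<in> B \<inter> chart_range c}"
    by (rule openin_continuous_map_preimage)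
  moreover have "{x \<in> topspace (top_of_set (fst c)). snd c x \<in> B \<inter> chart_range c} = {x \<in> fst c. snd c x \<in> B}"
    by (auto simp: chart_range_def)
  ultimately show ?thesis using openin_open_trans dom_open[OF c] by metis
qed

lemma smooth_map_preimage_open:
  assumes s: "smooth_map_to X A U f" and O: "openin X B"
  shows "open {x \<in> U. f x \<in> B}"
proof (rule open_contains_ball[THEN iffD2], rule ballI)
  fix x assume x: "x \<in> {x \<in> U. f x \<in> B}"
  then have "f x \<in> topspace X" using s by (auto simp: smooth_map_to_def)
  then obtain c where c: "c \<in> A" "f x \<in> chart_range c" using covers by blast
  let ?U = "{x \<in> U. f x \<in> chart_range c}"
  have U: "open ?U" and sm: "smooth_on ?U (\<lambda>x. coord c (f x))" using s c(1) by (simp_all add: smooth_map_to_def)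
  have "open (?U \<inter> (\<lambda>x. coord c (f x)) -` {x \<in> fst c. snd c x \<in> B})"
    by (rule continuous_open_preimage[OF smooth_on_continuous[OF sm] U preimage_open[OF c(1) O]])
  moreover have "?U \<inter> (\<lambda>x. coord c (f x)) -` {x \<in> fst c. snd c x \<in> B} =
      {y \<in> ?U. coord c (f y) \<in> {x \<in> fst c. snd c x \<in> B}}" by auto
  ultimately have "open {y \<in> ?U. coord c (f y) \<in> {x \<in> fst c. snd c x \<in> B}}" by simp
  moreover have "x \<in> {y \<in> ?U. coord c (f y) \<in> {x \<in> fst c. snd c x \<in> B}}"
    using x c by (auto simp: coord_mem of_coord)
  moreover have "{y \<in> ?U. coord c (f y) \<in> {x \<in> fst c. snd c x \<in> B}} \<subseteq> {x \<in> U. f x \<in> B}"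
    by (auto simp: of_coord)
  ultimately show "\<exists>e>0. ball x e \<subseteq> {x \<in> U. f x \<in> B}"
    by (meson open_contains_ball subset_trans)
qed

text \<open>The derivative is bijective because the transition maps between \<open>c\<close> and
  \<open>c'\<close> are smooth and inverse to each other.\<close>

lemma transition:
  assumes c: "c \<in> A" and c': "c' \<in> A"
  defines "W \<equiv> {x \<in> fst c. snd c x \<in> chart_range c'}" and "h \<equiv> \<lambda>x. coord c' (snd c x)"
  shows "chart_change c c' W h"
proof -
  have sm: "smooth_on {x \<in> fst c. snd c x \<in> chart_range c'} (\<lambda>x. coord c' (snd c x))" if "c \<in> A" "c' \<in> A" for c c'
    using mf that by (simp add: smooth_manifold_def)
  let ?W' = "{x \<in> fst c'. snd c' x \<in> chart_range c}" and ?h' = "\<lambda>x. coord c (snd c' x)"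
  have W: "open W" "open ?W'" unfolding W_def using preimage_open range_open c c' by blast+
  have hW: "h x \<in> ?W'" "?h' (h x) = x" if "x \<in> W" for x
    using that c by (auto simp: W_def h_def coord_mem of_coord in_range coord_of)
  have hW': "?h' x \<in> W" "h (?h' x) = x" if "x \<in> ?W'" for x
    using that c' by (auto simp: W_def h_def coord_mem of_coord in_range coord_of)
  have id: "dder q (p x) (dder p x v) = v"
    if "open P" "x \<in> P" "smooth_on P p" "p x \<in> Q" "smooth_on Q q" "\<And>y. y \<in> P \<Longrightarrow> q (p y) = y"
    for P Q :: "'e set" and p q x v
  proof -
    have "((\<lambda>y. q (p y)) has_derivative (\<lambda>v. dder q (p x) (dder p x v))) (at x)"
      by (rule has_derivative_compose[OF smooth_on_has_derivative[OF that(3,2)] smooth_on_has_derivative[OF that(5,4)]])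
    then have "((\<lambda>y. y) has_derivative (\<lambda>v. dder q (p x) (dder p x v))) (at x)"
      by (rule has_derivative_cong_open[OF that(1,2), THEN iffD1, rotated]) (rule that(6))
    from has_derivative_unique[OF this has_derivative_ident] show ?thesis by metis
  qed
  have "bij (dder h x)" if x: "x \<in> W" for x
  proof (rule o_bij)
    show "dder ?h' (h x) \<circ> dder h x = id"
      using id[OF W(1) x _ hW(1)[OF x] sm[OF c' c] hW(2)] sm[OF c c'] by (auto simp: W_def h_def fun_eq_iff)
    show "dder h x \<circ> dder ?h' (h x) = id"
      using id[OF W(2) hW(1)[OF x] sm[OF c' c] hW'(1)[OF hW(1)[OF x]] _ hW'(2)] sm[OF c c'] hW(2)[OF x]
      by (auto simp: W_def h_def fun_eq_iff)
  qed
  moreover have "W \<subseteq> fst c" "smooth_on W h" using sm[OF c c'] by (auto simp: W_def h_def)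
  moreover have "h x \<in> fst c' \<and> snd c' (h x) = snd c x" if "x \<in> W" for x
    using that by (auto simp: W_def h_def coord_mem of_coord)
  ultimately show ?thesis unfolding chart_change_def using W(1) by blast
qed

section \<open>The circle flow in charts and the invariance of basic forms\<close>

lemma action_mem: "p \<in> topspace X \<Longrightarrow> \<rho> (cis t) p \<in> topspace X"
  and action_one: "p \<in> topspace X \<Longrightarrow> \<rho> 1 p = p"
  and action_mult: "p \<in> topspace X \<Longrightarrow> z \<in> sphere 0 1 \<Longrightarrow> w \<in> sphere 0 1 \<Longrightarrow> \<rho> (z * w) p = \<rho> z (\<rho> w p)"
  and action_smooth: "c \<in> A \<Longrightarrow> smooth_map_to X A (UNIV \<times> fst c) (\<lambda>(t::real, x). \<rho> (cis t) (snd c x))"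
  using action unfolding circle_action_def by auto

text \<open>The first coordinate is the angle on the circle, the second a point in the chart
  \<open>c\<close>. The target chart \<open>c'\<close> is fixed, so that an orbit is followed
  through several such domains.\<close>

definition flow_dom :: "('e, 'm) chart \<Rightarrow> ('e, 'm) chart \<Rightarrow> (real \<times> 'e) set" where
  "flow_dom c c' = {y \<in> UNIV \<times> fst c. \<rho> (cis (fst y)) (snd c (snd y)) \<in> chart_range c'}"

definition flow_map :: "('e, 'm) chart \<Rightarrow> ('e, 'm) chart \<Rightarrow> real \<times> 'e \<Rightarrow> 'e" where
  "flow_map c c' y = coord c' (\<rho> (cis (fst y)) (snd c (snd y)))"

lemma flow_dom_open: "c \<in> A \<Longrightarrow> c' \<in> A \<Longrightarrow> open (flow_dom c c')"
  and flow_map_smooth: "c \<in> A \<Longrightarrow> c' \<in> A \<Longrightarrow> smooth_on (flow_dom c c') (flow_map c c')"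
  using action_smooth[of c] unfolding smooth_map_to_def flow_dom_def flow_map_def[abs_def] case_prod_unfold by auto

lemma flow_map_mem: "y \<in> flow_dom c c' \<Longrightarrow> flow_map c c' y \<in> fst c'"
  and snd_Pm: "y \<in> flow_dom c c' \<Longrightarrow> snd c' (flow_map c c' y) = \<rho> (cis (fst y)) (snd c (snd y))"
  by (auto simp: flow_dom_def flow_map_def coord_mem of_coord)

text \<open>\<open>integrates_to\<close> gives the velocity at angle 0 only, and the group law
  carries it along the orbit. The factor \<open>1 / l\<close> converts the angle into the time of
  \<open>Y\<close>.\<close>

lemma flow_derivative:
  "\<exists>l>0. \<forall>c\<in>A. \<forall>c'\<in>A. \<forall>y\<in>flow_dom c c'. dder (flow_map c c') y (1, 0) = (1 / l) *\<^sub>R Y c' (flow_map c c' y)"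
proof -
  obtain l where l: "l > 0" "\<And>c x. c \<in> A \<Longrightarrow> x \<in> fst c \<Longrightarrow>
      ((\<lambda>t. coord c (\<rho> (cis (l * t)) (snd c x))) has_vector_derivative Y c x) (at 0)"
    using flow unfolding integrates_to_def by blast
  have "dder (flow_map c c') y (1, 0) = (1 / l) *\<^sub>R Y c' (flow_map c c' y)" if c: "c \<in> A" "c' \<in> A" and y: "y \<in> flow_dom c c'" for c c' y
  proof -
    have t: "snd c (snd y) \<in> topspace X" using y c by (auto simp: flow_dom_def intro: in_topspace)
    have "((\<lambda>s. coord c' (\<rho> (cis (l * (s / l))) (snd c' (flow_map c c' y)))) has_derivative (\<lambda>h. (h / l) *\<^sub>R Y c' (flow_map c c' y))) (at 0)"
    proof (rule has_derivative_compose[of "\<lambda>s. s / l" "\<lambda>h. h / l" 0 UNIV "\<lambda>t. coord c' (\<rho> (cis (l * t)) (snd c' (flow_map c c' y)))"])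
      show "((\<lambda>s. s / l) has_derivative (\<lambda>h. h / l)) (at 0)"
        using l(1) by (auto intro!: derivative_eq_intros)
      show "((\<lambda>t. coord c' (\<rho> (cis (l * t)) (snd c' (flow_map c c' y)))) has_derivative (\<lambda>h. h *\<^sub>R Y c' (flow_map c c' y))) (at (0 / l))"
        using l(2)[OF c(2) flow_map_mem[OF y]] by (simp add: has_vector_derivative_def)
    qed
    moreover have "coord c' (\<rho> (cis (l * (s / l))) (snd c' (flow_map c c' y))) = flow_map c c' (y + s *\<^sub>R (1, 0))" for s
    proof -
      have "\<rho> (cis s) (\<rho> (cis (fst y)) (snd c (snd y))) = \<rho> (cis (fst y + s)) (snd c (snd y))"
        using action_mult[OF t, of "cis s" "cis (fst y)"] by (simp add: cis_mult add.commute)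
      then show ?thesis using l(1) unfolding snd_Pm[OF y] by (simp add: flow_map_def)
    qed
    ultimately have 1: "((\<lambda>s. flow_map c c' (y + s *\<^sub>R (1, 0))) has_derivative (\<lambda>h. (h / l) *\<^sub>R Y c' (flow_map c c' y))) (at 0)"
      by simp
    have "((\<lambda>s. y + s *\<^sub>R (1, 0)) has_derivative (\<lambda>s. s *\<^sub>R (1, 0))) (at 0)"
      by (auto intro!: derivative_eq_intros)
    then have 2: "((\<lambda>s. flow_map c c' (y + s *\<^sub>R (1, 0))) has_derivative (\<lambda>s. dder (flow_map c c') y (s *\<^sub>R (1, 0)))) (at 0)"
      by (rule has_derivative_compose) (use smooth_on_has_derivative[OF flow_map_smooth[OF c] y] in \<open>simp add: zero_prod_def[symmetric]\<close>)
    from has_derivative_unique[OF 2 1] have "dder (flow_map c c') y (1 *\<^sub>R (1, 0)) = (1 / l) *\<^sub>R Y c' (flow_map c c' y)"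
      by metis
    then show ?thesis by simp
  qed
  then show ?thesis using l(1) by blast
qed

text \<open>The pullback of \<open>\<beta>\<close> by the flow at the angle \<open>fst y\<close>,
  computed in the target chart \<open>c'\<close>.\<close>

definition pulled :: "nat \<Rightarrow> ('e, 'm) form \<Rightarrow> ('e, 'm) chart \<Rightarrow> ('e, 'm) chart \<Rightarrow> real \<times> 'e \<Rightarrow> (nat \<Rightarrow> 'e) \<Rightarrow> complex" where
  "pulled k \<beta> c c' y v = \<beta> c' (flow_map c c' y) (\<lambda>i. dder (flow_map c c') y (0, v i))"

lemma pulled_chart:
  assumes b: "form_field A k \<beta>" and c: "c \<in> A" "c' \<in> A" "c'' \<in> A" and y: "y \<in> flow_dom c c'" "y \<in> flow_dom c c''"
  shows "pulled k \<beta> c c' y v = pulled k \<beta> c c'' y v"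
proof -
  let ?W = "{x \<in> fst c'. snd c' x \<in> chart_range c''}" and ?h = "\<lambda>x. coord c'' (snd c' x)"
  note ch = transition[OF c(2,3)]
  then have hs: "smooth_on ?W ?h" by (simp add: chart_change_def)
  have e: "?h (flow_map c c' z) = flow_map c c'' z" if "z \<in> flow_dom c c'" for z
    using snd_Pm[OF that] by (simp add: flow_map_def)
  have W: "flow_map c c' y \<in> ?W" using flow_map_mem[OF y(1)] snd_Pm[OF y(1)] y(2) by (simp add: flow_dom_def)
  have "((\<lambda>z. ?h (flow_map c c' z)) has_derivative (\<lambda>u. dder ?h (flow_map c c' y) (dder (flow_map c c') y u))) (at y)"
    by (rule has_derivative_compose[OF smooth_on_has_derivative[OF flow_map_smooth[OF c(1,2)] y(1)] smooth_on_has_derivative[OF hs W]])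
  then have "(flow_map c c'' has_derivative (\<lambda>u. dder ?h (flow_map c c' y) (dder (flow_map c c') y u))) (at y)"
    by (rule has_derivative_cong_open[OF flow_dom_open[OF c(1,2)] y(1), THEN iffD1, rotated]) (rule e)
  then have d: "dder (flow_map c c'') y u = dder ?h (flow_map c c' y) (dder (flow_map c c') y u)" for u
    by (simp add: frechet_derivative_eq)
  show ?thesis
    unfolding pulled_def d e[OF y(1), symmetric] by (rule form_field_change[OF b c(2,3) ch W])
qed

text \<open>Along the flow, the derivative of the pullback is \<open>1 / l\<close> times the
  pullback of the Lie derivative, and the latter vanishes for a basic form.\<close>

lemma pulled_derivative:
  assumes b: "basic_form A Y k \<beta>" and c: "c \<in> A" "c' \<in> A" and y: "y \<in> flow_dom c c'"
  shows "((\<lambda>s. pulled k \<beta> c c' (y + s *\<^sub>R (1, 0)) v) has_derivative (\<lambda>h. 0)) (at 0)"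
proof -
  let ?P = "flow_map c c'" and ?U = "flow_dom c c'"
  have ff: "form_field A k \<beta>" using b by (simp add: basic_form_def)
  obtain l where l: "l > 0" "\<And>y. y \<in> ?U \<Longrightarrow> dder ?P y (1, 0) = (1 / l) *\<^sub>R Y c' (?P y)"
    using flow_derivative c by blast
  note U = flow_dom_open[OF c] and Ps = flow_map_smooth[OF c]
  have im: "?P ` ?U \<subseteq> fst c'" using flow_map_mem by blast
  define F where "F i y = dder ?P y (0, v i)" for i y
  have Fs: "smooth_on ?U (F i)" for i unfolding F_def[abs_def] by (rule smooth_on_derivative[OF Ps])
  have alt: "alternating k (\<beta> c' (?P z))" if "z \<in> ?U" for z
    by (rule form_field_alternating[OF ff c(2) flow_map_mem[OF that]])
  have bs: "smooth_on ?U (\<lambda>z. \<beta> c' (?P z) w)" for w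
    by (rule smooth_on_compose[OF U dom_open[OF c(2)] im Ps form_field_smooth[OF ff c(2)]])
  note AF = alternating_family[where \<beta> = "\<lambda>z. \<beta> c' (?P z)" and F = F, OF U alt bs Fs]
  have s: "smooth_on ?U (\<lambda>z. pulled k \<beta> c c' z v)"
    unfolding pulled_def using AF(1) by (simp add: F_def)
  have d1: "dder (\<lambda>z. \<beta> c' (?P z) w) y (1, 0) = (1 / l) *\<^sub>R dder (\<lambda>z. \<beta> c' z w) (?P y) (Y c' (?P y))" for w
  proof -
    have g: "((\<lambda>z. \<beta> c' z w) has_derivative dder (\<lambda>z. \<beta> c' z w) (?P y)) (at (?P y))"
      by (rule smooth_on_has_derivative[OF form_field_smooth[OF ff c(2)] flow_map_mem[OF y]])
    have "((\<lambda>z. \<beta> c' (?P z) w) has_derivative (\<lambda>u. dder (\<lambda>z. \<beta> c' z w) (?P y) (dder ?P y u))) (at y)"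
      by (rule has_derivative_compose[OF smooth_on_has_derivative[OF Ps y] g])
    then show ?thesis
      using has_derivative_linear[OF g] by (simp add: frechet_derivative_eq l(2)[OF y] linear_cmul)
  qed
  have d2: "dder (F i) y (1, 0) = (1 / l) *\<^sub>R dder (Y c') (?P y) (F i y)" for i
  proof -
    \<comment> \<open>Symmetry of second derivatives exchanges the derivative in the angle with the
      one along \<open>v i\<close>, which then acts on the velocity, a multiple of
      \<open>Y\<close>.\<close>
    have "dder (F i) y (1, 0) = dder (\<lambda>z. dder ?P z (1, 0)) y (0, v i)"
      unfolding F_def[abs_def] by (rule second_derivative_symmetric[OF U y Ps])
    also have "\<dots> = dder (\<lambda>z. (1 / l) *\<^sub>R Y c' (?P z)) y (0, v i)"
      by (rule fun_cong[OF frechet_derivative_cong_open[OF U y l(2)]])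
    also have "\<dots> = (1 / l) *\<^sub>R dder (Y c') (?P y) (dder ?P y (0, v i))"
    proof -
      have "((\<lambda>z. (1 / l) *\<^sub>R Y c' (?P z)) has_derivative (\<lambda>u. (1 / l) *\<^sub>R dder (Y c') (?P y) (dder ?P y u))) (at y)"
        by (intro has_derivative_scaleR_right has_derivative_compose[OF smooth_on_has_derivative[OF Ps y]
            smooth_on_has_derivative[OF Y_smooth[OF c(2)] flow_map_mem[OF y]]])
      then show ?thesis by (simp add: frechet_derivative_eq)
    qed
    finally show ?thesis by (simp add: F_def)
  qed
  have sc: "\<beta> c' (?P y) ((\<lambda>i. F i y)(i := (1 / l) *\<^sub>R a)) = (1 / l) *\<^sub>R \<beta> c' (?P y) ((\<lambda>i. F i y)(i := a))" if "i < k" for i a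
    by (rule linear_cmul[OF alternating_linear[OF alt[OF y] that]])
  have "dder (\<lambda>z. pulled k \<beta> c c' z v) y (1, 0) = (1 / l) *\<^sub>R lie_form k Y \<beta> c' (?P y) (\<lambda>i. F i y)"
  proof -
    have "dder (\<lambda>z. pulled k \<beta> c c' z v) y (1, 0) = dder (\<lambda>z. \<beta> c' (?P z) (\<lambda>i. F i y)) y (1, 0) +
       (\<Sum>i<k. \<beta> c' (?P y) ((\<lambda>i. F i y)(i := dder (F i) y (1, 0))))"
      unfolding pulled_def F_def[symmetric] by (rule AF(2)) (use y in simp_all)
    then show ?thesis
      unfolding lie_form_def d1 d2 by (simp add: sc scaleR_add_right scaleR_sum_right)
  qed
  also have "lie_form k Y \<beta> c' (?P y) (\<lambda>i. F i y) = 0"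
    using b c(2) flow_map_mem[OF y] unfolding basic_form_def by blast
  finally have z: "dder (\<lambda>z. pulled k \<beta> c c' z v) y (1, 0) = 0" by simp
  have "((\<lambda>s. y + s *\<^sub>R (1, 0)) has_derivative (\<lambda>s. s *\<^sub>R (1, 0))) (at (0::real))"
    by (auto intro!: derivative_eq_intros)
  then have "((\<lambda>s. pulled k \<beta> c c' (y + s *\<^sub>R (1, 0)) v) has_derivative
      (\<lambda>s. dder (\<lambda>z. pulled k \<beta> c c' z v) y (s *\<^sub>R (1, 0)))) (at 0)"
    by (rule has_derivative_compose) (use smooth_on_has_derivative[OF s y] in \<open>simp add: zero_prod_def[symmetric]\<close>)
  moreover have "dder (\<lambda>z. pulled k \<beta> c c' z v) y (t *\<^sub>R (1, 0)) = 0" for t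
    using linear_cmul[OF frechet_derivative_linear[OF s y], of t "(1, 0)"] z by simp
  ultimately show ?thesis by simp
qed

text \<open>An orbit may leave a chart, so a target chart \<open>S s\<close> is selected for each
  angle \<open>s\<close>; the pulled-back value does not depend on it. Its derivative in the angle
  is zero, so it equals its value at angle 0, where the flow is the identity.\<close>

lemma basic_invariant:
  assumes b: "basic_form A Y k \<beta>" and c: "c \<in> A" "c' \<in> A" and y: "(t, x) \<in> flow_dom c c'"
  shows "\<beta> c' (flow_map c c' (t, x)) (\<lambda>i. dder (flow_map c c') (t, x) (0, v i)) = \<beta> c x v"
proof -
  have ff: "form_field A k \<beta>" using b by (simp add: basic_form_def)
  have x: "x \<in> fst c" using y by (auto simp: flow_dom_def)
  define S where "S s = (SOME c'. c' \<in> A \<and> (s, x) \<in> flow_dom c c')" for s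
  have S: "S s \<in> A" "(s, x) \<in> flow_dom c (S s)" for s
  proof -
    have "\<rho> (cis s) (snd c x) \<in> topspace X" by (intro action_mem in_topspace c x)
    then obtain d where "d \<in> A" "\<rho> (cis s) (snd c x) \<in> chart_range d" using covers by blast
    then have "\<exists>c'. c' \<in> A \<and> (s, x) \<in> flow_dom c c'" using x by (intro exI[of _ d]) (simp add: flow_dom_def)
    from someI_ex[OF this] show "S s \<in> A" "(s, x) \<in> flow_dom c (S s)" by (simp_all add: S_def)
  qed
  define p where "p s = pulled k \<beta> c (S s) (s, x) v" for s
  have p: "p s = pulled k \<beta> c d (s, x) v" if "d \<in> A" "(s, x) \<in> flow_dom c d" for s d
    unfolding p_def by (rule pulled_chart[OF ff c(1) S(1) that(1) S(2) that(2)])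
  have "(p has_derivative (\<lambda>h. 0)) (at s)" for s
  proof -
    have "((\<lambda>u. pulled k \<beta> c (S s) ((s, x) + u *\<^sub>R (1, 0)) v) has_derivative (\<lambda>h. 0)) (at 0)"
      by (rule pulled_derivative[OF b c(1) S])
    then have "((\<lambda>u. pulled k \<beta> c (S s) (s + u, x) v) has_derivative (\<lambda>h. 0)) (at 0)" by simp
    moreover have "((\<lambda>r. r - s) has_derivative (\<lambda>h. h)) (at s)" by (auto intro!: derivative_eq_intros)
    ultimately have "((\<lambda>r. pulled k \<beta> c (S s) (s + (r - s), x) v) has_derivative (\<lambda>h. 0)) (at s)"
      using has_derivative_compose[of "\<lambda>r. r - s" "\<lambda>h. h" s UNIV "\<lambda>u. pulled k \<beta> c (S s) (s + u, x) v" "\<lambda>h. 0"] by simp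
    then have 1: "((\<lambda>r. pulled k \<beta> c (S s) (r, x) v) has_derivative (\<lambda>h. 0)) (at s)" by simp
    have "open ((\<lambda>r. (r, x)) -` flow_dom c (S s))"
      by (intro open_vimage flow_dom_open c S continuous_intros)
    then have o: "open {r. (r, x) \<in> flow_dom c (S s)}" by (simp add: vimage_def)
    show ?thesis
      by (rule has_derivative_cong_open[OF o, THEN iffD1, OF _ _ 1]) (simp_all add: S p[OF S(1)])
  qed
  then have const: "p t = p 0"
    using has_derivative_zero_unique[of UNIV p t 0] by simp
  have y0: "(0, x) \<in> flow_dom c c" using x c by (simp add: flow_dom_def action_one in_topspace in_range)
  have "p 0 = \<beta> c x v"
  proof -
    have e: "flow_map c c (0, z) = z" if "z \<in> fst c" for z
      using that c by (simp add: flow_map_def action_one in_topspace coord_of)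
    have "((\<lambda>z. (0::real, z)) has_derivative (\<lambda>u. (0, u))) (at x)"
      by (auto intro!: derivative_eq_intros)
    from has_derivative_compose[OF this smooth_on_has_derivative[OF flow_map_smooth[OF c(1) c(1)] y0]]
    have "((\<lambda>z. flow_map c c (0, z)) has_derivative (\<lambda>u. dder (flow_map c c) (0, x) (0, u))) (at x)" .
    then have "((\<lambda>z. z) has_derivative (\<lambda>u. dder (flow_map c c) (0, x) (0, u))) (at x)"
      by (rule has_derivative_cong_open[OF dom_open[OF c(1)] x, THEN iffD1, rotated]) (rule e)
    from has_derivative_unique[OF this has_derivative_ident] have "dder (flow_map c c) (0, x) (0, u) = u" for u by metis
    then show ?thesis using p[OF c(1) y0] e[OF x] by (simp add: pulled_def)
  qed
  then show ?thesis using const p[OF c(2) y] by (simp add: pulled_def)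
qed

end

text \<open>\<open>contract\<close> inserts \<open>u\<close> into slot 0; skewness carries the
  vanishing over to the other slots.\<close>

lemma alternating_horizontal_slot:
  assumes b: "alternating k b" and u: "\<And>v. contract u b v = 0" and j: "j < k"
  shows "b (v(j := u)) = 0"
proof (cases "j = 0")
  case True
  have "v(0 := u) = case_nat u (\<lambda>i. v (Suc i))" by (auto simp: fun_eq_iff split: nat.splits)
  then show ?thesis using u[of "\<lambda>i. v (Suc i)"] True by (simp add: contract_def)
next
  case False
  have "(v(0 := u, j := v 0)) = case_nat u (\<lambda>i. (v(j := v 0)) (Suc i))"
    using False by (auto simp: fun_eq_iff split: nat.splits)
  then have "b (v(0 := u, j := v 0)) = 0" using u[of "\<lambda>i. (v(j := v 0)) (Suc i)"] by (simp add: contract_def)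
  then have "b (v(0 := v 0, j := u)) = 0"
    using alternating_swap[OF b, of 0 j v "v 0" u] False j by simp
  then show ?thesis by simp
qed

lemma alternating_horizontal:
  assumes b: "alternating k b" and u: "\<And>v. contract u b v = 0"
  shows "b (\<lambda>i. w i + a i *\<^sub>R u) = b w"
proof -
  have "m \<le> k \<Longrightarrow> b (\<lambda>i. if i < m then w i + a i *\<^sub>R u else w i) = b w" for m
  proof (induction m)
    case (Suc m)
    let ?v = "\<lambda>i. if i < m then w i + a i *\<^sub>R u else w i"
    have m: "m < k" using Suc.prems by simp
    note l = alternating_linear[OF b m, of ?v]
    have "(\<lambda>i. if i < Suc m then w i + a i *\<^sub>R u else w i) = ?v(m := w m + a m *\<^sub>R u)"
      by (auto simp: fun_eq_iff less_Suc_eq)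
    then have "b (\<lambda>i. if i < Suc m then w i + a i *\<^sub>R u else w i) = b (?v(m := w m)) + a m *\<^sub>R b (?v(m := u))"
      using linear_add[OF l, of "w m" "a m *\<^sub>R u"] linear_cmul[OF l, of "a m" u] by simp
    also have "b (?v(m := u)) = 0" by (rule alternating_horizontal_slot[OF b u m])
    also have "?v(m := w m) = ?v" by auto
    finally show ?case using Suc by simp
  qed simp
  from this[of k] have "b (\<lambda>i. if i < k then w i + a i *\<^sub>R u else w i) = b w" by simp
  moreover have "b (\<lambda>i. if i < k then w i + a i *\<^sub>R u else w i) = b (\<lambda>i. w i + a i *\<^sub>R u)"
    by (rule alternating_depends[OF b]) simp
  ultimately show ?thesis by simp
qed

section \<open>Lifts of the same family of orbits\<close>

context circle_manifold
begin

text \<open>The group elements that take \<open>p\<close> to \<open>q\<close> form a coset of the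
  finite stabilizer of \<open>p\<close>, if there are any, and each of them has finitely many angles
  in the closed interval.\<close>

lemma finite_orbit_parameters:
  assumes p: "p \<in> topspace X"
  shows "finite {t \<in> {0..2 * pi}. \<rho> (cis t) p = q}"
proof (cases "\<exists>z\<in>sphere 0 1. \<rho> z p = q")
  case True
  then obtain z0 where z0: "z0 \<in> sphere 0 1" "\<rho> z0 p = q" by blast
  have nz: "norm z0 = 1" "z0 \<noteq> 0" using z0(1) by auto
  have "{z \<in> sphere 0 1. \<rho> z p = q} \<subseteq> (\<lambda>s. z0 * s) ` {z \<in> sphere 0 1. \<rho> z p = p}"
  proof
    fix z assume z: "z \<in> {z \<in> sphere 0 1. \<rho> z p = q}"
    have i: "inverse z0 \<in> sphere 0 1" "z \<in> sphere 0 1" using nz z by (auto simp: norm_inverse)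
    have "\<rho> (inverse z0 * z) p = \<rho> (inverse z0) (\<rho> z0 p)"
      using action_mult[OF p i] z z0 by simp
    also have "\<dots> = \<rho> (inverse z0 * z0) p" using action_mult[OF p i(1) z0(1)] by simp
    also have "\<dots> = p" using nz by (simp add: action_one[OF p])
    finally have "inverse z0 * z \<in> {z \<in> sphere 0 1. \<rho> z p = p}"
      using nz z by (auto simp: norm_mult norm_inverse)
    then show "z \<in> (\<lambda>s. z0 * s) ` {z \<in> sphere 0 1. \<rho> z p = p}"
      using nz by (intro image_eqI[of _ _ "inverse z0 * z"]) auto
  qed
  then have f: "finite {z \<in> sphere 0 1. \<rho> z p = q}"
    using finite_stabilizers[OF p] by (meson finite_imageI finite_subset)
  have "{t \<in> {0..2 * pi}. \<rho> (cis t) p = q} \<subseteq> (\<Union>z\<in>{z \<in> sphere 0 1. \<rho> z p = q}. {t \<in> {0..2 * pi}. cis t = z})"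
    by auto
  moreover have "finite (\<Union>z\<in>{z \<in> sphere 0 1. \<rho> z p = q}. {t \<in> {0..2 * pi}. cis t = z})"
    using f by (intro finite_UN_I finite_cis_fibre)
  ultimately show ?thesis by (rule finite_subset)
next
  case False
  then have "{t \<in> {0..2 * pi}. \<rho> (cis t) p = q} = {}" using cis_in_sphere by blast
  then show ?thesis by (simp only: finite.emptyI)
qed

text \<open>Two lifts \<open>\<tau>, \<tau>'\<close> of the same family of orbits differ by group elements which need not depend
  continuously on the point. Along a sequence tending to \<open>x\<^sub>0\<close> in the direction \<open>v\<close> these group elements
  accumulate at one of the finitely many elements that move \<open>\<tau> x\<^sub>0\<close> to \<open>\<tau>' x\<^sub>0\<close>, and for this element the
  derivatives along \<open>v\<close> agree modulo \<open>Y\<close>. As a vector space is not a finite union of proper subspaces, one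
  element works for all \<open>v\<close>.\<close>

lemma same_orbit_tangent:
  fixes \<tau> \<tau>' :: "'d::euclidean_space \<Rightarrow> 'm"
  assumes W: "open W" "x0 \<in> W" and c: "c \<in> A" "c' \<in> A"
    and r: "\<And>x. x \<in> W \<Longrightarrow> \<tau> x \<in> chart_range c" "\<And>x. x \<in> W \<Longrightarrow> \<tau>' x \<in> chart_range c'"
    and f: "((\<lambda>x. coord c (\<tau> x)) has_derivative f') (at x0)"
    and g: "((\<lambda>x. coord c' (\<tau>' x)) has_derivative g') (at x0)"
    and orb: "\<And>x. x \<in> W \<Longrightarrow> orbit \<rho> (\<tau>' x) = orbit \<rho> (\<tau> x)"
  shows "\<exists>t. (t, coord c (\<tau> x0)) \<in> flow_dom c c' \<and> flow_map c c' (t, coord c (\<tau> x0)) = coord c' (\<tau>' x0) \<and>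
     (\<forall>v. \<exists>a. g' v = dder (flow_map c c') (t, coord c (\<tau> x0)) (0, f' v) + a *\<^sub>R Y c' (coord c' (\<tau>' x0)))"
proof -
  let ?f = "\<lambda>x. coord c (\<tau> x)" and ?g = "\<lambda>x. coord c' (\<tau>' x)" and ?P = "flow_map c c'" and ?Y = "Y c' (coord c' (\<tau>' x0))"
  define T where "T = {t \<in> {0..2 * pi}. \<rho> (cis t) (\<tau> x0) = \<tau>' x0}"
  have top: "\<tau> x \<in> topspace X" "\<tau>' x \<in> topspace X" if "x \<in> W" for x
    using r[OF that] range_open c openin_subset by blast+
  have T: "finite T" unfolding T_def by (rule finite_orbit_parameters[OF top(1)[OF W(2)]])
  have inP: "(t, ?f x) \<in> flow_dom c c'" "?P (t, ?f x) = ?g x" if "x \<in> W" "\<rho> (cis t) (\<tau> x) = \<tau>' x" for x t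
    using that r by (simp_all add: flow_dom_def flow_map_def coord_mem of_coord)
  have ex: "\<exists>t\<in>{0..2 * pi}. \<rho> (cis t) (\<tau> x) = \<tau>' x" if "x \<in> W" for x
  proof -
    have "\<tau>' x \<in> orbit \<rho> (\<tau>' x)"
      unfolding orbit_def using action_one[OF top(2)[OF that]] by (intro image_eqI[of _ _ 1]) simp_all
    then have "\<tau>' x \<in> orbit \<rho> (\<tau> x)" using orb[OF that] by simp
    then obtain z where "z \<in> sphere 0 1" "\<tau>' x = \<rho> z (\<tau> x)" by (auto simp: orbit_def)
    then show ?thesis using cis_surj[of z] by metis
  qed
  obtain l where l: "l > 0" "\<And>y. y \<in> flow_dom c c' \<Longrightarrow> dder ?P y (1, 0) = (1 / l) *\<^sub>R Y c' (?P y)"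
    using flow_derivative c by blast
  have Y0: "?Y \<noteq> 0" by (rule Y_nonzero[OF c(2) coord_mem[OF r(2)[OF W(2)]]])
  have fl: "linear f'" and gl: "linear g'" using f g has_derivative_linear by blast+
  have Pl: "linear (dder ?P (t, ?f x0))" if "t \<in> T" for t
    using that frechet_derivative_linear[OF flow_map_smooth[OF c] inP(1)[OF W(2)]] by (simp add: T_def)
  \<comment> \<open>The directions for which the group element \<open>cis t\<close> works. They form
    a subspace because the condition says that a linear map takes its value in the line of
    \<open>?Y\<close>.\<close>
  define V where "V t = {v. \<exists>a. g' v = dder ?P (t, ?f x0) (0, f' v) + a *\<^sub>R ?Y}" for t
  have sub: "subspace (V t)" if t: "t \<in> T" for t
  proof -
    have L: "linear (\<lambda>v. g' v - dder ?P (t, ?f x0) (0, f' v))"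
      by (rule linear_compose_sub[OF gl])
        (use linear_compose[OF linear_compose[OF fl, of "\<lambda>u. (0, u)"] Pl[OF t]] in \<open>simp add: o_def linear_iff\<close>)
    have "V t = (\<lambda>v. g' v - dder ?P (t, ?f x0) (0, f' v)) -` span {?Y}"
      unfolding V_def span_singleton vimage_def image_iff by (simp add: diff_eq_eq add.commute)
    then show ?thesis using linear_subspace_vimage[OF L subspace_span[of "{?Y}"]] by simp
  qed
  have "v \<in> (\<Union>t\<in>T. V t)" for v
  proof -
    define s where "s n = inverse (real (Suc n))" for n
    have s0: "s \<longlonglongrightarrow> 0" unfolding s_def[abs_def] by (rule LIMSEQ_inverse_real_of_nat)
    have sp: "s n > 0" for n by (simp add: s_def)
    define x where "x n = x0 + s n *\<^sub>R v" for n
    have xl: "x \<longlonglongrightarrow> x0"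
      using tendsto_add[OF tendsto_const tendsto_scaleR[OF s0 tendsto_const], of x0 v] by (simp add: x_def[abs_def])
    then obtain N where N: "\<And>n. n \<ge> N \<Longrightarrow> x n \<in> W"
      using topological_tendstoD[OF xl W] by (auto simp: eventually_sequentially)
    define t where "t n = (SOME t. t \<in> {0..2 * pi} \<and> \<rho> (cis t) (\<tau> (x (n + N))) = \<tau>' (x (n + N)))" for n
    have t': "t n \<in> {0..2 * pi} \<and> \<rho> (cis (t n)) (\<tau> (x (n + N))) = \<tau>' (x (n + N))" for n
    proof -
      have "x (n + N) \<in> W" by (rule N) simp
      from ex[OF this] have "\<exists>t. t \<in> {0..2 * pi} \<and> \<rho> (cis t) (\<tau> (x (n + N))) = \<tau>' (x (n + N))"
        unfolding Bex_def .
      from someI_ex[OF this] show ?thesis unfolding t_def .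
    qed
    note t = conjunct1[OF t'] conjunct2[OF t']
    obtain t0 \<phi> where \<phi>: "t0 \<in> {0..2 * pi}" "strict_mono \<phi>" "(t \<circ> \<phi>) \<longlonglongrightarrow> t0"
      using seq_compactE[of "{0..2 * pi}" t] compact_imp_seq_compact[OF compact_Icc[of 0 "2 * pi"]] t(1) by metis
    \<comment> \<open>A common scale for the increments of the angle and of the base point. The
      quotients \<open>a\<close> and \<open>b\<close> are bounded, and
      \<open>\<bar>a\<bar> + b = 1\<close> persists in the limit, so they cannot both tend to
      0.\<close>
    define e where "e n = \<bar>t (\<phi> n) - t0\<bar> + s (\<phi> n + N)" for n
    have ep: "e n > 0" for n unfolding e_def using sp by (simp add: add_nonneg_pos)
    define a where "a n = (t (\<phi> n) - t0) / e n" for n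
    define b where "b n = s (\<phi> n + N) / e n" for n
    have ab: "\<bar>a n\<bar> + b n = 1" "b n \<ge> 0" for n
      using ep[of n] sp by (simp_all add: a_def b_def abs_divide add_divide_distrib[symmetric] e_def[symmetric] less_imp_le)
    have "(a n, b n) \<in> cbox (-1) 1 \<times> cbox 0 1" for n using ab[of n] by (auto simp: abs_le_iff)
    then have ball: "\<forall>n. (a n, b n) \<in> cbox (-1) 1 \<times> cbox 0 1" by blast
    obtain ab0 \<psi> where \<psi>: "strict_mono \<psi>" "((\<lambda>n. (a n, b n)) \<circ> \<psi>) \<longlonglongrightarrow> ab0"
      by (rule seq_compactE[OF compact_imp_seq_compact[OF compact_Times[OF compact_cbox compact_cbox]] ball])
    obtain a0 b0 where ab0: "ab0 = (a0, b0)" by (cases ab0)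
    have al: "(\<lambda>n. a (\<psi> n)) \<longlonglongrightarrow> a0" and bl: "(\<lambda>n. b (\<psi> n)) \<longlonglongrightarrow> b0"
      using tendsto_fst[OF \<psi>(2)] tendsto_snd[OF \<psi>(2)] by (simp_all add: ab0 o_def)
    have "(\<lambda>n. \<bar>a (\<psi> n)\<bar> + b (\<psi> n)) \<longlonglongrightarrow> \<bar>a0\<bar> + b0" by (intro tendsto_add tendsto_rabs al bl)
    then have one: "\<bar>a0\<bar> + b0 = 1" unfolding ab(1) by (simp add: LIMSEQ_const_iff)
    define X' where "X' n = x (\<phi> (\<psi> n) + N)" for n
    define T' where "T' n = t (\<phi> (\<psi> n))" for n
    have mono: "strict_mono (\<lambda>n. \<phi> (\<psi> n) + N)"
      using \<phi>(2) \<psi>(1) by (simp add: strict_mono_def)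
    have Xl: "X' \<longlonglongrightarrow> x0" unfolding X'_def[abs_def] using LIMSEQ_subseq_LIMSEQ[OF xl mono] by (simp add: o_def)
    have Tl: "T' \<longlonglongrightarrow> t0" unfolding T'_def[abs_def] using LIMSEQ_subseq_LIMSEQ[OF \<phi>(3) \<psi>(1)] by (simp add: o_def)
    have XW: "X' n \<in> W" for n unfolding X'_def by (rule N) simp
    have rel: "\<rho> (cis (T' n)) (\<tau> (X' n)) = \<tau>' (X' n)" for n unfolding X'_def T'_def by (rule t(2))
    have fc: "(\<lambda>n. ?f (X' n)) \<longlonglongrightarrow> ?f x0" and gc: "(\<lambda>n. ?g (X' n)) \<longlonglongrightarrow> ?g x0"
      using isCont_tendsto_compose[OF has_derivative_continuous[OF f] Xl]
        isCont_tendsto_compose[OF has_derivative_continuous[OF g] Xl] by simp_all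
    \<comment> \<open>Otherwise disjoint neighbourhoods of
      \<open>\<rho> (cis t0) (\<tau> x0)\<close> and of \<open>\<tau>' x0\<close> would both contain
      \<open>\<tau>' (X' n)\<close> for large \<open>n\<close>.\<close>
    have "t0 \<in> T"
    proof (rule ccontr)
      assume "t0 \<notin> T"
      then have ne: "\<rho> (cis t0) (\<tau> x0) \<noteq> \<tau>' x0" using \<phi>(1) by (simp add: T_def)
      have "Hausdorff_space X" using mf by (simp add: smooth_manifold_def)
      then obtain B1 B2 where B: "openin X B1" "openin X B2" "\<rho> (cis t0) (\<tau> x0) \<in> B1" "\<tau>' x0 \<in> B2" "disjnt B1 B2"
        using ne action_mem[OF top(1)[OF W(2)], of t0] top(2)[OF W(2)] unfolding Hausdorff_space_def by metis
      have o1: "open {y \<in> UNIV \<times> fst c. (\<lambda>(t::real, x). \<rho> (cis t) (snd c x)) y \<in> B1}"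
        by (rule smooth_map_preimage_open[OF action_smooth[OF c(1)] B(1)])
      have "(t0, ?f x0) \<in> {y \<in> UNIV \<times> fst c. (\<lambda>(t::real, x). \<rho> (cis t) (snd c x)) y \<in> B1}"
        using B(3) r(1)[OF W(2)] by (simp add: coord_mem of_coord)
      from topological_tendstoD[OF tendsto_Pair[OF Tl fc] o1 this]
      have ev1: "\<forall>\<^sub>F n in sequentially. \<tau>' (X' n) \<in> B1"
        by eventually_elim (use r(1)[OF XW] rel in \<open>simp add: of_coord\<close>)
      have o2: "open {y \<in> fst c'. snd c' y \<in> B2}" by (rule preimage_open[OF c(2) B(2)])
      have "?g x0 \<in> {y \<in> fst c'. snd c' y \<in> B2}" using B(4) r(2)[OF W(2)] by (simp add: coord_mem of_coord)
      from topological_tendstoD[OF gc o2 this]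
      have ev2: "\<forall>\<^sub>F n in sequentially. \<tau>' (X' n) \<in> B2"
        by eventually_elim (use r(2)[OF XW] in \<open>simp add: of_coord\<close>)
      have "\<forall>\<^sub>F n in sequentially. False"
        using ev1 ev2 by eventually_elim (use B(5) in \<open>auto simp: disjnt_def\<close>)
      then show False by simp
    qed
    have rel0: "\<rho> (cis t0) (\<tau> x0) = \<tau>' x0" using \<open>t0 \<in> T\<close> by (simp add: T_def)
    define \<epsilon> where "\<epsilon> n = e (\<psi> n)" for n
    have \<epsilon>p: "\<epsilon> n > 0" for n unfolding \<epsilon>_def by (rule ep)
    have "(X' n - x0) /\<^sub>R \<epsilon> n = b (\<psi> n) *\<^sub>R v" for n
      by (simp add: X'_def x_def \<epsilon>_def b_def divide_inverse mult.commute)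
    then have "(\<lambda>n. (X' n - x0) /\<^sub>R \<epsilon> n) \<longlonglongrightarrow> b0 *\<^sub>R v"
      using tendsto_scaleR[OF bl tendsto_const] by simp
    note q = this
    have F: "(\<lambda>n. (?f (X' n) - ?f x0) /\<^sub>R \<epsilon> n) \<longlonglongrightarrow> f' (b0 *\<^sub>R v)"
      by (rule sequential_derivative[OF f Xl q \<epsilon>p])
    have G: "(\<lambda>n. (?g (X' n) - ?g x0) /\<^sub>R \<epsilon> n) \<longlonglongrightarrow> g' (b0 *\<^sub>R v)"
      by (rule sequential_derivative[OF g Xl q \<epsilon>p])
    have "(T' n - t0) /\<^sub>R \<epsilon> n = a (\<psi> n)" for n
      by (simp add: T'_def \<epsilon>_def a_def divide_inverse mult.commute)
    then have "(\<lambda>n. ((T' n, ?f (X' n)) - (t0, ?f x0)) /\<^sub>R \<epsilon> n) \<longlonglongrightarrow> (a0, f' (b0 *\<^sub>R v))"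
      using tendsto_Pair[OF al F] by simp
    from sequential_derivative[OF smooth_on_has_derivative[OF flow_map_smooth[OF c] inP(1)[OF W(2) rel0]]
        tendsto_Pair[OF Tl fc] this \<epsilon>p]
    have P: "(\<lambda>n. (?g (X' n) - ?g x0) /\<^sub>R \<epsilon> n) \<longlonglongrightarrow> dder ?P (t0, ?f x0) (a0, f' (b0 *\<^sub>R v))"
      unfolding inP(2)[OF XW rel] inP(2)[OF W(2) rel0] .
    \<comment> \<open>One quotient has been computed in two ways: from the derivative of
      \<open>?g\<close>, and from the flow map applied to the angle and \<open>?f\<close>.\<close>
    have "g' (b0 *\<^sub>R v) = dder ?P (t0, ?f x0) (a0, f' (b0 *\<^sub>R v))"
      by (rule LIMSEQ_unique[OF G P])
    also have "(a0, f' (b0 *\<^sub>R v)) = a0 *\<^sub>R (1, 0) + b0 *\<^sub>R (0, f' v)"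
      by (simp add: linear_cmul[OF fl])
    finally have eq: "b0 *\<^sub>R g' v = (a0 / l) *\<^sub>R ?Y + b0 *\<^sub>R dder ?P (t0, ?f x0) (0, f' v)"
      unfolding linear_add[OF Pl[OF \<open>t0 \<in> T\<close>]] linear_cmul[OF Pl[OF \<open>t0 \<in> T\<close>]] linear_cmul[OF gl]
        l(2)[OF inP(1)[OF W(2) rel0]] inP(2)[OF W(2) rel0]
      by simp
    \<comment> \<open>If \<open>b0\<close> were 0, then \<open>\<bar>a0\<bar>\<close> would be 1 and
      the equation would force \<open>?Y = 0\<close>.\<close>
    have "b0 \<noteq> 0"
    proof
      assume b0: "b0 = 0"
      then have "a0 \<noteq> 0" using one by auto
      then show False using eq b0 Y0 l(1) by simp
    qed
    then have "g' v = (1 / b0) *\<^sub>R (b0 *\<^sub>R g' v)" by simp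
    also have "\<dots> = dder ?P (t0, ?f x0) (0, f' v) + (a0 / l / b0) *\<^sub>R ?Y"
      unfolding eq using \<open>b0 \<noteq> 0\<close> by (simp add: scaleR_add_right)
    finally have "v \<in> V t0" unfolding V_def by blast
    then show ?thesis using \<open>t0 \<in> T\<close> by blast
  qed
  then have "(\<Union>t\<in>T. V t) = UNIV" by blast
  from finite_subspace_cover[OF T sub this] obtain t where t: "t \<in> T" "V t = UNIV" by blast
  have rt: "\<rho> (cis t) (\<tau> x0) = \<tau>' x0" using t(1) by (simp add: T_def)
  have "\<forall>v. \<exists>a. g' v = dder ?P (t, ?f x0) (0, f' v) + a *\<^sub>R ?Y"
    using t(2) unfolding V_def by blast
  then show ?thesis using inP[OF W(2) rt] by blast
qed

text \<open>By \<open>same_orbit_tangent\<close> one derivative arises from the other through the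
  flow, up to multiples of \<open>Y\<close>. A horizontal form does not see these multiples, and a
  basic form is preserved by the flow.\<close>

lemma orbit_pullback:
  fixes \<tau> \<tau>' :: "'d::euclidean_space \<Rightarrow> 'm"
  assumes b: "basic_form A Y k \<beta>"
    and W: "open W" "x0 \<in> W" and c: "c \<in> A" "c' \<in> A"
    and r: "\<And>x. x \<in> W \<Longrightarrow> \<tau> x \<in> chart_range c" "\<And>x. x \<in> W \<Longrightarrow> \<tau>' x \<in> chart_range c'"
    and f: "((\<lambda>x. coord c (\<tau> x)) has_derivative f') (at x0)"
    and g: "((\<lambda>x. coord c' (\<tau>' x)) has_derivative g') (at x0)"
    and orb: "\<And>x. x \<in> W \<Longrightarrow> orbit \<rho> (\<tau>' x) = orbit \<rho> (\<tau> x)"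
  shows "\<beta> c' (coord c' (\<tau>' x0)) (\<lambda>i. g' (v i)) = \<beta> c (coord c (\<tau> x0)) (\<lambda>i. f' (v i))"
proof -
  obtain t where t: "(t, coord c (\<tau> x0)) \<in> flow_dom c c'" "flow_map c c' (t, coord c (\<tau> x0)) = coord c' (\<tau>' x0)"
    "\<forall>v. \<exists>a. g' v = dder (flow_map c c') (t, coord c (\<tau> x0)) (0, f' v) + a *\<^sub>R Y c' (coord c' (\<tau>' x0))"
    using same_orbit_tangent[OF W c r f g orb] by blast
  obtain a where a: "\<And>v. g' v = dder (flow_map c c') (t, coord c (\<tau> x0)) (0, f' v) + a v *\<^sub>R Y c' (coord c' (\<tau>' x0))"
    using t(3) by metis
  have m: "coord c' (\<tau>' x0) \<in> fst c'" by (rule coord_mem[OF r(2)[OF W(2)]])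
  have ff: "form_field A k \<beta>" and hz: "contract (Y c' (coord c' (\<tau>' x0))) (\<beta> c' (coord c' (\<tau>' x0))) v = 0" for v
    using b c(2) m unfolding basic_form_def by blast+
  have "\<beta> c' (coord c' (\<tau>' x0)) (\<lambda>i. g' (v i)) =
      \<beta> c' (coord c' (\<tau>' x0)) (\<lambda>i. dder (flow_map c c') (t, coord c (\<tau> x0)) (0, f' (v i)) + a (v i) *\<^sub>R Y c' (coord c' (\<tau>' x0)))"
    by (simp only: a)
  also have "\<dots> = \<beta> c' (coord c' (\<tau>' x0)) (\<lambda>i. dder (flow_map c c') (t, coord c (\<tau> x0)) (0, f' (v i)))"
    by (rule alternating_horizontal[OF form_field_alternating[OF ff c(2) m] hz])
  also have "\<dots> = \<beta> c (coord c (\<tau> x0)) (\<lambda>i. f' (v i))"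
    using basic_invariant[OF b c t(1), of "\<lambda>i. f' (v i)"] unfolding t(2) .
  finally show ?thesis .
qed

end

section \<open>Basic forms as forms on the leaf space\<close>

locale circle_manifold7 = circle_manifold X A Y \<rho>
  for X :: "'s topology" and A :: "(real^7, 's) chart set" and Y :: "(real^7, 's) vfield" and \<rho>
begin

abbreviation "LA \<equiv> leaf_atlas X A Y \<rho>"
abbreviation "slice \<equiv> slice_lift X A Y \<rho>"

definition slice_dom :: "(real^6, 's set) chart \<Rightarrow> (real^6 \<Rightarrow> 's) \<Rightarrow> (real^7, 's) chart \<Rightarrow> (real^6) set" where
  "slice_dom d \<sigma> c = {x \<in> fst d. \<sigma> x \<in> chart_range c}"

lemma slice_dom:
  assumes "slice d \<sigma>" "c \<in> A"
  shows "open (slice_dom d \<sigma> c)" "smooth_on (slice_dom d \<sigma> c) (\<lambda>x. coord c (\<sigma> x))"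
  using assms by (simp_all add: slice_lift_def smooth_map_to_def slice_dom_def)

lemma slice_covers:
  assumes "slice d \<sigma>" "x \<in> fst d"
  shows "\<exists>c\<in>A. x \<in> slice_dom d \<sigma> c"
proof -
  have "\<sigma> x \<in> topspace X" using assms by (auto simp: slice_lift_def smooth_map_to_def)
  then show ?thesis using covers[of "\<sigma> x"] assms(2) by (auto simp: slice_dom_def)
qed

definition slice_pull :: "(real^7, 's) form \<Rightarrow> (real^6 \<Rightarrow> 's) \<Rightarrow> (real^7, 's) chart \<Rightarrow> real^6 \<Rightarrow> (nat \<Rightarrow> real^6) \<Rightarrow> complex" where
  "slice_pull \<beta> \<sigma> c x v = \<beta> c (coord c (\<sigma> x)) (\<lambda>i. dder (\<lambda>y. coord c (\<sigma> y)) x (v i))"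

text \<open>A slice is chosen for each orbifold chart and a manifold chart for each point; for basic
  forms \<open>leaf_form_eq\<close> shows that the value depends on neither choice.\<close>

definition leaf_form :: "(real^7, 's) form \<Rightarrow> (real^6, 's set) form" where
  "leaf_form \<beta> d x v = (let \<sigma> = SOME \<sigma>. slice d \<sigma>; c = SOME c. c \<in> A \<and> \<sigma> x \<in> chart_range c in slice_pull \<beta> \<sigma> c x v)"

lemma leaf_chart_open: "d \<in> LA \<Longrightarrow> open (fst d)"
  by (simp add: leaf_atlas_def orbifold_chart_def Let_def)

lemma open_charts_LA: "open_charts LA"
  by (simp add: open_charts_def leaf_chart_open)

text \<open>Two slices over one orbifold chart pass through the same orbits, so
  \<open>orbit_pullback\<close> applies near \<open>x\<close>.\<close>

lemma leaf_form_eq: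
  assumes b: "basic_form A Y k \<beta>" and s: "slice d \<sigma>" and x: "x \<in> fst d" and c: "c \<in> A" "\<sigma> x \<in> chart_range c"
  shows "leaf_form \<beta> d x v = slice_pull \<beta> \<sigma> c x v"
proof -
  define \<sigma>0 where "\<sigma>0 = (SOME \<sigma>. slice d \<sigma>)"
  have s0: "slice d \<sigma>0" unfolding \<sigma>0_def by (rule someI[of "slice d", OF s])
  define c0 where "c0 = (SOME c. c \<in> A \<and> \<sigma>0 x \<in> chart_range c)"
  have "\<exists>c. c \<in> A \<and> \<sigma>0 x \<in> chart_range c" using slice_covers[OF s0 x] by (auto simp: slice_dom_def)
  from someI_ex[OF this] have c0: "c0 \<in> A" "\<sigma>0 x \<in> chart_range c0" by (simp_all add: c0_def)
  let ?W = "slice_dom d \<sigma>0 c0 \<inter> slice_dom d \<sigma> c"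
  have xs: "x \<in> slice_dom d \<sigma>0 c0" "x \<in> slice_dom d \<sigma> c" using x c c0 by (simp_all add: slice_dom_def)
  have "slice_pull \<beta> \<sigma> c x v = slice_pull \<beta> \<sigma>0 c0 x v"
    unfolding slice_pull_def
  proof (rule orbit_pullback[OF b _ _ c0(1) c(1)])
    show "open ?W" using slice_dom[OF s0 c0(1)] slice_dom[OF s c(1)] by blast
    show "x \<in> ?W" using xs by blast
    show "((\<lambda>x. coord c0 (\<sigma>0 x)) has_derivative dder (\<lambda>y. coord c0 (\<sigma>0 y)) x) (at x)"
      by (rule smooth_on_has_derivative[OF slice_dom(2)[OF s0 c0(1)] xs(1)])
    show "((\<lambda>x. coord c (\<sigma> x)) has_derivative dder (\<lambda>y. coord c (\<sigma> y)) x) (at x)"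
      by (rule smooth_on_has_derivative[OF slice_dom(2)[OF s c(1)] xs(2)])
    show "orbit \<rho> (\<sigma> y) = orbit \<rho> (\<sigma>0 y)" if "y \<in> ?W" for y
      using s s0 that by (simp add: slice_lift_def slice_dom_def)
  qed (auto simp: slice_dom_def)
  then show ?thesis by (simp add: leaf_form_def Let_def \<sigma>0_def[symmetric] c0_def[symmetric])
qed

lemma leaf_slice: "d \<in> LA \<Longrightarrow> \<exists>\<sigma>. slice d \<sigma>"
  by (simp add: leaf_atlas_def)

lemma slice_pull_smooth:
  assumes ff: "form_field A k \<beta>" and s: "slice d \<sigma>" and c: "c \<in> A"
  shows "smooth_on (slice_dom d \<sigma> c) (\<lambda>x. slice_pull \<beta> \<sigma> c x v)"
proof -
  let ?W = "slice_dom d \<sigma> c" and ?f = "\<lambda>x. coord c (\<sigma> x)"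
  have im: "?f ` ?W \<subseteq> fst c" by (auto simp: slice_dom_def coord_mem)
  show ?thesis unfolding slice_pull_def
  proof (rule alternating_family(1)[where \<beta> = "\<lambda>x. \<beta> c (?f x)" and k = k and F = "\<lambda>i x. dder ?f x (v i)"])
    show "open ?W" by (rule slice_dom(1)[OF s c])
    show "alternating k (\<beta> c (?f y))" if "y \<in> ?W" for y
      by (rule form_field_alternating[OF ff c]) (use that im in blast)
    show "smooth_on ?W (\<lambda>y. \<beta> c (?f y) w)" for w
      by (rule smooth_on_compose[OF slice_dom(1)[OF s c] dom_open[OF c] im slice_dom(2)[OF s c] form_field_smooth[OF ff c]])
    show "smooth_on ?W (\<lambda>x. dder ?f x (v i))" for i
      by (rule smooth_on_derivative[OF slice_dom(2)[OF s c]])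
  qed
qed

lemma slice_pull_alternating:
  assumes ff: "form_field A k \<beta>" and s: "slice d \<sigma>" and c: "c \<in> A" and x: "x \<in> slice_dom d \<sigma> c"
  shows "alternating k (slice_pull \<beta> \<sigma> c x)"
proof -
  have "coord c (\<sigma> x) \<in> fst c" using x by (simp add: slice_dom_def coord_mem)
  from alternating_pullback[OF form_field_alternating[OF ff c this] frechet_derivative_linear[OF slice_dom(2)[OF s c] x]]
  show ?thesis by (simp add: slice_pull_def[abs_def])
qed

text \<open>Smoothness is local, so one manifold chart at a time suffices. For a change of charts
  \<open>h\<close>, the slice \<open>\<sigma>\<close> and the composite of \<open>\<sigma>'\<close>
  with \<open>h\<close> lift the same orbits, and \<open>orbit_pullback\<close> applies
  again.\<close>

lemma form_field_leaf:
  assumes b: "basic_form A Y k \<beta>"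
  shows "form_field LA k (leaf_form \<beta>)"
proof (rule form_fieldI)
  have ff: "form_field A k \<beta>" using b by (simp add: basic_form_def)
  fix d x assume d: "d \<in> LA" and x: "x \<in> fst d"
  obtain \<sigma> where s: "slice d \<sigma>" using leaf_slice[OF d] by blast
  obtain c where c: "c \<in> A" "x \<in> slice_dom d \<sigma> c" using slice_covers[OF s x] by blast
  have "leaf_form \<beta> d x = slice_pull \<beta> \<sigma> c x"
    using leaf_form_eq[OF b s x c(1)] c(2) by (auto simp: slice_dom_def)
  then show "alternating k (leaf_form \<beta> d x)" using slice_pull_alternating[OF ff s c] by simp
next
  have ff: "form_field A k \<beta>" using b by (simp add: basic_form_def)
  fix d v assume d: "d \<in> LA"
  obtain \<sigma> where s: "slice d \<sigma>" using leaf_slice[OF d] by blast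
  show "smooth_on (fst d) (\<lambda>x. leaf_form \<beta> d x v)"
  proof (rule smooth_on_local)
    fix x assume x: "x \<in> fst d"
    obtain c where c: "c \<in> A" "x \<in> slice_dom d \<sigma> c" using slice_covers[OF s x] by blast
    have "smooth_on (slice_dom d \<sigma> c) (\<lambda>x. leaf_form \<beta> d x v)"
      by (rule smooth_on_cong[OF slice_dom(1)[OF s c(1)], THEN iffD1, OF _ slice_pull_smooth[OF ff s c(1)]])
        (rule leaf_form_eq[OF b s _ c(1), symmetric], simp_all add: slice_dom_def)
    then show "\<exists>V. open V \<and> x \<in> V \<and> smooth_on V (\<lambda>x. leaf_form \<beta> d x v)"
      using slice_dom(1)[OF s c(1)] c(2) by blast
  qed
next
  fix d d' W h x v assume d: "d \<in> LA" "d' \<in> LA" and ch: "chart_change d d' W h" and x: "x \<in> W"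
  have W: "open W" "W \<subseteq> fst d" "smooth_on W h" "\<And>x. x \<in> W \<Longrightarrow> h x \<in> fst d' \<and> snd d' (h x) = snd d x"
    using ch by (simp_all add: chart_change_def)
  obtain \<sigma> where s: "slice d \<sigma>" using leaf_slice[OF d(1)] by blast
  obtain \<sigma>' where s': "slice d' \<sigma>'" using leaf_slice[OF d(2)] by blast
  have xd: "x \<in> fst d" "h x \<in> fst d'" using W x by blast+
  obtain c where c: "c \<in> A" "x \<in> slice_dom d \<sigma> c" using slice_covers[OF s xd(1)] by blast
  obtain c' where c': "c' \<in> A" "h x \<in> slice_dom d' \<sigma>' c'" using slice_covers[OF s' xd(2)] by blast
  let ?V = "slice_dom d \<sigma> c \<inter> (W \<inter> h -` slice_dom d' \<sigma>' c')"
  let ?g = "\<lambda>y. coord c' (\<sigma>' y)"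
  have V: "open ?V"
    using slice_dom(1)[OF s c(1)] continuous_open_preimage[OF smooth_on_continuous[OF W(3)] W(1) slice_dom(1)[OF s' c'(1)]]
    by blast
  have gd: "((\<lambda>y. coord c' (\<sigma>' (h y))) has_derivative (\<lambda>u. dder ?g (h x) (dder h x u))) (at x)"
    by (rule has_derivative_compose[OF smooth_on_has_derivative[OF W(3) x] smooth_on_has_derivative[OF slice_dom(2)[OF s' c'(1)] c'(2)]])
  have "\<beta> c' (coord c' (\<sigma>' (h x))) (\<lambda>i. dder ?g (h x) (dder h x (v i))) = \<beta> c (coord c (\<sigma> x)) (\<lambda>i. dder (\<lambda>y. coord c (\<sigma> y)) x (v i))"
  proof (rule orbit_pullback[OF b V _ c(1) c'(1) _ _ _ gd])
    show "x \<in> ?V" using c c' x by simp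
    show "((\<lambda>x. coord c (\<sigma> x)) has_derivative dder (\<lambda>y. coord c (\<sigma> y)) x) (at x)"
      by (rule smooth_on_has_derivative[OF slice_dom(2)[OF s c(1)] c(2)])
    show "orbit \<rho> (\<sigma>' (h y)) = orbit \<rho> (\<sigma> y)" if "y \<in> ?V" for y
      using s s' that W(4)[of y] by (simp add: slice_lift_def slice_dom_def)
  qed (auto simp: slice_dom_def)
  moreover have "leaf_form \<beta> d x v = slice_pull \<beta> \<sigma> c x v"
    using leaf_form_eq[OF b s xd(1) c(1)] c(2) by (simp add: slice_dom_def)
  moreover have "leaf_form \<beta> d' (h x) (\<lambda>i. dder h x (v i)) = slice_pull \<beta> \<sigma>' c' (h x) (\<lambda>i. dder h x (v i))"
    using leaf_form_eq[OF b s' xd(2) c'(1)] c'(2) by (simp add: slice_dom_def)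
  ultimately show "leaf_form \<beta> d x v = leaf_form \<beta> d' (h x) (\<lambda>i. dder h x (v i))"
    by (simp add: slice_pull_def)
qed

lemma induces_leaf_form: "basic_form A Y k \<beta> \<Longrightarrow> induces X A Y \<rho> k \<beta> (leaf_form \<beta>)"
  unfolding induces_def using form_field_leaf leaf_form_eq by (auto simp: slice_pull_def)

end

section \<open>The induced \<open>SU(3)\<close>-structure\<close>

definition vec3 :: "'e \<Rightarrow> 'e \<Rightarrow> 'e \<Rightarrow> nat \<Rightarrow> 'e" where
  "vec3 u v w i = (if i = 0 then u else if i = 1 then v else w)"

lemma vec3_simps [simp]: "vec3 u v w 0 = u" "vec3 u v w 1 = v" "vec3 u v w (Suc 0) = v" "vec3 u v w 2 = w"
  by (simp_all add: vec3_def)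

lemma wprod_3: "wprod [f, g, h] v = f (v 0) * (g (v 1) * h (v 2) - g (v 2) * h (v 1))
    - f (v 1) * (g (v 0) * h (v 2) - g (v 2) * h (v 0)) + f (v 2) * (g (v 0) * h (v 1) - g (v 1) * h (v 0))"
proof -
  have "wprod [f, g, h] v = wedge 1 2 (wprod [f]) (wprod [g, h]) v"
    by (subst wedge_wprod) simp_all
  also have "\<dots> = wedge 1 2 (\<lambda>v. f (v 0)) (\<lambda>v. (\<lambda>u w. g u * h w - g w * h u) (v 0) (v 1)) v"
    unfolding wprod_1[abs_def] wprod_2[abs_def] ..
  also have "\<dots> = f (v 0) * (g (v 1) * h (v 2) - g (v 2) * h (v 1))
    - f (v 1) * (g (v 0) * h (v 2) - g (v 2) * h (v 0)) + f (v 2) * (g (v 0) * h (v 1) - g (v 1) * h (v 0))"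
    by (rule wedge_1_2) simp
  finally show ?thesis .
qed

lemma cnj_wprod: "cnj (wprod as v) = wprod (map (\<lambda>f u. cnj (f u)) as) v"
  by (simp add: wprod_def)

text \<open>Two-forms commute: exchanging two pairs takes an even number of transpositions.\<close>

lemma wprod_swap_blocks:
  "wprod [c, d, a, b] v = wprod [a, b, c, d] v"
  "wprod [a, b, e, f, c, d] v = wprod [a, b, c, d, e, f] v"
  "wprod [c, d, a, b, e, f] v = wprod [a, b, c, d, e, f] v"
  "wprod [e, f, a, b, c, d] v = wprod [a, b, c, d, e, f] v"
  "wprod [c, d, e, f, a, b] v = wprod [a, b, c, d, e, f] v"
  "wprod [e, f, c, d, a, b] v = wprod [a, b, c, d, e, f] v"
proof -
  show "wprod [c, d, a, b] v = wprod [a, b, c, d] v" for a b c d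
    using wprod_transpose[of 0 "[c, d, a, b]" 2 v] wprod_transpose[of 1 "[a, d, c, b]" 3 v] by simp
  show 1: "wprod [a, b, e, f, c, d] v = wprod [a, b, c, d, e, f] v" for a b c d e f
    using wprod_transpose[of 2 "[a, b, e, f, c, d]" 4 v] wprod_transpose[of 3 "[a, b, c, f, e, d]" 5 v]
    by (simp add: eval_nat_numeral)
  show 2: "wprod [c, d, a, b, e, f] v = wprod [a, b, c, d, e, f] v" for a b c d e f
    using wprod_transpose[of 0 "[c, d, a, b, e, f]" 2 v] wprod_transpose[of 1 "[a, d, c, b, e, f]" 3 v]
    by (simp add: eval_nat_numeral)
  show 3: "wprod [e, f, a, b, c, d] v = wprod [a, b, c, d, e, f] v" for a b c d e f
    using 2[of e f a b c d] 1[of a b e f c d] by simp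
  show "wprod [c, d, e, f, a, b] v = wprod [a, b, c, d, e, f] v"
    using 1[of c d e f a b] 2[of c d a b e f] by simp
  show "wprod [e, f, c, d, a, b] v = wprod [a, b, c, d, e, f] v"
    using 1[of e f c d a b] 3[of e f a b c d] by simp
qed

text \<open>With \<open>ga\<close> the conjugate of \<open>\<eta>\<close> and \<open>t\<close> for
  \<open>\<eta>\<^sub>3\<close>, the left-hand side is
  \<open>d \<eta>' \<and> P - \<eta>' \<and> d P\<close> after insertion of the structure equations,
  where \<open>P = al \<and> be\<close>. The terms with \<open>t\<close> cancel, as they must for a
  basic form.\<close>

lemma su3_coframe_dOmega:
  fixes al be ga :: "'e \<Rightarrow> complex" and t :: "'e \<Rightarrow> complex"
  defines "al' \<equiv> \<lambda>u. cnj (al u)" and "be' \<equiv> \<lambda>u. cnj (be u)" and "ga' \<equiv> \<lambda>u. cnj (ga u)"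
  shows "wedge 2 2 (\<lambda>v. 2 * (wprod [al', be'] v + \<i> * wprod [ga, t] v)) (wprod [al, be]) v
      - wedge 1 3 (wprod [ga]) (\<lambda>v. 2 * \<i> * wprod [al, be, t] v + (wprod [ga', al, al'] v + wprod [ga', be, be'] v)) v
     = - 2 * wprod [al, al', be, be'] v - wprod [al, al', ga, ga'] v - wprod [be, be', ga, ga'] v"
proof -
  have W: "wedge 2 2 (wprod [a, b]) (wprod [c, d]) = wprod [a, b, c, d]" for a b c d :: "'e \<Rightarrow> complex"
    by (subst wedge_wprod) simp_all
  have W3: "wedge 1 3 (wprod [a]) (wprod [b, c, d]) = wprod [a, b, c, d]" for a b c d :: "'e \<Rightarrow> complex"
    by (subst wedge_wprod) simp_all
  have 1: "wprod [al', be', al, be] v = - wprod [al, al', be, be'] v"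
    using wprod_transpose[of 0 "[al', be', al, be]" 2 v] wprod_transpose[of 1 "[al, be', al', be]" 2 v]
      wprod_transpose[of 2 "[al, al', be', be]" 3 v]
    by (simp add: eval_nat_numeral)
  have 2: "wprod [ga, t, al, be] v = wprod [ga, al, be, t] v"
    using wprod_transpose[of 1 "[ga, t, al, be]" 2 v] wprod_transpose[of 2 "[ga, al, t, be]" 3 v]
    by (simp add: eval_nat_numeral)
  show ?thesis
    by (simp add: wedge_scale_left wedge_add_left wedge_add_right wedge_scale_right W W3 1 2
        wprod_swap_blocks(1)[where a = al and b = al' and c = ga and d = ga' and v = v]
        wprod_swap_blocks(1)[where a = be and b = be' and c = ga and d = ga' and v = v] del: One_nat_def)
       (simp add: algebra_simps)?
qed

section \<open>Linear algebra of an \<open>SU(3)\<close> coframe\<close>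

locale su3_coframe =
  fixes al be ga :: "real^6 \<Rightarrow> complex"
  assumes lin: "linear al" "linear be" "linear ga"
    and inj: "al v = 0 \<Longrightarrow> be v = 0 \<Longrightarrow> ga v = 0 \<Longrightarrow> v = 0"
begin

abbreviation "al' \<equiv> \<lambda>u. cnj (al u)"
abbreviation "be' \<equiv> \<lambda>u. cnj (be u)"
abbreviation "ga' \<equiv> \<lambda>u. cnj (ga u)"

definition om :: "(real^6) covector" where
  "om v = \<i> / 2 * (wprod [al, al'] v + wprod [be, be'] v + wprod [ga, ga'] v)"

definition Om :: "(real^6) covector" where
  "Om = wprod [ga, al, be]"

text \<open>This is \<open>4 / 3 * (\<omega> + 3 * \<i> / 2 * \<eta> \<and> \<eta>')\<close> in the
  coframe. As \<open>ga\<close> stands for the conjugate of \<open>\<eta>\<close>, the second term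
  is a negative multiple of \<open>\<i> ga \<and> ga'\<close>, and the coefficients become
  proportional to 1, 1, -2.\<close>

definition tor :: "(real^6) covector" where
  "tor v = 2 * \<i> / 3 * (wprod [al, al'] v + wprod [be, be'] v + (- 2) * wprod [ga, ga'] v)"

text \<open>Source and target have the same real dimension 6, so injectivity suffices.\<close>

lemma surj: "\<exists>v. al v = a \<and> be v = b \<and> ga v = c"
proof -
  let ?L = "\<lambda>v. (al v, be v, ga v)"
  have L: "linear ?L" using lin by (simp add: linear_iff)
  have i: "inj ?L"
    unfolding linear_injective_0[OF L] using inj by (auto simp: zero_prod_def)
  have "dim (range ?L) = dim (UNIV :: (real^6) set)"
    by (rule dim_image_eq[OF L]) (use i in simp)
  then have "dim (range ?L) = DIM(complex \<times> complex \<times> complex)" by simp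
  then have "span (range ?L) = UNIV" using dim_eq_full by blast
  moreover have "span (range ?L) = range ?L"
    using linear_subspace_image[OF L subspace_UNIV] by (simp add: span_eq_iff)
  ultimately have "(a, b, c) \<in> range ?L" by simp
  then show ?thesis by auto
qed

lemmas blocks4 =
  wprod_swap_blocks(1)[where a = al and b = al' and c = be and d = be']
  wprod_swap_blocks(1)[where a = al and b = al' and c = ga and d = ga']
  wprod_swap_blocks(1)[where a = be and b = be' and c = ga and d = ga']

lemmas blocks6 =
  wprod_swap_blocks(2)[where a = al and b = al' and c = be and d = be' and e = ga and f = ga']
  wprod_swap_blocks(3)[where a = al and b = al' and c = be and d = be' and e = ga and f = ga']
  wprod_swap_blocks(4)[where a = al and b = al' and c = be and d = be' and e = ga and f = ga']
  wprod_swap_blocks(5)[where a = al and b = al' and c = be and d = be' and e = ga and f = ga']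
  wprod_swap_blocks(6)[where a = al and b = al' and c = be and d = be' and e = ga and f = ga']

lemma wedge_om:
  "wedge 2 k om (wprod l) v = \<i> / 2 * (wprod (al # al' # l) v + wprod (be # be' # l) v + wprod (ga # ga' # l) v)"
  if "k = length l"
  using wedge_wprod[of 2 "[al, al']" k l] wedge_wprod[of 2 "[be, be']" k l] wedge_wprod[of 2 "[ga, ga']" k l] that
  unfolding om_def[abs_def] wedge_scale_left wedge_add_left by simp

lemma wedge_om_scale_add:
  "wedge 2 k om (\<lambda>v. c * (a v + b v + d v)) v = c * (wedge 2 k om a v + wedge 2 k om b v + wedge 2 k om d v)"
  by (simp only: wedge_scale_right wedge_add_right)

text \<open>The factors are \<open>2 * (\<i> / 2)^2\<close> and \<open>6 * (\<i> / 2)^3\<close>: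
  products with a repeated pair vanish, and each product of distinct pairs occurs 2 or 6
  times.\<close>

lemma om_power:
  "wedge_power om 1 = om"
  "wedge_power om 2 = (\<lambda>v. - 1 / 2 * (wprod [al, al', be, be'] v + wprod [al, al', ga, ga'] v + wprod [be, be', ga, ga'] v))"
  "wedge_power om 3 = (\<lambda>v. - 6 * \<i> / 8 * wprod [al, al', be, be', ga, ga'] v)"
proof -
  have z: "wedge_power om 0 = wprod []" by (rule ext) (simp add: wprod_0)
  have n: "(1::nat) = Suc 0" "(2::nat) = Suc 1" "(3::nat) = Suc 2" by simp_all
  show 1: "wedge_power om 1 = om"
    unfolding n(1) wedge_power.simps(2) z
    by (rule ext, subst wedge_om) (simp_all add: om_def)
  have 2: "wedge_power om 2 v = - 1 / 2 * (wprod [al, al', be, be'] v + wprod [al, al', ga, ga'] v + wprod [be, be', ga, ga'] v)" for v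
  proof -
    have "wedge_power om 2 v = wedge 2 2 om om v"
      unfolding n(2) wedge_power.simps(2) 1 by simp
    also have "\<dots> = \<i> / 2 * (wedge 2 2 om (wprod [al, al']) v + wedge 2 2 om (wprod [be, be']) v + wedge 2 2 om (wprod [ga, ga']) v)"
      by (subst (2) om_def[abs_def]) (rule wedge_om_scale_add)
    also have "\<dots> = - 1 / 2 * (wprod [al, al', be, be'] v + wprod [al, al', ga, ga'] v + wprod [be, be', ga, ga'] v)"
      by (simp add: wedge_om wprod_not_distinct blocks4) (simp add: field_simps)
    finally show ?thesis .
  qed
  then show "wedge_power om 2 = (\<lambda>v. - 1 / 2 * (wprod [al, al', be, be'] v + wprod [al, al', ga, ga'] v + wprod [be, be', ga, ga'] v))"
    by (rule ext)
  note 2 = this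
  have "wedge_power om 3 v = - 6 * \<i> / 8 * wprod [al, al', be, be', ga, ga'] v" for v
  proof -
    have "wedge_power om 3 v = wedge 2 4 om (wedge_power om 2) v"
      unfolding n(3) wedge_power.simps(2) by simp
    also have "\<dots> = - 1 / 2 * (wedge 2 4 om (wprod [al, al', be, be']) v + wedge 2 4 om (wprod [al, al', ga, ga']) v
        + wedge 2 4 om (wprod [be, be', ga, ga']) v)"
      unfolding 2 by (rule wedge_om_scale_add)
    also have "\<dots> = - 6 * \<i> / 8 * wprod [al, al', be, be', ga, ga'] v"
      by (simp add: wedge_om wprod_not_distinct blocks6) (simp add: field_simps)?
    finally show ?thesis .
  qed
  then show "wedge_power om 3 = (\<lambda>v. - 6 * \<i> / 8 * wprod [al, al', be, be', ga, ga'] v)" by (rule ext)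
qed

lemma om_Om: "wedge 2 3 om Om v = 0"
  unfolding Om_def by (simp add: wedge_om wprod_not_distinct)

lemma Om_volume: "wedge 3 3 Om (\<lambda>v. cnj (Om v)) v = - 8 * \<i> * wedge_power om 3 v / fact 3"
proof -
  have c: "(\<lambda>v. cnj (Om v)) = wprod [ga', al', be']" by (rule ext) (simp add: Om_def cnj_wprod)
  have "wedge 3 3 Om (\<lambda>v. cnj (Om v)) v = wprod [ga, al, be, ga', al', be'] v"
    unfolding c unfolding Om_def by (subst wedge_wprod) simp_all
  \<comment> \<open>Three transpositions, an odd number, arrange the factors in conjugate pairs;
    this sign matches the factor \<open>- 8 * \<i>\<close>.\<close>
  also have "\<dots> = - wprod [al, al', be, be', ga, ga'] v"
    using wprod_transpose[of 0 "[ga, al, be, ga', al', be']" 1 v] wprod_transpose[of 1 "[al, ga, be, ga', al', be']" 4 v]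
      wprod_transpose[of 3 "[al, al', be, ga', ga, be']" 5 v]
    by (simp add: eval_nat_numeral)
  finally show ?thesis unfolding om_power(3) by (simp add: fact_numeral)
qed

text \<open>Each monomial of \<open>tor\<close> has a nonzero product with just one monomial of the
  square of \<open>om\<close>, and 1 + 1 - 2 = 0.\<close>

lemma tor_primitive: "wedge 2 4 tor (wedge_power om 2) v = 0"
proof -
  have W: "wedge 2 4 (wprod [a, b]) (wprod [c, d, e, f]) = wprod [a, b, c, d, e, f]" for a b c d e f :: "real^6 \<Rightarrow> complex"
    by (subst wedge_wprod) simp_all
  show ?thesis
    unfolding om_power(2) tor_def[abs_def]
    by (simp only: wedge_scale_left wedge_scale_right wedge_add_left wedge_add_right W)
      (simp add: wprod_not_distinct blocks6)
qed

text \<open>The coefficients -2, -1, -1 split into their mean -4/3, which is 8/3 times the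
  coefficient -1/2 in the square of \<open>om\<close>, and a traceless rest, which is the product of
  \<open>tor\<close> with \<open>om\<close>.\<close>

lemma tor_equation: "8 / 3 * wedge_power om 2 v + wedge 2 2 tor om v =
   - 2 * wprod [al, al', be, be'] v - wprod [al, al', ga, ga'] v - wprod [be, be', ga, ga'] v"
proof -
  have W: "wedge 2 2 (wprod [a, b]) (wprod [c, d]) = wprod [a, b, c, d]" for a b c d :: "real^6 \<Rightarrow> complex"
    by (subst wedge_wprod) simp_all
  have "wedge 2 2 tor om v = - 1 / 3 * (2 * wprod [al, al', be, be'] v - wprod [al, al', ga, ga'] v - wprod [be, be', ga, ga'] v)"
    unfolding om_def[abs_def] tor_def[abs_def]
    by (simp only: wedge_scale_left wedge_scale_right wedge_add_left wedge_add_right W)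
      (simp add: wprod_not_distinct blocks4 field_simps)
  moreover have "8 / 3 * (- 1 / 2 * (a + b + c)) + - 1 / 3 * (2 * a - b - c) = - 2 * a - b - c" for a b c :: complex
    by (simp add: field_simps)
  ultimately show ?thesis unfolding om_power(2) by simp
qed

text \<open>The almost complex structure for which the coframe has type \<open>(1,0)\<close>; it
  exists by \<open>surj\<close> and is unique by \<open>eqI\<close>.\<close>

definition Jp :: "real^6 \<Rightarrow> real^6" where
  "Jp v = (SOME u. al u = \<i> * al v \<and> be u = \<i> * be v \<and> ga u = \<i> * ga v)"

lemma Jp: "al (Jp v) = \<i> * al v" "be (Jp v) = \<i> * be v" "ga (Jp v) = \<i> * ga v"
  using someI_ex[OF surj[of "\<i> * al v" "\<i> * be v" "\<i> * ga v"]] unfolding Jp_def by auto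

lemma eqI: "al u = al v \<Longrightarrow> be u = be v \<Longrightarrow> ga u = ga v \<Longrightarrow> u = v"
  using inj[of "u - v"] by (simp add: linear_diff lin)

lemma Jp_linear: "linear Jp"
  by (rule linearI; rule eqI) (simp_all add: Jp linear_add linear_cmul lin algebra_simps)

lemma Jp_square: "Jp (Jp v) = - v"
  by (rule eqI) (simp_all add: Jp linear_neg lin)

text \<open>Reality of \<open>om\<close>, its invariance under \<open>Jp\<close> and the associated
  metric are read off from this expression by the hermitian form of the coframe.\<close>

lemma om_expand: "om v = - complex_of_real (Im (al (v 0) * cnj (al (v 1)) + be (v 0) * cnj (be (v 1)) + ga (v 0) * cnj (ga (v 1))))"
  by (simp add: om_def wprod_2 complex_eq_iff field_simps)

lemma om_Jp: "om (\<lambda>i. Jp (v i)) = om v"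
  by (simp add: om_expand Jp)

lemma om_metric: "Re (om (vec2 v (Jp w))) = Re (al v * cnj (al w) + be v * cnj (be w) + ga v * cnj (ga w))"
  "Re (om (vec2 v w)) = Re (al (Jp v) * cnj (al w) + be (Jp v) * cnj (be w) + ga (Jp v) * cnj (ga w))"
  by (simp_all add: om_expand Jp vec2_def)

lemma metric_pos: "v \<noteq> 0 \<Longrightarrow> Re (al v * cnj (al v) + be v * cnj (be v) + ga v * cnj (ga v)) > 0"
proof -
  assume v: "v \<noteq> 0"
  have "Re (al v * cnj (al v) + be v * cnj (be v) + ga v * cnj (ga v)) = (cmod (al v))\<^sup>2 + (cmod (be v))\<^sup>2 + (cmod (ga v))\<^sup>2"
    by (simp add: cmod_power2) (simp add: power2_eq_square)
  moreover have "al v \<noteq> 0 \<or> be v \<noteq> 0 \<or> ga v \<noteq> 0" using inj v by blast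
  ultimately show ?thesis
    by (auto intro: add_pos_nonneg add_nonneg_pos simp: add_pos_nonneg add_nonneg_pos)
qed

lemma tor_Jp: "tor (\<lambda>i. Jp (v i)) = tor v"
proof -
  have "(\<i> * x) * cnj (\<i> * y) = x * cnj y" for x y by (simp add: complex_eq_iff)
  then show ?thesis unfolding tor_def wprod_2 Jp by (simp only:)
qed

lemma Om_Jp: "j < 3 \<Longrightarrow> Om (v(j := Jp (v j))) = \<i> * Om v"
proof -
  assume "j < 3"
  then have "j = 0 \<or> j = 1 \<or> j = 2" by linarith
  then show ?thesis
    by (elim disjE) (simp_all add: Om_def wprod_3 Jp algebra_simps)
qed

lemma Om_nonzero: "\<exists>v. Om v \<noteq> 0"
proof -
  obtain p where p: "al p = 1" "be p = 0" "ga p = 0" using surj by blast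
  obtain q where q: "al q = 0" "be q = 1" "ga q = 0" using surj by blast
  obtain r where r: "al r = 0" "be r = 0" "ga r = 1" using surj by blast
  have "Om (vec3 r p q) = 1" by (simp add: Om_def wprod_3 p q r)
  then show ?thesis by (intro exI[of _ "vec3 r p q"]) simp
qed

lemma tor_nonzero: "\<exists>v. tor v \<noteq> 0"
proof -
  obtain p where p: "al p = 1" "be p = 0" "ga p = 0" using surj by blast
  obtain q where q: "al q = \<i>" "be q = 0" "ga q = 0" using surj by blast
  have "tor (vec2 p q) = 4 / 3" by (simp add: tor_def wprod_2 vec2_def p q)
  then have "tor (vec2 p q) \<noteq> 0" by (metis divide_eq_0_iff zero_neq_numeral)
  then show ?thesis by (rule exI[where x = "vec2 p q"])
qed

text \<open>\<open>Om\<close> determines the almost complex structure: a real vector is recovered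
  from its contraction with \<open>Om\<close>, since testing on pairs of vectors dual to the coframe
  yields its three complex components.\<close>

lemma Om_contract_eq:
  assumes "\<And>p q. Om (vec3 u p q) = \<i> * Om (vec3 v p q)"
  shows "u = Jp v"
proof -
  have h: "ga u * (al p * be q - al q * be p) - ga p * (al u * be q - al q * be u) + ga q * (al u * be p - al p * be u) =
     \<i> * (ga v * (al p * be q - al q * be p) - ga p * (al v * be q - al q * be v) + ga q * (al v * be p - al p * be v))" for p q
    using assms[of p q] by (simp add: Om_def wprod_3)
  obtain p where p: "al p = 1" "be p = 0" "ga p = 0" using surj by blast
  obtain q where q: "al q = 0" "be q = 1" "ga q = 0" using surj by blast
  obtain r where r: "al r = 0" "be r = 0" "ga r = 1" using surj by blast
  show ?thesis
    by (rule eqI) (use h[of p q] h[of r q] h[of r p] in \<open>simp_all add: p q r Jp\<close>)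
qed

lemma Om_contract_Jp: "Om (vec3 (Jp v) p q) = \<i> * Om (vec3 v p q)"
  by (simp add: Om_def wprod_3 Jp algebra_simps)

end

section \<open>Exterior derivatives of the forms of the coframe\<close>

lemma ext_d_3:
  "ext_d 3 \<beta> c x v = dder (\<lambda>y. \<beta> c y (\<lambda>j. v (Suc j))) x (v 0)
     - dder (\<lambda>y. \<beta> c y (\<lambda>j. if j < 1 then v j else v (Suc j))) x (v 1)
     + dder (\<lambda>y. \<beta> c y (\<lambda>j. if j < 2 then v j else v (Suc j))) x (v 2)
     - dder (\<lambda>y. \<beta> c y (\<lambda>j. if j < 3 then v j else v (Suc j))) x (v 3)"
  by (simp add: ext_d_def eval_nat_numeral)

text \<open>The Leibniz rule \<open>d (e \<and> B) = de \<and> B - e \<and> dB\<close>, where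
  \<open>E\<close> and \<open>Q\<close> are the exterior derivatives of \<open>e\<close> and
  \<open>B\<close> at \<open>x\<close>.\<close>

lemma ext_d_wedge_1_2:
  fixes e :: "'a::euclidean_space \<Rightarrow> 'a \<Rightarrow> complex" and B :: "'a \<Rightarrow> 'a \<Rightarrow> 'a \<Rightarrow> complex"
  assumes U: "open U" "x \<in> U" and skew: "\<And>y u w. y \<in> U \<Longrightarrow> B y u w = - B y w u"
    and e: "\<And>u. (\<lambda>y. e y u) differentiable (at x)" and B: "\<And>u w. (\<lambda>y. B y u w) differentiable (at x)"
  defines "E \<equiv> \<lambda>u w. dder (\<lambda>y. e y w) x u - dder (\<lambda>y. e y u) x w"
    and "Q \<equiv> \<lambda>u v w. dder (\<lambda>y. B y v w) x u - dder (\<lambda>y. B y u w) x v + dder (\<lambda>y. B y u v) x w"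
  shows "ext_d 3 (\<lambda>c y. wedge 1 2 (\<lambda>v. e y (v 0)) (\<lambda>v. B y (v 0) (v 1))) c x v =
     wedge 2 2 (\<lambda>v. E (v 0) (v 1)) (\<lambda>v. B x (v 0) (v 1)) v - wedge 1 3 (\<lambda>v. e x (v 0)) (\<lambda>v. Q (v 0) (v 1) (v 2)) v"
proof -
  have skD: "dder (\<lambda>y. B y u w) x h = - dder (\<lambda>y. B y w u) x h" for u w h
  proof -
    have "dder (\<lambda>y. B y u w) x h = dder (\<lambda>y. (- 1) * B y w u) x h"
      by (rule fun_cong[OF frechet_derivative_cong_open[OF U]]) (unfold mult_minus1, rule skew)
    also have "\<dots> = - dder (\<lambda>y. B y w u) x h" unfolding dder_cmult[OF B] by simp
    finally show ?thesis .
  qed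
  have d: "dder (\<lambda>y. e y p * B y q r - e y q * B y p r + e y r * B y p q) x h =
     (e x p * dder (\<lambda>y. B y q r) x h + dder (\<lambda>y. e y p) x h * B x q r)
     - (e x q * dder (\<lambda>y. B y p r) x h + dder (\<lambda>y. e y q) x h * B x p r)
     + (e x r * dder (\<lambda>y. B y p q) x h + dder (\<lambda>y. e y r) x h * B x p q)" for p q r h
  proof -
    have m: "(\<lambda>y. e y i * B y j k) differentiable (at x)" for i j k
      by (intro differentiable_mult e B)
    show ?thesis
      unfolding dder_add[OF differentiable_diff[OF m m] m] dder_diff[OF m m] dder_mult[OF e B] ..
  qed
  have W: "wedge 1 2 (\<lambda>v. e y (v 0)) (\<lambda>v. B y (v 0) (v 1)) w =
     e y (w 0) * B y (w 1) (w 2) - e y (w 1) * B y (w 0) (w 2) + e y (w 2) * B y (w 0) (w 1)" if "y \<in> U" for y w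
    using wedge_1_2[where f = "e y" and B = "B y" and v = w, OF skew[OF that]] .
  have w: "dder (\<lambda>y. wedge 1 2 (\<lambda>v. e y (v 0)) (\<lambda>v. B y (v 0) (v 1)) w) x h =
     dder (\<lambda>y. e y (w 0) * B y (w 1) (w 2) - e y (w 1) * B y (w 0) (w 2) + e y (w 2) * B y (w 0) (w 1)) x h" for w h
    by (rule fun_cong[OF frechet_derivative_cong_open[OF U]]) (rule W)
  have n: "(1::nat) = Suc 0" "(2::nat) = Suc (Suc 0)" "(3::nat) = Suc (Suc (Suc 0))" by simp_all
  have E: "E u w = - E w u" for u w by (simp add: E_def)
  have Q: "Q u v w = - Q v u w" "Q u v w = - Q u w v" for u v w
    unfolding Q_def using skD[of v w u] skD[of u v w] skD[of u w v] by (simp_all add: algebra_simps)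
  \<comment> \<open>Here \<open>e0_1\<close> stands for the derivative along \<open>v 0\<close> of
    \<open>e\<close> on \<open>v 1\<close>, and \<open>b0_12\<close> for the derivative along
    \<open>v 0\<close> of \<open>B\<close> on \<open>v 1\<close>, \<open>v 2\<close>; names without
    an underscore are values at \<open>x\<close>.\<close>
  have alg: "((e1 * b0_23 + e0_1 * b23) - (e2 * b0_13 + e0_2 * b13) + (e3 * b0_12 + e0_3 * b12))
     - ((e0 * b1_23 + e1_0 * b23) - (e2 * b1_03 + e1_2 * b03) + (e3 * b1_02 + e1_3 * b02))
     + ((e0 * b2_13 + e2_0 * b13) - (e1 * b2_03 + e2_1 * b03) + (e3 * b2_01 + e2_3 * b01))
     - ((e0 * b3_12 + e3_0 * b12) - (e1 * b3_02 + e3_1 * b02) + (e2 * b3_01 + e3_2 * b01))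
    = ((e0_1 - e1_0) * b23 - (e0_2 - e2_0) * b13 + (e0_3 - e3_0) * b12 + (e1_2 - e2_1) * b03 - (e1_3 - e3_1) * b02 + (e2_3 - e3_2) * b01)
     - (e0 * (b1_23 - b2_13 + b3_12) - e1 * (b0_23 - b2_03 + b3_02) + e2 * (b0_13 - b1_03 + b3_01) - e3 * (b0_12 - b1_02 + b2_01))"
    for e0 e1 e2 e3 b01 b02 b03 b12 b13 b23 e0_1 e0_2 e0_3 e1_0 e1_2 e1_3 e2_0 e2_1 e2_3 e3_0 e3_1 e3_2
      b0_12 b0_13 b0_23 b1_02 b1_03 b1_23 b2_01 b2_03 b2_13 b3_01 b3_02 b3_12 :: complex
    by (simp add: algebra_simps)
  note W2 = wedge_2_2[where A = E and B = "B x" and v = v, OF E skew[OF U(2)]]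
    and W3 = wedge_1_3[where f = "e x" and Q = Q and v = v, OF Q]
  define F where "F = (\<lambda>h p q r. dder (\<lambda>y. e y p * B y q r - e y q * B y p r + e y r * B y p q) x h)"
  have L: "ext_d 3 (\<lambda>c y. wedge 1 2 (\<lambda>v. e y (v 0)) (\<lambda>v. B y (v 0) (v 1))) c x v =
     F (v 0) (v 1) (v 2) (v 3) - F (v 1) (v 0) (v 2) (v 3) + F (v 2) (v 0) (v 1) (v 3) - F (v 3) (v 0) (v 1) (v 2)"
    unfolding ext_d_3 w F_def by (simp add: n)
  show ?thesis
    unfolding L F_def d
    unfolding W2 W3
    unfolding E_def Q_def
    by (rule alg)
qed

text \<open>The pullbacks of \<open>\<eta>\<close> and \<open>\<eta>\<^sub>3\<close> along a slice, with a coframe in which their exterior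
  derivatives take the normal form; \<open>al\<close> and \<open>be\<close> need not vary smoothly.\<close>

locale leaf_calculus =
  fixes W :: "(real^6) set" and a t al be :: "real^6 \<Rightarrow> real^6 \<Rightarrow> complex"
  assumes open_W: "open W"
    and a_linear: "y \<in> W \<Longrightarrow> linear (a y)" and t_linear: "y \<in> W \<Longrightarrow> linear (t y)"
    and a_smooth: "smooth_on W (\<lambda>y. a y u)" and t_smooth: "smooth_on W (\<lambda>y. t y u)"
    and t_real: "cnj (t y u) = t y u"
    and al_linear: "y \<in> W \<Longrightarrow> linear (al y)" and be_linear: "y \<in> W \<Longrightarrow> linear (be y)"
    and injective: "y \<in> W \<Longrightarrow> al y v = 0 \<Longrightarrow> be y v = 0 \<Longrightarrow> a y v = 0 \<Longrightarrow> v = 0"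
    and d_a: "y \<in> W \<Longrightarrow> dder (\<lambda>y. a y w) y v - dder (\<lambda>y. a y v) y w =
       2 * (al y v * be y w - al y w * be y v - \<i> * (a y v * t y w - a y w * t y v))"
    and d_t: "y \<in> W \<Longrightarrow> dder (\<lambda>y. t y w) y v - dder (\<lambda>y. t y v) y w =
       2 * (\<i> / 2 * (al y v * cnj (al y w) - al y w * cnj (al y v)
         + (be y v * cnj (be y w) - be y w * cnj (be y v)) + (a y v * cnj (a y w) - a y w * cnj (a y v))))"
begin

text \<open>\<open>\<omega>\<^sub>3\<close> enters as half the exterior derivative of
  \<open>t\<close>, and in \<open>P\<close> the form
  \<open>\<omega>\<^sub>1 + \<i> \<omega>\<^sub>2\<close> as half that of \<open>a\<close>. These
  expressions are smooth, and their own exterior derivatives vanish by symmetry of second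
  derivatives.\<close>

definition omg :: "real^6 \<Rightarrow> (real^6) covector" where
  "omg y v = 1 / 2 * (dder (\<lambda>y. t y (v 1)) y (v 0) - dder (\<lambda>y. t y (v 0)) y (v 1))
     - \<i> * (a y (v 0) * cnj (a y (v 1)) - a y (v 1) * cnj (a y (v 0)))"

definition P :: "real^6 \<Rightarrow> real^6 \<Rightarrow> real^6 \<Rightarrow> complex" where
  "P y u w = 1 / 2 * (dder (\<lambda>y. a y w) y u - dder (\<lambda>y. a y u) y w) + \<i> * (a y u * t y w - a y w * t y u)"

definition Omg :: "real^6 \<Rightarrow> (real^6) covector" where
  "Omg y = wedge 1 2 (\<lambda>v. cnj (a y (v 0))) (\<lambda>v. P y (v 0) (v 1))"

lemma P_skew: "P y u w = - P y w u"
  by (simp add: P_def field_simps)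

lemma Omg_eq: "Omg y v = cnj (a y (v 0)) * P y (v 1) (v 2) - cnj (a y (v 1)) * P y (v 0) (v 2) + cnj (a y (v 2)) * P y (v 0) (v 1)"
  unfolding Omg_def by (rule wedge_1_2[where f = "\<lambda>u. cnj (a y u)" and B = "P y", OF P_skew])

lemma coframe: "y \<in> W \<Longrightarrow> su3_coframe (al y) (be y) (\<lambda>u. cnj (a y u))"
  using al_linear be_linear a_linear injective by (simp add: su3_coframe_def linear_iff)

text \<open>The coefficient of \<open>\<eta> \<and> \<eta>'\<close> changes from
  \<open>\<i> / 2\<close> to \<open>- \<i> / 2\<close>, which is \<open>\<i> / 2\<close> once the
  conjugate of \<open>\<eta>\<close> takes the first place.\<close>

lemma omg_coframe: "y \<in> W \<Longrightarrow> omg y v = su3_coframe.om (al y) (be y) (\<lambda>u. cnj (a y u)) v"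
proof -
  assume y: "y \<in> W"
  show ?thesis
    unfolding omg_def d_t[OF y] su3_coframe.om_def[OF coframe[OF y]] wprod_2 complex_cnj_cnj by (simp add: field_simps)
qed

text \<open>The second term of \<open>P\<close> cancels the part of \<open>d_a\<close> that contains
  \<open>t\<close>.\<close>

lemma P_coframe: "y \<in> W \<Longrightarrow> P y (v 0) (v 1) = wprod [al y, be y] v"
proof -
  assume y: "y \<in> W"
  have "1 / 2 * (2 * (p - q)) + q = p" for p q :: complex by (simp add: field_simps)
  then show ?thesis unfolding P_def d_a[OF y] wprod_2 .
qed

lemma Omg_coframe: "y \<in> W \<Longrightarrow> Omg y v = su3_coframe.Om (al y) (be y) (\<lambda>u. cnj (a y u)) v"
proof -
  assume y: "y \<in> W"
  have P: "P y (v i) (v j) = al y (v i) * be y (v j) - al y (v j) * be y (v i)" for i j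
    using P_coframe[OF y, of "vec2 (v i) (v j)"] by (simp add: wprod_2 vec2_def)
  show ?thesis
    unfolding Omg_eq P su3_coframe.Om_def[OF coframe[OF y]] wprod_3 ..
qed

lemma a_diff: "x \<in> W \<Longrightarrow> (\<lambda>y. a y u) differentiable (at x)"
  and t_diff: "x \<in> W \<Longrightarrow> (\<lambda>y. t y u) differentiable (at x)"
  and da_diff: "x \<in> W \<Longrightarrow> (\<lambda>y. dder (\<lambda>y. a y u) y w) differentiable (at x)"
  and dt_diff: "x \<in> W \<Longrightarrow> (\<lambda>y. dder (\<lambda>y. t y u) y w) differentiable (at x)"
  by (rule smooth_on_differentiable[OF a_smooth], assumption)
     (rule smooth_on_differentiable[OF t_smooth], assumption,
      rule smooth_on_differentiable[OF smooth_on_derivative[OF a_smooth]], assumption,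
      rule smooth_on_differentiable[OF smooth_on_derivative[OF t_smooth]], assumption)

lemma cnj_a_diff: "x \<in> W \<Longrightarrow> (\<lambda>y. cnj (a y u)) differentiable (at x)"
  by (rule smooth_on_differentiable[OF smooth_on_bounded_linear[OF open_W bounded_linear_cnj a_smooth]])

lemma second_a: "x \<in> W \<Longrightarrow> dder (\<lambda>y. dder (\<lambda>y. a y w) y u) x v = dder (\<lambda>y. dder (\<lambda>y. a y w) y v) x u"
  by (rule second_derivative_symmetric[OF open_W _ a_smooth])

lemma second_t: "x \<in> W \<Longrightarrow> dder (\<lambda>y. dder (\<lambda>y. t y w) y u) x v = dder (\<lambda>y. dder (\<lambda>y. t y w) y v) x u"
  by (rule second_derivative_symmetric[OF open_W _ t_smooth])

text \<open>Half the exterior derivative of \<open>t\<close> is closed, so only the derivative of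
  \<open>\<eta> \<and> \<eta>'\<close> remains. It is compared with \<open>Omg\<close> without the
  coframe: \<open>P\<close> differs from half the exterior derivative of \<open>a\<close> by a term
  whose contribution to \<open>Omg\<close> is real, because \<open>t\<close> is real.\<close>

lemma d_omg:
  assumes x: "x \<in> W"
  shows "ext_d 2 (\<lambda>c. omg) c x v = 4 * complex_of_real (Im (Omg x v))"
proof -
  let ?D = "\<lambda>u w. dder (\<lambda>y. a y w) x u" and ?T = "\<lambda>u v w. dder (\<lambda>y. dder (\<lambda>y. t y w) y v) x u"
  note ad = a_diff[OF x] cnj_a_diff[OF x] dt_diff[OF x]
  have m: "(\<lambda>y. a y p * cnj (a y q)) differentiable (at x)" for p q by (intro differentiable_mult ad)
  have h: "(\<lambda>y. 1 / 2 * (dder (\<lambda>y. t y q) y p - dder (\<lambda>y. t y p) y q)) differentiable (at x)" for p q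
    by (intro differentiable_mult differentiable_diff differentiable_const ad)
  have d: "dder (\<lambda>y. omg y w) x h = 1 / 2 * (?T h (w 0) (w 1) - ?T h (w 1) (w 0))
     - \<i> * ((a x (w 0) * cnj (?D h (w 1)) + ?D h (w 0) * cnj (a x (w 1))) - (a x (w 1) * cnj (?D h (w 0)) + ?D h (w 1) * cnj (a x (w 0))))" for w h
    unfolding omg_def
      dder_diff[OF h differentiable_mult[OF differentiable_const differentiable_diff[OF m m]]]
      dder_cmult[OF differentiable_diff[OF m m]] dder_diff[OF m m] dder_mult[OF ad(1,2)] dder_cnj[OF ad(1)]
      dder_cmult[OF differentiable_diff[OF ad(3) ad(3)]] dder_diff[OF ad(3) ad(3)]
    by (rule refl)
  have n: "(1::nat) = Suc 0" "(2::nat) = Suc (Suc 0)" by simp_all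
  define u0 u1 u2 where u: "u0 = v 0" "u1 = v (Suc 0)" "u2 = v (Suc (Suc 0))"
  have L: "ext_d 2 (\<lambda>c. omg) c x v = (1 / 2 * (?T u0 u1 u2 - ?T u0 u2 u1)
     - \<i> * ((a x u1 * cnj (?D u0 u2) + ?D u0 u1 * cnj (a x u2)) - (a x u2 * cnj (?D u0 u1) + ?D u0 u2 * cnj (a x u1))))
    - (1 / 2 * (?T u1 u0 u2 - ?T u1 u2 u0)
     - \<i> * ((a x u0 * cnj (?D u1 u2) + ?D u1 u0 * cnj (a x u2)) - (a x u2 * cnj (?D u1 u0) + ?D u1 u2 * cnj (a x u0))))
    + (1 / 2 * (?T u2 u0 u1 - ?T u2 u1 u0)
     - \<i> * ((a x u0 * cnj (?D u2 u1) + ?D u2 u0 * cnj (a x u1)) - (a x u1 * cnj (?D u2 u0) + ?D u2 u1 * cnj (a x u0))))"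
    unfolding ext_d_2 d u by (simp add: n)
  \<comment> \<open>Expressing the imaginary part by conjugates turns the claim into a polynomial
    identity modulo \<open>\<i> * \<i> = -1\<close> and \<open>2 * half = 1\<close>.\<close>
  have I: "4 * complex_of_real (Im z) = - 2 * \<i> * (z - cnj z)" for z
    by (simp add: complex_eq_iff)
  have i2: "\<i> * \<i> = -1" by simp
  define half :: complex where "half = 1 / 2"
  have half: "2 * half = 1" "cnj half = half" by (simp_all add: half_def)
  show ?thesis
    unfolding L unfolding I Omg_eq P_def n u[symmetric] half_def[symmetric] complex_cnj_add complex_cnj_diff complex_cnj_mult complex_cnj_divide
      complex_cnj_numeral complex_cnj_i complex_cnj_cnj t_real half(2)
      second_t[OF x, of u2 u0 u1] second_t[OF x, of u1 u0 u2] second_t[OF x, of u0 u1 u2]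
    using i2 half(1) by algebra
qed

lemma d_Omg:
  assumes x: "x \<in> W"
  shows "ext_d 3 (\<lambda>c. Omg) c x v =
    - 2 * wprod [al x, \<lambda>u. cnj (al x u), be x, \<lambda>u. cnj (be x u)] v
    - wprod [al x, \<lambda>u. cnj (al x u), \<lambda>u. cnj (a x u), a x] v - wprod [be x, \<lambda>u. cnj (be x u), \<lambda>u. cnj (a x u), a x] v"
proof -
  let ?al' = "\<lambda>u. cnj (al x u)" and ?be' = "\<lambda>u. cnj (be x u)" and ?ga = "\<lambda>u. cnj (a x u)"
  let ?D = "\<lambda>u w. dder (\<lambda>y. a y w) x u" and ?T = "\<lambda>u w. dder (\<lambda>y. t y w) x u"
    and ?A = "\<lambda>u v w. dder (\<lambda>y. dder (\<lambda>y. a y w) y v) x u"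
  note ad = a_diff[OF x] t_diff[OF x] da_diff[OF x]
  have m: "(\<lambda>y. a y p * t y q) differentiable (at x)" for p q by (intro differentiable_mult ad)
  have h: "(\<lambda>y. 1 / 2 * (dder (\<lambda>y. a y q) y p - dder (\<lambda>y. a y p) y q)) differentiable (at x)" for p q
    by (intro differentiable_mult differentiable_diff differentiable_const ad)
  have flow_dom: "(\<lambda>y. P y u w) differentiable (at x)" for u w
    unfolding P_def by (intro differentiable_add h differentiable_mult differentiable_const differentiable_diff m ad)
  have d: "dder (\<lambda>y. P y p q) x h = 1 / 2 * (?A h p q - ?A h q p)
      + \<i> * ((a x p * ?T h q + ?D h p * t x q) - (a x q * ?T h p + ?D h q * t x p))" for p q h
    unfolding P_def
      dder_add[OF h differentiable_mult[OF differentiable_const differentiable_diff[OF m m]]]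
      dder_cmult[OF differentiable_diff[OF m m]] dder_diff[OF m m] dder_mult[OF ad(1,2)]
      dder_cmult[OF differentiable_diff[OF ad(3) ad(3)]] dder_diff[OF ad(3) ad(3)]
    by (rule refl)
  have i2: "\<i> * \<i> = -1" by simp
  have tau: "2 * (\<i> / 2 * z) = \<i> * z" for z by simp
  \<comment> \<open>The exterior derivative of \<open>P\<close>. Second derivatives cancel, and what
    is left is \<open>\<i> (da \<and> t - a \<and> dt)\<close>, into which the structure equations
    are inserted.\<close>
  have Q: "dder (\<lambda>y. P y (v 1) (v 2)) x (v 0) - dder (\<lambda>y. P y (v 0) (v 2)) x (v 1) + dder (\<lambda>y. P y (v 0) (v 1)) x (v 2) =
     2 * \<i> * wprod [al x, be x, t x] v + (wprod [a x, al x, ?al'] v + wprod [a x, be x, ?be'] v)" for v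
  proof -
    have "dder (\<lambda>y. P y (v 1) (v 2)) x (v 0) - dder (\<lambda>y. P y (v 0) (v 2)) x (v 1) + dder (\<lambda>y. P y (v 0) (v 1)) x (v 2) =
      \<i> * ((?D (v 0) (v 1) - ?D (v 1) (v 0)) * t x (v 2) - (?D (v 0) (v 2) - ?D (v 2) (v 0)) * t x (v 1)
       + (?D (v 1) (v 2) - ?D (v 2) (v 1)) * t x (v 0) + a x (v 1) * (?T (v 0) (v 2) - ?T (v 2) (v 0))
       - a x (v 2) * (?T (v 0) (v 1) - ?T (v 1) (v 0)) - a x (v 0) * (?T (v 1) (v 2) - ?T (v 2) (v 1)))"
      unfolding d second_a[OF x, of "v 2" "v 0" "v 1"] second_a[OF x, of "v 1" "v 0" "v 2"] second_a[OF x, of "v 0" "v 1" "v 2"]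
      by (simp add: algebra_simps)

    also have "\<dots> = 2 * \<i> * wprod [al x, be x, t x] v + (wprod [a x, al x, ?al'] v + wprod [a x, be x, ?be'] v)"
      unfolding d_a[OF x] d_t[OF x] wprod_3 tau using i2 by algebra
    finally show ?thesis .
  qed
  \<comment> \<open>The conjugate of the structure equation for \<open>a\<close>, with
    \<open>t\<close> real.\<close>
  have E: "dder (\<lambda>y. cnj (a y (v 1))) x (v 0) - dder (\<lambda>y. cnj (a y (v 0))) x (v 1) =
      2 * (wprod [?al', ?be'] v + \<i> * wprod [?ga, t x] v)" for v
  proof -
    have "dder (\<lambda>y. cnj (a y (v 1))) x (v 0) - dder (\<lambda>y. cnj (a y (v 0))) x (v 1) = cnj (?D (v 0) (v 1) - ?D (v 1) (v 0))"
      unfolding dder_cnj[OF ad(1)] by simp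
    also have "\<dots> = 2 * (wprod [?al', ?be'] v + \<i> * wprod [?ga, t x] v)"
      unfolding d_a[OF x] by (simp add: wprod_2 t_real)
    finally show ?thesis .
  qed
  have "ext_d 3 (\<lambda>c. Omg) c x v = wedge 2 2 (\<lambda>v. 2 * (wprod [?al', ?be'] v + \<i> * wprod [?ga, t x] v)) (wprod [al x, be x]) v
      - wedge 1 3 (wprod [?ga]) (\<lambda>v. 2 * \<i> * wprod [al x, be x, t x] v + (wprod [a x, al x, ?al'] v + wprod [a x, be x, ?be'] v)) v"
    unfolding Omg_def ext_d_wedge_1_2[where e = "\<lambda>y u. cnj (a y u)" and B = P and c = c and v = v,
        OF open_W x P_skew cnj_a_diff[OF x] flow_dom] Q E P_coframe[OF x] wprod_1[of ?ga, symmetric]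
    ..
  then show ?thesis
    using su3_coframe_dOmega[of "al x" "be x" ?ga "t x" v] by simp
qed

end

section \<open>From local coframes to an LT structure\<close>

lemma smooth_on_det:
  fixes M :: "'a::euclidean_space \<Rightarrow> real^'n^'n"
  assumes U: "open U" and M: "\<And>i j. smooth_on U (\<lambda>x. M x $ i $ j)"
  shows "smooth_on U (\<lambda>x. det (M x))"
  unfolding det_def
  by (intro smooth_on_sum[OF U] smooth_on_mult[OF U] smooth_on_prod[OF U] smooth_on_const M)

text \<open>By Cramer's rule the components of the solution are quotients of polynomials in the
  coefficients. Thus smoothness of \<open>u\<close> follows without any regularity of
  \<open>u\<close> being known beforehand.\<close>

lemma smooth_on_linear_system:
  fixes M :: "'a::euclidean_space \<Rightarrow> real^'n^'n" and b u :: "'a \<Rightarrow> real^'n"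
  assumes U: "open U" and M: "\<And>i j. smooth_on U (\<lambda>x. M x $ i $ j)" and b: "\<And>i. smooth_on U (\<lambda>x. b x $ i)"
    and eq: "\<And>x. x \<in> U \<Longrightarrow> M x *v u x = b x" and inj: "\<And>x v. x \<in> U \<Longrightarrow> M x *v v = 0 \<Longrightarrow> v = 0"
  shows "smooth_on U u"
proof -
  have det: "det (M x) \<noteq> 0" if "x \<in> U" for x
  proof -
    have "\<forall>v. M x *v v = 0 \<longrightarrow> v = 0" using inj[OF that] by blast
    then show ?thesis
      by (simp only: matrix_left_invertible_ker[symmetric] invertible_left_inverse[symmetric] invertible_det_nz not_False_eq_True)
  qed
  have "smooth_on U (\<lambda>x. u x $ k)" for k
  proof -
    have s: "smooth_on U (\<lambda>x. det (\<chi> i j. if j = k then b x $ i else M x $ i $ j) * inverse (det (M x)))"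
    proof (intro smooth_on_mult[OF U] smooth_on_inverse[OF U] smooth_on_det[OF U] M det)
      show "smooth_on U (\<lambda>x. (\<chi> i j. if j = k then b x $ i else M x $ i $ j) $ i $ j)" for i j
        using M b by (cases "j = k") simp_all
    qed
    have e: "det (\<chi> i j. if j = k then b x $ i else M x $ i $ j) * inverse (det (M x)) = u x $ k" if "x \<in> U" for x
      using cramer[OF det[OF that], of "u x" "b x"] eq[OF that] by (simp add: divide_inverse)
    show ?thesis
      by (rule smooth_on_cong[OF U, THEN iffD1, OF e s])
  qed
  note components = this
  show ?thesis
  proof (rule smooth_on_componentwise[OF U])
    fix e :: "real^'n" assume "e \<in> Basis"
    then obtain k where "e = axis k 1" by (auto simp: Basis_vec_def)
    then show "smooth_on U (\<lambda>x. u x \<bullet> e)" using components[of k] by (simp add: inner_axis)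
  qed
qed

lemma form_field_zero: "form_field A k (\<lambda>_ _ _. 0)"
  by (rule form_fieldI) (simp_all add: alternating_def linear_iff)

lemma has_type_zero: "has_type A J k P (\<lambda>_ _ _. 0)"
  by (simp add: has_type_def covector_type_def)

lemma bilinear_vec_expand:
  fixes G :: "real^'n \<Rightarrow> real^'n \<Rightarrow> real"
  assumes "bilinear G"
  shows "G u w = (\<Sum>i\<in>UNIV. u $ i * G (axis i 1) w)"
proof -
  have L: "linear (\<lambda>u. G u w)" using assms by (simp add: bilinear_def)
  have "G u w = G (\<Sum>i\<in>UNIV. u $ i *\<^sub>R axis i 1) w"
    using basis_expansion[of u] by (simp add: scalar_mult_eq_scaleR)
  also have "\<dots> = (\<Sum>i\<in>UNIV. u $ i * G (axis i 1) w)"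
    by (simp only: linear_sum[OF L] linear_cmul[OF L] real_scaleR_def)
  finally show ?thesis .
qed

text \<open>The forms \<open>al\<close> and \<open>be\<close> need not depend smoothly on the point.
  Therefore the hermitian metric of the coframe is required separately, as a smooth family
  \<open>G\<close>.\<close>

locale local_lt =
  fixes A :: "(real^6, 'z) chart set" and \<omega> \<Omega> \<theta> :: "(real^6, 'z) form"
  assumes open_charts: "open_charts A"
    and forms: "form_field A 2 \<omega>" "form_field A 3 \<Omega>" "form_field A 2 \<theta>"
    and local_coframe: "d \<in> A \<Longrightarrow> x \<in> fst d \<Longrightarrow> \<exists>W a t al be G. x \<in> W \<and> W \<subseteq> fst d \<and> leaf_calculus W a t al be \<and>
      (\<forall>y\<in>W. \<forall>v. \<omega> d y v = leaf_calculus.omg a t y v \<and> \<Omega> d y v = leaf_calculus.Omg a t y v \<and>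
         \<theta> d y v = a y (v 0) * cnj (a y (v 1)) - a y (v 1) * cnj (a y (v 0))) \<and>
      (\<forall>v w. smooth_on W (\<lambda>y. G y v w)) \<and>
      (\<forall>y\<in>W. \<forall>v w. G y v w = Re (al y v * cnj (al y w) + be y v * cnj (be y w) + a y v * cnj (a y w)))"
begin

definition W2 :: "(real^6, 'z) form" where
  "W2 d x v = 8 / 3 / 2 * (\<omega> d x v + 3 * \<i> / 2 * \<theta> d x v)"

lemma pointwise_all:
  assumes d: "d \<in> A" and x: "x \<in> fst d"
  obtains al be ga where "su3_coframe al be ga" "\<omega> d x = su3_coframe.om al be ga" "\<Omega> d x = su3_coframe.Om al be ga"
     "W2 d x = su3_coframe.tor al be ga"
     "\<And>v. ext_d 2 \<omega> d x v = 4 * complex_of_real (Im (\<Omega> d x v))"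
     "\<And>v. ext_d 3 \<Omega> d x v = 8 / 3 * wedge_power (\<omega> d x) 2 v + wedge 2 2 (W2 d x) (\<omega> d x) v"
proof -
  from local_coframe[OF d x] obtain W a t al be G where W: "x \<in> W" "W \<subseteq> fst d" "leaf_calculus W a t al be"
    and e: "\<forall>y\<in>W. \<forall>v. \<omega> d y v = leaf_calculus.omg a t y v \<and> \<Omega> d y v = leaf_calculus.Omg a t y v \<and>
         \<theta> d y v = a y (v 0) * cnj (a y (v 1)) - a y (v 1) * cnj (a y (v 0))"
    by (elim exE conjE)
  interpret leaf_calculus W a t al be by (rule W(3))
  have eo: "\<omega> d y v = omg y v" and eO: "\<Omega> d y v = Omg y v"
    and et: "\<theta> d y v = a y (v 0) * cnj (a y (v 1)) - a y (v 1) * cnj (a y (v 0))" if "y \<in> W" for y v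
    using e that by simp_all
  interpret S: su3_coframe "al x" "be x" "\<lambda>u. cnj (a x u)" by (rule coframe[OF W(1)])
  have om: "\<omega> d x = S.om" by (rule ext) (simp only: eo[OF W(1)] omg_coframe[OF W(1)])
  have Om: "\<Omega> d x = S.Om" by (rule ext) (simp only: eO[OF W(1)] Omg_coframe[OF W(1)])
  have tor: "W2 d x = S.tor"
  proof (rule ext)
    fix v
    show "W2 d x v = S.tor v"
      unfolding W2_def om S.om_def S.tor_def et[OF W(1)] wprod_2 complex_cnj_cnj by (simp add: field_simps)
  qed
  show thesis
  proof (rule that[OF S.su3_coframe_axioms om Om tor])
    show "ext_d 2 \<omega> d x v = 4 * complex_of_real (Im (\<Omega> d x v))" for v
      unfolding eO[OF W(1)] d_omg[OF W(1), of d v, symmetric] by (rule ext_d_cong[OF open_W W(1), where \<alpha> = \<omega> and \<beta> = "\<lambda>c. omg", OF eo])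
    have "ext_d 3 \<Omega> d x v = ext_d 3 (\<lambda>c. Omg) d x v" for v
      by (rule ext_d_cong[OF open_W W(1), where \<alpha> = \<Omega> and \<beta> = "\<lambda>c. Omg", OF eO])
    then show "ext_d 3 \<Omega> d x v = 8 / 3 * wedge_power (\<omega> d x) 2 v + wedge 2 2 (W2 d x) (\<omega> d x) v" for v
      unfolding om tor S.tor_equation d_Omg[OF W(1)] complex_cnj_cnj .
  qed
qed

lemma pointwise:
  assumes "d \<in> A" "x \<in> fst d"
  obtains al be ga where "su3_coframe al be ga" "\<omega> d x = su3_coframe.om al be ga" "\<Omega> d x = su3_coframe.Om al be ga"
     "W2 d x = su3_coframe.tor al be ga"
  by (rule pointwise_all[OF assms], rule that)

lemma exterior_derivatives:
  assumes "d \<in> A" "x \<in> fst d"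
  shows "ext_d 2 \<omega> d x v = 4 * complex_of_real (Im (\<Omega> d x v))"
    "ext_d 3 \<Omega> d x v = 8 / 3 * wedge_power (\<omega> d x) 2 v + wedge 2 2 (W2 d x) (\<omega> d x) v"
  by (rule pointwise_all[OF assms], assumption)+

text \<open>A description by \<open>\<Omega>\<close> alone makes \<open>Jz\<close> independent of
  coframe and chart. Such a vector exists by \<open>Om_contract_Jp\<close> and is unique by
  \<open>Om_contract_eq\<close>.\<close>

definition Jz :: "(real^6, 'z) endo" where
  "Jz d x v = (SOME u. \<forall>p q. \<Omega> d x (vec3 u p q) = \<i> * \<Omega> d x (vec3 v p q))"

lemma Jz_eq:
  assumes "su3_coframe al be ga" "\<Omega> d x = su3_coframe.Om al be ga"
  shows "Jz d x = su3_coframe.Jp al be ga"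
    "(\<And>p q. \<Omega> d x (vec3 u p q) = \<i> * \<Omega> d x (vec3 v p q)) \<Longrightarrow> u = Jz d x v"
proof -
  interpret su3_coframe al be ga by (rule assms(1))
  have u: "(\<And>p q. \<Omega> d x (vec3 u p q) = \<i> * \<Omega> d x (vec3 v p q)) \<Longrightarrow> u = Jp v" for u v
    unfolding assms(2) by (rule Om_contract_eq)
  show "Jz d x = Jp"
  proof (rule ext)
    fix v
    have "\<forall>p q. \<Omega> d x (vec3 (Jp v) p q) = \<i> * \<Omega> d x (vec3 v p q)"
      unfolding assms(2) by (intro allI Om_contract_Jp)
    from someI[of "\<lambda>u. \<forall>p q. \<Omega> d x (vec3 u p q) = \<i> * \<Omega> d x (vec3 v p q)", OF this]
    show "Jz d x v = Jp v" unfolding Jz_def by (intro u) blast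
  qed
  then show "(\<And>p q. \<Omega> d x (vec3 u p q) = \<i> * \<Omega> d x (vec3 v p q)) \<Longrightarrow> u = Jz d x v"
    using u by simp
qed

text \<open>\<open>\<omega> (v, w)\<close> equals \<open>G (Jz v, w)\<close>. Testing with the
  standard basis vectors \<open>w\<close> gives a linear system for \<open>Jz v\<close> with smooth
  coefficients, which is uniquely solvable because \<open>G\<close> is positive definite.\<close>

lemma Jz_smooth:
  assumes d: "d \<in> A"
  shows "smooth_on (fst d) (\<lambda>x. Jz d x v)"
proof (rule smooth_on_local)
  fix x assume x: "x \<in> fst d"
  from local_coframe[OF d x] obtain W a t al be G where W: "x \<in> W" "W \<subseteq> fst d" "leaf_calculus W a t al be"
    and e: "\<forall>y\<in>W. \<forall>v. \<omega> d y v = leaf_calculus.omg a t y v \<and> \<Omega> d y v = leaf_calculus.Omg a t y v \<and>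
         \<theta> d y v = a y (v 0) * cnj (a y (v 1)) - a y (v 1) * cnj (a y (v 0))"
    and G': "\<forall>v w. smooth_on W (\<lambda>y. G y v w)"
      "\<forall>y\<in>W. \<forall>v w. G y v w = Re (al y v * cnj (al y w) + be y v * cnj (be y w) + a y v * cnj (a y w))"
    by (elim exE conjE)
  interpret leaf_calculus W a t al be by (rule W(3))
  have eo: "\<omega> d y v = omg y v" and eO: "\<Omega> d y v = Omg y v" if "y \<in> W" for y v
    using e that by simp_all
  have G: "smooth_on W (\<lambda>y. G y v w)"
    "y \<in> W \<Longrightarrow> G y v w = Re (al y v * cnj (al y w) + be y v * cnj (be y w) + a y v * cnj (a y w))" for y v w
    using G' by simp_all
  have bil: "bilinear (G y)" if "y \<in> W" for y
    using al_linear[OF that] be_linear[OF that] a_linear[OF that]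
    unfolding bilinear_def linear_iff G(2)[OF that] by (simp add: algebra_simps)
  have sm: "smooth_on W (\<lambda>y. Re (\<omega> d y w))" for w
    by (rule smooth_on_bounded_linear[OF open_W bounded_linear_Re smooth_on_subset[OF form_field_smooth[OF forms(1) d] W(2)]])
  have "smooth_on W (\<lambda>y. Jz d y v)"
  proof (rule smooth_on_linear_system[OF open_W, where M = "\<lambda>y. \<chi> k i. G y (axis i 1) (axis k 1)"
        and b = "\<lambda>y. \<chi> k. Re (\<omega> d y (vec2 v (axis k 1)))"])
    show "smooth_on W (\<lambda>y. (\<chi> k i. G y (axis i 1) (axis k 1)) $ i $ j)" for i j
      using G(1) by simp
    show "smooth_on W (\<lambda>y. (\<chi> k. Re (\<omega> d y (vec2 v (axis k 1)))) $ i)" for i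
      using sm by simp
  next
    fix y assume y: "y \<in> W"
    interpret S: su3_coframe "al y" "be y" "\<lambda>u. cnj (a y u)" by (rule coframe[OF y])
    have mv: "((\<chi> k i. G y (axis i 1) (axis k 1)) *v u) $ k = G y u (axis k 1)" for u k
      unfolding matrix_vector_mult_def bilinear_vec_expand[OF bil[OF y], of u] by (simp add: mult.commute)
    have om: "\<omega> d y = S.om" by (rule ext) (simp only: eo[OF y] omg_coframe[OF y])
    have Om: "\<Omega> d y = S.Om" by (rule ext) (simp only: eO[OF y] Omg_coframe[OF y])
    have J: "Jz d y = S.Jp" by (rule Jz_eq(1)[where d = d and x = y, OF S.su3_coframe_axioms Om])
    show "(\<chi> k i. G y (axis i 1) (axis k 1)) *v Jz d y v = (\<chi> k. Re (\<omega> d y (vec2 v (axis k 1))))"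
    proof (rule vec_eq_iff[THEN iffD2], rule allI)
      fix k
      have "Re (\<omega> d y (vec2 v (axis k 1))) = G y (Jz d y v) (axis k 1)"
        unfolding om J S.om_metric(2) G(2)[OF y] by (simp add: algebra_simps)
      then show "((\<chi> k i. G y (axis i 1) (axis k 1)) *v Jz d y v) $ k = (\<chi> k. Re (\<omega> d y (vec2 v (axis k 1)))) $ k"
        unfolding mv by simp
    qed
    fix u assume "(\<chi> k i. G y (axis i 1) (axis k 1)) *v u = 0"
    then have "G y u (axis k 1) = 0" for k using mv[of u k] by simp
    moreover have "G y u u = (\<Sum>i\<in>UNIV. u $ i * G y (axis i 1) u)" by (rule bilinear_vec_expand[OF bil[OF y]])
    moreover have "G y p q = G y q p" for p q unfolding G(2)[OF y] by (simp add: algebra_simps)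
    ultimately have "G y u u = 0" by simp
    then show "u = 0" using S.metric_pos[of u] unfolding G(2)[OF y] by (auto simp: algebra_simps)
  qed
  then show "\<exists>V. open V \<and> x \<in> V \<and> smooth_on V (\<lambda>x. Jz d x v)" using open_W W(1) by blast
qed

text \<open>The derivative of \<open>h\<close> is bijective and pulls \<open>\<Omega>\<close> back
  to \<open>\<Omega>\<close>, so it carries the characterization of \<open>Jz\<close> from one chart
  to the other.\<close>

lemma Jz_change:
  assumes d: "d \<in> A" "d' \<in> A" and h: "chart_change d d' W h" and x: "x \<in> W"
  shows "dder h x (Jz d x v) = Jz d' (h x) (dder h x v)"
proof -
  have c: "x \<in> fst d" "h x \<in> fst d'" "bij (dder h x)" using h x by (auto simp: chart_change_def)
  obtain al be ga where S: "su3_coframe al be ga" "\<omega> d x = su3_coframe.om al be ga" "\<Omega> d x = su3_coframe.Om al be ga"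
    "W2 d x = su3_coframe.tor al be ga" by (rule pointwise[OF d(1) c(1)])
  obtain al' be' ga' where S': "su3_coframe al' be' ga'" "\<omega> d' (h x) = su3_coframe.om al' be' ga'"
    "\<Omega> d' (h x) = su3_coframe.Om al' be' ga'" "W2 d' (h x) = su3_coframe.tor al' be' ga'"
    by (rule pointwise[OF d(2) c(2)])
  have ch: "\<Omega> d' (h x) (vec3 (dder h x u) (dder h x p) (dder h x q)) = \<Omega> d x (vec3 u p q)" for u p q
  proof -
    have "vec3 (dder h x u) (dder h x p) (dder h x q) = (\<lambda>i. dder h x (vec3 u p q i))" by (auto simp: vec3_def)
    then show ?thesis using form_field_change[OF forms(2) d h x, of "vec3 u p q"] by simp
  qed
  show ?thesis
  proof (rule Jz_eq(2)[OF S'(1,3)])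
    fix p q
    obtain p0 q0 where pq: "p = dder h x p0" "q = dder h x q0" using c(3) by (meson bij_pointE)
    show "\<Omega> d' (h x) (vec3 (dder h x (Jz d x v)) p q) = \<i> * \<Omega> d' (h x) (vec3 (dder h x v) p q)"
      unfolding pq ch Jz_eq(1)[OF S(1,3)] S(3) by (rule su3_coframe.Om_contract_Jp[OF S(1)])
  qed
qed

lemma almost_complex_Jz: "almost_complex A Jz"
  unfolding almost_complex_def endo_field_def
proof (intro conjI ballI allI impI)
  fix d x v assume d: "d \<in> A" "x \<in> fst d"
  obtain al be ga where S: "su3_coframe al be ga" "\<omega> d x = su3_coframe.om al be ga" "\<Omega> d x = su3_coframe.Om al be ga"
    "W2 d x = su3_coframe.tor al be ga" by (rule pointwise[OF d])
  show "linear (Jz d x)" unfolding Jz_eq(1)[OF S(1,3)] by (rule su3_coframe.Jp_linear[OF S(1)])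
  show "Jz d x (Jz d x v) = - v" unfolding Jz_eq(1)[OF S(1,3)] by (rule su3_coframe.Jp_square[OF S(1)])
qed (use Jz_smooth Jz_change in simp_all)

lemma metric_Jz: "riemannian_metric A (\<lambda>d x v w. Re (\<omega> d x (vec2 v (Jz d x w))))"
  unfolding riemannian_metric_def
proof (intro conjI ballI allI impI)
  fix d x assume d: "d \<in> A" "x \<in> fst d"
  obtain al be ga where S: "su3_coframe al be ga" "\<omega> d x = su3_coframe.om al be ga" "\<Omega> d x = su3_coframe.Om al be ga"
    "W2 d x = su3_coframe.tor al be ga" by (rule pointwise[OF d])
  have e: "Re (\<omega> d x (vec2 v (Jz d x w))) = Re (al v * cnj (al w) + be v * cnj (be w) + ga v * cnj (ga w))" for v w
    unfolding Jz_eq(1)[OF S(1,3)] S(2) by (rule su3_coframe.om_metric(1)[OF S(1)])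
  show "bilinear (\<lambda>v w. Re (\<omega> d x (vec2 v (Jz d x w))))"
    using su3_coframe.lin[OF S(1)] unfolding e bilinear_def linear_iff by (simp add: algebra_simps)
  show "Re (\<omega> d x (vec2 v (Jz d x w))) = Re (\<omega> d x (vec2 w (Jz d x v)))" for v w
    unfolding e by (simp add: algebra_simps)
  show "0 < Re (\<omega> d x (vec2 v (Jz d x v)))" if "v \<noteq> 0" for v
    unfolding e by (rule su3_coframe.metric_pos[OF S(1) that])
next
  fix d v w assume d: "d \<in> A"
  have o: "open (fst d)" using open_charts d by (simp add: open_charts_def)
  have "smooth_on (fst d) (\<lambda>x. \<omega> d x (\<lambda>i. vec2 v (Jz d x w) i))"
  proof (rule alternating_family(1)[OF o form_field_alternating[OF forms(1) d] form_field_smooth[OF forms(1) d]])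
    show "smooth_on (fst d) (\<lambda>x. vec2 v (Jz d x w) i)" for i
      using Jz_smooth[OF d] by (cases "i = 0") (simp_all add: vec2_def)
  qed
  then show "smooth_on (fst d) (\<lambda>x. Re (\<omega> d x (vec2 v (Jz d x w))))"
    using smooth_on_bounded_linear[OF o bounded_linear_Re] by simp
next
  fix d d' W h x v w assume d: "d \<in> A" "d' \<in> A" and h: "chart_change d d' W h" and x: "x \<in> W"
  have "vec2 (dder h x v) (Jz d' (h x) (dder h x w)) = (\<lambda>i. dder h x (vec2 v (Jz d x w) i))"
    unfolding Jz_change[OF d h x, symmetric] by (auto simp: vec2_def)
  then show "Re (\<omega> d x (vec2 v (Jz d x w))) = Re (\<omega> d' (h x) (vec2 (dder h x v) (Jz d' (h x) (dder h x w))))"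
    using form_field_change[OF forms(1) d h x, of "vec2 v (Jz d x w)"] by simp
qed

lemma real_omega: "real_form A \<omega>"
  unfolding real_form_def
proof (intro ballI allI)
  fix d x v assume d: "d \<in> A" "x \<in> fst d"
  obtain al be ga where S: "su3_coframe al be ga" "\<omega> d x = su3_coframe.om al be ga" "\<Omega> d x = su3_coframe.Om al be ga"
    "W2 d x = su3_coframe.tor al be ga" by (rule pointwise[OF d])
  show "\<omega> d x v \<in> \<real>" unfolding S(2) su3_coframe.om_expand[OF S(1)] by simp
qed

lemma form_field_W2: "form_field A 2 W2"
  unfolding W2_def[abs_def]
  by (intro form_field_scale[OF open_charts] form_field_add[OF open_charts] forms)

lemma su3_structure: "su3_structure A Jz \<omega> \<Omega>"
  unfolding su3_structure_def nowhere_vanishing_def has_type_def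
proof (intro conjI ballI allI almost_complex_Jz forms real_omega metric_Jz)
  fix d x assume d: "d \<in> A" "x \<in> fst d"
  obtain al be ga where S: "su3_coframe al be ga" "\<omega> d x = su3_coframe.om al be ga" "\<Omega> d x = su3_coframe.Om al be ga"
    "W2 d x = su3_coframe.tor al be ga" by (rule pointwise[OF d])
  note J = Jz_eq(1)[OF S(1,3)]
  show "\<omega> d x (\<lambda>i. Jz d x (v i)) = \<omega> d x v" for v
    unfolding J S(2) by (rule su3_coframe.om_Jp[OF S(1)])
  show "\<exists>v. \<Omega> d x v \<noteq> 0" unfolding S(3) by (rule su3_coframe.Om_nonzero[OF S(1)])
  show "covector_type 3 {3} (Jz d x) (\<Omega> d x)"
    unfolding J S(3) by (rule covector_type_top[OF su3_coframe.Om_Jp[OF S(1)]])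
  show "wedge 2 3 (\<omega> d x) (\<Omega> d x) v = 0" for v
    unfolding S(2,3) by (rule su3_coframe.om_Om[OF S(1)])
  show "wedge 3 3 (\<Omega> d x) (conj_form \<Omega> d x) v = - 8 * \<i> * wedge_power (\<omega> d x) 3 v / fact 3" for v
    unfolding conj_form_def[abs_def] S(2,3) by (rule su3_coframe.Om_volume[OF S(1)])
qed

lemma torsion_classes:
  "torsion_classes A Jz \<omega> \<Omega> (\<lambda>_ _. 8 / 3) W2 (\<lambda>_ _ _. 0) (\<lambda>_ _ _. 0) (\<lambda>_ _ _. 0)"
  unfolding torsion_classes_def
proof (intro conjI ballI allI form_field_W2 form_field_zero has_type_zero)
  show "scalar_field A (\<lambda>_ _. 8 / 3)" by (simp add: scalar_field_def)
  show "primitive_form A \<omega> 3 (\<lambda>_ _ _. 0)" by (simp add: primitive_form_def wedge_zero_left)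
  show "real_form A (\<lambda>_ _ _. 0)" "real_form A (\<lambda>_ _ _. 0)" by (simp_all add: real_form_def)
  show "has_type A Jz 2 {1} W2" unfolding has_type_def
  proof (intro ballI)
    fix d x assume d: "d \<in> A" "x \<in> fst d"
    obtain al be ga where S: "su3_coframe al be ga" "\<omega> d x = su3_coframe.om al be ga" "\<Omega> d x = su3_coframe.Om al be ga"
    "W2 d x = su3_coframe.tor al be ga" by (rule pointwise[OF d])
    show "covector_type 2 {1} (Jz d x) (W2 d x)"
    proof (rule covector_type_1_1[OF form_field_alternating[OF form_field_W2 d]])
      show "W2 d x (\<lambda>i. Jz d x (v i)) = W2 d x v" for v
        unfolding Jz_eq(1)[OF S(1,3)] S(4) by (rule su3_coframe.tor_Jp[OF S(1)])
      show "Jz d x (Jz d x v) = - v" for v using almost_complex_Jz d by (simp add: almost_complex_def)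
    qed
  qed
  show "primitive_form A \<omega> 2 W2" unfolding primitive_form_def
  proof (intro ballI allI)
    fix d x v assume d: "d \<in> A" "x \<in> fst d"
    obtain al be ga where S: "su3_coframe al be ga" "\<omega> d x = su3_coframe.om al be ga" "\<Omega> d x = su3_coframe.Om al be ga"
    "W2 d x = su3_coframe.tor al be ga" by (rule pointwise[OF d])
    show "wedge 2 (2 * (4 - 2)) (W2 d x) (wedge_power (\<omega> d x) (4 - 2)) v = 0"
      unfolding S(2,4) using su3_coframe.tor_primitive[OF S(1), of v] by simp
  qed
  fix d x v assume d: "d \<in> A" "x \<in> fst d"
  note p = exterior_derivatives[OF d]
  \<comment> \<open>This is where \<open>d_omg\<close> fixes the constant: \<open>3 / 2\<close>
    times \<open>8 / 3\<close> is 4.\<close>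
  have 83: "3 / 2 * Im (cnj (8 / 3) * z) = 4 * Im z" for z by simp
  show "ext_d 2 \<omega> d x v = complex_of_real (3 / 2 * Im (cnj (8 / 3) * \<Omega> d x v)) + wedge 1 2 (\<lambda>_. 0) (\<omega> d x) v + 0"
    unfolding p(1) 83 wedge_zero_left by simp
  show "ext_d 3 \<Omega> d x v = 8 / 3 * wedge_power (\<omega> d x) 2 v + wedge 2 2 (W2 d x) (\<omega> d x) v
      + wedge 1 3 (conj_form (\<lambda>_ _ _. 0) d x) (\<Omega> d x) v"
    unfolding p(2) conj_form_def[abs_def] complex_cnj_zero wedge_zero_left by simp
qed

lemma lt_structure: "lt_structure A \<omega> \<Omega> (\<lambda>_ _. 8 / 3) W2"
  unfolding lt_structure_def nowhere_vanishing_def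
proof (intro conjI exI[of _ Jz] ballI su3_structure torsion_classes)
  fix d x assume d: "d \<in> A" "x \<in> fst d"
  obtain al be ga where S: "su3_coframe al be ga" "\<omega> d x = su3_coframe.om al be ga" "\<Omega> d x = su3_coframe.Om al be ga"
    "W2 d x = su3_coframe.tor al be ga" by (rule pointwise[OF d])
  show "\<exists>v. W2 d x v \<noteq> 0" unfolding S(4) by (rule su3_coframe.tor_nonzero[OF S(1)])
qed simp

end

section \<open>Pulling the structure equations back along slices\<close>

lemma dder_compose:
  assumes "smooth_on U f" "x \<in> U" "smooth_on V g" "f x \<in> V"
  shows "dder (\<lambda>z. g (f z)) x v = dder g (f x) (dder f x v)"
  by (rule fun_cong[OF frechet_derivative_eq[OF has_derivative_compose[OF
      smooth_on_has_derivative[OF assms(1,2)] smooth_on_has_derivative[OF assms(3,4)]]]])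

text \<open>Differentiating the pullback also produces second derivatives of \<open>f\<close>; they
  are symmetric and cancel in the exterior derivative.\<close>

lemma pullback_exterior_derivative:
  fixes th :: "'e::euclidean_space \<Rightarrow> 'e \<Rightarrow> complex" and f :: "'d::euclidean_space \<Rightarrow> 'e"
  assumes W: "open W" "x \<in> W" and V: "open V" and f: "smooth_on W f" "f ` W \<subseteq> V"
    and th: "\<And>y. y \<in> V \<Longrightarrow> linear (th y)" "\<And>u. smooth_on V (\<lambda>y. th y u)"
  shows "smooth_on W (\<lambda>y. th (f y) (dder f y w))"
    and "dder (\<lambda>y. th (f y) (dder f y w)) x v - dder (\<lambda>y. th (f y) (dder f y v)) x w =
      dder (\<lambda>z. th z (dder f x w)) (f x) (dder f x v) - dder (\<lambda>z. th z (dder f x v)) (f x) (dder f x w)"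
proof -
  have fx: "f y \<in> V" if "y \<in> W" for y using f(2) that by blast
  have lin: "linear (th (f y))" if "y \<in> W" for y by (rule th(1)[OF fx[OF that]])
  have sm: "smooth_on W (\<lambda>y. th (f y) u)" for u
    by (rule smooth_on_compose[OF W(1) V f(2,1) th(2)])
  have df: "smooth_on W (\<lambda>y. dder f y u)" for u by (rule smooth_on_derivative[OF f(1)])
  show "smooth_on W (\<lambda>y. th (f y) (dder f y w))"
    by (rule linear_family_smooth[where b = "\<lambda>y. th (f y)" and F = "\<lambda>y. dder f y w", OF W(1) lin sm df])
  have "dder (\<lambda>y. th (f y) (dder f y w)) x v =
      dder (\<lambda>z. th z (dder f x w)) (f x) (dder f x v) + th (f x) (dder (\<lambda>y. dder f y w) x v)" for v w
  proof -
    have "dder (\<lambda>y. th (f y) (dder f y w)) x v = dder (\<lambda>y. th (f y) (dder f x w)) x v + th (f x) (dder (\<lambda>y. dder f y w) x v)"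
      by (rule dder_linear_family[where b = "\<lambda>y. th (f y)" and F = "\<lambda>y. dder f y w", OF W lin sm df])
    also have "dder (\<lambda>y. th (f y) (dder f x w)) x v = dder (\<lambda>z. th z (dder f x w)) (f x) (dder f x v)"
      by (rule dder_compose[where g = "\<lambda>z. th z (dder f x w)", OF f(1) W(2) th(2) fx[OF W(2)]])
    finally show ?thesis .
  qed
  then show "dder (\<lambda>y. th (f y) (dder f y w)) x v - dder (\<lambda>y. th (f y) (dder f y v)) x w =
      dder (\<lambda>z. th z (dder f x w)) (f x) (dder f x v) - dder (\<lambda>z. th z (dder f x v)) (f x) (dder f x w)"
    using second_derivative_symmetric[OF W f(1), of w v] by simp
qed

locale sasakian_leaf = sasakian3 X A g J + circle_manifold7 X A "restrict_field (reeb J 3)" \<rho>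
  for X :: "'s topology" and A g J \<rho>
begin

definition adapted :: "(real^7, 's) chart \<Rightarrow> real^7 \<Rightarrow> (real^7 \<Rightarrow> complex) \<Rightarrow> (real^7 \<Rightarrow> complex) \<Rightarrow> bool" where
  "adapted c x al be \<longleftrightarrow> linear al \<and> linear be \<and>
    (\<forall>v w. us c x v w = al v * be w - al w * be v - \<i> * (et c x v * tt c x w - et c x w * tt c x v)) \<and>
    (\<forall>v w. o3 c x v w = \<i> / 2 * (al v * cnj (al w) - al w * cnj (al v)
         + (be v * cnj (be w) - be w * cnj (be v)) + (et c x v * cnj (et c x w) - et c x w * cnj (et c x v)))) \<and>
    (\<forall>v w. complex_of_real (g c x v w) - tt c x v * tt c x w
       = complex_of_real (Re (al v * cnj (al w) + be v * cnj (be w) + et c x v * cnj (et c x w)))) \<and>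
    (\<forall>v. al v = 0 \<longrightarrow> be v = 0 \<longrightarrow> et c x v = 0 \<longrightarrow> v = cth c 3 (x, 1) (v, 0) *\<^sub>R Yf c x)"

text \<open>The coframes of \<open>coframe_restricted\<close> are selected point by point with the
  axiom of choice, so no continuity in \<open>x\<close> comes with them.\<close>

lemma adapted_exists:
  assumes c: "c \<in> A"
  shows "\<exists>al be. \<forall>x\<in>fst c. adapted c x (al x) (be x)"
proof -
  have "\<forall>x. \<exists>p. x \<in> fst c \<longrightarrow> adapted c x (fst p) (snd p)"
  proof
    fix x show "\<exists>p. x \<in> fst c \<longrightarrow> adapted c x (fst p) (snd p)"
    proof (cases "x \<in> fst c")
      case True
      from coframe_restricted[OF c True] obtain al be where "adapted c x al be"
        unfolding adapted_def by (elim exE)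
      then show ?thesis by (intro exI[of _ "(al, be)"]) simp
    qed simp
  qed
  from choice[OF this] obtain p where "\<forall>x. x \<in> fst c \<longrightarrow> adapted c x (fst (p x)) (snd (p x))" ..
  then show ?thesis by (intro exI[of _ "\<lambda>x. fst (p x)"] exI[of _ "\<lambda>x. snd (p x)"]) simp
qed

context
  fixes d :: "(real^6, 's set) chart" and \<sigma> c
  assumes s: "slice d \<sigma>" and c: "c \<in> A"
begin

abbreviation "f \<equiv> \<lambda>y. coord c (\<sigma> y)"
abbreviation "W \<equiv> slice_dom d \<sigma> c"
abbreviation "a \<equiv> \<lambda>y u. et c (f y) (dder f y u)"
abbreviation "t \<equiv> \<lambda>y u. tt c (f y) (dder f y u)"
text \<open>The pullback of the transverse metric, that is, of the metric minus the square of
  \<open>\<eta>\<^sub>3\<close>. In this form its smoothness is accessible, and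
  \<open>G_pulled\<close> identifies it with the hermitian metric of the coframe.\<close>

abbreviation "G \<equiv> \<lambda>y v w. g c (f y) (dder f y v) (dder f y w) - Re (t y v * t y w)"

lemma slice_facts:
  shows "open W" "smooth_on W f" "f ` W \<subseteq> fst c" "y \<in> W \<Longrightarrow> f y \<in> fst c" "y \<in> W \<Longrightarrow> linear (dder f y)"
    "y \<in> W \<Longrightarrow> dder f y u = r *\<^sub>R Yf c (f y) \<Longrightarrow> u = 0"
proof -
  show "open W" and f: "smooth_on W f" by (rule slice_dom[OF s c])+
  show m: "y \<in> W \<Longrightarrow> f y \<in> fst c" for y by (simp add: slice_dom_def coord_mem)
  then show "f ` W \<subseteq> fst c" by blast
  show "y \<in> W \<Longrightarrow> linear (dder f y)" by (rule frechet_derivative_linear[OF f])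
  assume y: "y \<in> W" and u: "dder f y u = r *\<^sub>R Yf c (f y)"
  have "y \<in> fst d" "\<sigma> y \<in> chart_range c" using y by (simp_all add: slice_dom_def)
  with s[unfolded slice_lift_def, THEN conjunct2, THEN conjunct2, THEN bspec, THEN bspec, OF _ c, THEN mp, THEN spec, THEN spec, THEN mp, OF _ _ u]
  show "u = 0" by simp
qed

lemma t_smooth: "smooth_on W (\<lambda>y. t y u)" and a_smooth: "smooth_on W (\<lambda>y. a y u)"
proof -
  have o: "open (fst c)" by (rule chart_open[OF c])
  show "smooth_on W (\<lambda>y. t y u)" "smooth_on W (\<lambda>y. a y u)"
  proof (rule smooth_on_local, rule_tac [2] smooth_on_local)
    fix x assume x: "x \<in> W"
    have "smooth_on W (\<lambda>y. t y u)"
      by (rule pullback_exterior_derivative(1)[where th = "tt c", OF slice_facts(1) x o slice_facts(2,3) tt_linear[OF c] tt_smooth[OF c]])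
    then show "\<exists>V. open V \<and> x \<in> V \<and> smooth_on V (\<lambda>y. t y u)" using slice_facts(1) x by blast
    have "smooth_on W (\<lambda>y. a y u)"
      by (rule pullback_exterior_derivative(1)[where th = "et c", OF slice_facts(1) x o slice_facts(2,3) et_linear[OF c] et_smooth[OF c]])
    then show "\<exists>V. open V \<and> x \<in> V \<and> smooth_on V (\<lambda>y. a y u)" using slice_facts(1) x by blast
  qed
qed

lemma G_smooth: "smooth_on W (\<lambda>y. G y v w)"
proof -
  have o: "open (fst c)" by (rule chart_open[OF c])
  have b: "linear (g c x p)" "linear (\<lambda>p. g c x p q)" if "x \<in> fst c" for x p q
    using metric_bilinear[OF c that] by (simp_all add: bilinear_def)
  have df: "smooth_on W (\<lambda>y. dder f y u)" for u by (rule smooth_on_derivative[OF slice_facts(2)])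
  have 1: "smooth_on W (\<lambda>y. g c (f y) p q)" for p q
    by (rule smooth_on_compose[OF slice_facts(1) o slice_facts(3,2) metric_smooth[OF c]])
  have 2: "smooth_on W (\<lambda>y. g c (f y) p (dder f y w))" for p
    by (rule linear_family_smooth[where b = "\<lambda>y. g c (f y) p" and F = "\<lambda>y. dder f y w", OF slice_facts(1) b(1)[OF slice_facts(4)] 1 df])
  have L: "linear (\<lambda>p. g c (f y) p (dder f y w))" if "y \<in> W" for y
    by (rule b(2)[OF slice_facts(4)[OF that]])
  have 3: "smooth_on W (\<lambda>y. g c (f y) (dder f y v) (dder f y w))"
    by (rule linear_family_smooth[where b = "\<lambda>y p. g c (f y) p (dder f y w)" and F = "\<lambda>y. dder f y v", OF slice_facts(1) L 2 df])
  show ?thesis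
    by (rule smooth_on_diff[OF slice_facts(1) 3 smooth_on_bounded_linear[OF slice_facts(1) bounded_linear_Re
          smooth_on_mult[OF slice_facts(1) t_smooth t_smooth]]])
qed

lemma d_pulled:
  assumes y: "y \<in> W"
  shows "dder (\<lambda>y. a y w) y v - dder (\<lambda>y. a y v) y w = 2 * us c (f y) (dder f y v) (dder f y w)"
    "dder (\<lambda>y. t y w) y v - dder (\<lambda>y. t y v) y w = 2 * o3 c (f y) (dder f y v) (dder f y w)"
proof -
  show "dder (\<lambda>y. a y w) y v - dder (\<lambda>y. a y v) y w = 2 * us c (f y) (dder f y v) (dder f y w)"
    by (rule trans[OF pullback_exterior_derivative(2)[where th = "et c" and f = f,
        OF slice_facts(1) y chart_open[OF c] slice_facts(2,3) et_linear[OF c] et_smooth[OF c]] d_et(1)[OF c slice_facts(4)[OF y]]])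
  show "dder (\<lambda>y. t y w) y v - dder (\<lambda>y. t y v) y w = 2 * o3 c (f y) (dder f y v) (dder f y w)"
    by (rule trans[OF pullback_exterior_derivative(2)[where th = "tt c" and f = f,
        OF slice_facts(1) y chart_open[OF c] slice_facts(2,3) tt_linear[OF c] tt_smooth[OF c]] d_et(2)[OF c slice_facts(4)[OF y]]])
qed

text \<open>The structure equations are \<open>d_pulled\<close> with the adapted coframe inserted.
  Injectivity holds because the three forms vanish together only on multiples of
  \<open>\<xi>\<^sub>3\<close>, and a slice is an immersion transverse to it.\<close>

lemma leaf_calculus_pulled:
  assumes ab: "\<forall>x\<in>fst c. adapted c x (al x) (be x)"
  shows "leaf_calculus W a t (\<lambda>y u. al (f y) (dder f y u)) (\<lambda>y u. be (f y) (dder f y u))"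
proof (rule leaf_calculus.intro)
  have ad: "adapted c (f y) (al (f y)) (be (f y))" if "y \<in> W" for y using ab slice_facts(4)[OF that] by blast
  note ad = ad[unfolded adapted_def]
  show "open W" by (rule slice_facts(1))
  fix y
  show "cnj (t y u) = t y u" for u by (simp add: tt_def)
  show "smooth_on W (\<lambda>y. a y u)" "smooth_on W (\<lambda>y. t y u)" for u by (rule a_smooth, rule t_smooth)
  assume y: "y \<in> W"
  note L = slice_facts(5)[OF y] and m = slice_facts(4)[OF y] and ad = ad[OF y]
  show "linear (a y)" using linear_compose[OF L et_linear[OF c m]] by (simp only: o_def)
  show "linear (t y)" using linear_compose[OF L tt_linear[OF c m]] by (simp only: o_def)
  show "linear (\<lambda>u. al (f y) (dder f y u))" using linear_compose[OF L conjunct1[OF ad]] by (simp only: o_def)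
  show "linear (\<lambda>u. be (f y) (dder f y u))"
    using linear_compose[OF L ad[THEN conjunct2, THEN conjunct1]] by (simp only: o_def)
  show "dder (\<lambda>y. a y w) y v - dder (\<lambda>y. a y v) y w = 2 * (al (f y) (dder f y v) * be (f y) (dder f y w)
     - al (f y) (dder f y w) * be (f y) (dder f y v) - \<i> * (a y v * t y w - a y w * t y v))" for v w
    unfolding d_pulled[OF y] ad[THEN conjunct2, THEN conjunct2, THEN conjunct1, THEN spec, THEN spec] ..
  show "dder (\<lambda>y. t y w) y v - dder (\<lambda>y. t y v) y w = 2 * (\<i> / 2 * (al (f y) (dder f y v) * cnj (al (f y) (dder f y w))
     - al (f y) (dder f y w) * cnj (al (f y) (dder f y v)) + (be (f y) (dder f y v) * cnj (be (f y) (dder f y w))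
     - be (f y) (dder f y w) * cnj (be (f y) (dder f y v))) + (a y v * cnj (a y w) - a y w * cnj (a y v))))" for v w
    unfolding d_pulled[OF y] ad[THEN conjunct2, THEN conjunct2, THEN conjunct2, THEN conjunct1, THEN spec, THEN spec] ..
  show "v = 0" if "al (f y) (dder f y v) = 0" "be (f y) (dder f y v) = 0" "a y v = 0" for v
    using ad[THEN conjunct2, THEN conjunct2, THEN conjunct2, THEN conjunct2, THEN conjunct2, THEN spec, THEN mp, THEN mp, THEN mp, OF that]
    by (rule slice_facts(6)[OF y])
qed

text \<open>Halving the exterior derivatives of \<open>a\<close> and \<open>t\<close> returns the
  pullbacks of \<open>us\<close> and \<open>o3\<close>, so the expressions of
  \<open>leaf_calculus\<close> are the pullbacks of the restricted twisted forms.\<close>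

lemma leaf_forms_pulled:
  assumes y: "y \<in> W" and lc: "leaf_calculus W a t al be"
  shows "leaf_form (restrict_form (omega_twist g J)) d y v = leaf_calculus.omg a t y v"
    "leaf_form (restrict_form (Omega_twist g J)) d y v = leaf_calculus.Omg a t y v"
    "leaf_form (restrict_form (eta_etabar g J)) d y v = a y (v 0) * cnj (a y (v 1)) - a y (v 1) * cnj (a y (v 0))"
proof -
  interpret leaf_calculus W a t al be by (rule lc)
  note m = slice_facts(4)[OF y]
  have l: "leaf_form \<beta> d y v = \<beta> c (f y) (\<lambda>i. dder f y (v i))" if "basic_form A Yf k \<beta>" for \<beta> k v
    using leaf_form_eq[OF that s _ c] y by (simp add: slice_dom_def slice_pull_def)
  have half: "1 / 2 * (2 * z) = z" for z :: complex by simp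
  show "leaf_form (restrict_form (omega_twist g J)) d y v = omg y v"
    unfolding l[OF basic_omega_twist] omega_twist_restricted[OF c m] somega_eq[OF c m] omg_def d_pulled[OF y] half ..
  show "leaf_form (restrict_form (eta_etabar g J)) d y v = a y (v 0) * cnj (a y (v 1)) - a y (v 1) * cnj (a y (v 0))"
    unfolding l[OF basic_sth[unfolded sth_def]] unfolding sth_def[symmetric] eta_etabar_restricted[OF c m] ..
  have "leaf_form (restrict_form (Omega_twist g J)) d y v =
      wedge 1 2 (\<lambda>v. cnj (et c (f y) (v 0)))
        (\<lambda>v. us c (f y) (v 0) (v 1) + \<i> * (et c (f y) (v 0) * tt c (f y) (v 1) - et c (f y) (v 1) * tt c (f y) (v 0)))
        (\<lambda>i. dder f y (v i))"
    unfolding l[OF basic_Omega_twist] Omega_twist_restricted[OF c m] sOmega_eq[OF c m] ..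
  also have "\<dots> = Omg y v"
    unfolding Omg_def P_def d_pulled[OF y] half by (rule wedge_pullback[symmetric])
  finally show "leaf_form (restrict_form (Omega_twist g J)) d y v = Omg y v" .
qed

lemma G_pulled:
  assumes y: "y \<in> W" and ab: "\<forall>x\<in>fst c. adapted c x (al x) (be x)"
  shows "G y v w = Re (al (f y) (dder f y v) * cnj (al (f y) (dder f y w)) + be (f y) (dder f y v) * cnj (be (f y) (dder f y w))
     + a y v * cnj (a y w))"
proof -
  have "adapted c (f y) (al (f y)) (be (f y))" using ab slice_facts(4)[OF y] by blast
  then have "complex_of_real (g c (f y) (dder f y v) (dder f y w)) - t y v * t y w
    = complex_of_real (Re (al (f y) (dder f y v) * cnj (al (f y) (dder f y w)) + be (f y) (dder f y v) * cnj (be (f y) (dder f y w))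
     + a y v * cnj (a y w)))" unfolding adapted_def by (elim conjE) (drule spec, erule spec)
  from arg_cong[OF this, of Re] show ?thesis by (simp only: minus_complex.sel Re_complex_of_real)
qed

end

lemma local_lt_leaf:
  "local_lt LA (leaf_form (restrict_form (omega_twist g J))) (leaf_form (restrict_form (Omega_twist g J)))
     (leaf_form (restrict_form (eta_etabar g J)))"
proof (rule local_lt.intro)
  show "open_charts LA" by (rule open_charts_LA)
  show "form_field LA 2 (leaf_form (restrict_form (omega_twist g J)))" by (rule form_field_leaf[OF basic_omega_twist])
  show "form_field LA 3 (leaf_form (restrict_form (Omega_twist g J)))" by (rule form_field_leaf[OF basic_Omega_twist])
  show "form_field LA 2 (leaf_form (restrict_form (eta_etabar g J)))" by (rule form_field_leaf[OF basic_sth[unfolded sth_def]])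
next
  fix d x assume d: "d \<in> LA" and x: "x \<in> fst d"
  obtain \<sigma> where s: "slice d \<sigma>" using leaf_slice[OF d] ..
  obtain c where c: "c \<in> A" "x \<in> slice_dom d \<sigma> c" using slice_covers[OF s x] ..
  obtain al be where ab: "\<forall>x\<in>fst c. adapted c x (al x) (be x)" using adapted_exists[OF c(1)] by (elim exE)
  note lc = leaf_calculus_pulled[OF s c(1) ab]
  show "\<exists>W a t al be G. x \<in> W \<and> W \<subseteq> fst d \<and> leaf_calculus W a t al be \<and>
      (\<forall>y\<in>W. \<forall>v. leaf_form (restrict_form (omega_twist g J)) d y v = leaf_calculus.omg a t y v \<and>
         leaf_form (restrict_form (Omega_twist g J)) d y v = leaf_calculus.Omg a t y v \<and>
         leaf_form (restrict_form (eta_etabar g J)) d y v = a y (v 0) * cnj (a y (v 1)) - a y (v 1) * cnj (a y (v 0))) \<and>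
      (\<forall>v w. smooth_on W (\<lambda>y. G y v w)) \<and>
      (\<forall>y\<in>W. \<forall>v w. G y v w = Re (al y v * cnj (al y w) + be y v * cnj (be y w) + a y v * cnj (a y w)))"
    by (rule exI, rule exI, rule exI, rule exI, rule exI, rule exI[of _ "G \<sigma> c"],
        intro conjI ballI allI, rule c(2), force simp: slice_dom_def, rule lc,
        erule leaf_forms_pulled(1)[OF s c(1) _ lc], erule leaf_forms_pulled(2)[OF s c(1) _ lc],
        erule leaf_forms_pulled(3)[OF s c(1) _ lc], rule G_smooth[OF s c(1)], erule G_pulled[OF s c(1) _ ab])
qed

end

theorem theorem1:
  fixes X :: "'s topology"
    and A :: "(real^7, 's) chart set"
    and g :: "(real^7, 's) metric"
    and J :: "nat \<Rightarrow> ((real^7) \<times> real, 's \<times> real) endo"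
    and \<rho> :: "complex \<Rightarrow> 's \<Rightarrow> 's"
  assumes "three_sasakian X A g J"
    and "regular X A (restrict_field (reeb J 3)) \<rho> \<or> quasi_regular X A (restrict_field (reeb J 3)) \<rho>"
  shows "holomorphic_volume_form (cone_atlas A) (J 3) (\<lambda>C y v. 2 * Omega4 g J C y v)
    \<and> has_charge (cone_atlas A) (reeb J 3) 4 (4 * \<i>) (\<lambda>C y v. 2 * Omega4 g J C y v)
    \<and> twist_form (cone_atlas A) (J 3) (reeb J 3) (eta g J)
    \<and> has_charge (cone_atlas A) (reeb J 3) 1 (2 * \<i>) (eta g J)
    \<and> basic_form A (restrict_field (reeb J 3)) 2 (restrict_form (omega_twist g J))
    \<and> basic_form A (restrict_field (reeb J 3)) 3 (restrict_form (Omega_twist g J))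
    \<and> (\<exists>\<omega> \<Omega> \<theta> W1 W2.
          induces X A (restrict_field (reeb J 3)) \<rho> 2 (restrict_form (omega_twist g J)) \<omega>
        \<and> induces X A (restrict_field (reeb J 3)) \<rho> 3 (restrict_form (Omega_twist g J)) \<Omega>
        \<and> induces X A (restrict_field (reeb J 3)) \<rho> 2 (restrict_form (eta_etabar g J)) \<theta>
        \<and> W1 = (\<lambda>_ _. 8 / 3)
        \<and> W2 = (\<lambda>d x v. W1 d x / 2 * (\<omega> d x v + 3 * \<i> / 2 * \<theta> d x v))
        \<and> lt_structure (leaf_atlas X A (restrict_field (reeb J 3)) \<rho>) \<omega> \<Omega> W1 W2)"
proof -
  interpret sasakian3 X A g J by (rule sasakian3.intro[OF assms(1)])
  have stab: "finite {z \<in> sphere 0 1. \<rho> z p = p}" if "p \<in> topspace X" for p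
    using assms(2)
  proof
    assume "regular X A Yf \<rho>"
    then have "{z \<in> sphere 0 1. \<rho> z p = p} \<subseteq> {1}" using that by (auto simp: regular_def)
    then show ?thesis using finite_subset by blast
  next
    assume "quasi_regular X A Yf \<rho>"
    then show ?thesis using that by (simp add: quasi_regular_def)
  qed
  have act: "circle_action X A \<rho>" "integrates_to A Yf \<rho>"
    using assms(2) by (auto simp: regular_def quasi_regular_def)
  \<comment> \<open>The contact form \<open>\<eta>\<^sub>3\<close> takes the value 1 on the Reeb
    field.\<close>
  have nz: "Yf c x \<noteq> 0" if "c \<in> A" "x \<in> fst c" for c x
    using at_Yf(2)[OF that] linear_0[OF tt_linear[OF that]] by auto
  have cm: "circle_manifold7 X A Yf \<rho>"
    by (intro circle_manifold7.intro circle_manifold.intro manifold act stab Yf_smooth nz)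
  interpret sasakian_leaf X A g J \<rho>
    by (rule sasakian_leaf.intro[OF sasakian3_axioms cm])
  let ?\<omega> = "leaf_form (restrict_form (omega_twist g J))" and ?\<Omega> = "leaf_form (restrict_form (Omega_twist g J))"
    and ?\<theta> = "leaf_form (restrict_form (eta_etabar g J))"
  have lt: "lt_structure LA ?\<omega> ?\<Omega> (\<lambda>_ _. 8 / 3) (\<lambda>d x v. 8 / 3 / 2 * (?\<omega> d x v + 3 * \<i> / 2 * ?\<theta> d x v))"
    using local_lt.lt_structure[OF local_lt_leaf] unfolding local_lt.W2_def[OF local_lt_leaf, abs_def] .
  have "\<exists>\<omega> \<Omega> \<theta> W1 W2. induces X A Yf \<rho> 2 (restrict_form (omega_twist g J)) \<omega>
      \<and> induces X A Yf \<rho> 3 (restrict_form (Omega_twist g J)) \<Omega> \<and> induces X A Yf \<rho> 2 (restrict_form (eta_etabar g J)) \<theta>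
      \<and> W1 = (\<lambda>_ _. 8 / 3) \<and> W2 = (\<lambda>d x v. W1 d x / 2 * (\<omega> d x v + 3 * \<i> / 2 * \<theta> d x v))
      \<and> lt_structure LA \<omega> \<Omega> W1 W2"
    by (rule exI[of _ ?\<omega>], rule exI[of _ ?\<Omega>], rule exI[of _ ?\<theta>], rule exI, rule exI,
        intro conjI induces_leaf_form[OF basic_omega_twist] induces_leaf_form[OF basic_Omega_twist]
          induces_leaf_form[OF basic_sth[unfolded sth_def]])
      (rule refl, rule refl, rule lt)
  then show ?thesis
    by (intro conjI holomorphic_Omega4 charge_Omega4 twist_form_eta charge_eta basic_omega_twist basic_Omega_twist)
qed

end
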